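(* Let $\varepsilon>0$ be any constant, and let $p_1=p_1(n),p_2=p_2(n)\in[0,1]$. Let $G_1=G(n,p_1)$ and, independently, $G_2=G(n,p_2)$ be binomial random graphs on the same vertex set $[n]$, and let $G(n,p_1,p_2)$ be the random double graph $([n],E(G_1),E(G_2))$. \begin{enumerate} \item If $p_1p_2\le \frac{1-\varepsilon}{4n\ln n}$, then with high probability the jigsaw process on $G(n,p_1,p_2)$ does not percolate. \item If $p_1p_2\ge \frac{1+\varepsilon}{4n\ln n}$ and $p_1,p_2\ge \frac{\ln n}{n}$, then conditioned on $G_1$ and $G_2$ being connected, with high probability the jigsaw process on $G(n,p_1,p_2)$ percolates. \end{enumerate}
   Context: $[n]=\{1,\dots,n\}$. $G(n,p)$ is the random graph on $[n]$ in which each pair of vertices forms an edge with probability $p$ independently. "With high probability" means with probability tending to $1$ as $n\to\infty$. A double graph is a triple $(V,E_1,E_2)$ where $V$ is a (finite) set of vertices and $E_1,E_2\subset\binom V2$. Jigsaw process on a double graph $(V,E_1,E_2)$: set $V^{(0)}=V$, $E_j^{(0)}=E_j$ for $j=1,2$, and let $H^{(0)}$ be the auxiliary graph $(V^{(0)},E_1^{(0)}\cap E_2^{(0)})$. As long as $E(H^{(i)})\neq\emptyset$, let $V^{(i+1)}$ be the set of components of $H^{(i)}$; for distinct $C,D\in V^{(i+1)}$ and $j=1,2$ let $\{C,D\}\in E_j^{(i+1)}$ if and only if there is at least one edge between $C$ and $D$ in $E_j^{(i)}$; let $H^{(i+1)}=(V^{(i+1)},E_1^{(i+1)}\cap E_2^{(i+1)})$;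 proceed to step $i+1$. When $E(H^{(i)})=\emptyset$ the process stops. The jigsaw process percolates if at the end of the process $V^{(i)}$ contains exactly one vertex. *)

theory Defs
  imports
    "HOL-Probability.Probability"
    "HOL-Library.Ramsey"
    "HOL-Library.Disjoint_Sets"
begin

text \<open>A graph is given by its vertex set and a set of edges, an edge being a two-element set of
  vertices; \<open>[V]\<^bsup>2\<^esup>\<close> is the set of all two-element subsets of \<open>V\<close>.\<close>

definition same_component :: "'a set \<Rightarrow> 'a set set \<Rightarrow> ('a \<times> 'a) set" where
  "same_component V E =
     {(u, v). u \<in> V \<and> v \<in> V \<and> (u, v) \<in> {(x, y). x \<in> V \<and> y \<in> V \<and> {x, y} \<in> E}\<^sup>*}"

definition graph_components :: "'a set \<Rightarrow> 'a set set \<Rightarrow> 'a set set" where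
  "graph_components V E = V // same_component V E"

definition graph_connected :: "'a set \<Rightarrow> 'a set set \<Rightarrow> bool" where
  "graph_connected V E \<longleftrightarrow> V \<noteq> {} \<and> (\<forall>u\<in>V. \<forall>v\<in>V. (u, v) \<in> same_component V E)"

type_synonym 'a double_graph = "'a set \<times> 'a set set \<times> 'a set set"

fun double_graph :: "'a double_graph \<Rightarrow> bool" where
  "double_graph (V, E1, E2) \<longleftrightarrow> finite V \<and> E1 \<subseteq> [V]\<^bsup>2\<^esup> \<and> E2 \<subseteq> [V]\<^bsup>2\<^esup>"

fun verts :: "'a double_graph \<Rightarrow> 'a set" where
  "verts (V, E1, E2) = V"

fun aux_edges :: "'a double_graph \<Rightarrow> 'a set set" where
  "aux_edges (V, E1, E2) = E1 \<inter> E2"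

definition merged_edges :: "'a set set \<Rightarrow> 'a set set \<Rightarrow> 'a set set set" where
  "merged_edges W E =
     {{C, D} | C D. C \<in> W \<and> D \<in> W \<and> C \<noteq> D \<and> (\<exists>u\<in>C. \<exists>v\<in>D. {u, v} \<in> E)}"

fun jigsaw_step :: "'a double_graph \<Rightarrow> 'a set double_graph" where
  "jigsaw_step (V, E1, E2) =
     (let W = graph_components V (E1 \<inter> E2) in (W, merged_edges W E1, merged_edges W E2))"

fun relabel :: "('a \<Rightarrow> 'b) \<Rightarrow> 'a double_graph \<Rightarrow> 'b double_graph" where
  "relabel f (V, E1, E2) = (f ` V, (`) f ` E1, (`) f ` E2)"

text \<open>Each step turns vertices of type \<open>'a\<close> into vertices of type \<open>'a set\<close>, so the steps cannot be
  iterated literally at one type.  We therefore name every vertex of the \<open>i\<close>-th double graph by the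
  set of original vertices it contains: an original vertex \<open>v\<close> becomes \<open>{v}\<close>, and a component \<open>C\<close>
  of the current auxiliary graph becomes \<open>\<Union>C\<close>.  This relabelling is injective, see
  \<open>jigsaw_relabel_inj\<close> below, so it changes nothing but the names of the vertices.\<close>

primrec jigsaw :: "'a double_graph \<Rightarrow> nat \<Rightarrow> 'a set double_graph" where
  "jigsaw G 0 = relabel (\<lambda>v. {v}) G"
| "jigsaw G (Suc i) = relabel Union (jigsaw_step (jigsaw G i))"

definition jigsaw_stops_at :: "'a double_graph \<Rightarrow> nat \<Rightarrow> bool" where
  "jigsaw_stops_at G i \<longleftrightarrow>
     aux_edges (jigsaw G i) = {} \<and> (\<forall>k<i. aux_edges (jigsaw G k) \<noteq> {})"

definition jigsaw_percolates :: "'a double_graph \<Rightarrow> bool" where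
  "jigsaw_percolates G \<longleftrightarrow> (\<exists>i. jigsaw_stops_at G i \<and> card (verts (jigsaw G i)) = 1)"

text \<open>The vertex set is always \<open>{1..n}\<close>, so a random graph is described by its random edge set.\<close>

definition gnp :: "nat \<Rightarrow> real \<Rightarrow> nat set set pmf" where
  "gnp n p = map_pmf (\<lambda>f. {e \<in> [{1..n}]\<^bsup>2\<^esup>. f e})
     (Pi_pmf ([{1..n}]\<^bsup>2\<^esup>) False (\<lambda>_. bernoulli_pmf p))"

definition double_gnp :: "nat \<Rightarrow> real \<Rightarrow> real \<Rightarrow> nat double_graph pmf" where
  "double_gnp n p q = map_pmf (\<lambda>(E1, E2). ({1..n}, E1, E2)) (pair_pmf (gnp n p) (gnp n q))"

lemma double_graph_double_gnp:
  assumes "G \<in> set_pmf (double_gnp n p q)"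
  shows "double_graph G"
  using assms by (auto simp: double_gnp_def gnp_def)

lemma equiv_same_component: "equiv V (same_component V E)"
proof (rule equivI)
  let ?R = "{(x, y). x \<in> V \<and> y \<in> V \<and> {x, y} \<in> E}"
  show "same_component V E \<subseteq> V \<times> V" "refl_on V (same_component V E)"
    by (auto simp: same_component_def refl_on_def)
  have "sym ?R" by (auto simp: sym_def insert_commute)
  then have "sym (?R\<^sup>*)" by (rule sym_rtrancl)
  then show "sym (same_component V E)" by (auto simp: same_component_def sym_def)
  show "trans (same_component V E)"
    unfolding same_component_def trans_def by (auto intro: rtrancl_trans)
qed

lemma partition_on_graph_components: "partition_on V (graph_components V E)"
  unfolding graph_components_def by (rule partition_on_quotient) (rule equiv_same_component)

lemma partition_on_Union_parts:
  assumes P: "partition_on V P" and Q: "partition_on P Q"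
  shows "partition_on V (Union ` Q)" and "inj_on Union Q"
proof -
  have ne: "\<And>A. A \<in> P \<Longrightarrow> A \<noteq> {}" "\<And>C. C \<in> Q \<Longrightarrow> C \<noteq> {}"
    using P Q by (auto simp: partition_on_def)
  have sub: "\<And>C. C \<in> Q \<Longrightarrow> C \<subseteq> P" and UQ: "\<Union>Q = P" and UP: "\<Union>P = V"
    using P Q by (auto simp: partition_on_def)
  have eq: "C = D" if C: "C \<in> Q" and D: "D \<in> Q" and x: "x \<in> \<Union>C" "x \<in> \<Union>D" for C D x
  proof -
    from x obtain A B where AB: "A \<in> C" "x \<in> A" "B \<in> D" "x \<in> B" by auto
    with sub C D have "A \<in> P" "B \<in> P" by auto
    with P AB have "A = B" by (auto simp: partition_on_def disjoint_def)
    with Q C D AB show "C = D" by (auto simp: partition_on_def disjoint_def)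
  qed
  have Une: "\<Union>C \<noteq> {}" if "C \<in> Q" for C
  proof -
    from ne(2)[OF that] obtain A where "A \<in> C" by auto
    with sub[OF that] ne(1)[of A] show ?thesis by auto
  qed
  show "inj_on Union Q"
  proof (rule inj_onI)
    fix C D assume CD: "C \<in> Q" "D \<in> Q" "\<Union>C = \<Union>D"
    with Une[of C] obtain x where "x \<in> \<Union>C" by blast
    with eq[of C D x] CD show "C = D" by simp
  qed
  show "partition_on V (Union ` Q)"
  proof (rule partition_onI)
    show "\<Union>(Union ` Q) = V" using UQ UP by auto
    show "{} \<notin> Union ` Q"
      using Une by force
    show "disjnt p q" if pq: "p \<in> Union ` Q" "q \<in> Union ` Q" "p \<noteq> q" for p q
    proof -
      from pq obtain C D where CD: "C \<in> Q" "D \<in> Q" "p = \<Union>C" "q = \<Union>D" by blast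
      with pq(3) eq[of C D] show ?thesis unfolding disjnt_def by blast
    qed
  qed
qed

lemma verts_jigsaw_Suc:
  "\<exists>E. verts (jigsaw_step (jigsaw G i)) = graph_components (verts (jigsaw G i)) E
     \<and> verts (jigsaw G (Suc i)) = Union ` graph_components (verts (jigsaw G i)) E"
  by (cases "jigsaw G i") (auto simp: Let_def)

lemma partition_on_jigsaw: "partition_on (verts G) (verts (jigsaw G i))"
proof (induction i)
  case 0
  show ?case by (cases G) (simp add: partition_on_singletons)
next
  case (Suc i)
  obtain E where "verts (jigsaw G (Suc i)) = Union ` graph_components (verts (jigsaw G i)) E"
    using verts_jigsaw_Suc[of G i] by blast
  with partition_on_Union_parts(1)[OF Suc partition_on_graph_components[of _ E]]
  show ?case by (simp only:)
qed

lemma jigsaw_relabel_inj: "inj_on Union (verts (jigsaw_step (jigsaw G i)))"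
proof -
  obtain E where "verts (jigsaw_step (jigsaw G i)) = graph_components (verts (jigsaw G i)) E"
    using verts_jigsaw_Suc[of G i] by blast
  with partition_on_Union_parts(2)[OF partition_on_jigsaw partition_on_graph_components[of _ E]]
  show ?thesis by (simp only:)
qed

end

theory Submission
  imports Defs "HOL-Real_Asymp.Real_Asymp"
begin

text \<open>
  Call a vertex set spanned if it can be assembled from single vertices by repeatedly uniting two
  disjoint spanned sets joined by an edge of each colour; the process percolates iff the whole
  vertex set is spanned.

  Subcritical case: a spanned set has a root from which it can be explored one vertex at a time,
  absorbing at every step single vertices or spanned clusters no larger than the explored part.
  An exploration weight of product form bounds the probability of surviving up to size \<open>k\<close>. Applied
  to small sets it improves itself to \<open>C N! (2 e\<^sup>\<beta> N)\<^sup>N (p\<^sub>1 p\<^sub>2)\<^sup>N\<^sup>-\<^sup>1\<close> for every \<open>\<beta> > 0\<close>; fed back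
  into the exploration of all \<open>n\<close> vertices up to a size \<open>k\<close> of order \<open>ln n\<close> it gives
  \<open>n\<close> times a bound of order \<open>n\<^sup>-\<^sup>1\<^sup>-\<^sup>c\<close>.

  Supercritical case: disjoint trials, each exploring a fresh pool of vertices with a prescribed
  discovery profile, produce a spanned set of size \<open>M ln n\<close> with high probability; a first moment
  bound excludes spanned sets of intermediate size to which no further vertex attaches, so a spanned
  set of size \<open>C / p\<^sub>i\<close> exists, and with reserved vertices it becomes one to which every vertex has an
  edge of colour \<open>i\<close>. If the other colour is connected, everything is spanned. Both events are
  increasing, so by Harris' inequality conditioning on connectedness only helps.
\<close>

section \<open>Product measures on Boolean families\<close>

text \<open>Origin of the constant 1/4: put g = n p1 p2. A vertex attaches to t given vertices with
  probability about t^2 p1 p2, as it needs an edge of each colour. Exploring the (t+1)-st vertex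
  therefore discovers about (2 t + 1) g new ones. Growth is subcritical until t is about 1 / (2 g),
  and surviving that long has probability exp (- 1 / (4 g)) to leading order. For g = c / ln n this
  is n^(- 1 / (4 c)), to be weighed against n starting vertices, and the two balance at c = 1/4. The
  obstacle in the upper bound is that whole clusters may be absorbed, and their probability is of
  the kind being estimated. A cluster bound with a fixed excess factor \<open>exp \<beta>\<close>
  per vertex would move the threshold, hence the effort to reach every \<open>\<beta> > 0\<close>.
  The obstacle in the lower bound is that a trial succeeds only with a probability slightly above
  1/n. About n / ln n trials are therefore needed, so a trial may use up only its explored vertices,
  of order ln n, and not its whole pool.\<close>

definition bprod :: "'b set \<Rightarrow> ('b \<Rightarrow> real) \<Rightarrow> ('b \<Rightarrow> bool) pmf" where
  "bprod I ps = Pi_pmf I False (\<lambda>i. bernoulli_pmf (ps i))"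

abbreviation bprob :: "'b set \<Rightarrow> ('b \<Rightarrow> real) \<Rightarrow> (('b \<Rightarrow> bool) \<Rightarrow> bool) \<Rightarrow> real" where
  "bprob I ps A \<equiv> measure_pmf.prob (bprod I ps) {w. A w}"

text \<open>Measurability in terms of coordinates. Every independence claim below reduces to
  exhibiting disjoint coordinate sets.\<close>

definition depends :: "(('b \<Rightarrow> bool) \<Rightarrow> bool) \<Rightarrow> 'b set \<Rightarrow> bool" where
  "depends A X \<longleftrightarrow> (\<forall>w w'. (\<forall>i\<in>X. w i = w' i) \<longrightarrow> A w = A w')"

lemma dependsI: "(\<And>w w'. (\<And>i. i \<in> X \<Longrightarrow> w i = w' i) \<Longrightarrow> A w = A w') \<Longrightarrow> depends A X"
  unfolding depends_def by blast

lemma dependsI_imp: "(\<And>w w'. (\<And>i. i \<in> X \<Longrightarrow> w i = w' i) \<Longrightarrow> A w \<Longrightarrow> A w') \<Longrightarrow> depends A X"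
  unfolding depends_def by metis

lemma dependsD: "depends A X \<Longrightarrow> (\<And>i. i \<in> X \<Longrightarrow> w i = w' i) \<Longrightarrow> A w = A w'"
  unfolding depends_def by blast

lemma depends_mono: "depends A X \<Longrightarrow> X \<subseteq> Y \<Longrightarrow> depends A Y"
  unfolding depends_def by blast

lemma depends_conj: "depends A X \<Longrightarrow> depends B X \<Longrightarrow> depends (\<lambda>w. A w \<and> B w) X"
  unfolding depends_def by metis

lemma depends_disj: "depends A X \<Longrightarrow> depends B X \<Longrightarrow> depends (\<lambda>w. A w \<or> B w) X"
  unfolding depends_def by metis

lemma depends_not: "depends A X \<Longrightarrow> depends (\<lambda>w. \<not> A w) X"
  unfolding depends_def by metis

lemma depends_imp: "depends A X \<Longrightarrow> depends B X \<Longrightarrow> depends (\<lambda>w. A w \<longrightarrow> B w) X"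
  unfolding depends_def by metis

lemma depends_const: "depends (\<lambda>w. c) X"
  unfolding depends_def by simp

lemma depends_all: "(\<And>x. depends (A x) X) \<Longrightarrow> depends (\<lambda>w. \<forall>x. A x w) X"
  unfolding depends_def by metis

lemma depends_ex: "(\<And>x. depends (A x) X) \<Longrightarrow> depends (\<lambda>w. \<exists>x. A x w) X"
  unfolding depends_def by metis

lemma depends_ball: "(\<And>x. x \<in> S \<Longrightarrow> depends (A x) X) \<Longrightarrow> depends (\<lambda>w. \<forall>x\<in>S. A x w) X"
  unfolding depends_def by metis

lemma depends_bex: "(\<And>x. x \<in> S \<Longrightarrow> depends (A x) X) \<Longrightarrow> depends (\<lambda>w. \<exists>x\<in>S. A x w) X"
  unfolding depends_def by metis

lemma depends_coord: "i \<in> X \<Longrightarrow> depends (\<lambda>w. w i) X"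
  unfolding depends_def by simp

lemmas depends_intros = depends_conj depends_disj depends_not depends_imp depends_const
  depends_all depends_ex depends_ball depends_bex depends_coord

lemma set_bprod: "finite I \<Longrightarrow> w \<in> set_pmf (bprod I ps) \<Longrightarrow> i \<notin> I \<Longrightarrow> \<not> w i"
  using set_Pi_pmf_subset[of I False "\<lambda>i. bernoulli_pmf (ps i)"] unfolding bprod_def by auto

lemma measure_pmf_cong_set:
  "(\<And>w. w \<in> set_pmf M \<Longrightarrow> P w = Q w) \<Longrightarrow> measure_pmf.prob M {w. P w} = measure_pmf.prob M {w. Q w}"
  by (rule measure_prob_cong_0) (auto simp: set_pmf_iff)

lemma measure_pmf_mono_set:
  assumes "\<And>w. w \<in> set_pmf M \<Longrightarrow> P w \<Longrightarrow> Q w"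
  shows "measure_pmf.prob M {w. P w} \<le> measure_pmf.prob M {w. Q w}"
proof -
  have "measure_pmf.prob M {w. P w} = measure_pmf.prob M {w. P w \<and> w \<in> set_pmf M}"
    by (rule measure_pmf_cong_set) auto
  also have "\<dots> \<le> measure_pmf.prob M {w. Q w}"
    by (rule measure_pmf.finite_measure_mono) (use assms in auto)
  finally show ?thesis .
qed

lemma bprob_mono: "(\<And>w. A w \<Longrightarrow> B w) \<Longrightarrow> bprob I ps A \<le> bprob I ps B"
  by (rule measure_pmf_mono_set)

lemma prob_pair_prod:
  "measure_pmf.prob (pair_pmf M N) {(x, y). A x \<and> B y} =
   measure_pmf.prob M {x. A x} * measure_pmf.prob N {y. B y}"
proof -
  \<comment> \<open>The product rule is applied to countable sets, so both events are first cut down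
    to the supports.\<close>
  have "measure_pmf.prob (pair_pmf M N) {(x, y). A x \<and> B y} =
    measure_pmf.prob (pair_pmf M N) ({x. A x \<and> x \<in> set_pmf M} \<times> {y. B y \<and> y \<in> set_pmf N})"
    by (rule measure_prob_cong_0) (auto simp: set_pmf_iff pmf_pair)
  also have "\<dots> = measure_pmf.prob M {x. A x \<and> x \<in> set_pmf M} * measure_pmf.prob N {y. B y \<and> y \<in> set_pmf N}"
    by (rule measure_pmf_prob_product) (auto intro: countable_subset[OF _ countable_set_pmf])
  also have "measure_pmf.prob M {x. A x \<and> x \<in> set_pmf M} = measure_pmf.prob M {x. A x}"
    by (rule measure_pmf_cong_set) auto
  also have "measure_pmf.prob N {x. B x \<and> x \<in> set_pmf N} = measure_pmf.prob N {x. B x}"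
    by (rule measure_pmf_cong_set) auto
  finally show ?thesis .
qed

text \<open>The product is split at \<open>I \<inter> X\<close>; since \<open>Y\<close> is disjoint
  from \<open>X\<close>, the event \<open>B\<close> sees only the second factor. \<open>X\<close>
  and \<open>Y\<close> may reach outside \<open>I\<close>, where every coordinate is surely
  \<open>False\<close>.\<close>

lemma bprob_indep:
  assumes I: "finite I" and A: "depends A X" and B: "depends B Y" and XY: "X \<inter> Y = {}"
  shows "bprob I ps (\<lambda>w. A w \<and> B w) = bprob I ps A * bprob I ps B"
proof -
  define f where "f i = bernoulli_pmf (ps i)" for i
  let ?M = "Pi_pmf (I \<inter> X) False f" and ?N = "Pi_pmf (I - X) False f"
  let ?m = "\<lambda>(g, h) x. if x \<in> I \<inter> X then g x else h x"
  have "I = (I \<inter> X) \<union> (I - X)" by auto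
  then have eq: "bprod I ps = map_pmf ?m (pair_pmf ?M ?N)"
    using Pi_pmf_union[of "I \<inter> X" "I - X" False f] I unfolding bprod_def f_def by fastforce
  have *: "bprob I ps (\<lambda>w. C w \<and> D w) = measure_pmf.prob ?M {w. C w} * measure_pmf.prob ?N {w. D w}"
    if C: "depends C X" and D: "depends D Y" for C D
  proof -
    have "bprob I ps (\<lambda>w. C w \<and> D w) =
       measure_pmf.prob (pair_pmf ?M ?N) {z. C (?m z) \<and> D (?m z)}"
      unfolding eq by (simp add: measure_map_pmf vimage_def)
    also have "\<dots> = measure_pmf.prob (pair_pmf ?M ?N) {z. case z of (g, h) \<Rightarrow> C g \<and> D h}"
    proof (rule measure_pmf_cong_set)
      fix z assume z: "z \<in> set_pmf (pair_pmf ?M ?N)"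
      obtain g h where gh: "z = (g, h)" by (cases z)
      have g: "\<not> g x" if "x \<notin> I \<inter> X" for x
        using z gh set_Pi_pmf_subset[of "I \<inter> X" False f] I that by auto
      have h: "\<not> h x" if "x \<notin> I - X" for x
        using z gh set_Pi_pmf_subset[of "I - X" False f] I that by auto
      have "C (?m z) = C g"
        by (rule dependsD[OF C]) (use g h gh in auto)
      moreover have "D (?m z) = D h"
        by (rule dependsD[OF D]) (use g h gh XY in auto)
      ultimately show "(C (?m z) \<and> D (?m z)) = (case z of (g, h) \<Rightarrow> C g \<and> D h)" using gh by simp
    qed
    also have "\<dots> = measure_pmf.prob ?M {w. C w} * measure_pmf.prob ?N {w. D w}"
      using prob_pair_prod[of ?M ?N C D] by simp
    finally show ?thesis .
  qed
  have "bprob I ps A = measure_pmf.prob ?M {w. A w}"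
    using *[OF A depends_const[of True Y]] by simp
  moreover have "bprob I ps B = measure_pmf.prob ?N {w. B w}"
    using *[OF depends_const[of True X] B] by simp
  ultimately show ?thesis using *[OF A B] by simp
qed

lemma bprob_coord:
  assumes "finite I" "i \<in> I" "ps i \<in> {0..1}"
  shows "bprob I ps (\<lambda>w. w i) = ps i"
proof -
  have "measure_pmf.prob (map_pmf (\<lambda>f. f i) (bprod I ps)) {True} = bprob I ps (\<lambda>w. w i)"
    by (simp add: measure_map_pmf vimage_def)
  moreover have "map_pmf (\<lambda>f. f i) (bprod I ps) = bernoulli_pmf (ps i)"
    using assms unfolding bprod_def by (simp add: Pi_pmf_component)
  ultimately show ?thesis using assms by (simp add: measure_pmf_single)
qed

lemma bprob_not: "bprob I ps (\<lambda>w. \<not> A w) = 1 - bprob I ps A"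
  using measure_pmf.prob_compl[of "{w. A w}" "bprod I ps"] by (simp add: Compl_eq_Diff_UNIV[symmetric] Collect_neg_eq)

lemma bprob_none:
  assumes I: "finite I" and X: "X \<subseteq> I" and ps: "\<And>i. i \<in> X \<Longrightarrow> ps i \<in> {0..1}"
  shows "bprob I ps (\<lambda>w. \<forall>i\<in>X. \<not> w i) = (\<Prod>i\<in>X. 1 - ps i)"
proof -
  have "finite X" using I X finite_subset by blast
  then show ?thesis using X ps
  proof (induction X rule: finite_induct)
    case empty then show ?case by simp
  next
    case (insert i X)
    have "bprob I ps (\<lambda>w. \<forall>i\<in>insert i X. \<not> w i) = bprob I ps (\<lambda>w. \<not> w i \<and> (\<forall>i\<in>X. \<not> w i))" by simp
    also have "\<dots> = bprob I ps (\<lambda>w. \<not> w i) * bprob I ps (\<lambda>w. \<forall>i\<in>X. \<not> w i)"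
      by (rule bprob_indep[OF I, of _ "{i}" _ X]) (use insert in \<open>auto intro!: depends_intros\<close>)
    also have "bprob I ps (\<lambda>w. \<not> w i) = 1 - ps i"
      using insert I by (simp add: bprob_not bprob_coord)
    finally show ?case using insert by simp
  qed
qed

text \<open>Conditioning on one coordinate. It drives the inductions for Harris' inequality and for
  monotonicity in the parameters.\<close>

lemma bprob_insert:
  assumes "finite I" "x \<notin> I" "ps x \<in> {0..1}"
  shows "bprob (insert x I) ps A =
    ps x * bprob I ps (\<lambda>w. A (w(x := True))) + (1 - ps x) * bprob I ps (\<lambda>w. A (w(x := False)))"
proof -
  let ?N = "Pi_pmf I False (\<lambda>i. bernoulli_pmf (ps i))" and ?B = "bernoulli_pmf (ps x)"
  let ?P = "\<lambda>S. measure_pmf.prob (pair_pmf ?B ?N) S"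
  have "bprob (insert x I) ps A = ?P {z. A ((snd z)(x := fst z))}"
    using assms unfolding bprod_def
    by (simp add: Pi_pmf_insert measure_map_pmf vimage_def case_prod_beta)
  also have "{z. A ((snd z)(x := fst z))} =
     {(y, f). y \<and> A (f(x := True))} \<union> {(y, f). \<not> y \<and> A (f(x := False))}"
  proof (rule set_eqI)
    fix z :: "bool \<times> ('a \<Rightarrow> bool)"
    obtain b g where "z = (b, g)" by (cases z)
    then show "z \<in> {z. A ((snd z)(x := fst z))} \<longleftrightarrow>
      z \<in> {(y, f). y \<and> A (f(x := True))} \<union> {(y, f). \<not> y \<and> A (f(x := False))}"
      by (cases b) simp_all
  qed
  also have "?P \<dots> = ?P {(y, f). y \<and> A (f(x := True))} + ?P {(y, f). \<not> y \<and> A (f(x := False))}"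
    by (rule measure_pmf.finite_measure_Union) auto
  also have "\<dots> = measure_pmf.prob ?B {y. y} * bprob I ps (\<lambda>w. A (w(x := True)))
    + measure_pmf.prob ?B {y. \<not> y} * bprob I ps (\<lambda>w. A (w(x := False)))"
    unfolding prob_pair_prod bprod_def by simp
  also have "measure_pmf.prob ?B {y. y} = ps x"
  proof -
    have "{y. y} = {True}" by auto
    then show ?thesis using assms measure_pmf_single[of ?B True] by simp
  qed
  also have "measure_pmf.prob ?B {y. \<not> y} = 1 - ps x"
  proof -
    have "{y. \<not> y} = {False}" by auto
    then show ?thesis using assms measure_pmf_single[of ?B False] by simp
  qed
  finally show ?thesis .
qed

section \<open>Increasing events\<close>

definition increasing :: "(('b \<Rightarrow> bool) \<Rightarrow> bool) \<Rightarrow> bool" where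
  "increasing A \<longleftrightarrow> (\<forall>w w'. (\<forall>i. w i \<longrightarrow> w' i) \<longrightarrow> A w \<longrightarrow> A w')"

lemma increasing_upd: "increasing A \<Longrightarrow> increasing (\<lambda>w. A (w(x := b)))"
proof (unfold increasing_def, intro allI impI)
  fix w w' :: "'a \<Rightarrow> bool"
  assume A: "\<forall>w w'. (\<forall>i. w i \<longrightarrow> w' i) \<longrightarrow> A w \<longrightarrow> A w'" and "\<forall>i. w i \<longrightarrow> w' i" and "A (w(x := b))"
  then show "A (w'(x := b))" by (intro A[rule_format, of "w(x := b)" "w'(x := b)"]) auto
qed

lemma increasingD: "increasing A \<Longrightarrow> A w \<Longrightarrow> (\<And>i. w i \<Longrightarrow> w' i) \<Longrightarrow> A w'"
  unfolding increasing_def by blast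

lemma increasing_upd_le:
  "increasing A \<Longrightarrow> bprob I ps (\<lambda>w. A (w(x := False))) \<le> bprob I ps (\<lambda>w. A (w(x := True)))"
  by (rule bprob_mono, erule (1) increasingD) (auto split: if_splits)

theorem Harris_inequality:
  assumes "finite I" "\<And>i. i \<in> I \<Longrightarrow> ps i \<in> {0..1}" "increasing A" "increasing B"
  shows "bprob I ps A * bprob I ps B \<le> bprob I ps (\<lambda>w. A w \<and> B w)"
  using assms
proof (induction I arbitrary: A B rule: finite_induct)
  case empty
  then show ?case unfolding bprod_def by (simp add: indicator_def)
next
  case (insert x I)
  let ?a = "\<lambda>b. bprob I ps (\<lambda>w. A (w(x := b)))" and ?b = "\<lambda>b. bprob I ps (\<lambda>w. B (w(x := b)))"
  have IH: "?a c * ?b c \<le> bprob I ps (\<lambda>w. A (w(x := c)) \<and> B (w(x := c)))" for c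
    by (rule insert.IH[OF _ increasing_upd[OF insert.prems(2)] increasing_upd[OF insert.prems(3)]]) (use insert.prems(1) in blast)
  have p: "ps x \<in> {0..1}" using insert by auto
  \<comment> \<open>Switching coordinate \<open>x\<close> on raises both conditional probabilities,
    so their covariance under this coordinate is nonnegative.\<close>
  have "0 \<le> ps x * (1 - ps x) * ((?a True - ?a False) * (?b True - ?b False))"
    using p insert by (intro mult_nonneg_nonneg) (auto intro!: increasing_upd_le)
  then have "(ps x * ?a True + (1 - ps x) * ?a False) * (ps x * ?b True + (1 - ps x) * ?b False)
     \<le> ps x * (?a True * ?b True) + (1 - ps x) * (?a False * ?b False)"
    by (simp add: algebra_simps)
  also have "\<dots> \<le> ps x * bprob I ps (\<lambda>w. A (w(x := True)) \<and> B (w(x := True)))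
     + (1 - ps x) * bprob I ps (\<lambda>w. A (w(x := False)) \<and> B (w(x := False)))"
    using p IH by (intro add_mono mult_left_mono) auto
  finally show ?case using insert p by (simp add: bprob_insert)
qed

text \<open>The induction over coordinates takes the place of a monotone coupling of the two product
  measures.\<close>

lemma bprob_mono_params:
  assumes "finite I" "\<And>i. i \<in> I \<Longrightarrow> 0 \<le> ps i \<and> ps i \<le> ps' i \<and> ps' i \<le> 1" "increasing A"
  shows "bprob I ps A \<le> bprob I ps' A"
  using assms
proof (induction I arbitrary: A rule: finite_induct)
  case empty
  then show ?case unfolding bprod_def by simp
next
  case (insert x I)
  let ?a = "\<lambda>ps b. bprob I ps (\<lambda>w. A (w(x := b)))"
  have IH: "?a ps c \<le> ?a ps' c" for c
    by (rule insert.IH[OF _ increasing_upd[OF insert.prems(2)]]) (use insert.prems(1) in blast)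
  have p: "0 \<le> ps x" "ps x \<le> ps' x" "ps' x \<le> 1" using insert by auto
  have le: "?a ps' False \<le> ?a ps' True" using insert by (intro increasing_upd_le)
  have "ps x * ?a ps True + (1 - ps x) * ?a ps False \<le> ps x * ?a ps' True + (1 - ps x) * ?a ps' False"
    using p IH by (intro add_mono mult_left_mono) auto
  also have "\<dots> = ?a ps' False + ps x * (?a ps' True - ?a ps' False)" by (simp add: algebra_simps)
  also have "\<dots> \<le> ?a ps' False + ps' x * (?a ps' True - ?a ps' False)"
    using p le by (intro add_left_mono mult_right_mono) auto
  also have "\<dots> = ps' x * ?a ps' True + (1 - ps' x) * ?a ps' False" by (simp add: algebra_simps)
  finally show ?case
    using bprob_insert[of I x ps A] bprob_insert[of I x ps' A] insert.hyps p by simp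
qed

section \<open>Spanned sets and the jigsaw process\<close>

type_synonym world = "bool \<times> nat set \<Rightarrow> bool"

definition joined :: "world \<Rightarrow> bool \<Rightarrow> nat set \<Rightarrow> nat set \<Rightarrow> bool" where
  "joined w i A B \<longleftrightarrow> (\<exists>a\<in>A. \<exists>b\<in>B. w (i, {a, b}))"

definition djoin :: "world \<Rightarrow> nat set \<Rightarrow> nat set \<Rightarrow> bool" where
  "djoin w A B \<longleftrightarrow> joined w True A B \<and> joined w False A B"

text \<open>The vertex set is no parameter: whether a set is spanned is decided by the pairs inside
  it. This locality is what makes disjoint clusters independent.\<close>

inductive spanned :: "world \<Rightarrow> nat set \<Rightarrow> bool" for w where
  single: "spanned w {v}"
| merge: "spanned w A \<Longrightarrow> spanned w B \<Longrightarrow> A \<inter> B = {} \<Longrightarrow> djoin w A B \<Longrightarrow> spanned w (A \<union> B)"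

lemma joined_commute: "joined w i A B = joined w i B A"
  unfolding joined_def by (metis insert_commute)

lemma djoin_commute: "djoin w A B = djoin w B A"
  unfolding djoin_def by (metis joined_commute)

lemma joined_mono: "joined w i A B \<Longrightarrow> A \<subseteq> A' \<Longrightarrow> B \<subseteq> B' \<Longrightarrow> joined w i A' B'"
  unfolding joined_def by blast

lemma djoin_mono: "djoin w A B \<Longrightarrow> A \<subseteq> A' \<Longrightarrow> B \<subseteq> B' \<Longrightarrow> djoin w A' B'"
  unfolding djoin_def by (meson joined_mono)

lemma not_djoin_empty [simp]: "\<not> djoin w {} B" "\<not> djoin w B {}"
  unfolding djoin_def joined_def by auto

lemma spanned_finite: "spanned w A \<Longrightarrow> finite A"
  by (induction rule: spanned.induct) auto

lemma spanned_nonempty: "spanned w A \<Longrightarrow> A \<noteq> {}"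
  by (induction rule: spanned.induct) auto

lemma spanned_insert: "spanned w A \<Longrightarrow> v \<notin> A \<Longrightarrow> djoin w {v} A \<Longrightarrow> spanned w (insert v A)"
  using spanned.merge[OF _ spanned.single[of w v], of A] djoin_commute by auto

lemma spanned_attach:
  assumes "finite D" "spanned w A" "\<And>v. v \<in> D \<Longrightarrow> djoin w {v} A"
  shows "spanned w (A \<union> D)"
  using assms(1,3)
proof (induction D rule: finite_induct)
  case empty then show ?case using assms by simp
next
  case (insert v D)
  have "djoin w {v} (A \<union> D)" by (rule djoin_mono[OF insert(4)[of v]]) auto
  then show ?case using insert spanned_insert[of w "A \<union> D" v] by (cases "v \<in> A") (auto simp: insert_absorb)
qed

text \<open>Descending the merge tree of \<open>B\<close> along nodes that cross \<open>T\<close>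
  ends at a merge of a part inside \<open>T\<close> with a part disjoint from
  \<open>T\<close>.\<close>

lemma spanned_cross:
  assumes "spanned w B" "B \<inter> T \<noteq> {}" "\<not> B \<subseteq> T"
  shows "\<exists>C. C \<subseteq> B - T \<and> spanned w C \<and> djoin w C T"
  using assms
proof (induction rule: spanned.induct)
  case (single v) then show ?case by auto
next
  case (merge A B)
  consider "A \<inter> T \<noteq> {}" "\<not> A \<subseteq> T" | "B \<inter> T \<noteq> {}" "\<not> B \<subseteq> T" | "A \<subseteq> T" "B \<inter> T = {}" | "B \<subseteq> T" "A \<inter> T = {}"
    using merge.prems by (cases "A \<subseteq> T"; cases "B \<subseteq> T") auto
  then show ?case
  proof cases
    case 1
    then obtain C where "C \<subseteq> A - T" "spanned w C" "djoin w C T" using merge.IH(1) by auto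
    then show ?thesis by (intro exI[of _ C]) auto
  next
    case 2
    then obtain C where "C \<subseteq> B - T" "spanned w C" "djoin w C T" using merge.IH(2) by auto
    then show ?thesis by (intro exI[of _ C]) auto
  next
    case 3
    have "djoin w B A" using merge.hyps(4) djoin_commute[of w B A] by simp
    then have "djoin w B T" by (rule djoin_mono) (use 3 in auto)
    then show ?thesis using 3 merge.hyps(2) by (intro exI[of _ B]) auto
  next
    case 4
    have "djoin w A T" by (rule djoin_mono[OF merge.hyps(4)]) (use 4 in auto)
    then show ?thesis using 4 merge.hyps(1) by (intro exI[of _ A]) auto
  qed
qed

text \<open>A vertex that lies in the larger part of every merge is a root: however far a set \<open>T\<close> around it has
  grown, the next part merged with it is no larger than \<open>T\<close>.\<close>

definition root_of :: "world \<Rightarrow> nat set \<Rightarrow> nat \<Rightarrow> bool" where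
  "root_of w S v \<longleftrightarrow> (\<forall>T. v \<in> T \<and> T \<subset> S \<longrightarrow>
     (\<exists>B\<subseteq>S - T. spanned w B \<and> card B \<le> card T \<and> djoin w B T))"

text \<open>Here \<open>T\<close> may spill out of the set, because the induction hypothesis for one
  part of a merge is applied to a \<open>T\<close> that can already contain pieces of the other
  part.\<close>

lemma spanned_root_aux:
  assumes "spanned w S"
  shows "\<exists>v\<in>S. \<forall>T. finite T \<and> v \<in> T \<and> \<not> S \<subseteq> T \<longrightarrow>
     (\<exists>B\<subseteq>S - T. spanned w B \<and> card B \<le> card T \<and> djoin w B T)"
  using assms
proof (induction rule: spanned.induct)
  case (single v) then show ?case by auto
next
  case (merge A B)
  have *: "\<exists>v\<in>A \<union> B. \<forall>T. finite T \<and> v \<in> T \<and> \<not> A \<union> B \<subseteq> T \<longrightarrow>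
     (\<exists>C\<subseteq>(A \<union> B) - T. spanned w C \<and> card C \<le> card T \<and> djoin w C T)"
    if A: "\<exists>v\<in>A. \<forall>T. finite T \<and> v \<in> T \<and> \<not> A \<subseteq> T \<longrightarrow>
     (\<exists>B\<subseteq>A - T. spanned w B \<and> card B \<le> card T \<and> djoin w B T)"
      and sA: "spanned w A" and sB: "spanned w B" and AB: "djoin w B A" "card B \<le> card A" for A B
  proof -
    from A obtain v where v: "v \<in> A" and vT: "\<forall>T. finite T \<and> v \<in> T \<and> \<not> A \<subseteq> T \<longrightarrow>
     (\<exists>B\<subseteq>A - T. spanned w B \<and> card B \<le> card T \<and> djoin w B T)" by (elim bexE)
    show ?thesis
    proof (intro bexI[of _ v] allI impI)
      show "v \<in> A \<union> B" using v by simp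
      fix T assume T: "finite T \<and> v \<in> T \<and> \<not> A \<union> B \<subseteq> T"
      show "\<exists>C\<subseteq>(A \<union> B) - T. spanned w C \<and> card C \<le> card T \<and> djoin w C T"
      proof (cases "A \<subseteq> T")
        case False
        with vT[rule_format, of T] T obtain C where "C \<subseteq> A - T" "spanned w C" "card C \<le> card T" "djoin w C T" by auto
        then show ?thesis by (intro exI[of _ C]) auto
      next
        case True
        then have BT: "\<not> B \<subseteq> T" using T by blast
        \<comment> \<open>Once \<open>T\<close> contains the larger part \<open>A\<close>, every
          piece of \<open>B\<close> is small enough.\<close>
        have cT: "card B \<le> card T" using True T AB(2) card_mono[of T A] by linarith
        show ?thesis
        proof (cases "B \<inter> T = {}")
          case True': True
          have "djoin w B T" by (rule djoin_mono[OF AB(1)]) (use True in auto)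
          then show ?thesis using True' sB cT by (intro exI[of _ B]) auto
        next
          case False
          then obtain C where C: "C \<subseteq> B - T" "spanned w C" "djoin w C T"
            using spanned_cross[OF sB False BT] by blast
          have "card C \<le> card B" using C(1) spanned_finite[OF sB] by (meson Diff_subset card_mono subset_trans)
          then show ?thesis using C cT by (intro exI[of _ C]) auto
        qed
      qed
    qed
  qed
  show ?case
  proof (cases "card B \<le> card A")
    case True
    then show ?thesis
      using *[OF merge.IH(1) merge.hyps(1,2)] merge.hyps(4) djoin_commute[of w A B] by simp
  next
    case False
    then show ?thesis
      using *[OF merge.IH(2) merge.hyps(2,1) merge.hyps(4)] by (simp add: Un_commute)
  qed
qed

lemma spanned_root: "spanned w S \<Longrightarrow> \<exists>v\<in>S. root_of w S v"
  using spanned_root_aux[of w S] finite_subset[OF _ spanned_finite[of w S]] unfolding root_of_def psubset_eq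
  by (metis subset_antisym)

text \<open>Applied to the final partition of the process: if no two parts are joined in both
  colours, no merge can leave a part.\<close>

lemma spanned_in_part:
  assumes P: "\<Union>P = V" "spanned w A" "A \<subseteq> V"
    and nj: "\<And>X Y. X \<in> P \<Longrightarrow> Y \<in> P \<Longrightarrow> X \<noteq> Y \<Longrightarrow> \<not> djoin w X Y"
  shows "\<exists>X\<in>P. A \<subseteq> X"
  using P(2,3)
proof (induction rule: spanned.induct)
  case (single v) then show ?case using P(1) by auto
next
  case (merge A B)
  then obtain X Y where XY: "X \<in> P" "Y \<in> P" "A \<subseteq> X" "B \<subseteq> Y" by auto
  have "djoin w X Y" by (rule djoin_mono[OF merge.hyps(4) XY(3,4)])
  then have "X = Y" using nj XY by auto
  then show ?case using XY by (intro bexI[of _ X]) auto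
qed

lemma spanned_split:
  assumes "spanned w S" "card S \<noteq> 1"
  shows "\<exists>A. A \<subseteq> S \<and> A \<noteq> {} \<and> A \<noteq> S \<and> spanned w A \<and> spanned w (S - A) \<and> djoin w A (S - A)"
  using assms
proof cases
  case (single v) then show ?thesis using assms by simp
next
  case (merge A B)
  then have "S - A = B" by auto
  then show ?thesis using merge spanned_nonempty[of w A] spanned_nonempty[of w B]
    by (intro exI[of _ A]) auto
qed

section \<open>Equivalence of jigsaw percolation and spannedness\<close>

definition edge_world :: "nat set set \<Rightarrow> nat set set \<Rightarrow> world" where
  "edge_world E1 E2 = (\<lambda>(i, e). if i then e \<in> E1 else e \<in> E2)"

lemma joined_edge_world:
  "joined (edge_world E1 E2) i A B \<longleftrightarrow> (\<exists>a\<in>A. \<exists>b\<in>B. {a, b} \<in> (if i then E1 else E2))"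
  unfolding joined_def edge_world_def by auto

text \<open>Edges of the contracted graph, read off from the original edge set. This gives every
  stage of the process a closed form.\<close>

definition cluster_edges :: "nat set set \<Rightarrow> nat set set \<Rightarrow> nat set set set" where
  "cluster_edges P E = {{X, Y} | X Y. X \<in> P \<and> Y \<in> P \<and> X \<noteq> Y \<and> (\<exists>a\<in>X. \<exists>b\<in>Y. {a, b} \<in> E)}"

lemma cluster_edges_iff:
  "{X, Y} \<in> cluster_edges P E \<longleftrightarrow> X \<in> P \<and> Y \<in> P \<and> X \<noteq> Y \<and> (\<exists>a\<in>X. \<exists>b\<in>Y. {a, b} \<in> E)"
proof
  assume "{X, Y} \<in> cluster_edges P E"
  then obtain X' Y' where *: "{X, Y} = {X', Y'}" "X' \<in> P" "Y' \<in> P" "X' \<noteq> Y'" "\<exists>a\<in>X'. \<exists>b\<in>Y'. {a, b} \<in> E"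
    unfolding cluster_edges_def by auto
  then have "(X = X' \<and> Y = Y') \<or> (X = Y' \<and> Y = X')" by (auto simp: doubleton_eq_iff)
  then show "X \<in> P \<and> Y \<in> P \<and> X \<noteq> Y \<and> (\<exists>a\<in>X. \<exists>b\<in>Y. {a, b} \<in> E)"
    using * by (metis insert_commute)
qed (auto simp: cluster_edges_def)

text \<open>Contracting twice is contracting once along the coarser partition. Disjointness of
  distinct blocks of \<open>Q\<close> ensures that the two inner parts carrying the edge are
  different.\<close>

lemma relabel_merged:
  assumes P: "partition_on V P" and Q: "partition_on P Q"
  shows "(`) Union ` merged_edges Q (cluster_edges P E) = cluster_edges (Union ` Q) E"
proof -
  have inj: "inj_on Union Q" by (rule partition_on_Union_parts(2)[OF P Q])
  have sub: "C \<subseteq> P" if "C \<in> Q" for C using Q that by (auto simp: partition_on_def)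
  have edge: "(\<exists>u\<in>C. \<exists>v\<in>D. {u, v} \<in> cluster_edges P E) \<longleftrightarrow> (\<exists>a\<in>\<Union>C. \<exists>b\<in>\<Union>D. {a, b} \<in> E)"
    if CD: "C \<in> Q" "D \<in> Q" "C \<noteq> D" for C D
  proof
    assume "\<exists>u\<in>C. \<exists>v\<in>D. {u, v} \<in> cluster_edges P E"
    then show "\<exists>a\<in>\<Union>C. \<exists>b\<in>\<Union>D. {a, b} \<in> E" unfolding cluster_edges_iff by auto
  next
    assume "\<exists>a\<in>\<Union>C. \<exists>b\<in>\<Union>D. {a, b} \<in> E"
    then obtain X Y a b where XY: "X \<in> C" "Y \<in> D" "a \<in> X" "b \<in> Y" "{a, b} \<in> E" by auto
    have "C \<inter> D = {}" using CD Q by (auto simp: partition_on_def disjoint_def)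
    then have "X \<noteq> Y" using XY by auto
    then have "{X, Y} \<in> cluster_edges P E"
      using XY sub[OF CD(1)] sub[OF CD(2)] unfolding cluster_edges_iff by auto
    then show "\<exists>u\<in>C. \<exists>v\<in>D. {u, v} \<in> cluster_edges P E" using XY(1,2) by (intro bexI)
  qed
  show ?thesis
  proof (intro equalityI subsetI)
    fix e assume "e \<in> (`) Union ` merged_edges Q (cluster_edges P E)"
    then obtain C D where CD: "e = {\<Union>C, \<Union>D}" "C \<in> Q" "D \<in> Q" "C \<noteq> D"
       "\<exists>u\<in>C. \<exists>v\<in>D. {u, v} \<in> cluster_edges P E"
      unfolding merged_edges_def by auto
    moreover have "\<Union>C \<noteq> \<Union>D" using inj CD by (auto simp: inj_on_def)
    ultimately show "e \<in> cluster_edges (Union ` Q) E"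
      using edge[of C D] unfolding cluster_edges_iff CD(1) by auto
  next
    fix e assume "e \<in> cluster_edges (Union ` Q) E"
    then obtain X Y where XY: "e = {X, Y}" "X \<in> Union ` Q" "Y \<in> Union ` Q" "X \<noteq> Y" "\<exists>a\<in>X. \<exists>b\<in>Y. {a, b} \<in> E"
      unfolding cluster_edges_def mem_Collect_eq by (elim exE conjE)
    then obtain C D where CD: "C \<in> Q" "D \<in> Q" "X = \<Union>C" "Y = \<Union>D" by (elim imageE)
    have "C \<noteq> D" using XY CD by auto
    then have "\<exists>u\<in>C. \<exists>v\<in>D. {u, v} \<in> cluster_edges P E"
      using edge[of C D] XY(5) CD by simp
    then have "{C, D} \<in> merged_edges Q (cluster_edges P E)"
      using CD \<open>C \<noteq> D\<close> unfolding merged_edges_def by auto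
    then show "e \<in> (`) Union ` merged_edges Q (cluster_edges P E)"
      by (intro image_eqI[of _ _ "{C, D}"]) (use CD XY in simp_all)
  qed
qed

lemma jigsaw_form:
  assumes E: "E1 \<subseteq> [V]\<^bsup>2\<^esup>" "E2 \<subseteq> [V]\<^bsup>2\<^esup>"
  shows "\<exists>P. partition_on V P \<and> jigsaw (V, E1, E2) i = (P, cluster_edges P E1, cluster_edges P E2)"
proof (induction i)
  case 0
  have *: "(`) (\<lambda>v. {v}) ` E = cluster_edges ((\<lambda>v. {v}) ` V) E" if EV: "E \<subseteq> [V]\<^bsup>2\<^esup>" for E :: "nat set set"
  proof (intro equalityI subsetI)
    fix e assume "e \<in> (`) (\<lambda>v. {v}) ` E"
    then obtain e' where e': "e' \<in> E" "e = (\<lambda>v. {v}) ` e'" by auto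
    then obtain a b where "e' = {a, b}" "a \<in> V" "b \<in> V" "a \<noteq> b" 
      using nsets2_E[OF subsetD[OF EV e'(1)]] by metis
    then show "e \<in> cluster_edges ((\<lambda>v. {v}) ` V) E" using e' unfolding cluster_edges_def by auto
  next
    fix e assume "e \<in> cluster_edges ((\<lambda>v. {v}) ` V) E"
    then obtain a b where "e = {{a}, {b}}" "{a, b} \<in> E" unfolding cluster_edges_def by auto
    then show "e \<in> (`) (\<lambda>v. {v}) ` E" by (intro image_eqI[of _ _ "{a, b}"]) auto
  qed
  show ?case using *[OF E(1)] *[OF E(2)] by (auto simp: partition_on_singletons)
next
  case (Suc i)
  then obtain P where P: "partition_on V P" "jigsaw (V, E1, E2) i = (P, cluster_edges P E1, cluster_edges P E2)" by blast
  define Q where "Q = graph_components P (cluster_edges P E1 \<inter> cluster_edges P E2)"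
  have Q: "partition_on P Q" unfolding Q_def by (rule partition_on_graph_components)
  have "jigsaw (V, E1, E2) (Suc i) = (Union ` Q, cluster_edges (Union ` Q) E1, cluster_edges (Union ` Q) E2)"
    using P(2) relabel_merged[OF P(1) Q] by (simp add: Let_def Q_def)
  then show ?case using partition_on_Union_parts(1)[OF P(1) Q] by blast
qed

lemma cluster_edges_djoin:
  "{X, Y} \<in> cluster_edges P E1 \<inter> cluster_edges P E2 \<longleftrightarrow>
     X \<in> P \<and> Y \<in> P \<and> X \<noteq> Y \<and> djoin (edge_world E1 E2) X Y"
  unfolding Int_iff cluster_edges_iff djoin_def joined_edge_world by auto

text \<open>The component is assembled part by part: while \<open>D\<close> is not all of
  \<open>C\<close>, a path from \<open>X0\<close> leaves \<open>D\<close>, and the part at which it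
  leaves is joined to the union of \<open>D\<close> in both colours.\<close>

lemma spanned_component:
  assumes P: "partition_on V P" and fin: "finite P" and sp: "\<And>X. X \<in> P \<Longrightarrow> spanned w X"
    and C: "C \<in> graph_components P E"
    and E: "\<And>X Y. {X, Y} \<in> E \<Longrightarrow> X \<noteq> Y \<Longrightarrow> djoin w X Y"
  shows "spanned w (\<Union>C)"
proof -
  let ?R = "{(x, y). x \<in> P \<and> y \<in> P \<and> {x, y} \<in> E}"
  obtain X0 where X0: "X0 \<in> P" "C = same_component P E `` {X0}"
    using C unfolding graph_components_def by (auto elim: quotientE)
  have Ceq: "C = {Y. Y \<in> P \<and> (X0, Y) \<in> ?R\<^sup>*}" using X0 unfolding same_component_def by auto
  have finC: "finite C" using fin Ceq by auto
  have disj: "X \<inter> Y = {}" if "X \<in> P" "Y \<in> P" "X \<noteq> Y" for X Y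
    using P that by (auto simp: partition_on_def disjoint_def)
  have "spanned w (\<Union>C)" if D: "D \<subseteq> C" "X0 \<in> D" "spanned w (\<Union>D)" for D
    using D
  proof (induction "card (C - D)" arbitrary: D rule: less_induct)
    case less
    show ?case
    proof (cases "D = C")
      case True then show ?thesis using less by simp
    next
      case False
      then obtain Y where Y: "Y \<in> C" "Y \<notin> D" using less by blast
      have "(X0, Y) \<in> ?R\<^sup>*" using Y Ceq by auto
      then have "\<exists>A B. A \<in> D \<and> B \<notin> D \<and> (A, B) \<in> ?R \<and> (X0, A) \<in> ?R\<^sup>*"
        using Y(2)
      proof (induction rule: rtrancl_induct)
        case base then show ?case using less by simp
      next
        case (step y z) then show ?case by blast
      qed
      then obtain A B where AB: "A \<in> D" "B \<notin> D" "(A, B) \<in> ?R" "(X0, A) \<in> ?R\<^sup>*" by blast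
      have BC: "B \<in> C" using AB Ceq by (auto intro: rtrancl.rtrancl_into_rtrancl)
      have BP: "B \<in> P" using AB by auto
      have "djoin w A B" using E[of A B] AB by auto
      then have dj: "djoin w (\<Union>D) B" by (rule djoin_mono) (use AB(1) in auto)
      have "\<Union>D \<inter> B = {}"
      proof -
        have "X \<inter> B = {}" if "X \<in> D" for X
          using disj[of X B] that AB(2) BP less(2) Ceq by auto
        then show ?thesis by auto
      qed
      then have "spanned w (\<Union>D \<union> B)" using spanned.merge[OF less(4) sp[OF BP] _ dj] by simp
      then have "spanned w (\<Union>(insert B D))" by (simp add: Un_commute)
      moreover have "card (C - insert B D) < card (C - D)"
        using finC BC AB(2) by (intro psubset_card_mono) auto
      ultimately show ?thesis using less BC by (intro less(1)[of "insert B D"]) auto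
    qed
  qed
  from this[of "{X0}"] show ?thesis using X0 Ceq sp by auto
qed

lemma jigsaw_spanned:
  assumes V: "finite V" and E: "E1 \<subseteq> [V]\<^bsup>2\<^esup>" "E2 \<subseteq> [V]\<^bsup>2\<^esup>"
  shows "X \<in> verts (jigsaw (V, E1, E2) i) \<Longrightarrow> spanned (edge_world E1 E2) X"
proof (induction i arbitrary: X)
  case 0 then show ?case by (auto intro: spanned.single)
next
  case (Suc i)
  obtain P where P: "partition_on V P" "jigsaw (V, E1, E2) i = (P, cluster_edges P E1, cluster_edges P E2)"
    using jigsaw_form[OF E] by blast
  from Suc.prems P(2) obtain C where C: "X = \<Union>C" "C \<in> graph_components P (cluster_edges P E1 \<inter> cluster_edges P E2)"
    by (auto simp: Let_def)
  show ?case unfolding C(1)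
    by (rule spanned_component[OF P(1) _ _ C(2)])
      (use P Suc.IH V cluster_edges_djoin in \<open>auto simp: finite_elements[OF V P(1)]\<close>)
qed

lemma percolates_imp_spanned:
  assumes V: "finite V" and E: "E1 \<subseteq> [V]\<^bsup>2\<^esup>" "E2 \<subseteq> [V]\<^bsup>2\<^esup>"
    and "jigsaw_percolates (V, E1, E2)"
  shows "spanned (edge_world E1 E2) V"
proof -
  obtain i where i: "card (verts (jigsaw (V, E1, E2) i)) = 1"
    using assms unfolding jigsaw_percolates_def by blast
  then obtain X where X: "verts (jigsaw (V, E1, E2) i) = {X}" by (auto simp: card_1_singleton_iff)
  have "partition_on V {X}" using partition_on_jigsaw[of "(V, E1, E2)" i] X by simp
  then have "X = V" by (auto simp: partition_on_def)
  then show ?thesis using jigsaw_spanned[OF V E] X by blast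
qed

lemma card_graph_components_less:
  assumes fin: "finite P" and XY: "X \<in> P" "Y \<in> P" "X \<noteq> Y" "{X, Y} \<in> E"
  shows "card (graph_components P E) < card P"
proof -
  let ?c = "\<lambda>x. same_component P E `` {x}"
  have eq: "graph_components P E = ?c ` P" unfolding graph_components_def quotient_def by auto
  have "(X, Y) \<in> same_component P E" using XY unfolding same_component_def by auto
  then have "?c X = ?c Y" by (rule equiv_class_eq[OF equiv_same_component])
  then have "?c X \<in> ?c ` (P - {X})" using XY by (intro image_eqI[of _ _ Y]) auto
  then have "?c ` P = ?c ` (P - {X})" using XY(1) by (metis image_insert insert_Diff insert_absorb)
  then have "card (graph_components P E) \<le> card (P - {X})"
    unfolding eq using fin by (simp add: card_image_le)
  also have "\<dots> < card P" using fin XY(1) by (meson card_Diff1_less)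
  finally show ?thesis .
qed

text \<open>Each step with an auxiliary edge merges at least two vertices, so the number of vertices
  strictly decreases.\<close>

lemma jigsaw_stops:
  fixes V :: "nat set"
  assumes V: "finite V" and E: "E1 \<subseteq> [V]\<^bsup>2\<^esup>" "E2 \<subseteq> [V]\<^bsup>2\<^esup>"
  shows "\<exists>i. jigsaw_stops_at (V, E1, E2) i"
proof -
  let ?J = "jigsaw (V, E1, E2)"
  have "\<exists>i. aux_edges (?J i) = {}"
  proof (rule ccontr)
    assume ne: "\<nexists>i. aux_edges (?J i) = {}"
    have dec: "card (verts (?J (Suc i))) < card (verts (?J i))" for i
    proof -
      obtain P where P: "partition_on V P" "?J i = (P, cluster_edges P E1, cluster_edges P E2)"
        using jigsaw_form[OF E] by blast
      let ?E = "cluster_edges P E1 \<inter> cluster_edges P E2"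
      have "aux_edges (?J i) \<noteq> {}" using ne by blast
      then obtain e where "e \<in> ?E" using P by auto
      moreover from this obtain X Y where "e = {X, Y}"
        unfolding cluster_edges_def Int_iff mem_Collect_eq by (elim conjE exE)
      ultimately have XY: "{X, Y} \<in> ?E" by simp
      then have "X \<in> P" "Y \<in> P" "X \<noteq> Y" unfolding Int_iff cluster_edges_iff by simp_all
      then have "card (graph_components P ?E) < card P"
        using card_graph_components_less[OF finite_elements[OF V P(1)] _ _ _ XY] by simp
      moreover have "verts (?J (Suc i)) = Union ` graph_components P ?E" using P by (simp add: Let_def)
      moreover have "finite (graph_components P ?E)"
        by (rule finite_elements[OF finite_elements[OF V P(1)] partition_on_graph_components])
      moreover have "verts (?J i) = P" using P(2) by simp
      ultimately show ?thesis
        using card_image_le[of "graph_components P ?E" Union] by (simp del: jigsaw.simps)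
    qed
    have "card (verts (?J i)) + i \<le> card (verts (?J 0))" for i
    proof (induction i)
      case (Suc i) then show ?case using dec[of i] by linarith
    qed simp
    from this[of "Suc (card (verts (?J 0)))"] show False by linarith
  qed
  then have "aux_edges (?J (LEAST i. aux_edges (?J i) = {})) = {}" by (rule LeastI_ex)
  moreover have "\<forall>k<(LEAST i. aux_edges (?J i) = {}). aux_edges (?J k) \<noteq> {}"
    by (intro allI impI) (erule not_less_Least)
  ultimately show ?thesis unfolding jigsaw_stops_at_def by (intro exI conjI)
qed

text \<open>When the process stops, no two parts are joined in both colours, so the whole merge
  history of \<open>V\<close> stays inside one part.\<close>

lemma spanned_imp_percolates:
  assumes V: "finite V" and E: "E1 \<subseteq> [V]\<^bsup>2\<^esup>" "E2 \<subseteq> [V]\<^bsup>2\<^esup>"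
    and sp: "spanned (edge_world E1 E2) V"
  shows "jigsaw_percolates (V, E1, E2)"
proof -
  obtain i where i: "jigsaw_stops_at (V, E1, E2) i" using jigsaw_stops[OF V E] by blast
  obtain P where P: "partition_on V P" "jigsaw (V, E1, E2) i = (P, cluster_edges P E1, cluster_edges P E2)"
    using jigsaw_form[OF E] by blast
  have none: "cluster_edges P E1 \<inter> cluster_edges P E2 = {}"
    using i P unfolding jigsaw_stops_at_def by simp
  have nj: "\<not> djoin (edge_world E1 E2) X Y" if "X \<in> P" "Y \<in> P" "X \<noteq> Y" for X Y
    using cluster_edges_djoin[of X Y P E1 E2] none that by simp
  have UP: "\<Union>P = V" using P(1) by (auto simp: partition_on_def)
  obtain X where X: "X \<in> P" "V \<subseteq> X" using spanned_in_part[OF UP sp subset_refl nj] by auto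
  have "Y = X" if "Y \<in> P" for Y
  proof (rule ccontr)
    assume "Y \<noteq> X"
    then have "Y \<inter> X = {}" using P(1) that X(1) by (auto simp: partition_on_def disjoint_def)
    moreover have "Y \<subseteq> V" using UP that by auto
    moreover have "Y \<noteq> {}" using P(1) that by (auto simp: partition_on_def)
    ultimately show False using X(2) by auto
  qed
  then have "P = {X}" using X(1) by blast
  then have "card (verts (jigsaw (V, E1, E2) i)) = 1" unfolding P(2) by simp
  then show ?thesis unfolding jigsaw_percolates_def using i by (intro exI conjI)
qed

text \<open>Connectedness always gives an edge of the other colour leaving the current set
  \<open>A\<close>. Its outer endpoint has an edge of colour \<open>i\<close> into \<open>S\<close>,
  so it can be added.\<close>

lemma dominating_connected_spanned:
  assumes V: "finite V" and S: "S \<subseteq> V" "spanned w S"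
    and dom: "\<And>v. v \<in> V - S \<Longrightarrow> joined w i {v} S"
    and conn: "graph_connected V E" and E: "\<And>x y. {x, y} \<in> E \<Longrightarrow> w (\<not> i, {x, y})"
  shows "spanned w V"
proof -
  have "spanned w V" if "S \<subseteq> A" "A \<subseteq> V" "spanned w A" for A
    using that
  proof (induction "card (V - A)" arbitrary: A rule: less_induct)
    case less
    show ?case
    proof (cases "A = V")
      case True then show ?thesis using less by simp
    next
      case False
      then obtain y where y: "y \<in> V" "y \<notin> A" using less by auto
      obtain u where u: "u \<in> A" using spanned_nonempty[OF less(4)] by auto
      let ?R = "{(x, y). x \<in> V \<and> y \<in> V \<and> {x, y} \<in> E}"
      have "(u, y) \<in> ?R\<^sup>*" using conn u y less(3) unfolding graph_connected_def same_component_def by auto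
      then have "\<exists>a b. a \<in> A \<and> b \<notin> A \<and> (a, b) \<in> ?R" using y(2)
      proof (induction rule: rtrancl_induct)
        case base then show ?case using u by simp
      next
        case (step y z) then show ?case by (cases "y \<in> A") auto
      qed
      then obtain a b where ab: "a \<in> A" "b \<notin> A" "b \<in> V" "{a, b} \<in> E" by auto
      have "joined w (\<not> i) {b} A" using E[OF ab(4)] ab(1) unfolding joined_def by (auto simp: insert_commute)
      moreover have "joined w i {b} A" using joined_mono[OF dom[of b], of "{b}" A] ab less(2) by auto
      ultimately have "djoin w {b} A" unfolding djoin_def by (cases i) auto
      then have "spanned w (insert b A)" using spanned_insert[OF less(4) ab(2)] by simp
      moreover have "card (V - insert b A) < card (V - A)"
        using V ab by (intro psubset_card_mono) auto
      ultimately show ?thesis using less ab by (intro less(1)[of "insert b A"]) auto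
    qed
  qed
  from this[of S] S show ?thesis by auto
qed

section \<open>Exploring a spanned set\<close>

definition pr :: "nat set \<Rightarrow> (bool \<Rightarrow> real) \<Rightarrow> (world \<Rightarrow> bool) \<Rightarrow> real" where
  "pr V p A = bprob (UNIV \<times> [V]\<^bsup>2\<^esup>) (\<lambda>(i, e). p i) A"

lemma sum_Pow_card:
  fixes f :: "nat \<Rightarrow> real"
  assumes "finite R"
  shows "(\<Sum>D\<in>Pow R. f (card D)) = (\<Sum>d\<le>card R. real (card R choose d) * f d)"
proof -
  have "(\<Sum>D\<in>Pow R. f (card D)) = (\<Sum>d\<in>{..card R}. \<Sum>D\<in>{D \<in> Pow R. card D = d}. f (card D))"
    using assms by (intro sum.group[symmetric]) (auto intro: card_mono)
  also have "\<dots> = (\<Sum>d\<le>card R. real (card R choose d) * f d)"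
  proof (rule sum.cong[OF refl])
    fix d
    have "{D \<in> Pow R. card D = d} = {D. D \<subseteq> R \<and> card D = d}" by auto
    then show "(\<Sum>D\<in>{D \<in> Pow R. card D = d}. f (card D)) = real (card R choose d) * f d"
      using n_subsets[OF assms, of d] by simp
  qed
  finally show ?thesis .
qed

lemma depends_joined:
  "(\<And>a b. a \<in> A \<Longrightarrow> b \<in> B \<Longrightarrow> (i, {a, b}) \<in> X) \<Longrightarrow> depends (\<lambda>w. joined w i A B) X"
  unfolding joined_def by (intro depends_intros) auto

lemma depends_djoin:
  "(\<And>i a b. a \<in> A \<Longrightarrow> b \<in> B \<Longrightarrow> (i, {a, b}) \<in> X) \<Longrightarrow> depends (\<lambda>w. djoin w A B) X"
  unfolding djoin_def by (intro depends_conj depends_joined) auto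

lemma spanned_cong:
  "spanned w B \<Longrightarrow> (\<And>i a b. a \<in> B \<Longrightarrow> b \<in> B \<Longrightarrow> w (i, {a, b}) = w' (i, {a, b})) \<Longrightarrow> spanned w' B"
proof (induction rule: spanned.induct)
  case (single v) then show ?case by (intro spanned.single)
next
  case (merge A B)
  have "djoin w' A B" using merge.hyps(4) merge.prems unfolding djoin_def joined_def by (metis UnCI)
  then show ?case using merge by (intro spanned.merge) auto
qed

lemma depends_spanned:
  "(\<And>i a b. a \<in> B \<Longrightarrow> b \<in> B \<Longrightarrow> (i, {a, b}) \<in> X) \<Longrightarrow> depends (\<lambda>w. spanned w B) X"
  by (rule dependsI_imp, erule spanned_cong) auto

text \<open>For fixed \<open>Y\<close> this set and \<open>avoiding Y\<close> are complementary.
  With \<open>Y\<close> the undiscovered vertices, the future of an exploration uses pairs of the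
  first kind and its past pairs of the second.\<close>

definition touching :: "nat set \<Rightarrow> (bool \<times> nat set) set" where
  "touching Y = {(i, e). e \<inter> Y \<noteq> {}}"

definition avoiding :: "nat set \<Rightarrow> (bool \<times> nat set) set" where
  "avoiding Y = {(i, e). e \<inter> Y = {}}"

lemma touching_avoiding: "touching Y \<inter> avoiding Y = {}" "avoiding Y \<inter> touching Y = {}"
  unfolding touching_def avoiding_def by auto

definition noatt :: "world \<Rightarrow> nat set \<Rightarrow> nat set \<Rightarrow> bool" where
  "noatt w T R \<longleftrightarrow> (\<forall>v\<in>R. \<not> djoin w {v} T)"

definition newatt :: "world \<Rightarrow> nat set \<Rightarrow> nat set \<Rightarrow> nat set \<Rightarrow> bool" where
  "newatt w T T1 D \<longleftrightarrow> (\<forall>v\<in>D. djoin w {v} T1 \<and> \<not> djoin w {v} T)"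

text \<open>What remains of \<open>root_of\<close> once \<open>U\<close> has been reached.\<close>

definition grow :: "world \<Rightarrow> nat set \<Rightarrow> nat set \<Rightarrow> bool" where
  "grow w U W \<longleftrightarrow> (\<forall>T. U \<subseteq> T \<and> T \<subset> W \<longrightarrow> (\<exists>B\<subseteq>W - T. spanned w B \<and> card B \<le> card T \<and> djoin w B T))"

lemma grow_mono:
  assumes "grow w U W" "U \<subseteq> U'"
  shows "grow w U' W"
  unfolding grow_def
proof (intro allI impI)
  fix T assume "U' \<subseteq> T \<and> T \<subset> W"
  then have "U \<subseteq> T \<and> T \<subset> W" using assms(2) by auto
  then show "\<exists>B\<subseteq>W - T. spanned w B \<and> card B \<le> card T \<and> djoin w B T"
    by (rule assms(1)[unfolded grow_def, rule_format])
qed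

text \<open>Exploration state: \<open>T\<close> is explored, \<open>U\<close> discovered but not yet explored, \<open>R\<close> undiscovered. In the
  intermediate state \<open>half_explored\<close> one vertex of \<open>U\<close> has been added to \<open>T\<close>, giving \<open>T1\<close>, and the single
  vertices it discovers have already left \<open>R\<close>.\<close>

definition explored :: "world \<Rightarrow> nat set \<Rightarrow> nat set \<Rightarrow> nat set \<Rightarrow> bool" where
  "explored w T U R \<longleftrightarrow> (\<forall>B\<subseteq>R. spanned w B \<and> card B \<le> card T \<longrightarrow> \<not> djoin w B T) \<and> grow w (T \<union> U) (T \<union> U \<union> R)"

text \<open>The two ways in which a cluster can become relevant when \<open>T\<close> grows to
  \<open>T1\<close>: through an edge at the added vertex, or because its size has just come within
  the allowed bound.\<close>

definition newjoin :: "world \<Rightarrow> nat set \<Rightarrow> nat set \<Rightarrow> nat set \<Rightarrow> bool" where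
  "newjoin w T T1 B \<longleftrightarrow> djoin w B T1 \<and> (\<not> djoin w B T \<or> card B = card T1)"

definition half_explored :: "world \<Rightarrow> nat set \<Rightarrow> nat set \<Rightarrow> nat set \<Rightarrow> nat set \<Rightarrow> bool" where
  "half_explored w T T1 U R \<longleftrightarrow> noatt w T1 R \<and>
    (\<forall>B\<subseteq>R. spanned w B \<and> card B \<le> card T1 \<and> djoin w B T1 \<longrightarrow> newjoin w T T1 B) \<and>
    grow w (T1 \<union> U) (T1 \<union> U \<union> R)"

lemma depends_noatt:
  "(\<And>i a b. a \<in> R \<Longrightarrow> b \<in> T \<Longrightarrow> (i, {a, b}) \<in> X) \<Longrightarrow> depends (\<lambda>w. noatt w T R) X"
  unfolding noatt_def by (intro depends_ball depends_not depends_djoin) auto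

lemma depends_newatt:
  "(\<And>i a b. a \<in> D \<Longrightarrow> b \<in> T1 \<Longrightarrow> (i, {a, b}) \<in> X) \<Longrightarrow> T \<subseteq> T1 \<Longrightarrow> depends (\<lambda>w. newatt w T T1 D) X"
  unfolding newatt_def by (intro depends_ball depends_conj depends_not depends_djoin) auto

lemma depends_newjoin:
  "(\<And>i a b. a \<in> B \<Longrightarrow> b \<in> T1 \<Longrightarrow> (i, {a, b}) \<in> X) \<Longrightarrow> T \<subseteq> T1 \<Longrightarrow> depends (\<lambda>w. newjoin w T T1 B) X"
  unfolding newjoin_def by (intro depends_conj depends_disj depends_not depends_djoin depends_const) auto

text \<open>A set above \<open>U\<close> leaves only clusters inside \<open>R\<close>, and every
  pair needed to test such a cluster touches \<open>R\<close>.\<close>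

lemma depends_grow:
  assumes "W - U \<subseteq> R"
  shows "depends (\<lambda>w. grow w U W) (touching R)"
proof -
  have "depends (\<lambda>w. U \<subseteq> T \<and> T \<subset> W \<longrightarrow>
      (\<exists>B. B \<subseteq> W - T \<and> (spanned w B \<and> card B \<le> card T \<and> djoin w B T))) (touching R)" for T
  proof (cases "U \<subseteq> T")
    case True
    have "depends (\<lambda>w. B \<subseteq> W - T \<and> (spanned w B \<and> card B \<le> card T \<and> djoin w B T)) (touching R)" for B
    proof (cases "B \<subseteq> W - T")
      case B: True
      then have "B \<subseteq> R" using True assms by auto
      then show ?thesis
        by (intro depends_conj depends_const depends_spanned depends_djoin) (auto simp: touching_def)
    qed (simp add: depends_const)
    then show ?thesis by (intro depends_imp depends_const depends_ex)
  qed (simp add: depends_const)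
  then show ?thesis unfolding grow_def by (intro depends_all)
qed

lemma depends_subsets:
  assumes "\<And>B. B \<subseteq> R \<Longrightarrow> depends (A B) X"
  shows "depends (\<lambda>w. \<forall>B\<subseteq>R. A B w) X"
proof -
  have "depends (\<lambda>w. B \<subseteq> R \<longrightarrow> A B w) X" for B
    by (cases "B \<subseteq> R") (use assms[of B] in \<open>simp_all add: depends_const\<close>)
  then show ?thesis by (intro depends_all)
qed

text \<open>Only pairs with an endpoint in \<open>R\<close> matter, so the event is independent of
  the pairs that led to the present state.\<close>

lemma depends_half_explored: "T \<subseteq> T1 \<Longrightarrow> depends (\<lambda>w. half_explored w T T1 U R) (touching R)"
  unfolding half_explored_def
  by (intro depends_conj depends_subsets depends_grow depends_imp depends_not depends_const
      depends_spanned depends_djoin depends_noatt depends_newjoin) (auto simp: touching_def)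

lemma explored_step:
  assumes e: "explored w T U R" and x: "x \<in> U" and fin: "finite T" "x \<notin> T"
    and D: "D = {v \<in> R. djoin w {v} (insert x T)}"
  shows "newatt w T (insert x T) D \<and> half_explored w T (insert x T) (U - {x} \<union> D) (R - D)"
proof -
  have inv: "\<And>B. B \<subseteq> R \<Longrightarrow> spanned w B \<Longrightarrow> card B \<le> card T \<Longrightarrow> \<not> djoin w B T"
    and gr: "grow w (T \<union> U) (T \<union> U \<union> R)" using e unfolding explored_def by auto
  \<comment> \<open>A single vertex is a spanned set of size one, so the invariant excludes it
    unless \<open>T\<close> is empty, and nothing is joined to the empty set.\<close>
  have na: "\<not> djoin w {v} T" if "v \<in> R" for v
  proof (cases "T = {}")
    case False
    then have "card {v} \<le> card T" using fin(1) by (simp add: Suc_leI card_gt_0_iff)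
    then show ?thesis using inv[of "{v}"] that spanned.single[of w v] by simp
  qed simp
  have "newatt w T (insert x T) D" unfolding newatt_def D using na by auto
  moreover have "noatt w (insert x T) (R - D)" unfolding noatt_def D by auto
  moreover have "newjoin w T (insert x T) B"
    if "B \<subseteq> R - D" "spanned w B" "card B \<le> card (insert x T)" "djoin w B (insert x T)" for B
  proof (cases "card B \<le> card T")
    case True then show ?thesis using inv[of B] that unfolding newjoin_def by auto
  next
    case False then show ?thesis using that fin unfolding newjoin_def by auto
  qed
  moreover have "grow w (insert x T \<union> (U - {x} \<union> D)) (insert x T \<union> (U - {x} \<union> D) \<union> (R - D))"
  proof -
    have "D \<subseteq> R" unfolding D by auto
    then have "insert x T \<union> (U - {x} \<union> D) \<union> (R - D) = T \<union> U \<union> R" using x by auto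
    moreover have "T \<union> U \<subseteq> insert x T \<union> (U - {x} \<union> D)" by auto
    ultimately show ?thesis using grow_mono[OF gr] by (simp only:)
  qed
  ultimately show ?thesis unfolding half_explored_def by auto
qed

text \<open>If the invariant of \<open>explored\<close> still fails, a cluster witnessing this is
  moved into \<open>U\<close>. It has at least two vertices, since all single vertices joined to
  \<open>T1\<close> have already left \<open>R\<close>.\<close>

lemma half_explored_step:
  assumes e: "half_explored w T T1 U R" and fin: "finite T1" "finite R"
  shows "explored w T1 U R \<or> (\<exists>B. B \<subseteq> R \<and> 2 \<le> card B \<and> card B \<le> card T1 \<and>
     spanned w B \<and> newjoin w T T1 B \<and> half_explored w T T1 (U \<union> B) (R - B))"
proof (cases "\<forall>B\<subseteq>R. spanned w B \<and> card B \<le> card T1 \<longrightarrow> \<not> djoin w B T1")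
  case True
  then show ?thesis using e unfolding explored_def half_explored_def by auto
next
  case False
  then obtain B where B: "B \<subseteq> R" "spanned w B" "card B \<le> card T1" "djoin w B T1" by auto
  have nj: "newjoin w T T1 B" using e B unfolding half_explored_def by auto
  have "card B \<noteq> 0" using B spanned_nonempty spanned_finite by auto
  moreover have "card B \<noteq> 1"
  proof
    assume "card B = 1"
    then obtain v where "B = {v}" by (auto simp: card_1_singleton_iff)
    then show False using B e unfolding half_explored_def noatt_def by auto
  qed
  ultimately have "2 \<le> card B" by linarith
  moreover have "half_explored w T T1 (U \<union> B) (R - B)"
  proof -
    have "T1 \<union> (U \<union> B) \<union> (R - B) = T1 \<union> U \<union> R" using B(1) by auto
    moreover have "T1 \<union> U \<subseteq> T1 \<union> (U \<union> B)" by auto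
    ultimately have "grow w (T1 \<union> (U \<union> B)) (T1 \<union> (U \<union> B) \<union> (R - B))"
      using grow_mono[of w "T1 \<union> U" "T1 \<union> U \<union> R" "T1 \<union> (U \<union> B)"] e unfolding half_explored_def by simp
    then show ?thesis using e unfolding half_explored_def noatt_def by auto
  qed
  ultimately show ?thesis using B nj by (intro disjI2 exI[of _ B]) auto
qed

lemma root_of_explored:
  assumes "v \<in> S" "root_of w S v"
  shows "explored w {} {v} (S - {v})"
proof -
  have "{} \<union> {v} \<union> (S - {v}) = S" using assms by auto
  then show ?thesis using assms(2) unfolding explored_def grow_def root_of_def by (simp add: insert_absorb assms)
qed

section \<open>Attachment probabilities in the random double graph\<close>

locale two_graphs =
  fixes V :: "nat set" and p :: "bool \<Rightarrow> real"
  assumes fin: "finite V" and p01: "p i \<in> {0..1}"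
begin

abbreviation Pr :: "(world \<Rightarrow> bool) \<Rightarrow> real" where "Pr \<equiv> pr V p"

lemma p_bounds: "0 \<le> p i" "p i \<le> 1" using p01[of i] by auto

lemma finI: "finite (UNIV \<times> [V]\<^bsup>2\<^esup> :: (bool \<times> nat set) set)"
  using fin by (simp add: finite_imp_finite_nsets)

lemma Pr_mono: "(\<And>w. A w \<Longrightarrow> B w) \<Longrightarrow> Pr A \<le> Pr B"
  unfolding pr_def by (rule bprob_mono)

lemma Pr_nonneg: "0 \<le> Pr A" unfolding pr_def by simp

lemma Pr_le_1: "Pr A \<le> 1" unfolding pr_def by simp

lemma Pr_not: "Pr (\<lambda>w. \<not> A w) = 1 - Pr A" unfolding pr_def by (rule bprob_not)

lemma Pr_indep: "depends A X \<Longrightarrow> depends B Y \<Longrightarrow> X \<inter> Y = {} \<Longrightarrow> Pr (\<lambda>w. A w \<and> B w) = Pr A * Pr B"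
  unfolding pr_def by (rule bprob_indep[OF finI])

lemma Pr_split: "Pr A = Pr (\<lambda>w. A w \<and> B w) + Pr (\<lambda>w. A w \<and> \<not> B w)"
proof -
  have "{w. A w} = {w. A w \<and> B w} \<union> {w. A w \<and> \<not> B w}" by auto
  then show ?thesis unfolding pr_def
    using measure_pmf.finite_measure_Union[of "{w. A w \<and> B w}" _ "{w. A w \<and> \<not> B w}"] by auto
qed

lemma Pr_disj: "Pr (\<lambda>w. A w \<or> B w) \<le> Pr A + Pr B"
proof -
  have "Pr (\<lambda>w. A w \<or> B w) = Pr (\<lambda>w. (A w \<or> B w) \<and> A w) + Pr (\<lambda>w. (A w \<or> B w) \<and> \<not> A w)"
    by (rule Pr_split)
  also have "\<dots> \<le> Pr A + Pr B" by (intro add_mono Pr_mono) auto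
  finally show ?thesis .
qed

lemma Pr_bex: "finite X \<Longrightarrow> Pr (\<lambda>w. \<exists>x\<in>X. A x w) \<le> (\<Sum>x\<in>X. Pr (A x))"
proof (induction X rule: finite_induct)
  case empty then show ?case by (simp add: pr_def)
next
  case (insert x X)
  have "Pr (\<lambda>w. \<exists>x\<in>insert x X. A x w) \<le> Pr (A x) + Pr (\<lambda>w. \<exists>x\<in>X. A x w)"
    using Pr_disj[of "A x" "\<lambda>w. \<exists>x\<in>X. A x w"] by simp
  then show ?case using insert by simp
qed

lemma Pr_bex_disjoint:
  assumes "finite X" "\<And>x y w. x \<in> X \<Longrightarrow> y \<in> X \<Longrightarrow> A x w \<Longrightarrow> A y w \<Longrightarrow> x = y"
  shows "Pr (\<lambda>w. \<exists>x\<in>X. A x w) = (\<Sum>x\<in>X. Pr (A x))"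
  using assms
proof (induction X rule: finite_induct)
  case empty then show ?case by (simp add: pr_def)
next
  case (insert x X)
  have "Pr (\<lambda>w. \<exists>x\<in>insert x X. A x w) =
      Pr (\<lambda>w. (\<exists>x\<in>insert x X. A x w) \<and> A x w) + Pr (\<lambda>w. (\<exists>x\<in>insert x X. A x w) \<and> \<not> A x w)"
    by (rule Pr_split)
  also have "(\<lambda>w. (\<exists>x\<in>insert x X. A x w) \<and> A x w) = A x" by auto
  also have "(\<lambda>w. (\<exists>x\<in>insert x X. A x w) \<and> \<not> A x w) = (\<lambda>w. \<exists>x\<in>X. A x w)"
    using insert.hyps(2) insert.prems by fastforce
  finally show ?case using insert by simp
qed

lemma Pr_ball_prod:
  assumes "finite D" "\<And>v. v \<in> D \<Longrightarrow> depends (A v) (X v)"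
    "\<And>u v. u \<in> D \<Longrightarrow> v \<in> D \<Longrightarrow> u \<noteq> v \<Longrightarrow> X u \<inter> X v = {}"
  shows "Pr (\<lambda>w. \<forall>v\<in>D. A v w) = (\<Prod>v\<in>D. Pr (A v))"
  using assms
proof (induction D rule: finite_induct)
  case empty then show ?case by (simp add: pr_def)
next
  case (insert x D)
  have "Pr (\<lambda>w. \<forall>v\<in>insert x D. A v w) = Pr (\<lambda>w. A x w \<and> (\<forall>v\<in>D. A v w))" by simp
  also have "\<dots> = Pr (A x) * Pr (\<lambda>w. \<forall>v\<in>D. A v w)"
  proof (rule Pr_indep)
    show "depends (A x) (X x)" using insert by simp
    show "depends (\<lambda>w. \<forall>v\<in>D. A v w) (\<Union>v\<in>D. X v)"
      using insert by (intro depends_ball) (auto intro: depends_mono)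
    show "X x \<inter> (\<Union>v\<in>D. X v) = {}" using insert by blast
  qed
  finally show ?case using insert by simp
qed

lemma Pr_not_joined:
  assumes A: "A \<subseteq> V" and B: "B \<subseteq> V" and AB: "A \<inter> B = {}"
  shows "Pr (\<lambda>w. \<not> joined w i A B) = (1 - p i) ^ (card A * card B)"
proof -
  let ?f = "\<lambda>(a, b). (i, {a, b})"
  have inj: "inj_on ?f (A \<times> B)" using AB by (auto simp: inj_on_def doubleton_eq_iff)
  have eq: "(\<lambda>w. \<not> joined w i A B) = (\<lambda>w. \<forall>j\<in>?f ` (A \<times> B). \<not> w j)"
    unfolding joined_def by auto
  have "Pr (\<lambda>w. \<not> joined w i A B) = (\<Prod>j\<in>?f ` (A \<times> B). 1 - (\<lambda>(i, e). p i) j)"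
    unfolding eq pr_def by (rule bprob_none[OF finI]) (use A B AB p01 in auto)
  also have "\<dots> = (\<Prod>j\<in>A \<times> B. 1 - p i)"
    by (subst prod.reindex[OF inj]) (simp add: case_prod_beta)
  finally show ?thesis by (simp add: card_cartesian_product)
qed

text \<open>Probability that at least one of \<open>s\<close> given pairs is an edge of colour
  \<open>i\<close>. \<open>Q s\<close> below asks this of both colours, so \<open>Q (card T)\<close>
  is the probability that an outside vertex attaches to \<open>T\<close>.\<close>

definition rr :: "bool \<Rightarrow> nat \<Rightarrow> real" where "rr i s = 1 - (1 - p i) ^ s"

definition Q :: "nat \<Rightarrow> real" where "Q s = rr True s * rr False s"

definition pp :: real where "pp = p True * p False"

lemma pp_nonneg: "0 \<le> pp" unfolding pp_def using p_bounds by simp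

lemma rr_nonneg: "0 \<le> rr i s" unfolding rr_def using p_bounds[of i] by (simp add: power_le_one)

lemma rr_le_1: "rr i s \<le> 1" unfolding rr_def using p_bounds[of i] by simp

lemma rr_le: "rr i s \<le> real s * p i"
  unfolding rr_def using Bernoulli_inequality[of "- p i" s] p_bounds[of i] by simp

lemma rr_mono: "s \<le> t \<Longrightarrow> rr i s \<le> rr i t"
  unfolding rr_def using p_bounds[of i] by (simp add: power_decreasing)

lemma Q_mono: "s \<le> t \<Longrightarrow> Q s \<le> Q t"
  unfolding Q_def by (intro mult_mono rr_mono rr_nonneg)

lemma Q_nonneg: "0 \<le> Q s" unfolding Q_def by (simp add: rr_nonneg)

lemma Q_le_1: "Q s \<le> 1" unfolding Q_def using rr_nonneg rr_le_1 by (simp add: mult_le_one)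

lemma Q_0 [simp]: "Q 0 = 0" unfolding Q_def rr_def by simp

lemma Q_le: "Q s \<le> (real s)\<^sup>2 * pp"
proof -
  have "Q s \<le> (real s * p True) * (real s * p False)"
    unfolding Q_def using p_bounds by (intro mult_mono rr_le rr_nonneg) auto
  then show ?thesis unfolding pp_def by (simp add: power2_eq_square mult_ac)
qed

lemma Pr_joined:
  assumes "A \<subseteq> V" "B \<subseteq> V" "A \<inter> B = {}"
  shows "Pr (\<lambda>w. joined w i A B) = rr i (card A * card B)"
  using Pr_not[of "\<lambda>w. joined w i A B"] Pr_not_joined[OF assms, of i] unfolding rr_def by simp

lemma Pr_two_colours:
  assumes "A \<subseteq> V" "B \<subseteq> V" "A \<inter> B = {}" "C \<subseteq> V" "D \<subseteq> V" "C \<inter> D = {}"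
  shows "Pr (\<lambda>w. joined w True A B \<and> joined w False C D) = rr True (card A * card B) * rr False (card C * card D)"
proof -
  have "Pr (\<lambda>w. joined w True A B \<and> joined w False C D) = Pr (\<lambda>w. joined w True A B) * Pr (\<lambda>w. joined w False C D)"
    by (rule Pr_indep[of _ "{(i, e). i}" _ "{(i, e). \<not> i}"]) (auto intro!: depends_joined)
  then show ?thesis using assms by (simp add: Pr_joined)
qed

lemma Pr_djoin:
  assumes "A \<subseteq> V" "B \<subseteq> V" "A \<inter> B = {}"
  shows "Pr (\<lambda>w. djoin w A B) = Q (card A * card B)"
  unfolding djoin_def Q_def using Pr_two_colours[OF assms assms] .

lemma Pr_newatt1:
  assumes "v \<in> V - T1" "T \<subseteq> T1" "T1 \<subseteq> V"
  shows "Pr (\<lambda>w. djoin w {v} T1 \<and> \<not> djoin w {v} T) = Q (card T1) - Q (card T)"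
proof -
  have "Pr (\<lambda>w. djoin w {v} T1) = Pr (\<lambda>w. djoin w {v} T1 \<and> djoin w {v} T) + Pr (\<lambda>w. djoin w {v} T1 \<and> \<not> djoin w {v} T)"
    by (rule Pr_split)
  also have "(\<lambda>w. djoin w {v} T1 \<and> djoin w {v} T) = (\<lambda>w. djoin w {v} T)"
    using djoin_mono[of _ "{v}" T "{v}" T1] assms by auto
  finally have "Pr (\<lambda>w. djoin w {v} T1) = Pr (\<lambda>w. djoin w {v} T) + Pr (\<lambda>w. djoin w {v} T1 \<and> \<not> djoin w {v} T)" .
  moreover have "Pr (\<lambda>w. djoin w {v} T1) = Q (card T1)" "Pr (\<lambda>w. djoin w {v} T) = Q (card T)"
    using Pr_djoin[of "{v}" T1] Pr_djoin[of "{v}" T] assms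
    by (simp_all add: subset_iff) (metis)
  ultimately show ?thesis by simp
qed

definition star :: "nat \<Rightarrow> nat set \<Rightarrow> (bool \<times> nat set) set" where
  "star v T = {(i, {v, t}) | i t. t \<in> T}"

lemma star_disjoint: "u \<noteq> v \<Longrightarrow> u \<notin> T \<Longrightarrow> v \<notin> T \<Longrightarrow> star u T \<inter> star v T = {}"
  unfolding star_def by (auto simp: doubleton_eq_iff)

text \<open>Attaching to \<open>T\<close> implies attaching to \<open>T1\<close>, so the probability
  for one vertex is a difference of values of \<open>Q\<close>; distinct vertices use disjoint stars
  of pairs.\<close>

lemma Pr_newatt:
  assumes "D \<subseteq> V - T1" "T \<subseteq> T1" "T1 \<subseteq> V"
  shows "Pr (\<lambda>w. newatt w T T1 D) = (Q (card T1) - Q (card T)) ^ card D"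
proof -
  have "finite D" using assms fin finite_subset by blast
  then have "Pr (\<lambda>w. newatt w T T1 D) = (\<Prod>v\<in>D. Pr (\<lambda>w. djoin w {v} T1 \<and> \<not> djoin w {v} T))"
    unfolding newatt_def
  proof (rule Pr_ball_prod[where X = "\<lambda>v. star v T1"])
    show "depends (\<lambda>w. djoin w {v} T1 \<and> \<not> djoin w {v} T) (star v T1)" for v
      using assms by (intro depends_conj depends_not depends_djoin) (auto simp: star_def)
    show "star u T1 \<inter> star v T1 = {}" if "u \<in> D" "v \<in> D" "u \<noteq> v" for u v
      using star_disjoint that assms by blast
  qed
  also have "\<dots> = (\<Prod>v\<in>D. Q (card T1) - Q (card T))"
    using assms by (intro prod.cong refl Pr_newatt1) auto
  finally show ?thesis by simp
qed

lemma Pr_noatt: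
  assumes "R \<subseteq> V - T" "T \<subseteq> V"
  shows "Pr (\<lambda>w. noatt w T R) = (1 - Q (card T)) ^ card R"
proof -
  have "finite R" using assms fin finite_subset by blast
  then have "Pr (\<lambda>w. noatt w T R) = (\<Prod>v\<in>R. Pr (\<lambda>w. \<not> djoin w {v} T))"
    unfolding noatt_def
  proof (rule Pr_ball_prod[where X = "\<lambda>v. star v T"])
    show "depends (\<lambda>w. \<not> djoin w {v} T) (star v T)" for v
      by (intro depends_not depends_djoin) (auto simp: star_def)
    show "star u T \<inter> star v T = {}" if "u \<in> R" "v \<in> R" "u \<noteq> v" for u v
      using star_disjoint that assms by blast
  qed
  also have "\<dots> = (\<Prod>v\<in>R. 1 - Q (card T))"
    using assms by (intro prod.cong refl) (subst Pr_not, subst Pr_djoin, auto)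
  finally show ?thesis by simp
qed

text \<open>With s the size of \<open>insert x T\<close> and b that of \<open>B\<close>, joining
  costs s^2 b^2 p1 p2. A cluster not joined before must use an edge at \<open>x\<close> in one
  colour, which saves a factor s. If instead b = s, the saving comes from replacing one s by b,
  whence the third power of b.\<close>

lemma Pr_newjoin:
  assumes "B \<subseteq> V - insert x T" "insert x T \<subseteq> V" "x \<notin> T" "card B \<le> Suc (card T)"
  shows "Pr (\<lambda>w. newjoin w T (insert x T) B) \<le> 2 * real (card (insert x T)) * real (card B) ^ 3 * pp"
proof -
  let ?T = "insert x T" and ?b = "real (card B)" and ?s = "real (card (insert x T))"
  have finT: "finite T" by (rule finite_subset[OF _ fin]) (use assms in auto)
  have s: "card ?T = Suc (card T)" using finT assms by simp
  show ?thesis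
  proof (cases "B = {}")
    case True then show ?thesis by (simp add: newjoin_def pr_def)
  next
    case False
    moreover have "finite B" by (rule finite_subset[OF _ fin]) (use assms in auto)
    ultimately have "0 < card B" by (simp add: card_gt_0_iff)
    then have b1: "?b \<ge> 1" by simp
    show ?thesis
    proof (cases "card B = card ?T")
      case True
      have "Pr (\<lambda>w. newjoin w T ?T B) \<le> Pr (\<lambda>w. djoin w B ?T)"
        by (rule Pr_mono) (auto simp: newjoin_def)
      also have "\<dots> = Q (card B * card ?T)" using assms by (intro Pr_djoin) auto
      also have "\<dots> \<le> (real (card B * card ?T))\<^sup>2 * pp" by (rule Q_le)
      also have "\<dots> = ?s * ?b ^ 3 * pp" using True by (simp add: power2_eq_square power3_eq_cube)
      also have "\<dots> \<le> 2 * ?s * ?b ^ 3 * pp" using pp_nonneg b1 by (intro mult_right_mono) auto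
      finally show ?thesis .
    next
      case False
      have "newjoin w T ?T B \<Longrightarrow> (joined w True B {x} \<and> joined w False B ?T) \<or> (joined w True B ?T \<and> joined w False B {x})" for w
        using False unfolding newjoin_def djoin_def joined_def by auto
      then have "Pr (\<lambda>w. newjoin w T ?T B) \<le> Pr (\<lambda>w. (joined w True B {x} \<and> joined w False B ?T) \<or> (joined w True B ?T \<and> joined w False B {x}))"
        by (rule Pr_mono)
      also have "\<dots> \<le> Pr (\<lambda>w. joined w True B {x} \<and> joined w False B ?T) + Pr (\<lambda>w. joined w True B ?T \<and> joined w False B {x})"
        by (rule Pr_disj)
      also have "\<dots> = rr True (card B * card {x}) * rr False (card B * card ?T) + rr True (card B * card ?T) * rr False (card B * card {x})"
        using assms by (subst (1 2) Pr_two_colours) auto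
      also have "\<dots> \<le> (?b * p True) * (?b * ?s * p False) + (?b * ?s * p True) * (?b * p False)"
        using p_bounds rr_le[of True "card B"] rr_le[of False "card B"]
          rr_le[of True "card B * card ?T"] rr_le[of False "card B * card ?T"]
        by (intro add_mono mult_mono rr_nonneg) auto
      also have "\<dots> = 2 * ?s * ?b ^ 2 * pp" unfolding pp_def by (simp add: power2_eq_square algebra_simps)
      also have "\<dots> \<le> 2 * ?s * ?b ^ 3 * pp"
        using pp_nonneg b1 by (intro mult_right_mono mult_left_mono power_increasing) auto
      finally show ?thesis .
    qed
  qed
qed

end

section \<open>Recursive bound for the survival of the exploration\<close>

context two_graphs
begin

definition jbound :: "nat \<Rightarrow> nat \<Rightarrow> real" where
  "jbound s b = 2 * real s * real b ^ 3 * pp"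

text \<open>Relative to \<open>h\<close>, the number \<open>\<rho>\<close> bounds the total weight
  of absorbing one cluster. Absorption can repeat, and the factor \<open>1 + 2 * \<rho>\<close> is
  stable under it because \<open>1 + \<rho> * (1 + 2 * \<rho>) \<le> 1 + 2 * \<rho>\<close> for
  \<open>\<rho> \<le> 1/2\<close>.\<close>

lemma explore_step_bound:
  assumes TUR: "x \<notin> T" "insert x T \<subseteq> V" "R \<subseteq> V - insert x T"
    and h0: "\<And>u r. 0 \<le> h u r" and rho: "0 \<le> \<rho>" "\<rho> \<le> 1/2"
    and H: "\<And>R' U'. R' \<subseteq> R \<Longrightarrow> U' \<union> R' = U \<union> R \<Longrightarrow> U' \<inter> R' = {} \<Longrightarrow>
       Pr (\<lambda>w. explored w (insert x T) U' R') \<le> h (card U') (card R')"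
    and \<beta>: "\<And>B. B \<subseteq> R \<Longrightarrow> 2 \<le> card B \<Longrightarrow> Pr (\<lambda>w. spanned w B) \<le> \<beta> (card B)" "\<And>b. 0 \<le> \<beta> b"
    and \<sigma>: "\<And>u r. r \<le> card R \<Longrightarrow> (\<Sum>b=2..card (insert x T). if b \<le> r then
         real (r choose b) * (\<beta> b * jbound (card (insert x T)) b * h (u + b) (r - b)) else 0) \<le> \<rho> * h u r"
    and U: "U \<inter> R = {}" "finite U"
  shows "Pr (\<lambda>w. half_explored w T (insert x T) U R) \<le> (1 + 2 * \<rho>) * h (card U) (card R)"
proof -
  let ?T = "insert x T"
  let ?s = "card ?T"
  have finT: "finite ?T" by (rule finite_subset[OF TUR(2) fin])
  have sT: "?s = Suc (card T)" using finT TUR by simp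
  have "Pr (\<lambda>w. half_explored w T ?T U' R') \<le> (1 + 2 * \<rho>) * h (card U') (card R')"
    if "R' \<subseteq> R" "U' \<union> R' = U \<union> R" "U' \<inter> R' = {}" for U' R'
    using that
  proof (induction "card R'" arbitrary: U' R' rule: less_induct)
    case less
    have finR0: "finite R" by (rule finite_subset[OF _ fin]) (use TUR in auto)
    have finR: "finite R'" by (rule finite_subset[OF less.prems(1) finR0])
    have finU: "finite U'" by (rule finite_subset[of _ "U \<union> R"]) (use less.prems U finR0 in auto)
    let ?X = "{B. B \<subseteq> R' \<and> 2 \<le> card B \<and> card B \<le> ?s}"
    have finX: "finite ?X" using finR by (intro finite_subset[of ?X "Pow R'"]) auto
    let ?h = "h (card U') (card R')"
    let ?g = "\<lambda>b. if 2 \<le> b \<and> b \<le> ?s then \<beta> b * jbound ?s b * ((1 + 2 * \<rho>) * h (card U' + b) (card R' - b)) else 0"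
    have jb: "0 \<le> jbound ?s b" for b unfolding jbound_def using pp_nonneg by simp
    have g0: "0 \<le> ?g b" for b using \<beta>(2)[of b] jb h0 rho by simp
    have "Pr (\<lambda>w. half_explored w T ?T U' R') \<le> Pr (\<lambda>w. explored w ?T U' R' \<or>
        (\<exists>B\<in>?X. spanned w B \<and> newjoin w T ?T B \<and> half_explored w T ?T (U' \<union> B) (R' - B)))"
      by (rule Pr_mono, drule half_explored_step[OF _ finT finR]) auto
    also have "\<dots> \<le> Pr (\<lambda>w. explored w ?T U' R') +
        Pr (\<lambda>w. \<exists>B\<in>?X. spanned w B \<and> newjoin w T ?T B \<and> half_explored w T ?T (U' \<union> B) (R' - B))"
      by (rule Pr_disj)
    also have "\<dots> \<le> ?h + (\<Sum>B\<in>?X. Pr (\<lambda>w. spanned w B \<and> newjoin w T ?T B \<and> half_explored w T ?T (U' \<union> B) (R' - B)))"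
      using less.prems by (intro add_mono H Pr_bex finX) auto
    also have "(\<Sum>B\<in>?X. Pr (\<lambda>w. spanned w B \<and> newjoin w T ?T B \<and> half_explored w T ?T (U' \<union> B) (R' - B))) \<le> (\<Sum>B\<in>?X. ?g (card B))"
    proof (rule sum_mono)
      fix B assume B: "B \<in> ?X"
      then have BV: "B \<subseteq> V - ?T" using less.prems TUR by auto
      have BR: "B \<subseteq> R'" "2 \<le> card B" using B by auto
      have finB: "finite B" by (rule finite_subset[OF BR(1) finR])
      have "Pr (\<lambda>w. spanned w B \<and> newjoin w T ?T B \<and> half_explored w T ?T (U' \<union> B) (R' - B)) =
          Pr (\<lambda>w. (spanned w B \<and> newjoin w T ?T B) \<and> half_explored w T ?T (U' \<union> B) (R' - B))"
        by (simp add: conj_assoc)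
      also have "\<dots> = Pr (\<lambda>w. spanned w B \<and> newjoin w T ?T B) * Pr (\<lambda>w. half_explored w T ?T (U' \<union> B) (R' - B))"
      proof (rule Pr_indep[OF _ depends_half_explored touching_avoiding(2)])
        show "depends (\<lambda>w. spanned w B \<and> newjoin w T ?T B) (avoiding (R' - B))"
          using BV less.prems TUR
          by (intro depends_conj depends_spanned depends_newjoin) (auto simp: avoiding_def)
      qed auto
      \<comment> \<open>Being spanned uses pairs inside \<open>B\<close>, joining uses pairs between
        \<open>B\<close> and the explored set.\<close>
      also have "Pr (\<lambda>w. spanned w B \<and> newjoin w T ?T B) = Pr (\<lambda>w. spanned w B) * Pr (\<lambda>w. newjoin w T ?T B)"
      proof (rule Pr_indep[OF _ _ touching_avoiding(2)])
        show "depends (\<lambda>w. spanned w B) (avoiding ?T)"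
          using BV by (intro depends_spanned) (auto simp: avoiding_def)
        show "depends (\<lambda>w. newjoin w T ?T B) (touching ?T)"
          by (intro depends_newjoin) (auto simp: touching_def)
      qed
      also have "\<dots> * Pr (\<lambda>w. half_explored w T ?T (U' \<union> B) (R' - B)) \<le>
          \<beta> (card B) * jbound ?s (card B) * ((1 + 2 * \<rho>) * h (card U' + card B) (card R' - card B))"
      proof (intro mult_mono mult_nonneg_nonneg Pr_nonneg \<beta>(2) jb)
        show "Pr (\<lambda>w. spanned w B) \<le> \<beta> (card B)" using \<beta>(1)[of B] BR less.prems(1) by simp
        show "Pr (\<lambda>w. newjoin w T ?T B) \<le> jbound ?s (card B)"
          unfolding jbound_def using B sT TUR by (intro Pr_newjoin BV) auto
        have "B \<noteq> {}" using BR(2) by auto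
        then have "R' - B \<subset> R'" using BR(1) by auto
        then have "card (R' - B) < card R'" by (rule psubset_card_mono[OF finR])
        moreover have "U' \<union> B \<union> (R' - B) = U \<union> R" using BR less.prems by auto
        moreover have "(U' \<union> B) \<inter> (R' - B) = {}" using less.prems by auto
        ultimately have "Pr (\<lambda>w. half_explored w T ?T (U' \<union> B) (R' - B)) \<le> (1 + 2 * \<rho>) * h (card (U' \<union> B)) (card (R' - B))"
          using less.prems(1) by (intro less.hyps) auto
        moreover have "card (U' \<union> B) = card U' + card B" using finU finB BR less.prems by (intro card_Un_disjoint) auto
        moreover have "card (R' - B) = card R' - card B" using finB BR by (intro card_Diff_subset)
        ultimately show "Pr (\<lambda>w. half_explored w T ?T (U' \<union> B) (R' - B)) \<le> (1 + 2 * \<rho>) * h (card U' + card B) (card R' - card B)"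
          by simp
      qed
      finally show "Pr (\<lambda>w. spanned w B \<and> newjoin w T ?T B \<and> half_explored w T ?T (U' \<union> B) (R' - B)) \<le> ?g (card B)"
        using B by simp
    qed
    also have "(\<Sum>B\<in>?X. ?g (card B)) \<le> (\<Sum>B\<in>Pow R'. ?g (card B))"
      using finR g0 by (intro sum_mono2) auto
    also have "\<dots> = (\<Sum>b\<le>card R'. real (card R' choose b) * ?g b)" by (rule sum_Pow_card[OF finR])
    also have "\<dots> = (\<Sum>b\<in>{..card R'} \<inter> {2..?s}. real (card R' choose b) * ?g b)"
      by (rule sum.mono_neutral_right) auto
    also have "\<dots> = (\<Sum>b\<in>{2..?s} \<inter> {..card R'}. (1 + 2 * \<rho>) * (real (card R' choose b) * (\<beta> b * jbound ?s b * h (card U' + b) (card R' - b))))"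
      by (intro sum.cong) (auto simp: mult_ac)
    also have "\<dots> = (1 + 2 * \<rho>) * (\<Sum>b=2..?s. if b \<le> card R' then real (card R' choose b) * (\<beta> b * jbound ?s b * h (card U' + b) (card R' - b)) else 0)"
      unfolding sum_distrib_left[symmetric] by (subst sum.inter_restrict) auto
    also have "\<dots> \<le> (1 + 2 * \<rho>) * (\<rho> * ?h)"
      using rho card_mono[OF finR0 less.prems(1)] by (intro mult_left_mono \<sigma>) auto
    finally have "Pr (\<lambda>w. half_explored w T ?T U' R') \<le> (1 + \<rho> + 2 * \<rho> * \<rho>) * ?h" by (simp add: algebra_simps)
    also have "\<dots> \<le> (1 + 2 * \<rho>) * ?h"
    proof (rule mult_right_mono[OF _ h0])
      have "2 * \<rho> * \<rho> \<le> 2 * \<rho> * (1/2)" using rho by (intro mult_left_mono) auto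
      then show "1 + \<rho> + 2 * \<rho> * \<rho> \<le> 1 + 2 * \<rho>" by simp
    qed
    finally show ?case .
  qed
  from this[of R U] U show ?thesis by simp
qed

definition explore_weight :: "(nat \<Rightarrow> real) \<Rightarrow> (nat \<Rightarrow> nat \<Rightarrow> real) \<Rightarrow> real \<Rightarrow> nat \<Rightarrow> nat \<Rightarrow> nat \<Rightarrow> nat \<Rightarrow> real" where
  "explore_weight \<theta> \<Gamma> \<rho> k t u r = \<theta> (Suc t) ^ u * (\<Prod>s\<in>{t<..k}. 1 / \<theta> s) * \<Gamma> t r * (1 + 2 * \<rho>) ^ (k - t)"

text \<open>In the weight \<open>explore_weight\<close> the factor \<open>\<theta>\<close> accounts for discovered vertices and \<open>\<Gamma>\<close> for undiscovered ones.
  Assumptions \<open>a\<close>, \<open>b\<close>, \<open>c\<close> make it a supersolution of the recursion given by \<open>explore_step_bound\<close>: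
  discovery of single vertices, absorption of a cluster of size \<open>b\<close>, and the final state.\<close>

lemma explore_bound:
  fixes \<theta> v \<beta> :: "nat \<Rightarrow> real" and \<Gamma> :: "nat \<Rightarrow> nat \<Rightarrow> real"
  assumes S: "S \<subseteq> V" "card S = N" and k: "1 \<le> k" "k \<le> N"
    and \<theta>pos: "\<And>s. 0 < \<theta> s" and \<theta>dec: "\<And>s. \<theta> (Suc s) \<le> \<theta> s"
    and \<Gamma>0: "\<And>t r. 0 \<le> \<Gamma> t r"
    and a: "\<And>t r. t < k \<Longrightarrow> (\<Sum>d\<le>r. real (r choose d) * ((Q (Suc t) - Q t) * \<theta> (Suc t)) ^ d * \<Gamma> (Suc t) (r - d)) \<le> \<Gamma> t r"
    and b: "\<And>t r b. 1 \<le> t \<Longrightarrow> t \<le> k \<Longrightarrow> 2 \<le> b \<Longrightarrow> b \<le> t \<Longrightarrow> b \<le> r \<Longrightarrow> r \<le> N \<Longrightarrow> real (r choose b) * \<Gamma> t (r - b) \<le> v b * \<Gamma> t r"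
    and c: "\<And>u r. k + u + r = N \<Longrightarrow> (1 - Q k) ^ r \<le> \<theta> (Suc k) ^ u * \<Gamma> k r"
    and \<beta>: "\<And>B. B \<subseteq> S \<Longrightarrow> 2 \<le> card B \<Longrightarrow> card B < N \<Longrightarrow> Pr (\<lambda>w. spanned w B) \<le> \<beta> (card B)"
    and \<beta>0: "\<And>b. 0 \<le> \<beta> b"
    and \<sigma>: "\<And>s. 1 \<le> s \<Longrightarrow> s \<le> k \<Longrightarrow> (\<Sum>b=2..s. \<beta> b * jbound s b * v b * \<theta> s ^ b) \<le> \<rho>"
    and rho: "0 \<le> \<rho>" "\<rho> \<le> 1/2" and v0: "\<And>b. 0 \<le> v b"
    and T: "T \<subseteq> S" "U \<subseteq> S - T" "card T \<le> k"
  shows "Pr (\<lambda>w. explored w T U (S - T - U)) \<le> explore_weight \<theta> \<Gamma> \<rho> k (card T) (card U) (card (S - T - U))"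
  using T
proof (induction "k - card T" arbitrary: T U)
  case 0
  define R where "R = S - T - U"
  have finS: "finite S" by (rule finite_subset[OF S(1) fin])
  have finT: "finite T" "finite U" "finite R"
    using finite_subset[OF 0(2) finS] finite_subset[OF 0(3)] finS unfolding R_def by auto
  have tk: "card T = k" using 0 by simp
  have SU: "S = T \<union> (U \<union> R)" using 0 unfolding R_def by auto
  have "card S = card T + card (U \<union> R)"
    unfolding SU using 0 finT R_def by (intro card_Un_disjoint) auto
  also have "card (U \<union> R) = card U + card R"
    using 0 finT R_def by (intro card_Un_disjoint) auto
  finally have N: "k + card U + card R = N" using S tk by simp
  \<comment> \<open>At the final size only the condition on single vertices is kept.\<close>
  have "Pr (\<lambda>w. explored w T U R) \<le> Pr (\<lambda>w. noatt w T R)"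
  proof (rule Pr_mono)
    fix w assume e: "explored w T U R"
    show "noatt w T R" unfolding noatt_def
    proof
      fix v assume "v \<in> R"
      moreover have "card {v} \<le> card T" using tk k by simp
      ultimately show "\<not> djoin w {v} T" using e spanned.single[of w v] unfolding explored_def by blast
    qed
  qed
  also have "\<dots> = (1 - Q k) ^ card R" using 0 S tk R_def by (subst Pr_noatt) auto
  also have "\<dots> \<le> \<theta> (Suc k) ^ card U * \<Gamma> k (card R)" by (rule c[OF N])
  finally show ?case unfolding explore_weight_def tk R_def by simp
next
  case (Suc m)
  define R where "R = S - T - U"
  define t where "t = card T"
  have tk: "t < k" using Suc.hyps unfolding t_def by simp
  have finS: "finite S" by (rule finite_subset[OF S(1) fin])
  have finT: "finite T" "finite U" "finite R"
    using finite_subset[OF Suc.prems(1) finS] finite_subset[OF Suc.prems(2)] finS unfolding R_def by auto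
  have hb0: "0 \<le> explore_weight \<theta> \<Gamma> \<rho> k t u r" for t u r
    unfolding explore_weight_def using \<theta>pos \<Gamma>0 rho by (intro mult_nonneg_nonneg prod_nonneg) (auto simp: less_imp_le)
  show ?case
  proof (cases "U = {}")
    case True
    \<comment> \<open>Without an active vertex the state is impossible below size \<open>k\<close>:
      \<open>grow\<close> supplies a cluster joined to \<open>T\<close>, and the other half of
      \<open>explored\<close> forbids it.\<close>
    have "T \<noteq> S" using tk k S t_def by auto
    have "\<not> explored w T U (S - T - U)" for w
    proof
      assume e: "explored w T U (S - T - U)"
      have "T \<union> U \<union> (S - T - U) = S" using Suc.prems by auto
      then have "grow w T S" using e True unfolding explored_def by simp
      then obtain B where "B \<subseteq> S - T" "spanned w B" "card B \<le> card T" "djoin w B T"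
        unfolding grow_def using Suc.prems(1) \<open>T \<noteq> S\<close> by (metis psubsetI subset_refl)
      then show False using e True unfolding explored_def by auto
    qed
    then show ?thesis using hb0 by (simp add: pr_def)
  next
    case False
    then obtain x where x: "x \<in> U" by auto
    let ?T = "insert x T" and ?q = "Q (Suc t) - Q t"
    have xT: "x \<notin> T" "?T \<subseteq> S" "?T \<subseteq> V" "R \<subseteq> V - ?T" using x Suc.prems S unfolding R_def by auto
    have sT: "card ?T = Suc t" using xT finT t_def by simp
    define h where "h = explore_weight \<theta> \<Gamma> \<rho> k (Suc t)"
    have G: "Pr (\<lambda>w. half_explored w T ?T U1 R1) \<le> (1 + 2 * \<rho>) * h (card U1) (card R1)"
      if 1: "R1 \<subseteq> R" "U1 \<union> R1 = S - ?T" "U1 \<inter> R1 = {}" for U1 R1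
    proof (rule explore_step_bound[where \<beta> = \<beta>])
      show "x \<notin> T" "?T \<subseteq> V" "R1 \<subseteq> V - ?T" using xT 1 by auto
      show "0 \<le> h u r" for u r unfolding h_def by (rule hb0)
      show "0 \<le> \<rho>" "\<rho> \<le> 1/2" "\<And>b. 0 \<le> \<beta> b" "U1 \<inter> R1 = {}" using rho \<beta>0 1 by auto
      show "finite U1" using 1 finS by (metis finite_Diff finite_Un)
      \<comment> \<open>The vertex \<open>x\<close> is missing from \<open>B\<close>, so
        \<open>B\<close> is strictly smaller than \<open>S\<close>. This strictness allows the
        cluster bound to be an induction hypothesis.\<close>
      show "Pr (\<lambda>w. spanned w B) \<le> \<beta> (card B)" if "B \<subseteq> R1" "2 \<le> card B" for B
      proof (rule \<beta>)
        show "B \<subseteq> S" using that 1 R_def by auto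
        moreover have "x \<in> S" "x \<notin> B" using xT that 1 by auto
        ultimately have "B \<subset> S" by auto
        then show "card B < N" using psubset_card_mono[OF finS] S by auto
      qed fact
      show "Pr (\<lambda>w. explored w ?T U' R') \<le> h (card U') (card R')"
        if "R' \<subseteq> R1" "U' \<union> R' = U1 \<union> R1" "U' \<inter> R' = {}" for R' U'
      proof -
        have R': "R' = S - ?T - U'" and U': "U' \<subseteq> S - ?T" using that 1 by auto
        show ?thesis unfolding h_def R' sT[symmetric]
          using Suc.hyps(2) tk sT xT U' unfolding t_def by (intro Suc.hyps(1)) auto
      qed
      fix u r assume r: "r \<le> card R1"
      have "card R1 \<le> N" using card_mono[OF finS, of R1] 1 S by auto
      then have rN: "r \<le> N" using r by simp
      have "(\<Sum>b=2..card ?T. if b \<le> r then real (r choose b) * (\<beta> b * jbound (card ?T) b * h (u + b) (r - b)) else 0)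
        \<le> (\<Sum>b=2..Suc t. (\<beta> b * jbound (Suc t) b * v b * \<theta> (Suc t) ^ b) * h u r)"
        unfolding sT
      proof (rule sum_mono)
        fix b assume bb: "b \<in> {2..Suc t}"
        have j0: "0 \<le> jbound (Suc t) b" unfolding jbound_def using pp_nonneg by simp
        have h0: "0 \<le> h u r" unfolding h_def by (rule hb0)
        show "(if b \<le> r then real (r choose b) * (\<beta> b * jbound (Suc t) b * h (u + b) (r - b)) else 0)
          \<le> (\<beta> b * jbound (Suc t) b * v b * \<theta> (Suc t) ^ b) * h u r"
        proof (cases "b \<le> r")
          case False
          have "0 \<le> (\<beta> b * jbound (Suc t) b * v b * \<theta> (Suc t) ^ b) * h u r"
            by (intro mult_nonneg_nonneg zero_le_power less_imp_le[OF \<theta>pos] j0 h0 \<beta>0 v0)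
          then show ?thesis using False by simp
        next
          case True
          let ?P = "(\<Prod>s\<in>{Suc t<..k}. 1 / \<theta> s) * (1 + 2 * \<rho>) ^ (k - Suc t)"
          have P0: "0 \<le> ?P" using \<theta>pos rho by (intro mult_nonneg_nonneg prod_nonneg) (auto simp: less_imp_le)
          have "real (r choose b) * h (u + b) (r - b) =
            \<theta> (Suc (Suc t)) ^ b * (\<theta> (Suc (Suc t)) ^ u * ?P * (real (r choose b) * \<Gamma> (Suc t) (r - b)))"
            unfolding h_def explore_weight_def by (simp add: power_add mult_ac)
          also have "\<dots> \<le> \<theta> (Suc t) ^ b * (\<theta> (Suc (Suc t)) ^ u * ?P * (v b * \<Gamma> (Suc t) r))"
          proof (rule mult_mono)
            have bb': "real (r choose b) * \<Gamma> (Suc t) (r - b) \<le> v b * \<Gamma> (Suc t) r"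
              by (rule b) (use tk bb True rN in auto)
            show "\<theta> (Suc (Suc t)) ^ u * ?P * (real (r choose b) * \<Gamma> (Suc t) (r - b))
              \<le> \<theta> (Suc (Suc t)) ^ u * ?P * (v b * \<Gamma> (Suc t) r)"
              by (rule mult_left_mono[OF bb' mult_nonneg_nonneg[OF zero_le_power[OF less_imp_le[OF \<theta>pos]] P0]])
            show "\<theta> (Suc (Suc t)) ^ b \<le> \<theta> (Suc t) ^ b"
              by (rule power_mono[OF \<theta>dec less_imp_le[OF \<theta>pos]])
            show "0 \<le> \<theta> (Suc t) ^ b" by (rule zero_le_power[OF less_imp_le[OF \<theta>pos]])
            show "0 \<le> \<theta> (Suc (Suc t)) ^ u * ?P * (real (r choose b) * \<Gamma> (Suc t) (r - b))"
              by (intro mult_nonneg_nonneg[OF mult_nonneg_nonneg[OF zero_le_power[OF less_imp_le[OF \<theta>pos]] P0]]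
                  mult_nonneg_nonneg[OF of_nat_0_le_iff \<Gamma>0])
          qed
          also have "\<dots> = v b * \<theta> (Suc t) ^ b * h u r" unfolding h_def explore_weight_def by (simp add: mult_ac)
          finally have *: "real (r choose b) * h (u + b) (r - b) \<le> v b * \<theta> (Suc t) ^ b * h u r" .
          have "real (r choose b) * (\<beta> b * jbound (Suc t) b * h (u + b) (r - b)) =
            (\<beta> b * jbound (Suc t) b) * (real (r choose b) * h (u + b) (r - b))" by (simp add: mult_ac)
          also have "\<dots> \<le> (\<beta> b * jbound (Suc t) b) * (v b * \<theta> (Suc t) ^ b * h u r)"
            by (rule mult_left_mono[OF * mult_nonneg_nonneg[OF \<beta>0 j0]])
          finally show ?thesis using True by (simp add: mult_ac)
        qed
      qed
      also have "\<dots> = (\<Sum>b=2..Suc t. \<beta> b * jbound (Suc t) b * v b * \<theta> (Suc t) ^ b) * h u r"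
        by (rule sum_distrib_right[symmetric])
      also have "\<dots> \<le> \<rho> * h u r"
        using tk by (intro mult_right_mono[OF \<sigma>]) (auto simp: h_def hb0)
      finally show "(\<Sum>b=2..card ?T. if b \<le> r then real (r choose b) * (\<beta> b * jbound (card ?T) b * h (u + b) (r - b)) else 0) \<le> \<rho> * h u r" .
    qed
    define u where "u = card U - 1"
    have "card U \<noteq> 0" using x finT by auto
    then have cU: "card U = Suc u" unfolding u_def by simp
    define K where "K = (\<Prod>s\<in>{Suc t<..k}. 1 / \<theta> s) * (1 + 2 * \<rho>) ^ (k - t)"
    have K0: "0 \<le> K" unfolding K_def using \<theta>pos rho by (intro mult_nonneg_nonneg prod_nonneg) (auto simp: less_imp_le)
    have q0: "0 \<le> ?q" using Q_mono[of t "Suc t"] by simp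
    have Y: "(1 + 2 * \<rho>) * (1 + 2 * \<rho>) ^ (k - Suc t) = (1 + 2 * \<rho>) ^ (k - t)"
      using tk by (metis Suc_diff_Suc power_Suc)
    have "Pr (\<lambda>w. explored w T U R) \<le> Pr (\<lambda>w. \<exists>D\<in>Pow R. newatt w T ?T D \<and> half_explored w T ?T (U - {x} \<union> D) (R - D))"
    proof (rule Pr_mono)
      fix w assume "explored w T U R"
      then have "newatt w T ?T {v \<in> R. djoin w {v} ?T} \<and>
         half_explored w T ?T (U - {x} \<union> {v \<in> R. djoin w {v} ?T}) (R - {v \<in> R. djoin w {v} ?T})"
        by (rule explored_step[OF _ x finT(1) xT(1) refl])
      then show "\<exists>D\<in>Pow R. newatt w T ?T D \<and> half_explored w T ?T (U - {x} \<union> D) (R - D)"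
        by (intro bexI[of _ "{v \<in> R. djoin w {v} ?T}"]) auto
    qed
    also have "\<dots> \<le> (\<Sum>D\<in>Pow R. Pr (\<lambda>w. newatt w T ?T D \<and> half_explored w T ?T (U - {x} \<union> D) (R - D)))"
      using finT by (intro Pr_bex) auto
    also have "\<dots> \<le> (\<Sum>D\<in>Pow R. (\<theta> (Suc t) ^ u * K) * ((?q * \<theta> (Suc t)) ^ card D * \<Gamma> (Suc t) (card R - card D)))"
    proof (rule sum_mono)
      fix D assume "D \<in> Pow R"
      then have D: "D \<subseteq> R" by auto
      have finD: "finite D" by (rule finite_subset[OF D finT(3)])
      have cR: "card (R - D) = card R - card D" using finD D by (intro card_Diff_subset)
      have cUD: "card (U - {x} \<union> D) = u + card D"
      proof -
        have "(U - {x}) \<inter> D = {}" using D R_def by auto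
        then show ?thesis using finT finD x u_def by (subst card_Un_disjoint) auto
      qed
      have "Pr (\<lambda>w. newatt w T ?T D \<and> half_explored w T ?T (U - {x} \<union> D) (R - D)) =
        Pr (\<lambda>w. newatt w T ?T D) * Pr (\<lambda>w. half_explored w T ?T (U - {x} \<union> D) (R - D))"
      proof (rule Pr_indep[OF _ depends_half_explored touching_avoiding(2)])
        show "depends (\<lambda>w. newatt w T ?T D) (avoiding (R - D))"
          using xT by (intro depends_newatt) (auto simp: avoiding_def)
      qed auto
      also have "\<dots> \<le> ?q ^ card D * (\<theta> (Suc t) ^ (u + card D) * (K * \<Gamma> (Suc t) (card R - card D)))"
      proof (rule mult_mono)
        have "Pr (\<lambda>w. newatt w T ?T D) = ?q ^ card D"
          using D xT sT t_def by (subst Pr_newatt) auto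
        then show "Pr (\<lambda>w. newatt w T ?T D) \<le> ?q ^ card D" by simp
        have "Pr (\<lambda>w. half_explored w T ?T (U - {x} \<union> D) (R - D)) \<le> (1 + 2 * \<rho>) * h (card (U - {x} \<union> D)) (card (R - D))"
        proof (rule G)
          show "R - D \<subseteq> R" by auto
          show "U - {x} \<union> D \<union> (R - D) = S - ?T" using D x Suc.prems R_def by auto
          show "(U - {x} \<union> D) \<inter> (R - D) = {}" using R_def by auto
        qed
        also have "\<dots> = \<theta> (Suc (Suc t)) ^ (u + card D) * (K * \<Gamma> (Suc t) (card R - card D))"
          unfolding h_def explore_weight_def K_def Y[symmetric] cR cUD by (simp add: mult_ac)
        also have "\<dots> \<le> \<theta> (Suc t) ^ (u + card D) * (K * \<Gamma> (Suc t) (card R - card D))"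
          by (rule mult_right_mono[OF power_mono[OF \<theta>dec less_imp_le[OF \<theta>pos]] mult_nonneg_nonneg[OF K0 \<Gamma>0]])
        finally show "Pr (\<lambda>w. half_explored w T ?T (U - {x} \<union> D) (R - D)) \<le>
          \<theta> (Suc t) ^ (u + card D) * (K * \<Gamma> (Suc t) (card R - card D))" .
      qed (use q0 Pr_nonneg in auto)
      also have "\<dots> = (\<theta> (Suc t) ^ u * K) * ((?q * \<theta> (Suc t)) ^ card D * \<Gamma> (Suc t) (card R - card D))"
        by (simp add: power_add power_mult_distrib mult_ac)
      finally show "Pr (\<lambda>w. newatt w T ?T D \<and> half_explored w T ?T (U - {x} \<union> D) (R - D))
         \<le> (\<theta> (Suc t) ^ u * K) * ((?q * \<theta> (Suc t)) ^ card D * \<Gamma> (Suc t) (card R - card D))" .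
    qed
    also have "\<dots> = (\<theta> (Suc t) ^ u * K) * (\<Sum>D\<in>Pow R. (?q * \<theta> (Suc t)) ^ card D * \<Gamma> (Suc t) (card R - card D))"
      by (rule sum_distrib_left[symmetric])
    also have "(\<Sum>D\<in>Pow R. (?q * \<theta> (Suc t)) ^ card D * \<Gamma> (Suc t) (card R - card D)) =
       (\<Sum>d\<le>card R. real (card R choose d) * (?q * \<theta> (Suc t)) ^ d * \<Gamma> (Suc t) (card R - d))"
      using sum_Pow_card[OF finT(3), of "\<lambda>d. (?q * \<theta> (Suc t)) ^ d * \<Gamma> (Suc t) (card R - d)"]
      by (simp add: mult.assoc)
    also have "(\<theta> (Suc t) ^ u * K) * \<dots> \<le> (\<theta> (Suc t) ^ u * K) * \<Gamma> t (card R)"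
      by (rule mult_left_mono[OF a[OF tk] mult_nonneg_nonneg[OF zero_le_power[OF less_imp_le[OF \<theta>pos]] K0]])
    also have "\<dots> = explore_weight \<theta> \<Gamma> \<rho> k t (card U) (card R)"
    proof -
      \<comment> \<open>The explored vertex has left \<open>U\<close>, so one factor
        \<open>\<theta> (Suc t)\<close> is missing; the additional factor of the product cancels
        it.\<close>
      have "{t<..k} = insert (Suc t) {Suc t<..k}" using tk by auto
      then have "(\<Prod>s\<in>{t<..k}. 1 / \<theta> s) = 1 / \<theta> (Suc t) * (\<Prod>s\<in>{Suc t<..k}. 1 / \<theta> s)" by simp
      then show ?thesis unfolding explore_weight_def cU K_def using \<theta>pos[of "Suc t"] by simp
    qed
    finally show ?thesis unfolding R_def t_def .
  qed
qed

end

section \<open>The probability that a small set is spanned\<close>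

lemma sum_exp_le:
  fixes x :: real
  assumes "0 \<le> x"
  shows "(\<Sum>d\<le>n. x ^ d / fact d) \<le> exp x"
proof -
  have "(\<Sum>d\<in>{..n}. inverse (fact d) * x ^ d) \<le> (\<Sum>d. inverse (fact d) * x ^ d)"
    using assms by (intro sum_le_suminf summable_exp) auto
  then show ?thesis by (simp add: exp_def field_simps)
qed

lemma power_le_fact_exp:
  fixes x :: real
  assumes "0 \<le> x"
  shows "x ^ n \<le> fact n * exp x"
proof -
  have "x ^ n / fact n \<le> (\<Sum>d\<le>n. x ^ d / fact d)"
    using assms by (intro member_le_sum) auto
  also have "\<dots> \<le> exp x" by (rule sum_exp_le[OF assms])
  finally show ?thesis by (simp add: field_simps)
qed

lemma fact_upper:
  assumes "1 \<le> n"
  shows "(fact n :: real) \<le> exp 1 * n * (n / exp 1) ^ n"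
  using assms
proof (induction n rule: nat_induct_at_least)
  case base then show ?case by simp
next
  case (Suc n)
  have n: "0 < real n" using Suc by simp
  have "1 / (real n + 1) \<le> ln ((real n + 1) / real n)"
  proof -
    have "ln (real n / (real n + 1)) \<le> real n / (real n + 1) - 1" using n by (intro ln_le_minus_one) auto
    then show ?thesis using n by (simp add: ln_div field_simps)
  qed
  then have "1 \<le> (real n + 1) * ln ((real n + 1) / real n)" using n by (simp add: field_simps)
  then have "exp 1 \<le> exp (real (Suc n) * ln ((real n + 1) / real n))" by (simp add: add.commute)
  also have "\<dots> = ((real n + 1) / real n) ^ Suc n"
    unfolding exp_of_nat_mult using n by simp
  finally have "exp 1 * real n ^ Suc n \<le> real (Suc n) ^ Suc n"
    using n by (simp add: power_divide field_simps)
  then have e: "real n * real n ^ n * exp 1 \<le> real (Suc n) ^ Suc n" by (simp add: mult_ac)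
  have "(fact (Suc n) :: real) = real (Suc n) * fact n" by simp
  also have "\<dots> \<le> real (Suc n) * (exp 1 * n * (n / exp 1) ^ n)"
    using Suc by (intro mult_left_mono) auto
  also have "\<dots> = real (Suc n) * (real n * real n ^ n * exp 1) / exp 1 ^ n"
    by (simp add: power_divide)
  also have "\<dots> \<le> real (Suc n) * real (Suc n) ^ Suc n / exp 1 ^ n"
    using e by (intro divide_right_mono mult_left_mono) auto
  also have "\<dots> = exp 1 * real (Suc n) * (real (Suc n) / exp 1) ^ Suc n"
    by (simp add: power_divide)
  finally show ?case .
qed

text \<open>The fifth power is the b^3 of \<open>jbound\<close> times a b^2 left over in
  \<open>cluster_weight_bound\<close>. The exponential is the gap \<open>\<kappa>\<close> between
  the exponent of the cluster bound and that used in \<open>\<theta>\<close>.\<close>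

lemma sum_pow5_exp_bounded:
  fixes \<kappa> :: real
  assumes "0 < \<kappa>"
  shows "\<exists>K>0. \<forall>n. (\<Sum>b=2..n. real b ^ 5 * exp (- \<kappa> * real b)) \<le> K"
proof -
  define D where "D = 120 * (2 / \<kappa>) ^ 5"
  define x where "x = exp (- \<kappa> / 2)"
  have D: "0 < D" unfolding D_def using assms by simp
  have x: "0 < x" "x < 1" unfolding x_def using assms by auto
  have t: "real b ^ 5 * exp (- \<kappa> * real b) \<le> D * x ^ b" for b
  proof -
    have f: "(fact 5 :: real) = 120" by (simp add: fact_numeral)
    have "(\<kappa> / 2 * real b) ^ 5 \<le> 120 * exp (\<kappa> / 2 * real b)"
      using power_le_fact_exp[of "\<kappa> / 2 * real b" 5] assms f by simp
    then have "real b ^ 5 \<le> D * exp (\<kappa> / 2 * real b)"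
      unfolding D_def using assms by (simp add: power_mult_distrib power_divide field_simps)
    then have "real b ^ 5 * exp (- \<kappa> * real b) \<le> D * exp (\<kappa> / 2 * real b) * exp (- \<kappa> * real b)"
      by (rule mult_right_mono) simp
    also have "\<dots> = D * exp (real b * (- \<kappa> / 2))" by (simp add: mult_exp_exp algebra_simps)
    also have "\<dots> = D * x ^ b" unfolding x_def by (subst exp_of_nat_mult) simp
    finally show ?thesis .
  qed
  have "(\<Sum>b=2..n. real b ^ 5 * exp (- \<kappa> * real b)) \<le> D / (1 - x)" for n
  proof -
    have "(\<Sum>b=2..n. real b ^ 5 * exp (- \<kappa> * real b)) \<le> (\<Sum>b=2..n. D * x ^ b)" by (intro sum_mono t)
    also have "\<dots> \<le> (\<Sum>b<Suc n. D * x ^ b)" using D x by (intro sum_mono2) auto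
    also have "\<dots> = D * (\<Sum>b<Suc n. x ^ b)" by (rule sum_distrib_left[symmetric])
    also have "\<dots> \<le> D * (1 / (1 - x))"
    proof (rule mult_left_mono)
      have "(\<Sum>b<Suc n. x ^ b) = (1 - x ^ Suc n) / (1 - x)" using x by (subst sum_gp_strict) auto
      also have "\<dots> \<le> 1 / (1 - x)" using x by (intro divide_right_mono) auto
      finally show "(\<Sum>b<Suc n. x ^ b) \<le> 1 / (1 - x)" .
    qed (use D in auto)
    finally show ?thesis by simp
  qed
  moreover have "0 < D / (1 - x)" using D x by simp
  ultimately show ?thesis by blast
qed

text \<open>Capping \<open>s\<close> from below at \<open>s0\<close> costs only a constant factor
  against the factorial.\<close>

lemma prod_max_le:
  assumes "1 \<le> s0"
  shows "(\<Prod>s=1..n. real (max s s0)) \<le> real s0 ^ s0 * fact n"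
proof -
  have "(\<Prod>s=1..n. real (max s s0)) \<le> real s0 ^ min n s0 * fact n"
  proof (induction n)
    case (Suc n)
    have "(\<Prod>s=1..Suc n. real (max s s0)) = (\<Prod>s=1..n. real (max s s0)) * real (max (Suc n) s0)" by simp
    also have "\<dots> \<le> (real s0 ^ min n s0 * fact n) * real (max (Suc n) s0)"
      using Suc by (intro mult_right_mono) auto
    also have "\<dots> \<le> real s0 ^ min (Suc n) s0 * fact (Suc n)"
    proof (cases "Suc n \<le> s0")
      case True
      then have "real s0 ^ min (Suc n) s0 * fact (Suc n) = (real s0 ^ min n s0 * fact n) * (real s0 * real (Suc n))"
        by (simp add: min_def)
      moreover have "real (max (Suc n) s0) \<le> real s0 * real (Suc n)"
        using True assms by (simp add: max_def)
      ultimately show ?thesis by (metis mult_left_mono mult_nonneg_nonneg of_nat_0_le_iff zero_le_power fact_ge_zero)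
    next
      case False
      then have "min n s0 = s0" "min (Suc n) s0 = s0" "max (Suc n) s0 = Suc n" by auto
      then show ?thesis by (simp only: fact_Suc) (simp add: mult_ac)
    qed
    finally show ?case .
  qed simp
  also have "\<dots> \<le> real s0 ^ s0 * fact n"
    using assms by (intro mult_right_mono power_increasing) auto
  finally show ?thesis .
qed

text \<open>Summation by parts for a nonincreasing \<open>\<theta>\<close>: only values of
  \<open>Q\<close> are compared with those of s^2 P, not increments. The induction carries the
  boundary term along.\<close>

lemma abel_bound:
  fixes Q \<theta> :: "nat \<Rightarrow> real"
  assumes \<theta>: "\<And>s. 0 \<le> \<theta> s" "\<And>s. \<theta> (Suc s) \<le> \<theta> s" and Q: "Q 0 = 0" "\<And>s. Q s \<le> (real s)\<^sup>2 * P"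
  shows "(\<Sum>s\<in>{0<..n}. (Q s - Q (s - 1)) * \<theta> s) \<le> (\<Sum>s\<in>{0<..n}. (2 * real s - 1) * P * \<theta> s)"
proof -
  have I: "{0<..Suc n} = insert (Suc n) {0<..n}" for n by auto
  have "(\<Sum>s\<in>{0<..n}. (Q s - Q (s - 1)) * \<theta> s) \<le>
    (\<Sum>s\<in>{0<..n}. (2 * real s - 1) * P * \<theta> s) - ((real n)\<^sup>2 * P - Q n) * \<theta> n" for n
  proof (induction n)
    case 0 then show ?case using Q by simp
  next
    case (Suc n)
    have "((real n)\<^sup>2 * P - Q n) * \<theta> (Suc n) \<le> ((real n)\<^sup>2 * P - Q n) * \<theta> n"
      using Q(2)[of n] \<theta>(2)[of n] by (intro mult_left_mono) auto
    then show ?case using Suc unfolding I by (simp add: power2_eq_square algebra_simps)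
  qed
  then have "(\<Sum>s\<in>{0<..n}. (Q s - Q (s - 1)) * \<theta> s) \<le>
    (\<Sum>s\<in>{0<..n}. (2 * real s - 1) * P * \<theta> s) - ((real n)\<^sup>2 * P - Q n) * \<theta> n" .
  moreover have "0 \<le> ((real n)\<^sup>2 * P - Q n) * \<theta> n" using Q(2)[of n] \<theta>(1)[of n] by simp
  ultimately show ?thesis by linarith
qed

text \<open>The power of \<open>P\<close> is the number of merges, each of which needs an edge of
  both colours. The parameter \<open>\<beta>\<close> is the exponential excess per vertex that gets
  improved below.\<close>

definition sbound :: "real \<Rightarrow> real \<Rightarrow> real \<Rightarrow> nat \<Rightarrow> real" where
  "sbound C \<beta> P N = C * fact N * (2 * exp \<beta> * real N) ^ N * P ^ (N - 1)"

lemma sbound_nonneg: "0 \<le> C \<Longrightarrow> 0 \<le> P \<Longrightarrow> 0 \<le> sbound C \<beta> P N"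
  unfolding sbound_def by simp

lemma sbound_mono:
  assumes "0 \<le> C" "C \<le> C'" "\<beta> \<le> \<beta>'" "0 \<le> P"
  shows "sbound C \<beta> P N \<le> sbound C' \<beta>' P N"
  unfolding sbound_def using assms by (intro mult_right_mono mult_mono power_mono) auto

text \<open>As b is at most m = \<open>max s s0\<close>, the power (b / m)^b is at most (b / m)^2,
  and s / m^2 is at most 1 / \<open>s0\<close>. A large \<open>s0\<close> thus makes the whole sum
  small, uniformly in \<open>s\<close>.\<close>

lemma cluster_weight_bound:
  assumes K: "\<And>n. (\<Sum>b=2..n. real b ^ 5 * exp (- \<kappa> * real b)) \<le> K"
    and s0: "1 \<le> s0" "2 * C0 * K \<le> \<rho> * real s0" and C0: "0 \<le> C0" and s: "1 \<le> s"
    and w: "\<And>b. 2 \<le> b \<Longrightarrow> b \<le> s \<Longrightarrow> w b \<le> 2 * C0 * real s * real b ^ 3 * (exp (- \<kappa>) * real b / real (max s s0)) ^ b"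
  shows "(\<Sum>b=2..s. w b) \<le> \<rho>"
proof -
  let ?m = "real (max s s0)"
  have m: "0 < ?m" using s by simp
  have "w b \<le> 2 * C0 / real s0 * (real b ^ 5 * exp (- \<kappa> * real b))" if b: "b \<in> {2..s}" for b
  proof -
    have "w b \<le> 2 * C0 * real s * real b ^ 3 * (exp (- \<kappa>) * real b / ?m) ^ b" using w b by simp
    also have "(exp (- \<kappa>) * real b / ?m) ^ b = exp (- \<kappa> * real b) * (real b / ?m) ^ b"
      using exp_of_nat_mult[of b "- \<kappa>"] by (simp add: power_mult_distrib power_divide mult_ac)
    also have "(real b / ?m) ^ b \<le> (real b / ?m) ^ 2"
      using b m by (intro power_decreasing) auto
    finally have "w b \<le> 2 * C0 * real s * real b ^ 3 * (exp (- \<kappa> * real b) * (real b / ?m)\<^sup>2)"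
      using C0 by (simp add: mult_left_mono)
    also have "\<dots> = 2 * C0 * (real s / ?m\<^sup>2) * (real b ^ 5 * exp (- \<kappa> * real b))"
      by (simp add: power_divide power2_eq_square eval_nat_numeral)
    also have "\<dots> \<le> 2 * C0 * (1 / real s0) * (real b ^ 5 * exp (- \<kappa> * real b))"
    proof (intro mult_right_mono mult_left_mono)
      have "real s * real s0 \<le> ?m * ?m" by (intro mult_mono) auto
      then show "real s / ?m\<^sup>2 \<le> 1 / real s0" using m s0 by (simp add: field_simps power2_eq_square)
    qed (use C0 in auto)
    finally show ?thesis by simp
  qed
  then have "(\<Sum>b=2..s. w b) \<le> (\<Sum>b=2..s. 2 * C0 / real s0 * (real b ^ 5 * exp (- \<kappa> * real b)))"
    by (rule sum_mono)
  also have "\<dots> = 2 * C0 / real s0 * (\<Sum>b=2..s. real b ^ 5 * exp (- \<kappa> * real b))"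
    by (rule sum_distrib_left[symmetric])
  also have "\<dots> \<le> 2 * C0 / real s0 * K" using C0 by (intro mult_left_mono K) auto
  also have "\<dots> \<le> \<rho>" using s0 by (simp add: field_simps)
  finally show ?thesis .
qed

lemma choose_fact: "b \<le> r \<Longrightarrow> real (r choose b) * fact (r - b) = fact r / fact b"
  by (simp add: binomial_fact)

section \<open>Self-improvement of the bound for small sets\<close>

context two_graphs
begin

lemma Pr_spanned_explore:
  assumes S: "S \<subseteq> V"
  shows "Pr (\<lambda>w. spanned w S) \<le> (\<Sum>v\<in>S. Pr (\<lambda>w. explored w {} {v} (S - {v})))"
proof -
  have "Pr (\<lambda>w. spanned w S) \<le> Pr (\<lambda>w. \<exists>v\<in>S. explored w {} {v} (S - {v}))"
  proof (rule Pr_mono)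
    fix w assume "spanned w S"
    then obtain v where "v \<in> S" "root_of w S v" using spanned_root by blast
    then show "\<exists>v\<in>S. explored w {} {v} (S - {v})" using root_of_explored by (intro bexI[of _ v]) auto
  qed
  also have "\<dots> \<le> (\<Sum>v\<in>S. Pr (\<lambda>w. explored w {} {v} (S - {v})))"
    by (rule Pr_bex[OF finite_subset[OF S fin]])
  finally show ?thesis .
qed

text \<open>The exploration is run to the very end, \<open>k = N\<close>. The choice of
  \<open>\<theta>\<close> makes a cluster of size b cost at most (exp (- \<kappa>) b / max s s0)^b
  up to polynomial factors, while the discoveries of single vertices cost at most a factor
  \<open>exp (exp (- \<eta>))\<close> per step, \<open>\<eta> = \<beta> + \<kappa>\<close>. The
  product of the \<open>1 / \<theta> s\<close> contributes \<open>exp \<eta>\<close> per vertex and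
  a factorial, and Stirling's formula for that factorial contributes the -1 in the exponent.\<close>

lemma spanned_recursive_bound:
  fixes \<beta> \<kappa> \<xi> P :: real
  assumes S: "S \<subseteq> V" "S \<noteq> {}" and P: "0 < P" "pp \<le> P" and \<beta>: "0 \<le> \<beta>" and \<kappa>: "0 < \<kappa>" and C0: "0 \<le> C0"
    and \<xi>: "0 < \<xi>" "\<xi> \<le> 1"
    and K: "\<And>n. (\<Sum>b=2..n. real b ^ 5 * exp (- \<kappa> * real b)) \<le> K"
    and s0: "1 \<le> s0" "2 * C0 * K \<le> \<xi> / 4 * real s0"
    and IH: "\<And>B. B \<subseteq> S \<Longrightarrow> 2 \<le> card B \<Longrightarrow> card B < card S \<Longrightarrow> Pr (\<lambda>w. spanned w B) \<le> sbound C0 \<beta> P (card B)"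
  shows "Pr (\<lambda>w. spanned w S) \<le>
    sbound (real s0 ^ s0 * exp 1 * (2 / \<xi>)) (\<beta> + \<kappa> - 1 + exp (- (\<beta> + \<kappa>)) + \<xi>) P (card S)"
proof -
  define N where "N = card S"
  define \<eta> where "\<eta> = \<beta> + \<kappa>"
  \<comment> \<open>One half of \<open>\<xi>\<close> pays for the power of
    \<open>1 + 2 * \<rho>\<close>, the other half for a polynomial factor \<open>N\<close>.\<close>
  define \<rho> where "\<rho> = \<xi> / 4"
  define \<theta> where "\<theta> s = exp (- \<eta>) / (2 * real (max s s0) * P)" for s
  define W where "W t = (\<Sum>s\<in>{t<..N}. (Q s - Q (s - 1)) * \<theta> s)" for t
  \<comment> \<open>With the factor \<open>fact r\<close>, choosing the discovered vertices turns
    into an exponential series, so a step adds its term to \<open>W\<close>.\<close>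
  define \<Gamma> where "\<Gamma> t r = fact r * exp (W t)" for t r
  have finS: "finite S" by (rule finite_subset[OF S(1) fin])
  have N1: "1 \<le> N" using finS S unfolding N_def by (simp add: Suc_leI card_gt_0_iff)
  have \<eta>0: "0 \<le> \<eta>" using \<beta> \<kappa> unfolding \<eta>_def by simp
  have \<theta>pos: "0 < \<theta> s" for s unfolding \<theta>_def using P s0 by simp
  have \<theta>dec: "\<theta> (Suc s) \<le> \<theta> s" for s
    unfolding \<theta>_def using P s0 by (intro divide_left_mono mult_right_mono mult_left_mono) auto
  have W_Suc: "W t = (Q (Suc t) - Q t) * \<theta> (Suc t) + W (Suc t)" if "t < N" for t
  proof -
    have "{t<..N} = insert (Suc t) {Suc t<..N}" using that by auto
    then show ?thesis unfolding W_def by simp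
  qed
  have main: "Pr (\<lambda>w. explored w {} {v} (S - {} - {v})) \<le> explore_weight \<theta> \<Gamma> \<rho> N (card ({} :: nat set)) (card {v}) (card (S - {} - {v}))"
    if v: "v \<in> S" for v
  proof (rule explore_bound[where v = "\<lambda>b. 1 / fact b" and \<beta> = "sbound C0 \<beta> P"])
    show "S \<subseteq> V" "card S = N" "1 \<le> N" "N \<le> N" using S N1 N_def by auto
    show "0 < \<theta> s" "\<theta> (Suc s) \<le> \<theta> s" for s by (fact \<theta>pos \<theta>dec)+
    show "0 \<le> \<Gamma> t r" for t r unfolding \<Gamma>_def by simp
    show "0 \<le> \<rho>" "\<rho> \<le> 1/2" unfolding \<rho>_def using \<xi> by auto
    show "0 \<le> 1 / (fact b :: real)" for b by simp
    show "0 \<le> sbound C0 \<beta> P b" for b using C0 P by (intro sbound_nonneg) auto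
    show "{} \<subseteq> S" "{v} \<subseteq> S - {}" "card ({} :: nat set) \<le> N" using v by auto
    show "Pr (\<lambda>w. spanned w B) \<le> sbound C0 \<beta> P (card B)" if "B \<subseteq> S" "2 \<le> card B" "card B < N" for B
      using IH that N_def by simp
    show "(1 - Q N) ^ r \<le> \<theta> (Suc N) ^ u * \<Gamma> N r" if "N + u + r = N" for u r
      using that unfolding \<Gamma>_def W_def by simp
    show "(\<Sum>d\<le>r. real (r choose d) * ((Q (Suc t) - Q t) * \<theta> (Suc t)) ^ d * \<Gamma> (Suc t) (r - d)) \<le> \<Gamma> t r" if "t < N" for t r
    proof -
      let ?x = "(Q (Suc t) - Q t) * \<theta> (Suc t)"
      have x0: "0 \<le> ?x" using Q_mono[of t "Suc t"] less_imp_le[OF \<theta>pos[of "Suc t"]] by simp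
      have "(\<Sum>d\<le>r. real (r choose d) * ?x ^ d * \<Gamma> (Suc t) (r - d)) = (\<Sum>d\<le>r. (fact r * exp (W (Suc t))) * (?x ^ d / fact d))"
      proof (rule sum.cong[OF refl])
        fix d assume d: "d \<in> {..r}"
        have "real (r choose d) * ?x ^ d * \<Gamma> (Suc t) (r - d) = (real (r choose d) * fact (r - d)) * (?x ^ d * exp (W (Suc t)))"
          unfolding \<Gamma>_def by (simp add: mult_ac)
        also have "real (r choose d) * fact (r - d) = fact r / fact d" using d by (intro choose_fact) auto
        finally show "real (r choose d) * ?x ^ d * \<Gamma> (Suc t) (r - d) = (fact r * exp (W (Suc t))) * (?x ^ d / fact d)"
          by (simp add: mult_ac)
      qed
      also have "\<dots> = (fact r * exp (W (Suc t))) * (\<Sum>d\<le>r. ?x ^ d / fact d)" by (rule sum_distrib_left[symmetric])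
      also have "\<dots> \<le> (fact r * exp (W (Suc t))) * exp ?x" by (intro mult_left_mono sum_exp_le x0) auto
      also have "\<dots> = \<Gamma> t r" unfolding \<Gamma>_def W_Suc[OF that] by (simp add: exp_add mult_ac)
      finally show ?thesis .
    qed
    show "real (r choose b) * \<Gamma> t (r - b) \<le> 1 / fact b * \<Gamma> t r" if "b \<le> r" for t r b
    proof -
      have "real (r choose b) * \<Gamma> t (r - b) = (real (r choose b) * fact (r - b)) * exp (W t)" unfolding \<Gamma>_def by simp
      then show ?thesis unfolding choose_fact[OF that] \<Gamma>_def by simp
    qed
    show "(\<Sum>b=2..s. sbound C0 \<beta> P b * jbound s b * (1 / fact b) * \<theta> s ^ b) \<le> \<rho>" if s: "1 \<le> s" for s
    proof (rule cluster_weight_bound[OF K s0[folded \<rho>_def] C0 s])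
      fix b assume b: "2 \<le> b" "b \<le> s"
      let ?m = "real (max s s0)"
      have m: "0 < ?m" using s by simp
      have "sbound C0 \<beta> P b * jbound s b * (1 / fact b) * \<theta> s ^ b =
        2 * C0 * real s * real b ^ 3 * (2 * exp \<beta> * real b * \<theta> s) ^ b * (P ^ (b - 1) * pp)"
        unfolding sbound_def jbound_def by (simp add: power_mult_distrib mult_ac)
      also have "\<dots> \<le> 2 * C0 * real s * real b ^ 3 * (2 * exp \<beta> * real b * \<theta> s) ^ b * (P ^ (b - 1) * P)"
        using P C0 \<theta>pos[of s] by (intro mult_left_mono) auto
      also have "P ^ (b - 1) * P = P ^ b" using b by (metis Suc_diff_1 less_le_trans pos2 power_Suc2)
      also have "2 * C0 * real s * real b ^ 3 * (2 * exp \<beta> * real b * \<theta> s) ^ b * P ^ b =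
         2 * C0 * real s * real b ^ 3 * (2 * exp \<beta> * real b * \<theta> s * P) ^ b"
        by (simp add: power_mult_distrib mult_ac)
      also have "2 * exp \<beta> * real b * \<theta> s * P = exp (- \<kappa>) * real b / ?m"
      proof -
        have "exp \<beta> * exp (- \<eta>) = exp (- \<kappa>)" unfolding \<eta>_def by (simp add: exp_add[symmetric])
        moreover have "2 * exp \<beta> * real b * \<theta> s * P = (exp \<beta> * exp (- \<eta>)) * real b / ?m"
          unfolding \<theta>_def using P m by (simp add: field_simps)
        ultimately show ?thesis by simp
      qed
      finally show "sbound C0 \<beta> P b * jbound s b * (1 / fact b) * \<theta> s ^ b \<le>
         2 * C0 * real s * real b ^ 3 * (exp (- \<kappa>) * real b / ?m) ^ b" .
    qed
  qed
  have W0: "W 0 \<le> real N * exp (- \<eta>)"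
  proof -
    have "W 0 \<le> (\<Sum>s\<in>{0<..N}. (2 * real s - 1) * P * \<theta> s)"
      unfolding W_def
    proof (rule abel_bound)
      show "Q s \<le> (real s)\<^sup>2 * P" for s
        using Q_le[of s] mult_left_mono[OF P(2), of "(real s)\<^sup>2"] by simp
    qed (use \<theta>pos \<theta>dec in \<open>auto intro: less_imp_le\<close>)
    also have "\<dots> \<le> (\<Sum>s\<in>{0<..N}. exp (- \<eta>))"
    proof (rule sum_mono)
      fix s assume s: "s \<in> {0<..N}"
      have *: "a * P * (E / (2 * m * P)) = a / (2 * m) * E" for a m E :: real
        using P by (simp add: field_simps)
      have "(2 * real s - 1) * P * \<theta> s = (2 * real s - 1) / (2 * real (max s s0)) * exp (- \<eta>)"
        unfolding \<theta>_def by (rule *)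
      also have "\<dots> \<le> 1 * exp (- \<eta>)" using s by (intro mult_right_mono) (auto simp: field_simps)
      finally show "(2 * real s - 1) * P * \<theta> s \<le> exp (- \<eta>)" by simp
    qed
    finally show ?thesis by simp
  qed
  have \<theta>prod: "\<theta> 1 * (\<Prod>s\<in>{0<..N}. 1 / \<theta> s) \<le> (2 * exp \<eta> * P) ^ (N - 1) * (real s0 ^ s0 * fact N)"
  proof -
    let ?A = "2 * exp \<eta> * P"
    have A: "0 < ?A" using P by simp
    have "1 / \<theta> s = ?A * real (max s s0)" for s
      unfolding \<theta>_def using P by (simp add: exp_minus field_simps)
    then have "(\<Prod>s\<in>{0<..N}. 1 / \<theta> s) = (\<Prod>s\<in>{0<..N}. ?A * real (max s s0))" by simp
    also have "\<dots> = ?A ^ N * (\<Prod>s\<in>{0<..N}. real (max s s0))" by (simp add: prod.distrib)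
    also have "(\<Prod>s\<in>{0<..N}. real (max s s0)) = (\<Prod>s=1..N. real (max s s0))"
      by (rule prod.cong) auto
    also have "?A ^ N * (\<Prod>s=1..N. real (max s s0)) \<le> ?A ^ N * (real s0 ^ s0 * fact N)"
      using A by (intro mult_left_mono prod_max_le s0) auto
    finally have 1: "(\<Prod>s\<in>{0<..N}. 1 / \<theta> s) \<le> ?A ^ N * (real s0 ^ s0 * fact N)" .
    have 2: "\<theta> 1 \<le> 1 / ?A"
    proof -
      have "\<theta> 1 = 1 / (?A * real (max 1 s0))" unfolding \<theta>_def using P by (simp add: exp_minus field_simps)
      also have "\<dots> \<le> 1 / (?A * 1)" using A P s0 by (intro divide_left_mono mult_left_mono mult_pos_pos) auto
      finally show ?thesis by simp
    qed
    have "\<theta> 1 * (\<Prod>s\<in>{0<..N}. 1 / \<theta> s) \<le> 1 / ?A * (?A ^ N * (real s0 ^ s0 * fact N))"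
      using A by (intro mult_mono 1 2 prod_nonneg) (auto intro: less_imp_le[OF \<theta>pos])
    also have "?A ^ N = ?A * ?A ^ (N - 1)" using N1 by (simp add: power_eq_if)
    finally show ?thesis using A P by simp
  qed
  have "Pr (\<lambda>w. spanned w S) \<le> (\<Sum>v\<in>S. Pr (\<lambda>w. explored w {} {v} (S - {v})))" by (rule Pr_spanned_explore[OF S(1)])
  also have "\<dots> \<le> (\<Sum>v\<in>S. explore_weight \<theta> \<Gamma> \<rho> N 0 1 (N - 1))"
  proof (rule sum_mono)
    fix v assume v: "v \<in> S"
    then have "card (S - {v}) = N - 1" using finS N_def by simp
    then show "Pr (\<lambda>w. explored w {} {v} (S - {v})) \<le> explore_weight \<theta> \<Gamma> \<rho> N 0 1 (N - 1)" using main[OF v] by simp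
  qed
  also have "\<dots> = (\<theta> 1 * (\<Prod>s\<in>{0<..N}. 1 / \<theta> s)) * (real N * fact (N - 1)) * exp (W 0) * (1 + 2 * \<rho>) ^ N"
    unfolding explore_weight_def \<Gamma>_def N_def by (simp add: mult_ac)
  \<comment> \<open>The number of possible roots completes the factorial.\<close>
  also have "real N * fact (N - 1) = (fact N :: real)" using N1 by (simp add: fact_reduce)
  also have "(\<theta> 1 * (\<Prod>s\<in>{0<..N}. 1 / \<theta> s)) * fact N * exp (W 0) * (1 + 2 * \<rho>) ^ N
     \<le> ((2 * exp \<eta> * P) ^ (N - 1) * (real s0 ^ s0 * fact N)) * fact N * exp (real N * exp (- \<eta>)) * exp (real N * (2 * \<rho>))"
  proof (rule mult_mono[OF mult_mono[OF mult_right_mono[OF \<theta>prod]]])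
    have "(1 + 2 * \<rho>) ^ N \<le> exp (2 * \<rho>) ^ N" using \<xi> \<rho>_def by (intro power_mono exp_ge_add_one_self) auto
    then show "(1 + 2 * \<rho>) ^ N \<le> exp (real N * (2 * \<rho>))" by (simp add: exp_of_nat_mult)
    show "0 \<le> (1 + 2 * \<rho>) ^ N" using \<xi> \<rho>_def by simp
  qed (use W0 P in auto)
  also have "\<dots> = fact N * real s0 ^ s0 * P ^ (N - 1) * ((2 * exp \<eta>) ^ (N - 1) * fact N) * exp (real N * (exp (- \<eta>) + 2 * \<rho>))"
    by (simp add: power_mult_distrib exp_add[symmetric] algebra_simps)
  \<comment> \<open>Stirling is applied to one of the two factorials; the other one is part of
    \<open>sbound\<close>.\<close>
  also have "\<dots> \<le> fact N * real s0 ^ s0 * P ^ (N - 1) * ((2 * exp \<eta>) ^ N * (exp 1 * real N * (real N / exp 1) ^ N)) * exp (real N * (exp (- \<eta>) + 2 * \<rho>))"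
  proof (intro mult_right_mono mult_left_mono mult_mono fact_upper[OF N1] power_increasing)
    have "1 \<le> exp \<eta>" using \<eta>0 by simp
    then show "1 \<le> 2 * exp \<eta>" by linarith
  qed (use P in auto)
  also have "\<dots> = exp 1 * real N * (fact N * real s0 ^ s0 * P ^ (N - 1) * (2 * real N) ^ N * (exp \<eta> ^ N * exp (real N * (exp (- \<eta>) + 2 * \<rho>)) / exp 1 ^ N))"
    by (simp add: power_mult_distrib power_divide mult_ac)
  also have "exp \<eta> ^ N * exp (real N * (exp (- \<eta>) + 2 * \<rho>)) / exp 1 ^ N = exp (real N * (\<eta> - 1 + exp (- \<eta>) + 2 * \<rho>))"
    by (simp add: exp_of_nat_mult[symmetric] exp_add[symmetric] exp_diff[symmetric] algebra_simps)
  also have "exp 1 * real N * (fact N * real s0 ^ s0 * P ^ (N - 1) * (2 * real N) ^ N * exp (real N * (\<eta> - 1 + exp (- \<eta>) + 2 * \<rho>)))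
     \<le> exp 1 * (2 / \<xi> * exp (real N * (\<xi> / 2))) * (fact N * real s0 ^ s0 * P ^ (N - 1) * (2 * real N) ^ N * exp (real N * (\<eta> - 1 + exp (- \<eta>) + 2 * \<rho>)))"
  proof (intro mult_right_mono mult_left_mono)
    have "real N * (\<xi> / 2) \<le> exp (real N * (\<xi> / 2))" using exp_ge_add_one_self[of "real N * (\<xi> / 2)"] by linarith
    then show "real N \<le> 2 / \<xi> * exp (real N * (\<xi> / 2))" using \<xi> by (simp add: field_simps)
  qed (use P in auto)
  also have "\<dots> = sbound (real s0 ^ s0 * exp 1 * (2 / \<xi>)) (\<eta> - 1 + exp (- \<eta>) + \<xi>) P N"
  proof -
    have "exp (real N * (\<xi> / 2)) * exp (real N * (\<eta> - 1 + exp (- \<eta>) + 2 * \<rho>)) = exp (\<eta> - 1 + exp (- \<eta>) + \<xi>) ^ N"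
      unfolding \<rho>_def by (simp add: exp_of_nat_mult[symmetric] exp_add[symmetric] algebra_simps)
    then show ?thesis unfolding sbound_def by (simp add: power_mult_distrib mult_ac)
  qed
  finally show ?thesis unfolding N_def \<eta>_def .
qed

end

section \<open>Uniform bounds and their iteration\<close>

definition spanned_bounded :: "real \<Rightarrow> real \<Rightarrow> bool" where
  "spanned_bounded C \<beta> \<longleftrightarrow> (\<forall>V p P S. two_graphs V p \<longrightarrow> p True * p False \<le> P \<longrightarrow> 0 < P \<longrightarrow> S \<subseteq> V \<longrightarrow> S \<noteq> {} \<longrightarrow>
     pr V p (\<lambda>w. spanned w S) \<le> sbound C \<beta> P (card S))"

lemma spanned_boundedD:
  "spanned_bounded C \<beta> \<Longrightarrow> two_graphs V p \<Longrightarrow> p True * p False \<le> P \<Longrightarrow> 0 < P \<Longrightarrow> S \<subseteq> V \<Longrightarrow> S \<noteq> {} \<Longrightarrow>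
     pr V p (\<lambda>w. spanned w S) \<le> sbound C \<beta> P (card S)"
  unfolding spanned_bounded_def by simp

text \<open>The constant may depend on \<open>N\<close> in any way. It serves for the finitely many
  small sizes in \<open>spanned_bounded_init\<close>.\<close>

definition spanned_crude :: "nat \<Rightarrow> real \<Rightarrow> bool" where
  "spanned_crude N M \<longleftrightarrow> 0 \<le> M \<and> (\<forall>V p P S. two_graphs V p \<longrightarrow> p True * p False \<le> P \<longrightarrow> 0 < P \<longrightarrow> S \<subseteq> V \<longrightarrow>
     card S = N \<longrightarrow> pr V p (\<lambda>w. spanned w S) \<le> M * P ^ (N - 1))"

lemma spanned_crudeD:
  "spanned_crude N M \<Longrightarrow> two_graphs V p \<Longrightarrow> p True * p False \<le> P \<Longrightarrow> 0 < P \<Longrightarrow> S \<subseteq> V \<Longrightarrow> card S = N \<Longrightarrow>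
     pr V p (\<lambda>w. spanned w S) \<le> M * P ^ (N - 1)"
  unfolding spanned_crude_def by simp

text \<open>Splitting at the last merge: there are at most 2^N splits, and with parts of sizes a and
  N - a the powers of \<open>P\<close> add up to (a - 1) + (N - a - 1) + 1.\<close>

lemma spanned_crude_bound:
  assumes "1 \<le> N"
  shows "\<exists>M. spanned_crude N M"
  using assms
proof (induction N rule: less_induct)
  case (less N)
  show ?case
  proof (cases "N = 1")
    case True
    then have "spanned_crude N 1" unfolding spanned_crude_def by (auto intro: two_graphs.Pr_le_1)
    then show ?thesis by blast
  next
    case False
    then have N2: "2 \<le> N" using less by simp
    have "\<forall>a\<in>{1..<N}. \<exists>M. spanned_crude a M" using less by auto
    then obtain f where f': "\<And>a. a \<in> {1..<N} \<Longrightarrow> spanned_crude a (f a)" by metis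
    have f: "a \<in> {1..<N} \<Longrightarrow> 0 \<le> f a" for a using f'[of a] unfolding spanned_crude_def by simp
    define F where "F = (\<Sum>a\<in>{1..<N}. f a)"
    have F: "f a \<le> F" if "a \<in> {1..<N}" for a
      unfolding F_def using that f by (intro member_le_sum) auto
    have F0: "0 \<le> F" unfolding F_def using f by (intro sum_nonneg) auto
    define M where "M = 2 ^ N * (F * F * (real N ^ 4))"
    have M0: "0 \<le> M" unfolding M_def using F0 by simp
    have "pr V p (\<lambda>w. spanned w S) \<le> M * P ^ (N - 1)"
      if g: "two_graphs V p" and P: "p True * p False \<le> P" "0 < P" and S: "S \<subseteq> V" "card S = N" for V p P S
    proof -
      interpret two_graphs V p by (rule g)
      have finS: "finite S" by (rule finite_subset[OF S(1) fin])
      let ?X = "Pow S - {{}, S}"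
      have "Pr (\<lambda>w. spanned w S) \<le> Pr (\<lambda>w. \<exists>A\<in>?X. spanned w A \<and> spanned w (S - A) \<and> djoin w A (S - A))"
      proof (rule Pr_mono)
        fix w assume "spanned w S"
        then obtain A where "A \<subseteq> S" "A \<noteq> {}" "A \<noteq> S" "spanned w A" "spanned w (S - A)" "djoin w A (S - A)"
          using spanned_split[of w S] S N2 by auto
        then show "\<exists>A\<in>?X. spanned w A \<and> spanned w (S - A) \<and> djoin w A (S - A)"
          by (intro bexI[of _ A]) auto
      qed
      also have "\<dots> \<le> (\<Sum>A\<in>?X. Pr (\<lambda>w. spanned w A \<and> spanned w (S - A) \<and> djoin w A (S - A)))"
        using finS by (intro Pr_bex) auto
      also have "\<dots> \<le> (\<Sum>A\<in>?X. F * F * real N ^ 4 * P ^ (N - 1))"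
      proof (rule sum_mono)
        fix A assume A: "A \<in> ?X"
        then have finA: "finite A" using finS finite_subset[of A S] by auto
        have "card A \<noteq> 0" using A finA by auto
        moreover have "card A < N" using A finS S(2) psubset_card_mono[of S A] by auto
        ultimately have cA: "card A \<in> {1..<N}" by auto
        have cB: "card (S - A) = N - card A" using A finA S by (subst card_Diff_subset) auto
        have "Pr (\<lambda>w. spanned w A \<and> spanned w (S - A) \<and> djoin w A (S - A)) =
          Pr (\<lambda>w. spanned w A) * Pr (\<lambda>w. spanned w (S - A) \<and> djoin w A (S - A))"
          by (rule Pr_indep[of _ "{(i, {a, b}) | i a b. a \<in> A \<and> b \<in> A}" _ "touching (S - A)"])
            (auto intro!: depends_conj depends_spanned depends_djoin simp: touching_def)
        also have "Pr (\<lambda>w. spanned w (S - A) \<and> djoin w A (S - A)) = Pr (\<lambda>w. spanned w (S - A)) * Pr (\<lambda>w. djoin w A (S - A))"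
          by (rule Pr_indep[OF _ _ touching_avoiding(2)[of A]])
            (auto intro!: depends_spanned depends_djoin simp: touching_def avoiding_def)
        also have "Pr (\<lambda>w. spanned w A) * (Pr (\<lambda>w. spanned w (S - A)) * Pr (\<lambda>w. djoin w A (S - A))) \<le>
           (F * P ^ (card A - 1)) * ((F * P ^ (N - card A - 1)) * (real N ^ 4 * P))"
        proof (intro mult_mono mult_nonneg_nonneg Pr_nonneg)
          have "Pr (\<lambda>w. spanned w A) \<le> f (card A) * P ^ (card A - 1)"
            using A S(1) by (intro spanned_crudeD[OF f'[OF cA] g P]) auto
          also have "\<dots> \<le> F * P ^ (card A - 1)" using F[OF cA] P by (intro mult_right_mono) auto
          finally show "Pr (\<lambda>w. spanned w A) \<le> F * P ^ (card A - 1)" .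
          have cB': "N - card A \<in> {1..<N}" using cA by auto
          have "Pr (\<lambda>w. spanned w (S - A)) \<le> f (N - card A) * P ^ (N - card A - 1)"
            using S(1) cB by (intro spanned_crudeD[OF f'[OF cB'] g P]) auto
          also have "\<dots> \<le> F * P ^ (N - card A - 1)" using F[OF cB'] P by (intro mult_right_mono) auto
          finally show "Pr (\<lambda>w. spanned w (S - A)) \<le> F * P ^ (N - card A - 1)" .
          have "Pr (\<lambda>w. djoin w A (S - A)) = Q (card A * card (S - A))"
            using A S(1) by (intro Pr_djoin) auto
          also have "\<dots> \<le> (real (card A * card (S - A)))\<^sup>2 * pp" by (rule Q_le)
          also have "\<dots> \<le> (real (N * N))\<^sup>2 * P"
            using cA cB P pp_nonneg unfolding pp_def
            by (intro mult_mono power_mono of_nat_mono mult_le_mono) auto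
          also have "(real (N * N))\<^sup>2 = real N ^ 4" by (simp add: eval_nat_numeral)
          finally show "Pr (\<lambda>w. djoin w A (S - A)) \<le> real N ^ 4 * P" .
        qed (use F0 P in auto)
        also have "\<dots> = F * F * real N ^ 4 * (P ^ (card A - 1) * P ^ (N - card A - 1) * P)" by (simp add: mult_ac)
        also have "P ^ (card A - 1) * P ^ (N - card A - 1) * P = P ^ (N - 1)"
        proof -
          have "N - 1 = Suc ((card A - 1) + (N - card A - 1))" using cA by auto
          then show ?thesis by (simp only: power_Suc2 power_add)
        qed
        finally show "Pr (\<lambda>w. spanned w A \<and> spanned w (S - A) \<and> djoin w A (S - A)) \<le> F * F * real N ^ 4 * P ^ (N - 1)" .
      qed
      also have "\<dots> = real (card ?X) * (F * F * real N ^ 4 * P ^ (N - 1))" by simp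
      also have "\<dots> \<le> 2 ^ N * (F * F * real N ^ 4 * P ^ (N - 1))"
      proof (rule mult_right_mono)
        have "card ?X \<le> card (Pow S)" using finS by (intro card_mono) auto
        also have "\<dots> = 2 ^ N" using finS S by (simp add: card_Pow)
        finally show "real (card ?X) \<le> 2 ^ N" by (metis of_nat_le_iff of_nat_numeral of_nat_power)
      qed (use F0 P in auto)
      finally show ?thesis unfolding M_def by (simp add: mult_ac)
    qed
    then have "spanned_crude N M" using M0 unfolding spanned_crude_def by simp
    then show ?thesis by blast
  qed
qed

text \<open>The order of choices matters: \<open>K\<close>, \<open>s0\<close>, \<open>C1\<close> and
  \<open>N0\<close> do not involve \<open>\<beta>\<close>, so \<open>\<beta>\<close> can be chosen
  last and large enough for the crude bounds below \<open>N0\<close>. From \<open>N0\<close> on, one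
  application with gap 1/2 and error 1/10 lowers the exponent by at least 3/10 per vertex, since
  \<open>exp (- 19/2)\<close> is at most 1/10. This gain absorbs \<open>C1\<close> and closes the
  induction with constant 1.\<close>

lemma spanned_bounded_init: "\<exists>\<beta>\<ge>0. spanned_bounded 1 \<beta>"
proof -
  obtain K where K: "0 < K" "\<And>n. (\<Sum>b=2..n. real b ^ 5 * exp (- (1/2) * real b)) \<le> K"
    using sum_pow5_exp_bounded[of "1/2"] by auto
  define s0 where "s0 = max 1 (nat \<lceil>2 * 1 * K * 40\<rceil>)"
  have s0: "1 \<le> s0" "2 * 1 * K \<le> (1/10) / 4 * real s0" unfolding s0_def by linarith+
  define C1 where "C1 = real s0 ^ s0 * exp 1 * (2 / (1/10))"
  have C1: "0 < C1" unfolding C1_def using s0 by simp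
  obtain N0 :: nat where N0: "ln C1 \<le> 3/10 * real N0" using real_arch_simple[of "ln C1 / (3/10)"] by (auto simp: field_simps)
    have "\<forall>a\<in>{1..<N0}. \<exists>M. spanned_crude a M" using spanned_crude_bound by simp
    then obtain f where f': "\<And>a. a \<in> {1..<N0} \<Longrightarrow> spanned_crude a (f a)" by metis
    have f: "a \<in> {1..<N0} \<Longrightarrow> 0 \<le> f a" for a using f'[of a] unfolding spanned_crude_def by simp
    define F where "F = (\<Sum>a\<in>{1..<N0}. f a)"
  have F: "f a \<le> F" if "a \<in> {1..<N0}" for a
    unfolding F_def using that f by (intro member_le_sum) auto
  define \<beta> where "\<beta> = max 9 F"
  have \<beta>: "9 \<le> \<beta>" "F \<le> \<beta>" unfolding \<beta>_def by auto
  have F\<beta>: "F \<le> exp \<beta>" using \<beta> exp_ge_add_one_self[of \<beta>] by linarith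
  have "pr V p (\<lambda>w. spanned w S) \<le> sbound 1 \<beta> P (card S)"
    if g: "two_graphs V p" and P: "p True * p False \<le> P" "0 < P" and S: "S \<subseteq> V" "S \<noteq> {}" for V p P S
    using S
  proof (induction "card S" arbitrary: S rule: less_induct)
    case less
    interpret two_graphs V p by (rule g)
    have finS: "finite S" by (rule finite_subset[OF less(2) fin])
    have N1: "1 \<le> card S" using finS less(3) by (simp add: Suc_leI card_gt_0_iff)
    show ?case
    proof (cases "card S < N0")
      case True
      then have N: "card S \<in> {1..<N0}" using N1 by simp
      have "Pr (\<lambda>w. spanned w S) \<le> f (card S) * P ^ (card S - 1)" by (rule spanned_crudeD[OF f'[OF N] g P less(2) refl])
      also have "\<dots> \<le> (1 * fact (card S) * (2 * exp \<beta> * real (card S)) ^ card S) * P ^ (card S - 1)"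
      proof (rule mult_right_mono)
        have "f (card S) \<le> exp \<beta>" using F[OF N] F\<beta> by simp
        also have "\<dots> \<le> 2 * exp \<beta> * real (card S)" using N1 by (simp add: mult_ge1_I)
        also have "\<dots> \<le> (2 * exp \<beta> * real (card S)) ^ card S"
        proof -
          have "1 \<le> exp \<beta>" using \<beta> by simp
          then have "1 \<le> 2 * exp \<beta> * real (card S)" using N1 by (smt (verit) mult_le_cancel_left1 of_nat_1 of_nat_le_iff)
          then show ?thesis using N1 power_increasing[of 1 "card S" "2 * exp \<beta> * real (card S)"] by simp
        qed
        also have "\<dots> \<le> 1 * fact (card S) * (2 * exp \<beta> * real (card S)) ^ card S"
        proof -
          have "1 * (2 * exp \<beta> * real (card S)) ^ card S \<le> fact (card S) * (2 * exp \<beta> * real (card S)) ^ card S"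
            by (intro mult_right_mono) auto
          then show ?thesis by (simp only: mult_1_left)
        qed
        finally show "f (card S) \<le> 1 * fact (card S) * (2 * exp \<beta> * real (card S)) ^ card S" .
      qed (use P in auto)
      finally show ?thesis unfolding sbound_def .
    next
      case False
      have "Pr (\<lambda>w. spanned w S) \<le> sbound C1 (\<beta> + 1/2 - 1 + exp (- (\<beta> + 1/2)) + 1/10) P (card S)"
        unfolding C1_def
      proof (rule spanned_recursive_bound[OF less(2,3) P(2)])
        show "pp \<le> P" using P unfolding pp_def by simp
        show "Pr (\<lambda>w. spanned w B) \<le> sbound 1 \<beta> P (card B)" if "B \<subseteq> S" "2 \<le> card B" "card B < card S" for B
          using that less(2) by (intro less(1)) auto
        show "2 * 1 * K \<le> (1/10) / 4 * real s0" "1 \<le> s0" by (rule s0)+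
        show "(\<Sum>b=2..n. real b ^ 5 * exp (- (1/2) * real b)) \<le> K" for n by (rule K)
      qed (use \<beta> in auto)
      also have "\<dots> \<le> sbound C1 (\<beta> - 3/10) P (card S)"
      proof (rule sbound_mono)
        have "exp (19/2) \<ge> (10 :: real)" using exp_ge_add_one_self[of "19/2"] by simp
        then have "exp (- (19/2)) \<le> (1/10 :: real)" by (simp add: exp_minus field_simps)
        moreover have "exp (- (\<beta> + 1/2)) \<le> exp (- (19/2))" using \<beta> by simp
        ultimately show "\<beta> + 1/2 - 1 + exp (- (\<beta> + 1/2)) + 1/10 \<le> \<beta> - 3/10" by linarith
      qed (use C1 P in auto)
      also have "\<dots> = (C1 * exp (real (card S) * (- 3/10))) * sbound 1 \<beta> P (card S)"
      proof -
        have "exp (\<beta> - 3/10) = exp \<beta> * exp (- 3/10)" by (simp add: exp_add[symmetric])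
        then have "(2 * exp (\<beta> - 3/10) * real (card S)) ^ card S = exp (real (card S) * (- 3/10)) * (2 * exp \<beta> * real (card S)) ^ card S"
          unfolding exp_of_nat_mult by (simp add: power_mult_distrib mult_ac)
        then show ?thesis unfolding sbound_def by (simp add: mult_ac)
      qed
      also have "\<dots> \<le> 1 * sbound 1 \<beta> P (card S)"
      proof (rule mult_right_mono)
        have "3/10 * real N0 \<le> 3/10 * real (card S)" using False by simp
        then have "ln C1 + real (card S) * (- 3/10) \<le> 0" using N0 by linarith
        then have "exp (ln C1 + real (card S) * (- 3/10)) \<le> 1" by simp
        then have "exp (ln C1) * exp (real (card S) * (- 3/10)) \<le> 1" by (simp only: exp_add)
        then show "C1 * exp (real (card S) * (- 3/10)) \<le> 1" using C1 by (simp only: exp_ln)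
      qed (use P in \<open>auto intro: sbound_nonneg\<close>)
      finally show ?thesis by simp
    qed
  qed
  then have "spanned_bounded 1 \<beta>" unfolding spanned_bounded_def by simp
  then show ?thesis using \<beta> by (intro exI[of _ \<beta>]) auto
qed

lemma spanned_bounded_mono:
  assumes "spanned_bounded C \<beta>" "0 \<le> C" "C \<le> C'" "\<beta> \<le> \<beta>'"
  shows "spanned_bounded C' \<beta>'"
  unfolding spanned_bounded_def
proof (intro allI impI)
  fix V p P S
  assume "two_graphs V p" "p True * p False \<le> P" "0 < (P :: real)" "S \<subseteq> V" "S \<noteq> {}"
  then have "pr V p (\<lambda>w. spanned w S) \<le> sbound C \<beta> P (card S)" by (rule spanned_boundedD[OF assms(1)])
  also have "\<dots> \<le> sbound C' \<beta>' P (card S)" using \<open>0 < P\<close> by (intro sbound_mono assms) auto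
  finally show "pr V p (\<lambda>w. spanned w S) \<le> sbound C' \<beta>' P (card S)" .
qed

lemma spanned_bounded_step:
  assumes b: "spanned_bounded C \<beta>" "0 \<le> C" "0 \<le> \<beta>" and \<kappa>: "0 < \<kappa>" and \<xi>: "0 < \<xi>" "\<xi> \<le> 1"
  shows "\<exists>C'\<ge>0. spanned_bounded C' (\<beta> + \<kappa> - 1 + exp (- (\<beta> + \<kappa>)) + \<xi>)"
proof -
  obtain K where K: "0 < K" "\<And>n. (\<Sum>b=2..n. real b ^ 5 * exp (- \<kappa> * real b)) \<le> K"
    using sum_pow5_exp_bounded[OF \<kappa>] by auto
  define s0 where "s0 = max 1 (nat \<lceil>2 * C * K * (4 / \<xi>)\<rceil>)"
  have "2 * C * K * (4 / \<xi>) \<le> real s0" unfolding s0_def by linarith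
  then have s0: "1 \<le> s0" "2 * C * K \<le> \<xi> / 4 * real s0" using \<xi> unfolding s0_def by (auto simp: field_simps)
  let ?C' = "real s0 ^ s0 * exp 1 * (2 / \<xi>)"
  have "spanned_bounded ?C' (\<beta> + \<kappa> - 1 + exp (- (\<beta> + \<kappa>)) + \<xi>)"
    unfolding spanned_bounded_def
  proof (intro allI impI)
    fix V p P S
    assume g: "two_graphs V p" and P: "p True * p False \<le> P" "0 < (P :: real)" and S: "S \<subseteq> V" "S \<noteq> {}"
    interpret two_graphs V p by (rule g)
    show "Pr (\<lambda>w. spanned w S) \<le> sbound ?C' (\<beta> + \<kappa> - 1 + exp (- (\<beta> + \<kappa>)) + \<xi>) P (card S)"
    proof (rule spanned_recursive_bound[OF S P(2) _ b(3) \<kappa> b(2) \<xi> K(2) s0])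
      show "pp \<le> P" using P unfolding pp_def by simp
      show "Pr (\<lambda>w. spanned w B) \<le> sbound C \<beta> P (card B)" if "B \<subseteq> S" "2 \<le> card B" "card B < card S" for B
        using that S by (intro spanned_boundedD[OF b(1) g P]) auto
    qed
  qed
  moreover have "0 \<le> ?C'" using \<xi> by simp
  ultimately show ?thesis by blast
qed

text \<open>Up to an arbitrarily small error \<open>spanned_bounded_step\<close> replaces \<open>\<beta>\<close> by \<open>\<beta> - 1 + exp (- \<beta>)\<close>, whose only
  fixed point is \<open>0\<close>; so iterating it drives \<open>\<beta>\<close> to \<open>0\<close>.\<close>

theorem spanned_bounded_ex:
  assumes "0 < \<beta>"
  shows "\<exists>C\<ge>0. spanned_bounded C \<beta>"
proof -
  \<comment> \<open>For every exponent b at least \<open>\<beta>\<close> the drop 1 - exp (- b) is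
    at least \<open>\<tau>\<close>. Spending \<open>\<tau> / 4\<close> each on the gap and on the
    error leaves a drop of \<open>\<tau> / 2\<close> per pass.\<close>
  define \<tau> where "\<tau> = min 1 (1 - exp (- \<beta>))"
  have \<tau>: "0 < \<tau>" "\<tau> \<le> 1" "\<tau> \<le> 1 - exp (- \<beta>)" unfolding \<tau>_def using assms by auto
  obtain \<beta>0 where \<beta>0: "0 \<le> \<beta>0" "spanned_bounded 1 \<beta>0" using spanned_bounded_init by blast
  have "\<exists>C\<ge>0. spanned_bounded C (max \<beta> (\<beta>0 - real m * (\<tau> / 2)))" for m
  proof (induction m)
    case 0
    have "spanned_bounded 1 (max \<beta> (\<beta>0 - real 0 * (\<tau> / 2)))" by (rule spanned_bounded_mono[OF \<beta>0(2)]) auto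
    then show ?case by (intro exI[of _ 1]) auto
  next
    case (Suc m)
    then obtain C where C: "0 \<le> C" "spanned_bounded C (max \<beta> (\<beta>0 - real m * (\<tau> / 2)))" by blast
    let ?b = "max \<beta> (\<beta>0 - real m * (\<tau> / 2))"
    have b: "\<beta> \<le> ?b" by simp
    then have b0: "0 \<le> ?b" using assms by linarith
    have \<tau>4: "0 < \<tau> / 4" "\<tau> / 4 \<le> 1" using \<tau> by auto
    obtain C' where C': "0 \<le> C'" "spanned_bounded C' (?b + \<tau> / 4 - 1 + exp (- (?b + \<tau> / 4)) + \<tau> / 4)"
      using spanned_bounded_step[OF C(2,1) b0 \<tau>4(1) \<tau>4] by (elim exE conjE)
    have "exp (- (?b + \<tau> / 4)) \<le> exp (- \<beta>)" using b \<tau> by simp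
    then have "?b + \<tau> / 4 - 1 + exp (- (?b + \<tau> / 4)) + \<tau> / 4 \<le> ?b - \<tau> / 2" using \<tau> by linarith
    also have "\<dots> \<le> max \<beta> (\<beta>0 - real (Suc m) * (\<tau> / 2))"
    proof -
      have "\<beta>0 - real (Suc m) * (\<tau> / 2) = (\<beta>0 - real m * (\<tau> / 2)) - \<tau> / 2" by (simp add: algebra_simps)
      moreover have "max \<beta> z - \<tau> / 2 \<le> max \<beta> (z - \<tau> / 2)" for z using \<tau> by (simp add: max_def)
      ultimately show ?thesis by (simp only:)
    qed
    finally have "spanned_bounded C' (max \<beta> (\<beta>0 - real (Suc m) * (\<tau> / 2)))"
      by (rule spanned_bounded_mono[OF C'(2,1) order_refl])
    then show ?case using C' by blast
  qed
  moreover obtain m :: nat where "(\<beta>0 - \<beta>) / (\<tau> / 2) \<le> real m" using real_arch_simple by blast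
  then have "\<beta>0 - real m * (\<tau> / 2) \<le> \<beta>" using \<tau> by (simp add: field_simps)
  then have "max \<beta> (\<beta>0 - real m * (\<tau> / 2)) = \<beta>" by simp
  ultimately show ?thesis by metis
qed

section \<open>The subcritical regime\<close>

text \<open>There are \<open>k\<close> factors \<open>1 / \<theta> s\<close>, but the root carries
  one \<open>\<theta> 1\<close>, whence the exponent \<open>k - 1\<close>.\<close>

lemma prod_theta_bound:
  fixes \<theta> :: "nat \<Rightarrow> real"
  assumes A: "0 < A" and s0: "1 \<le> s0" and k: "1 \<le> k" and \<theta>: "\<And>s. \<theta> s = 1 / (A * real (max s s0))"
  shows "\<theta> 1 * (\<Prod>s\<in>{0<..k}. 1 / \<theta> s) \<le> A ^ (k - 1) * (real s0 ^ s0 * fact k)"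
proof -
  have "(\<Prod>s\<in>{0<..k}. 1 / \<theta> s) = (\<Prod>s\<in>{0<..k}. A * real (max s s0))" by (simp add: \<theta>)
  also have "\<dots> = A ^ k * (\<Prod>s\<in>{0<..k}. real (max s s0))" by (simp add: prod.distrib)
  also have "(\<Prod>s\<in>{0<..k}. real (max s s0)) = (\<Prod>s=1..k. real (max s s0))" by (rule prod.cong) auto
  also have "A ^ k * (\<Prod>s=1..k. real (max s s0)) \<le> A ^ k * (real s0 ^ s0 * fact k)"
    using A by (intro mult_left_mono prod_max_le s0) auto
  finally have 1: "(\<Prod>s\<in>{0<..k}. 1 / \<theta> s) \<le> A ^ k * (real s0 ^ s0 * fact k)" .
  have 2: "\<theta> 1 \<le> 1 / A"
  proof -
    have "1 / (A * real (max 1 s0)) \<le> 1 / (A * 1)"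
      using A s0 by (intro divide_left_mono mult_left_mono mult_pos_pos) auto
    then show ?thesis using \<theta>[of 1] by simp
  qed
  have "\<theta> 1 * (\<Prod>s\<in>{0<..k}. 1 / \<theta> s) \<le> 1 / A * (A ^ k * (real s0 ^ s0 * fact k))"
    using A s0 by (intro mult_mono 1 2 prod_nonneg) (auto simp: \<theta>)
  also have "A ^ k = A * A ^ (k - 1)" using k by (simp add: power_eq_if)
  finally show ?thesis using A by simp
qed

lemma sum_odd_real: "(\<Sum>s\<in>{0<..k}. 2 * real s - 1) = (real k)\<^sup>2"
proof (induction k)
  case (Suc k)
  have "{0<..Suc k} = insert (Suc k) {0<..k}" by auto
  then show ?case using Suc by (simp add: power2_eq_square algebra_simps)
qed simp

context two_graphs
begin

text \<open>Up to a logarithmic size nearly all vertices stay undiscovered, so here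
  \<open>\<Gamma>\<close> is a power with one factor \<open>W t\<close> per undiscovered vertex. The
  condition on \<open>k + 1\<close> says that \<open>\<theta>\<close> is at least 1 up to there,
  which also gives \<open>A * real k \<le> 1\<close>: essentially, \<open>k\<close> stays below the
  size at which growth ceases to be subcritical.\<close>

lemma spanned_subcritical_bound:
  fixes C0 \<beta> \<kappa> \<rho> P K :: real and s0 k n :: nat
  assumes n: "card V = n" "1 \<le> n" and P: "0 < P" "pp \<le> P"
    and sb: "spanned_bounded C0 \<beta>" and C0: "0 \<le> C0" and \<beta>: "0 \<le> \<beta>" and \<kappa>: "0 < \<kappa>"
    and \<rho>: "0 < \<rho>" "\<rho> \<le> 1/2"
    and K: "\<And>n. (\<Sum>b=2..n. real b ^ 5 * exp (- \<kappa> * real b)) \<le> K"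
    and s0: "1 \<le> s0" "2 * (2 * C0) * K \<le> \<rho> * real s0"
    and k: "1 \<le> k" "k \<le> n" "s0 \<le> k + 1" "real (k + 1) * (2 * exp (\<beta> + \<kappa>) * (real n * P)) \<le> 1"
    and kP: "real k * ((real k)\<^sup>2 * P) \<le> 1/2"
  shows "Pr (\<lambda>w. spanned w V) \<le> real n * exp 1 * real s0 ^ s0 * (real k)\<^sup>2 *
     exp (- real k * (1 - exp (- (\<beta> + \<kappa>)) + real n * P * real k - 2 * \<rho>))"
proof -
  define \<eta> where "\<eta> = \<beta> + \<kappa>"
  define g where "g = real n * P"
  define A where "A = 2 * exp \<eta> * g"
  define \<theta> where "\<theta> s = 1 / (A * real (max s s0))" for s
  \<comment> \<open>A vertex never discovered contributes \<open>1 - Q k\<close>; one discovered at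
    step \<open>s\<close> contributes the increment of \<open>Q\<close> weighted by
    \<open>\<theta> s\<close>.\<close>
  define W where "W t = 1 - Q k + (\<Sum>s\<in>{t<..k}. (Q s - Q (s - 1)) * \<theta> s)" for t
  define \<Gamma> where "\<Gamma> t r = W t ^ r" for t r :: nat
  have g: "0 < g" unfolding g_def using n P by simp
  have A: "0 < A" unfolding A_def using g by simp
  have Ak: "real (k + 1) * A \<le> 1" using k(4) unfolding A_def \<eta>_def g_def .
  have \<theta>pos: "0 < \<theta> s" for s unfolding \<theta>_def using A s0 by simp
  have \<theta>dec: "\<theta> (Suc s) \<le> \<theta> s" for s
    unfolding \<theta>_def using A s0 by (intro divide_left_mono mult_left_mono mult_pos_pos) auto
  have \<theta>1: "1 \<le> \<theta> s" if "s \<le> Suc k" for s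
  proof -
    have "A * real (max s s0) \<le> A * real (k + 1)" using that k(3) A by (intro mult_left_mono) auto
    also have "\<dots> \<le> 1" using Ak by (simp add: mult.commute)
    finally have "A * real (max s s0) \<le> 1" .
    moreover have "0 < A * real (max s s0)" using A s0 by simp
    ultimately show ?thesis unfolding \<theta>_def by simp
  qed
  have Qk: "Q k \<le> (real k)\<^sup>2 * P" using Q_le[of k] mult_left_mono[OF P(2), of "(real k)\<^sup>2"] by simp
  have Qk2: "real k * Q k \<le> 1/2" using Qk kP mult_left_mono[OF Qk, of "real k"] by simp
  have "1 * Q k \<le> real k * Q k" using k Q_nonneg[of k] by (intro mult_right_mono) auto
  then have Qk1: "Q k \<le> 1/2" using Qk2 by simp
  have q0: "0 \<le> Q s - Q (s - 1)" for s using Q_mono[of "s - 1" s] by simp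
  have W_ge: "1 - Q k \<le> W t" for t
  proof -
    have "0 \<le> (\<Sum>s\<in>{t<..k}. (Q s - Q (s - 1)) * \<theta> s)"
      by (intro sum_nonneg mult_nonneg_nonneg q0 less_imp_le[OF \<theta>pos])
    then show ?thesis unfolding W_def by simp
  qed
  have W_pos: "0 < W t" for t using W_ge[of t] Qk1 by simp
  have W_Suc: "W t = (Q (Suc t) - Q t) * \<theta> (Suc t) + W (Suc t)" if "t < k" for t
  proof -
    have "{t<..k} = insert (Suc t) {Suc t<..k}" using that by auto
    then show ?thesis unfolding W_def by simp
  qed
  \<comment> \<open>A cluster takes at most \<open>k\<close> vertices from the pool, which changes
    the power of \<open>W t\<close> by at most a factor 2. This is the 2 in the weight
    \<open>v\<close>.\<close>
  have W_b: "1/2 \<le> W t ^ b" if "b \<le> k" for t b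
  proof -
    have "1/2 \<le> 1 - real k * Q k" using Qk2 by simp
    also have "\<dots> \<le> 1 - real b * Q k" using that Q_nonneg[of k] by (simp add: mult_right_mono)
    also have "\<dots> \<le> (1 - Q k) ^ b" using Bernoulli_inequality[of "- Q k" b] Qk1 by simp
    also have "\<dots> \<le> W t ^ b" using W_ge Qk1 by (intro power_mono) auto
    finally show ?thesis .
  qed
  have finV: "finite V" by (rule fin)
  have main: "Pr (\<lambda>w. explored w {} {v} (V - {} - {v})) \<le> explore_weight \<theta> \<Gamma> \<rho> k (card ({} :: nat set)) (card {v}) (card (V - {} - {v}))"
    if v: "v \<in> V" for v
  proof (rule explore_bound[where v = "\<lambda>b. 2 * real n ^ b / fact b" and \<beta> = "sbound C0 \<beta> P"])
    show "V \<subseteq> V" "card V = n" "1 \<le> k" "k \<le> n" using n k by auto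
    show "0 < \<theta> s" "\<theta> (Suc s) \<le> \<theta> s" for s by (fact \<theta>pos \<theta>dec)+
    show "0 \<le> \<Gamma> t r" for t r unfolding \<Gamma>_def using W_pos[of t] by simp
    show "0 \<le> \<rho>" "\<rho> \<le> 1/2" using \<rho> by auto
    show "0 \<le> 2 * real n ^ b / (fact b :: real)" for b by simp
    show "0 \<le> sbound C0 \<beta> P b" for b using C0 P by (intro sbound_nonneg) auto
    show "{} \<subseteq> V" "{v} \<subseteq> V - {}" "card ({} :: nat set) \<le> k" using v by auto
    show "Pr (\<lambda>w. spanned w B) \<le> sbound C0 \<beta> P (card B)" if "B \<subseteq> V" "2 \<le> card B" for B
    proof (rule spanned_boundedD[OF sb two_graphs_axioms _ P(1) that(1)])
      show "p True * p False \<le> P" using P(2) unfolding pp_def by simp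
    qed (use that in auto)
    show "(1 - Q k) ^ r \<le> \<theta> (Suc k) ^ u * \<Gamma> k r" for u r
    proof -
      have "1 \<le> \<theta> (Suc k) ^ u" using \<theta>1[of "Suc k"] by (intro one_le_power) auto
      then have "1 * \<Gamma> k r \<le> \<theta> (Suc k) ^ u * \<Gamma> k r"
        by (rule mult_right_mono) (use W_pos[of k] in \<open>auto simp: \<Gamma>_def\<close>)
      then show ?thesis unfolding \<Gamma>_def W_def by simp
    qed
    \<comment> \<open>An equality, by the binomial theorem.\<close>
    show "(\<Sum>d\<le>r. real (r choose d) * ((Q (Suc t) - Q t) * \<theta> (Suc t)) ^ d * \<Gamma> (Suc t) (r - d)) \<le> \<Gamma> t r" if "t < k" for t r
      unfolding \<Gamma>_def W_Suc[OF that] binomial_ring by simp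
    show "real (r choose b) * \<Gamma> t (r - b) \<le> 2 * real n ^ b / fact b * \<Gamma> t r"
      if "t \<le> k" "b \<le> t" "b \<le> r" "r \<le> n" for t r b
    proof -
      have "real (r choose b) * fact b \<le> real r ^ b"
        using binomial_fact_pow[of r b] by (metis of_nat_fact of_nat_le_iff of_nat_mult of_nat_power)
      also have "\<dots> \<le> real n ^ b" using that by (intro power_mono) auto
      finally have c: "real (r choose b) \<le> real n ^ b / fact b" by (simp add: field_simps)
      have "W t ^ r = W t ^ b * W t ^ (r - b)" using that by (simp add: power_add[symmetric])
      moreover have "1/2 * W t ^ (r - b) \<le> W t ^ b * W t ^ (r - b)"
        using W_b[of b t] that W_pos[of t] by (intro mult_right_mono) auto
      ultimately have w: "W t ^ (r - b) \<le> 2 * W t ^ r" by simp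
      have "real (r choose b) * W t ^ (r - b) \<le> real n ^ b / fact b * (2 * W t ^ r)"
        using c w W_pos[of t] by (intro mult_mono) auto
      then show ?thesis unfolding \<Gamma>_def by (simp add: mult_ac)
    qed
    show "(\<Sum>b=2..s. sbound C0 \<beta> P b * jbound s b * (2 * real n ^ b / fact b) * \<theta> s ^ b) \<le> \<rho>" if s: "1 \<le> s" for s
    proof (rule cluster_weight_bound[OF K s0 _ s])
      show "0 \<le> 2 * C0" using C0 by simp
      fix b assume b: "2 \<le> b" "b \<le> s"
      let ?m = "real (max s s0)"
      have m: "0 < ?m" using s by simp
      have "sbound C0 \<beta> P b * jbound s b * (2 * real n ^ b / fact b) * \<theta> s ^ b =
        2 * (2 * C0) * real s * real b ^ 3 * (2 * exp \<beta> * real b * \<theta> s * real n) ^ b * (P ^ (b - 1) * pp)"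
        unfolding sbound_def jbound_def by (simp add: power_mult_distrib mult_ac)
      also have "\<dots> \<le> 2 * (2 * C0) * real s * real b ^ 3 * (2 * exp \<beta> * real b * \<theta> s * real n) ^ b * (P ^ (b - 1) * P)"
        using P C0 \<theta>pos[of s] by (intro mult_left_mono) auto
      also have "P ^ (b - 1) * P = P ^ b" using b by (metis Suc_diff_1 less_le_trans pos2 power_Suc2)
      also have "2 * (2 * C0) * real s * real b ^ 3 * (2 * exp \<beta> * real b * \<theta> s * real n) ^ b * P ^ b =
         2 * (2 * C0) * real s * real b ^ 3 * (2 * exp \<beta> * real b * \<theta> s * g) ^ b"
        unfolding g_def by (simp add: power_mult_distrib mult_ac)
      also have "2 * exp \<beta> * real b * \<theta> s * g = exp (- \<kappa>) * real b / ?m"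
      proof -
        have "exp \<beta> / exp \<eta> = exp (- \<kappa>)" unfolding \<eta>_def by (simp add: exp_diff[symmetric])
        moreover have "2 * exp \<beta> * real b * \<theta> s * g = (exp \<beta> / exp \<eta>) * real b / ?m"
          unfolding \<theta>_def A_def using g m by (simp add: field_simps)
        ultimately show ?thesis by simp
      qed
      finally show "sbound C0 \<beta> P b * jbound s b * (2 * real n ^ b / fact b) * \<theta> s ^ b \<le>
         2 * (2 * C0) * real s * real b ^ 3 * (exp (- \<kappa>) * real b / ?m) ^ b" .
    qed
  qed
  define E where "E = (\<Sum>s\<in>{0<..k}. (2 * real s - 1) * P * \<theta> s)"
  have E1: "E * real n \<le> real k * exp (- \<eta>)"
  proof -
    have "E * real n = (\<Sum>s\<in>{0<..k}. (2 * real s - 1) * g * \<theta> s)"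
      unfolding E_def g_def sum_distrib_right by (simp add: mult_ac)
    also have "\<dots> \<le> (\<Sum>s\<in>{0<..k}. exp (- \<eta>))"
    proof (rule sum_mono)
      fix s assume s: "s \<in> {0<..k}"
      have *: "a * g * (1 / (2 * e * g * m)) = a / (2 * m) * (1 / e)" for a e m :: real
        using g by (simp add: field_simps)
      have "(2 * real s - 1) * g * \<theta> s = (2 * real s - 1) / (2 * real (max s s0)) * (1 / exp \<eta>)"
        unfolding \<theta>_def A_def by (rule *)
      also have "\<dots> \<le> 1 * (1 / exp \<eta>)" using s by (intro mult_right_mono) (auto simp: field_simps)
      finally show "(2 * real s - 1) * g * \<theta> s \<le> exp (- \<eta>)" by (simp add: exp_minus field_simps)
    qed
    finally show ?thesis by simp
  qed
  have W0: "W 0 \<le> 1 + E - (real k)\<^sup>2 * P"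
  proof -
    \<comment> \<open>Summation by parts is applied to \<open>\<theta> s - 1\<close>, so that not
      attaching up to size \<open>k\<close> yields the gain - k^2 P.\<close>
    have *: "(\<Sum>s\<in>{0<..k}. (Q s - Q (s - 1)) * (\<theta> s - 1)) \<le> (\<Sum>s\<in>{0<..k}. (2 * real s - 1) * P * (\<theta> s - 1))"
    proof -
      \<comment> \<open>Beyond \<open>k\<close> the difference may be negative, so it is cut off
        there.\<close>
      define \<theta>' where "\<theta>' s = (if s \<le> k then \<theta> s - 1 else 0)" for s
      have "(\<Sum>s\<in>{0<..k}. (Q s - Q (s - 1)) * \<theta>' s) \<le> (\<Sum>s\<in>{0<..k}. (2 * real s - 1) * P * \<theta>' s)"
      proof (rule abel_bound)
        show "0 \<le> \<theta>' s" for s unfolding \<theta>'_def using \<theta>1[of s] by auto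
        show "\<theta>' (Suc s) \<le> \<theta>' s" for s unfolding \<theta>'_def using \<theta>1[of s] \<theta>dec[of s] by auto
        show "Q s \<le> (real s)\<^sup>2 * P" for s
          using Q_le[of s] mult_left_mono[OF P(2), of "(real s)\<^sup>2"] by simp
      qed simp
      then show ?thesis unfolding \<theta>'_def by simp
    qed
    have tel: "(\<Sum>s\<in>{0<..m}. Q s - Q (s - 1)) = Q m" for m
    proof (induction m)
      case (Suc m)
      have "{0<..Suc m} = insert (Suc m) {0<..m}" by auto
      then show ?case using Suc by simp
    qed simp
    have "W 0 = 1 + (\<Sum>s\<in>{0<..k}. (Q s - Q (s - 1)) * (\<theta> s - 1))"
    proof -
      have "(\<Sum>s\<in>{0<..k}. (Q s - Q (s - 1)) * \<theta> s) =
          (\<Sum>s\<in>{0<..k}. (Q s - Q (s - 1)) * (\<theta> s - 1)) + (\<Sum>s\<in>{0<..k}. Q s - Q (s - 1))"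
        unfolding sum.distrib[symmetric] by (rule sum.cong) (auto simp: algebra_simps)
      then show ?thesis unfolding W_def using tel[of k] by simp
    qed
    also have "\<dots> \<le> 1 + (\<Sum>s\<in>{0<..k}. (2 * real s - 1) * P * (\<theta> s - 1))" using * by simp
    also have "(\<Sum>s\<in>{0<..k}. (2 * real s - 1) * P * (\<theta> s - 1)) = E - (\<Sum>s\<in>{0<..k}. 2 * real s - 1) * P"
      unfolding E_def sum_distrib_right sum_subtractf[symmetric]
      by (rule sum.cong) (auto simp: algebra_simps)
    finally show ?thesis unfolding sum_odd_real by simp
  qed
  have W0n: "W 0 ^ (n - 1) \<le> exp (real k * exp (- \<eta>) - g * (real k)\<^sup>2)"
  proof -
    let ?x = "E - (real k)\<^sup>2 * P"
    \<comment> \<open>This makes the exponent nonnegative, so that its multiple \<open>n - 1\<close>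
      may be enlarged to \<open>n\<close>.\<close>
    have "1 \<le> W 0"
    proof -
      have tel: "(\<Sum>s\<in>{0<..m}. Q s - Q (s - 1)) = Q m" for m
      proof (induction m)
        case (Suc m)
        have "{0<..Suc m} = insert (Suc m) {0<..m}" by auto
        then show ?case using Suc by simp
      qed simp
      have "Q k = (\<Sum>s\<in>{0<..k}. (Q s - Q (s - 1)) * 1)" using tel by simp
      also have "\<dots> \<le> (\<Sum>s\<in>{0<..k}. (Q s - Q (s - 1)) * \<theta> s)"
        using \<theta>1 q0 by (intro sum_mono mult_left_mono) auto
      finally show ?thesis unfolding W_def by simp
    qed
    then have x0: "0 \<le> ?x" using W0 by simp
    have "W 0 \<le> exp ?x" using W0 exp_ge_add_one_self[of ?x] by linarith
    then have "W 0 ^ (n - 1) \<le> exp ?x ^ (n - 1)"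
      using W_pos[of 0] by (intro power_mono) auto
    also have "\<dots> = exp (real (n - 1) * ?x)" by (simp add: exp_of_nat_mult)
    also have "\<dots> \<le> exp (real n * ?x)" using x0 by (simp add: mult_right_mono)
    also have "\<dots> \<le> exp (real k * exp (- \<eta>) - g * (real k)\<^sup>2)"
      using E1 unfolding g_def by (simp add: algebra_simps)
    finally show ?thesis .
  qed
  have "Pr (\<lambda>w. spanned w V) \<le> (\<Sum>v\<in>V. Pr (\<lambda>w. explored w {} {v} (V - {v})))" by (rule Pr_spanned_explore) simp
  also have "\<dots> \<le> (\<Sum>v\<in>V. explore_weight \<theta> \<Gamma> \<rho> k 0 1 (n - 1))"
  proof (rule sum_mono)
    fix v assume v: "v \<in> V"
    then have "card (V - {v}) = n - 1" using finV n by simp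
    then show "Pr (\<lambda>w. explored w {} {v} (V - {v})) \<le> explore_weight \<theta> \<Gamma> \<rho> k 0 1 (n - 1)" using main[OF v] by simp
  qed
  also have "\<dots> = real n * (\<theta> 1 * (\<Prod>s\<in>{0<..k}. 1 / \<theta> s) * W 0 ^ (n - 1) * (1 + 2 * \<rho>) ^ k)"
    unfolding explore_weight_def \<Gamma>_def using n by simp
  also have "\<dots> \<le> real n * (A ^ (k - 1) * (real s0 ^ s0 * (exp 1 * real k * (real k / exp 1) ^ k))
      * exp (real k * exp (- \<eta>) - g * (real k)\<^sup>2) * exp (real k * (2 * \<rho>)))"
  proof (rule mult_left_mono[OF mult_mono[OF mult_mono]])
    have "\<theta> 1 * (\<Prod>s\<in>{0<..k}. 1 / \<theta> s) \<le> A ^ (k - 1) * (real s0 ^ s0 * fact k)"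
      by (rule prod_theta_bound[OF A s0(1) k(1) \<theta>_def])
    also have "\<dots> \<le> A ^ (k - 1) * (real s0 ^ s0 * (exp 1 * real k * (real k / exp 1) ^ k))"
      using A fact_upper[OF k(1)] by (intro mult_left_mono) auto
    finally show "\<theta> 1 * (\<Prod>s\<in>{0<..k}. 1 / \<theta> s) \<le> A ^ (k - 1) * (real s0 ^ s0 * (exp 1 * real k * (real k / exp 1) ^ k))" .
    have "(1 + 2 * \<rho>) ^ k \<le> exp (2 * \<rho>) ^ k" using \<rho> by (intro power_mono exp_ge_add_one_self) auto
    then show "(1 + 2 * \<rho>) ^ k \<le> exp (real k * (2 * \<rho>))" by (simp add: exp_of_nat_mult)
  qed (use W0n W_pos[of 0] A \<rho> in auto)
  also have "\<dots> = real n * exp 1 * real s0 ^ s0 * real k * (A ^ (k - 1) * real k ^ k) *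
      (1 / exp 1 ^ k * exp (real k * exp (- \<eta>) - g * (real k)\<^sup>2) * exp (real k * (2 * \<rho>)))"
    by (simp add: power_divide mult_ac)
  also have "A ^ (k - 1) * real k ^ k = (A * real k) ^ (k - 1) * real k"
    using power_minus_mult[of k "real k"] k(1) by (simp add: power_mult_distrib mult_ac)
  also have "1 / exp 1 ^ k * exp (real k * exp (- \<eta>) - g * (real k)\<^sup>2) * exp (real k * (2 * \<rho>)) =
     exp (- real k * (1 - exp (- \<eta>) + g * real k - 2 * \<rho>))"
  proof -
    have "1 / exp 1 ^ k = exp (- real k)" using exp_of_nat_mult[of k "1 :: real"] by (simp add: exp_minus field_simps)
    then show ?thesis by (simp add: exp_add[symmetric] algebra_simps power2_eq_square)
  qed
  also have "real n * exp 1 * real s0 ^ s0 * real k * ((A * real k) ^ (k - 1) * real k) * exp (- real k * (1 - exp (- \<eta>) + g * real k - 2 * \<rho>))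
    \<le> real n * exp 1 * real s0 ^ s0 * real k * (1 * real k) * exp (- real k * (1 - exp (- \<eta>) + g * real k - 2 * \<rho>))"
  proof (intro mult_right_mono mult_left_mono power_le_one)
    show "A * real k \<le> 1" using Ak A by (simp add: algebra_simps)
  qed (use A in auto)
  finally show ?thesis unfolding \<eta>_def g_def by (simp add: power2_eq_square mult_ac)
qed

end

text \<open>Here n P = c / ln n, and k is about a ln n, the largest size allowed in
  \<open>spanned_subcritical_bound\<close>. There n P k is about x / 2, so each of the k explored
  vertices contributes exp (- D) with D close to 1/2. As a is close to 1 / (2 c), which exceeds 2,
  the product a D exceeds 1 and beats the factor n.\<close>

theorem subcritical_not_spanned:
  fixes \<epsilon> :: real
  assumes \<epsilon>: "0 < \<epsilon>" "\<epsilon> < 1"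
  shows "\<exists>f :: nat \<Rightarrow> real. f \<longlonglongrightarrow> 0 \<and> (\<forall>\<^sub>F n in sequentially. \<forall>p. two_graphs {1..n} p \<longrightarrow>
    p True * p False \<le> (1 - \<epsilon>) / (4 * real n * ln (real n)) \<longrightarrow> pr {1..n} p (\<lambda>w. spanned w {1..n}) \<le> f n)"
proof -
  define \<eta> where "\<eta> = \<epsilon> / 8"
  define \<rho> where "\<rho> = \<epsilon> / 32"
  define c where "c = (1 - \<epsilon>) / 4"
  define x where "x = exp (- \<eta>)"
  define a where "a = x / (2 * c)"
  define D where "D = 1 - x / 2 - 2 * \<rho>"
  have c: "0 < c" unfolding c_def using \<epsilon> by simp
  have x: "1 - \<eta> \<le> x" "x < 1" "0 < x" unfolding x_def \<eta>_def using \<epsilon> exp_ge_add_one_self[of "- (\<epsilon> / 8)"] by auto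
  have a: "0 < a" unfolding a_def using x c by simp
  have D: "1/2 - 2 * \<rho> \<le> D" "0 < D" unfolding D_def \<rho>_def using x \<epsilon> by auto
  have aD: "1 + \<epsilon> / 2 \<le> a * D"
  proof -
    have "(1 + \<epsilon> / 2) * (1 - \<epsilon>) \<le> 1 - \<epsilon> / 4" using \<epsilon> by (simp add: algebra_simps)
    also have "\<dots> \<le> (1 - \<epsilon> / 8) * (1 - \<epsilon> / 8)" by (simp add: algebra_simps)
    also have "\<dots> \<le> x * (2 * D)" using x D \<epsilon> unfolding \<eta>_def \<rho>_def by (intro mult_mono) auto
    finally show ?thesis unfolding a_def c_def using \<epsilon> by (simp add: field_simps)
  qed
  obtain C0 where C0: "0 \<le> C0" "spanned_bounded C0 (\<eta> / 2)" using spanned_bounded_ex[of "\<eta> / 2"] \<epsilon> unfolding \<eta>_def by auto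
  obtain K where K: "0 < K" "\<And>n. (\<Sum>b=2..n. real b ^ 5 * exp (- (\<eta> / 2) * real b)) \<le> K"
    using sum_pow5_exp_bounded[of "\<eta> / 2"] \<epsilon> unfolding \<eta>_def by auto
  define s0 where "s0 = max 1 (nat \<lceil>2 * (2 * C0) * K / \<rho>\<rceil>)"
  have \<rho>: "0 < \<rho>" "\<rho> \<le> 1/2" unfolding \<rho>_def using \<epsilon> by auto
  have "2 * (2 * C0) * K / \<rho> \<le> real s0" unfolding s0_def by linarith
  then have s0: "1 \<le> s0" "2 * (2 * C0) * K \<le> \<rho> * real s0" using \<rho> unfolding s0_def by (auto simp: field_simps)
  \<comment> \<open>The last factor pays for rounding: \<open>k\<close> may fall short of a ln n by
    up to 2.\<close>
  define M where "M = exp 1 * real s0 ^ s0 * a\<^sup>2 * exp (2 * a * c + 2 * D)"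
  define f where "f n = M * (ln (real n))\<^sup>2 * exp (- (\<epsilon> / 2) * ln (real n))" for n :: nat
  have "f \<longlonglongrightarrow> 0"
    unfolding f_def using \<epsilon> by real_asymp
  moreover have "\<forall>\<^sub>F n in sequentially. \<forall>p. two_graphs {1..n} p \<longrightarrow>
    p True * p False \<le> (1 - \<epsilon>) / (4 * real n * ln (real n)) \<longrightarrow> pr {1..n} p (\<lambda>w. spanned w {1..n}) \<le> f n"
  proof -
    have e1: "\<forall>\<^sub>F n :: nat in sequentially. real s0 + 4 \<le> a * ln (real n)" using a by real_asymp
    have e2: "\<forall>\<^sub>F n :: nat in sequentially. 2 * c / ln (real n) \<le> D" using D c by real_asymp
    have e3: "\<forall>\<^sub>F n :: nat in sequentially. a * ln (real n) \<le> real n" using a by real_asymp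
    have e4: "\<forall>\<^sub>F n :: nat in sequentially. (a * ln (real n)) * ((a * ln (real n))\<^sup>2 * (c / (real n * ln (real n)))) \<le> 1/2"
      using a c by real_asymp
    have e5: "\<forall>\<^sub>F n :: nat in sequentially. 3 \<le> n" by (rule eventually_ge_at_top)
    show ?thesis using e1 e2 e3 e4 e5
    proof eventually_elim
      case (elim n)
      define L where "L = ln (real n)"
      define P where "P = c / (real n * L)"
      \<comment> \<open>The subtraction leaves room for
        \<open>real k + 1 \<le> a * L\<close>.\<close>
      define k where "k = nat \<lfloor>a * L\<rfloor> - 1"
      have L: "0 < L" unfolding L_def using elim(5) by simp
      have aL: "real s0 + 4 \<le> a * L" using elim(1) unfolding L_def .
      have k: "a * L - 2 \<le> real k" "real k + 1 \<le> a * L" "1 \<le> k" "s0 \<le> k + 1" unfolding k_def using aL by linarith+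
      have P: "0 < P" unfolding P_def using c L elim(5) by simp
      have nP: "real n * P = c / L" unfolding P_def using elim(5) by simp
      show ?case
      proof (intro allI impI)
        fix p assume g: "two_graphs {1..n} p" and pp: "p True * p False \<le> (1 - \<epsilon>) / (4 * real n * ln (real n))"
        interpret two_graphs "{1..n}" p by (rule g)
        have "pp \<le> P" unfolding P_def c_def L_def pp_def using pp by (simp add: mult_ac)
        have "Pr (\<lambda>w. spanned w {1..n}) \<le> real n * exp 1 * real s0 ^ s0 * (real k)\<^sup>2 *
           exp (- real k * (1 - exp (- (\<eta> / 2 + \<eta> / 2)) + real n * P * real k - 2 * \<rho>))"
        proof (rule spanned_subcritical_bound[OF _ _ P \<open>pp \<le> P\<close> C0(2,1) _ _ \<rho> K(2) s0 k(3) _ k(4)])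
          have "real k \<le> real n" using k(2) elim(3) unfolding L_def by linarith
          then show "k \<le> n" by simp
          have "real (k + 1) * (2 * exp (\<eta> / 2 + \<eta> / 2) * (real n * P)) = real (k + 1) / (a * L)"
            unfolding nP a_def x_def using L c by (simp add: exp_minus field_simps)
          also have "\<dots> \<le> 1" using k(2) a L by simp
          finally show "real (k + 1) * (2 * exp (\<eta> / 2 + \<eta> / 2) * (real n * P)) \<le> 1" .
          have "real k * ((real k)\<^sup>2 * P) \<le> (a * L) * ((a * L)\<^sup>2 * P)"
            using k a L P by (intro mult_mono power_mono) auto
          also have "\<dots> \<le> 1/2" using elim(4) unfolding L_def P_def by simp
          finally show "real k * ((real k)\<^sup>2 * P) \<le> 1/2" .
        qed (use elim(5) \<epsilon> in \<open>auto simp: \<eta>_def\<close>)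
        also have "\<dots> \<le> real n * exp 1 * real s0 ^ s0 * (a * L)\<^sup>2 * exp (- (1 + \<epsilon> / 2) * L + (2 * a * c + 2 * D))"
        proof (intro mult_mono mult_left_mono)
          show "(real k)\<^sup>2 \<le> (a * L)\<^sup>2" using k by (intro power_mono) auto
          have gk: "x / 2 - 2 * c / L \<le> real n * P * real k"
          proof -
            have "c / L * (a * L - 2) \<le> c / L * real k" using k(1) c L by (intro mult_left_mono) auto
            moreover have "c / L * (a * L - 2) = x / 2 - 2 * c / L" unfolding a_def using c L by (simp add: field_simps)
            ultimately show ?thesis unfolding nP by simp
          qed
          then have br: "D - 2 * c / L \<le> 1 - exp (- (\<eta> / 2 + \<eta> / 2)) + real n * P * real k - 2 * \<rho>"
            unfolding D_def x_def by simp
          have "(a * L - 2) * (D - 2 * c / L) \<le> real k * (1 - exp (- (\<eta> / 2 + \<eta> / 2)) + real n * P * real k - 2 * \<rho>)"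
            using k(1) br aL elim(2) unfolding L_def[symmetric] by (intro mult_mono) auto
          moreover have "(a * L - 2) * (D - 2 * c / L) = (a * D) * L - 2 * a * c - 2 * D + 4 * c / L"
            using L by (simp add: field_simps)
          moreover have "(1 + \<epsilon> / 2) * L \<le> (a * D) * L" using aD L by (intro mult_right_mono) auto
          moreover have "0 \<le> 4 * c / L" using c L by simp
          ultimately have "- (real k * (1 - exp (- (\<eta> / 2 + \<eta> / 2)) + real n * P * real k - 2 * \<rho>)) \<le>
              - ((1 + \<epsilon> / 2) * L) + (2 * a * c + 2 * D)" by linarith
          then have "- real k * (1 - exp (- (\<eta> / 2 + \<eta> / 2)) + real n * P * real k - 2 * \<rho>) \<le>
              - (1 + \<epsilon> / 2) * L + (2 * a * c + 2 * D)" by (simp only: mult_minus_left)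
          then show "exp (- real k * (1 - exp (- (\<eta> / 2 + \<eta> / 2)) + real n * P * real k - 2 * \<rho>)) \<le>
              exp (- (1 + \<epsilon> / 2) * L + (2 * a * c + 2 * D))" by (simp only: exp_le_cancel_iff)
        qed auto
        also have "\<dots> = f n"
        proof -
          have "exp (- (1 + \<epsilon> / 2) * L + (2 * a * c + 2 * D)) = exp (- L) * exp (- (\<epsilon> / 2) * L) * exp (2 * a * c + 2 * D)"
            by (simp add: exp_add[symmetric] algebra_simps)
          moreover have "real n * exp (- L) = 1" unfolding L_def using elim(5) by (simp add: exp_minus)
          ultimately have "real n * exp (- (1 + \<epsilon> / 2) * L + (2 * a * c + 2 * D)) = exp (- (\<epsilon> / 2) * L) * exp (2 * a * c + 2 * D)"
            by (simp add: mult.assoc[symmetric])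
          moreover have "real n * exp 1 * s * q * Y = exp 1 * s * q * (real n * Y)" for s q Y :: real by simp
          ultimately have "real n * exp 1 * real s0 ^ s0 * (a * L)\<^sup>2 * exp (- (1 + \<epsilon> / 2) * L + (2 * a * c + 2 * D)) =
             exp 1 * real s0 ^ s0 * (a * L)\<^sup>2 * (exp (- (\<epsilon> / 2) * L) * exp (2 * a * c + 2 * D))"
            by (simp only:)
          then show ?thesis unfolding f_def M_def L_def[symmetric] by (simp add: power_mult_distrib mult_ac)
        qed
        finally show "Pr (\<lambda>w. spanned w {1..n}) \<le> f n" .
      qed
    qed
  qed
  ultimately show ?thesis by blast
qed

section \<open>Trials producing a spanned set of logarithmic size\<close>

text \<open>A choice made from the vertex set alone, so it reveals nothing about the edges.\<close>

definition pick :: "nat \<Rightarrow> nat set \<Rightarrow> nat set" where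
  "pick l U = (SOME X. X \<subseteq> U \<and> card X = l)"

lemma pick:
  assumes "l \<le> card U"
  shows "pick l U \<subseteq> U" "card (pick l U) = l"
proof -
  have "\<exists>X. X \<subseteq> U \<and> card X = l" using obtain_subset_with_card_n[OF assms] by metis
  then have "pick l U \<subseteq> U \<and> card (pick l U) = l" unfolding pick_def by (rule someI_ex)
  then show "pick l U \<subseteq> U" "card (pick l U) = l" by auto
qed

definition attset :: "world \<Rightarrow> nat set \<Rightarrow> nat set \<Rightarrow> nat set" where
  "attset w R T = {v \<in> R. djoin w {v} T}"

text \<open>A list entry \<open>(l, d)\<close> stands for a round that explores \<open>l\<close> vertices and discovers exactly \<open>d\<close>
  new ones.\<close>

fun run :: "(nat \<times> nat) list \<Rightarrow> world \<Rightarrow> nat set \<Rightarrow> nat set \<Rightarrow> nat set \<Rightarrow> bool" where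
  "run [] w T U R \<longleftrightarrow> True"
| "run ((l, d) # xs) w T U R \<longleftrightarrow> card (attset w R (T \<union> pick l U)) = d \<and>
     run xs w (T \<union> pick l U) (U - pick l U \<union> attset w R (T \<union> pick l U)) (R - attset w R (T \<union> pick l U))"

text \<open>\<open>u\<close> counts active vertices; the prescribed discoveries must keep enough of
  them for every round.\<close>

fun run_ok :: "(nat \<times> nat) list \<Rightarrow> nat \<Rightarrow> bool" where
  "run_ok [] u \<longleftrightarrow> True"
| "run_ok ((l, d) # xs) u \<longleftrightarrow> l \<le> u \<and> run_ok xs (u - l + d)"

text \<open>The exact probability of a run, see \<open>Pr_run\<close>. The last factor says that no
  undiscovered vertex attaches to the explored set.\<close>

fun run_val :: "(nat \<Rightarrow> real) \<Rightarrow> (nat \<times> nat) list \<Rightarrow> nat \<Rightarrow> nat \<Rightarrow> real" where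
  "run_val Q [] t r = (1 - Q t) ^ r"
| "run_val Q ((l, d) # xs) t r = real (r choose d) * (Q (t + l) - Q t) ^ d * run_val Q xs (t + l) (r - d)"

definition nobig :: "nat \<Rightarrow> nat set \<Rightarrow> world \<Rightarrow> bool" where
  "nobig a W w \<longleftrightarrow> (\<forall>B\<subseteq>W. spanned w B \<longrightarrow> card B < a)"

lemma nobig_mono: "nobig a W w \<Longrightarrow> W' \<subseteq> W \<Longrightarrow> nobig a W' w"
  unfolding nobig_def by (meson subset_trans)

lemma depends_nobig: "W \<inter> T = {} \<Longrightarrow> depends (nobig a W) (avoiding T)"
  unfolding nobig_def
  by (intro depends_subsets depends_imp depends_const depends_spanned) (auto simp: avoiding_def)

lemma attset_subset: "attset w R T \<subseteq> R"
  unfolding attset_def by auto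

lemma attset_cong:
  assumes "\<And>i. i \<in> touching R \<Longrightarrow> w i = w' i"
  shows "attset w R T = attset w' R T"
proof -
  have "djoin w {v} T = djoin w' {v} T" if "v \<in> R" for v
    using that by (intro dependsD[OF depends_djoin[of "{v}" T "touching R"]] assms) (auto simp: touching_def)
  then show ?thesis unfolding attset_def by auto
qed

lemma depends_run: "depends (\<lambda>w. run xs w T U R) (touching R)"
proof (induction xs arbitrary: T U R)
  case Nil then show ?case by (simp add: depends_const)
next
  case (Cons x xs)
  obtain l d where x: "x = (l, d)" by (cases x)
  show ?case
  proof (rule dependsI)
    fix w w' :: world assume ag: "\<And>i. i \<in> touching R \<Longrightarrow> w i = w' i"
    let ?T = "T \<union> pick l U" and ?D = "attset w R (T \<union> pick l U)"
    have D: "attset w' R ?T = ?D" using attset_cong[OF ag] by simp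
    have "run xs w ?T (U - pick l U \<union> ?D) (R - ?D) = run xs w' ?T (U - pick l U \<union> ?D) (R - ?D)"
      by (rule dependsD[OF Cons]) (use ag in \<open>auto simp: touching_def\<close>)
    then show "run (x # xs) w T U R = run (x # xs) w' T U R" unfolding x by (simp add: D)
  qed
qed

lemma attset_unique:
  "newatt w T T1 D \<Longrightarrow> noatt w T1 (R - D) \<Longrightarrow> D \<subseteq> R \<Longrightarrow> attset w R T1 = D"
  unfolding newatt_def noatt_def attset_def by auto

lemma attset_props:
  assumes "noatt w T R"
  shows "newatt w T T1 (attset w R T1)" "noatt w T1 (R - attset w R T1)" "attset w R T1 \<subseteq> R"
  using assms unfolding newatt_def noatt_def attset_def by auto

lemma noatt_combine:
  "newatt w T T1 D \<Longrightarrow> noatt w T1 (R - D) \<Longrightarrow> T \<subseteq> T1 \<Longrightarrow> noatt w T R"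
  unfolding newatt_def noatt_def by (metis DiffI djoin_mono order_refl)

lemma run_spanned:
  assumes "run xs w T U R" "run_ok xs (card U)" "spanned w (T \<union> U)" "finite U" "finite R"
    "T \<inter> U = {}" "T \<inter> R = {}" "U \<inter> R = {}"
  shows "\<exists>B. spanned w B \<and> B \<subseteq> T \<union> U \<union> R \<and> card B = card (T \<union> U) + sum_list (map snd xs)"
  using assms
proof (induction xs arbitrary: T U R)
  case Nil then show ?case by (intro exI[of _ "T \<union> U"]) auto
next
  case (Cons x xs)
  obtain l d where x: "x = (l, d)" by (cases x)
  let ?X = "pick l U" let ?T = "T \<union> ?X"
  let ?D = "attset w R ?T"
  have ok: "l \<le> card U" "run_ok xs (card U - l + d)" using Cons.prems x by auto
  note X = pick[OF ok(1)]
  have D: "?D \<subseteq> R" "card ?D = d" using Cons.prems(1) x attset_subset by simp_all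
  have finD: "finite ?D" by (rule finite_subset[OF D(1) Cons.prems(5)])
  have finX: "finite ?X" by (rule finite_subset[OF X(1) Cons.prems(4)])
  have eq: "?T \<union> (U - ?X \<union> ?D) = (T \<union> U) \<union> ?D" using X(1) by auto
  have sp: "spanned w (?T \<union> (U - ?X \<union> ?D))"
    unfolding eq
  proof (rule spanned_attach[OF finD Cons.prems(3)])
    fix v assume "v \<in> ?D"
    then have "djoin w {v} ?T" unfolding attset_def by simp
    then show "djoin w {v} (T \<union> U)" by (rule djoin_mono) (use X(1) in auto)
  qed
  have cU: "card (U - ?X \<union> ?D) = card U - l + d"
  proof -
    have "(U - ?X) \<inter> ?D = {}" using D(1) Cons.prems(8) by auto
    then show ?thesis using Cons.prems(4) finD finX X D by (simp add: card_Un_disjoint card_Diff_subset)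
  qed
  have "\<exists>B. spanned w B \<and> B \<subseteq> ?T \<union> (U - ?X \<union> ?D) \<union> (R - ?D) \<and>
     card B = card (?T \<union> (U - ?X \<union> ?D)) + sum_list (map snd xs)"
  proof (rule Cons.IH)
    show "run xs w ?T (U - ?X \<union> ?D) (R - ?D)" using Cons.prems(1) x by simp
    show "run_ok xs (card (U - ?X \<union> ?D))" using ok cU by simp
    show "finite (U - ?X \<union> ?D)" "finite (R - ?D)" using Cons.prems finD by auto
    show "?T \<inter> (U - ?X \<union> ?D) = {}" "?T \<inter> (R - ?D) = {}" "(U - ?X \<union> ?D) \<inter> (R - ?D) = {}"
      using Cons.prems(6,7,8) X(1) D(1) by auto
  qed (rule sp)
  then obtain B where B: "spanned w B" "B \<subseteq> ?T \<union> (U - ?X \<union> ?D) \<union> (R - ?D)"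
     "card B = card (?T \<union> (U - ?X \<union> ?D)) + sum_list (map snd xs)" by auto
  have fTU: "finite (T \<union> U)" by (rule spanned_finite[OF Cons.prems(3)])
  have "(T \<union> U) \<inter> ?D = {}" using D(1) Cons.prems(7,8) by auto
  then have "card (?T \<union> (U - ?X \<union> ?D)) = card (T \<union> U) + d"
    unfolding eq using fTU finD D(2) by (simp add: card_Un_disjoint)
  then have "card B = card (T \<union> U) + sum_list (map snd (x # xs))" using B(3) x by simp
  moreover have "B \<subseteq> T \<union> U \<union> R" using B(2) X(1) D(1) by auto
  ultimately show ?case using B(1) by blast
qed

context two_graphs
begin

text \<open>The conjunct \<open>noatt w T R\<close> records that the vertices of \<open>R\<close>
  have failed to attach so far. Given this, the discovered set \<open>D\<close> determines a
  decomposition into \<open>newatt\<close> and the remaining run, which use disjoint pairs, and the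
  probability is exact.\<close>

lemma Pr_run:
  assumes "run_ok xs (card U)" "T \<subseteq> V" "U \<subseteq> V" "R \<subseteq> V" "T \<inter> U = {}" "T \<inter> R = {}" "U \<inter> R = {}"
  shows "Pr (\<lambda>w. noatt w T R \<and> run xs w T U R) = run_val Q xs (card T) (card R)"
  using assms
proof (induction xs arbitrary: T U R)
  case Nil
  then have "R \<subseteq> V - T" by auto
  then show ?case using Pr_noatt[of R T] Nil by simp
next
  case (Cons x xs)
  obtain l d where x: "x = (l, d)" by (cases x)
  let ?X = "pick l U" let ?T = "T \<union> ?X"
  have ok: "l \<le> card U" "run_ok xs (card U - l + d)" using Cons.prems x by auto
  note X = pick[OF ok(1)]
  note finU = finite_subset[OF Cons.prems(3) fin] and finR = finite_subset[OF Cons.prems(4) fin]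
    and finT = finite_subset[OF Cons.prems(2) fin]
  have finX: "finite ?X" by (rule finite_subset[OF X(1) finU])
  have TX: "T \<inter> ?X = {}" using Cons.prems(5) X(1) by auto
  have cT: "card ?T = card T + l" using finT finX TX X(2) by (simp add: card_Un_disjoint)
  have TV: "?T \<subseteq> V" using Cons.prems X(1) by auto
  have RT: "R \<inter> ?T = {}" using Cons.prems X(1) by auto
  let ?S = "{D. D \<subseteq> R \<and> card D = d}"
  have finS: "finite ?S" using finR by (intro finite_subset[of ?S "Pow R"]) auto
  let ?A = "\<lambda>D w. newatt w T ?T D \<and> (noatt w ?T (R - D) \<and> run xs w ?T (U - ?X \<union> D) (R - D))"
  have "(\<lambda>w. noatt w T R \<and> run (x # xs) w T U R) = (\<lambda>w. \<exists>D\<in>?S. ?A D w)"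
  proof (rule ext, rule iffI)
    fix w assume a: "noatt w T R \<and> run (x # xs) w T U R"
    show "\<exists>D\<in>?S. ?A D w"
      by (rule bexI[of _ "attset w R ?T"]) (use a x attset_props[of w T R ?T] in auto)
  next
    fix w assume "\<exists>D\<in>?S. ?A D w"
    then obtain D where D: "D \<subseteq> R" "card D = d" "?A D w" by auto
    then have "attset w R ?T = D" using attset_unique[of w T ?T D R] by simp
    then show "noatt w T R \<and> run (x # xs) w T U R"
      using D x noatt_combine[of w T ?T D R] by auto
  qed
  then have "Pr (\<lambda>w. noatt w T R \<and> run (x # xs) w T U R) = Pr (\<lambda>w. \<exists>D\<in>?S. ?A D w)" by (rule arg_cong)
  also have "\<dots> = (\<Sum>D\<in>?S. Pr (?A D))"
  proof (rule Pr_bex_disjoint[OF finS])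
    fix D D' w assume "D \<in> ?S" "D' \<in> ?S" "?A D w" "?A D' w"
    then show "D = D'" using attset_unique[of w T ?T D R] attset_unique[of w T ?T D' R] by auto
  qed
  also have "\<dots> = (\<Sum>D\<in>?S. (Q (card T + l) - Q (card T)) ^ d * run_val Q xs (card T + l) (card R - d))"
  proof (rule sum.cong[OF refl])
    fix D assume "D \<in> ?S"
    then have D: "D \<subseteq> R" "card D = d" by auto
    have finD: "finite D" by (rule finite_subset[OF D(1) finR])
    have "(U - ?X) \<inter> D = {}" using D(1) Cons.prems by auto
    then have cU: "card (U - ?X \<union> D) = card U - l + d"
      using finU finD finX X D by (simp add: card_Un_disjoint card_Diff_subset)
    have "Pr (?A D) = Pr (\<lambda>w. newatt w T ?T D) * Pr (\<lambda>w. noatt w ?T (R - D) \<and> run xs w ?T (U - ?X \<union> D) (R - D))"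
    proof (rule Pr_indep[OF _ _ touching_avoiding(2)])
      show "depends (\<lambda>w. newatt w T ?T D) (avoiding (R - D))"
        using RT by (intro depends_newatt) (auto simp: avoiding_def)
      show "depends (\<lambda>w. noatt w ?T (R - D) \<and> run xs w ?T (U - ?X \<union> D) (R - D)) (touching (R - D))"
        by (intro depends_conj depends_run depends_noatt) (auto simp: touching_def)
    qed
    also have "Pr (\<lambda>w. newatt w T ?T D) = (Q (card ?T) - Q (card T)) ^ card D"
      using D(1) RT TV Cons.prems(4) by (intro Pr_newatt) auto
    also have "Pr (\<lambda>w. noatt w ?T (R - D) \<and> run xs w ?T (U - ?X \<union> D) (R - D)) = run_val Q xs (card ?T) (card (R - D))"
    proof (rule Cons.IH)
      show "run_ok xs (card (U - ?X \<union> D))" using ok cU by simp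
      show "?T \<subseteq> V" by (rule TV)
      show "U - ?X \<union> D \<subseteq> V" "R - D \<subseteq> V" using Cons.prems D by auto
      show "?T \<inter> (U - ?X \<union> D) = {}" "?T \<inter> (R - D) = {}" "(U - ?X \<union> D) \<inter> (R - D) = {}"
        using Cons.prems(5,6,7) X(1) D(1) by auto
    qed
    finally show "Pr (?A D) = (Q (card T + l) - Q (card T)) ^ d * run_val Q xs (card T + l) (card R - d)"
      using D finD by (simp add: cT card_Diff_subset)
  qed
  also have "\<dots> = real (card R choose d) * ((Q (card T + l) - Q (card T)) ^ d * run_val Q xs (card T + l) (card R - d))"
    using n_subsets[OF finR, of d] by simp
  finally show ?case unfolding x by (simp add: mult.assoc)
qed

text \<open>The first round with a wrong number of discoveries stops the trial; in that round the
  factor \<open>\<pi>\<close> splits off by independence, and before it the induction applies. The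
  bound \<open>\<pi>\<close> is assumed for all sets missing at most as many vertices as the whole
  run explores. \<open>X\<close> holds the vertices kept out of the trial.\<close>

lemma Pr_run_fails:
  assumes "run_ok xs (card U)" "T \<subseteq> V" "U \<subseteq> V" "R \<subseteq> V" "T \<inter> U = {}" "T \<inter> R = {}" "U \<inter> R = {}"
    and "X \<subseteq> V" "X \<inter> T = {}" "X \<inter> U = {}" "X \<inter> R = {}" and \<pi>: "0 \<le> \<pi>"
    and "\<And>W. W \<subseteq> U \<union> R \<union> X \<Longrightarrow> card (U \<union> R \<union> X) - sum_list (map fst xs) \<le> card W \<Longrightarrow> Pr (nobig a W) \<le> \<pi>"
  shows "Pr (\<lambda>w. noatt w T R \<and> \<not> run xs w T U R \<and> nobig a (U \<union> R \<union> X) w) \<le>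
    ((1 - Q (card T)) ^ card R - run_val Q xs (card T) (card R)) * \<pi>"
  using assms(1-11,13)
proof (induction xs arbitrary: T U R)
  case Nil then show ?case by (simp add: pr_def)
next
  case (Cons x xs)
  obtain l d where x: "x = (l, d)" by (cases x)
  let ?X = "pick l U" let ?T = "T \<union> ?X"
  have ok: "l \<le> card U" "run_ok xs (card U - l + d)" using Cons.prems x by auto
  note X = pick[OF ok(1)]
  note finU = finite_subset[OF Cons.prems(3) fin] and finR = finite_subset[OF Cons.prems(4) fin]
    and finT = finite_subset[OF Cons.prems(2) fin] and finXX = finite_subset[OF Cons.prems(8) fin]
  have finX: "finite ?X" by (rule finite_subset[OF X(1) finU])
  have TX: "T \<inter> ?X = {}" using Cons.prems(5) X(1) by auto
  have cT: "card ?T = card T + l" using finT finX TX X(2) by (simp add: card_Un_disjoint)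
  have TV: "?T \<subseteq> V" using Cons.prems X(1) by auto
  have RT: "R \<inter> ?T = {}" using Cons.prems X(1) by auto
  let ?U = "U - ?X" and ?t = "card T + l"
  let ?q = "Q ?t - Q (card T)"
  let ?W = "?U \<union> R \<union> X"
  have WT: "?W \<inter> ?T = {}" using Cons.prems X(1) by auto
  have WU: "?W \<subseteq> U \<union> R \<union> X" by auto
  have cW: "card ?W = card (U \<union> R \<union> X) - l"
  proof -
    have "?W = (U \<union> R \<union> X) - ?X" using X(1) Cons.prems(7,10) by auto
    moreover have "?X \<subseteq> U \<union> R \<union> X" using X(1) by auto
    ultimately show ?thesis using card_Diff_subset[OF finX, of "U \<union> R \<union> X"] X(2) by simp
  qed
  let ?E = "\<lambda>D w. noatt w ?T (R - D) \<and> (card D = d \<longrightarrow> \<not> run xs w ?T (?U \<union> D) (R - D)) \<and> nobig a ?W w"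
  let ?g = "\<lambda>b. ?q ^ b * (((1 - Q ?t) ^ (card R - b) - (if b = d then run_val Q xs ?t (card R - d) else 0)) * \<pi>)"
  have "Pr (\<lambda>w. noatt w T R \<and> \<not> run (x # xs) w T U R \<and> nobig a (U \<union> R \<union> X) w) \<le>
     Pr (\<lambda>w. \<exists>D\<in>Pow R. newatt w T ?T D \<and> ?E D w)"
  proof (rule Pr_mono)
    fix w assume a: "noatt w T R \<and> \<not> run (x # xs) w T U R \<and> nobig a (U \<union> R \<union> X) w"
    let ?D = "attset w R ?T"
    have "nobig a ?W w" using a nobig_mono[OF _ WU] by auto
    then show "\<exists>D\<in>Pow R. newatt w T ?T D \<and> ?E D w"
      using a x attset_props[of w T R ?T] by (intro bexI[of _ ?D]) auto
  qed
  also have "\<dots> \<le> (\<Sum>D\<in>Pow R. Pr (\<lambda>w. newatt w T ?T D \<and> ?E D w))"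
    using finR by (intro Pr_bex) auto
  also have "\<dots> \<le> (\<Sum>D\<in>Pow R. ?g (card D))"
  proof (rule sum_mono)
    fix D assume "D \<in> Pow R"
    then have D: "D \<subseteq> R" by auto
    have finD: "finite D" by (rule finite_subset[OF D(1) finR])
    have cR: "card (R - D) = card R - card D" using finD D by (simp add: card_Diff_subset)
    have q0: "0 \<le> ?q" using Q_mono[of "card T" ?t] by simp
    have "Pr (\<lambda>w. newatt w T ?T D \<and> ?E D w) = Pr (\<lambda>w. newatt w T ?T D) * Pr (?E D)"
    proof (rule Pr_indep)
      show "depends (\<lambda>w. newatt w T ?T D) (avoiding (R - D) \<inter> touching ?T)"
        using RT by (intro depends_newatt) (auto simp: avoiding_def touching_def)
      have "depends (\<lambda>w. noatt w ?T (R - D)) (touching (R - D) \<union> avoiding ?T)"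
        by (intro depends_noatt) (auto simp: touching_def)
      moreover have "depends (\<lambda>w. card D = d \<longrightarrow> \<not> run xs w ?T (?U \<union> D) (R - D)) (touching (R - D) \<union> avoiding ?T)"
        by (intro depends_imp depends_const depends_not depends_mono[OF depends_run]) auto
      moreover have "depends (nobig a ?W) (touching (R - D) \<union> avoiding ?T)"
        by (rule depends_mono[OF depends_nobig[OF WT]]) auto
      ultimately show "depends (?E D) (touching (R - D) \<union> avoiding ?T)" by (intro depends_conj)
      show "avoiding (R - D) \<inter> touching ?T \<inter> (touching (R - D) \<union> avoiding ?T) = {}"
        by (auto simp: avoiding_def touching_def)
    qed
    also have "Pr (\<lambda>w. newatt w T ?T D) = ?q ^ card D"
      using D(1) RT TV Cons.prems(4) cT by (subst Pr_newatt) auto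
    also have "?q ^ card D * Pr (?E D) \<le> ?g (card D)"
    proof (rule mult_left_mono)
      show "Pr (?E D) \<le> ((1 - Q ?t) ^ (card R - card D) - (if card D = d then run_val Q xs ?t (card R - d) else 0)) * \<pi>"
      proof (cases "card D = d")
        case False
        have "Pr (?E D) = Pr (\<lambda>w. noatt w ?T (R - D) \<and> nobig a ?W w)" using False by simp
        also have "\<dots> = Pr (\<lambda>w. noatt w ?T (R - D)) * Pr (nobig a ?W)"
          by (rule Pr_indep[OF _ depends_nobig[OF WT] touching_avoiding(1)], rule depends_noatt) (auto simp: touching_def)
        also have "Pr (\<lambda>w. noatt w ?T (R - D)) = (1 - Q (card ?T)) ^ card (R - D)"
          using RT TV Cons.prems(4) by (intro Pr_noatt) auto
        also have "\<dots> * Pr (nobig a ?W) \<le> (1 - Q (card ?T)) ^ card (R - D) * \<pi>"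
        proof (rule mult_left_mono)
          show "Pr (nobig a ?W) \<le> \<pi>"
            by (rule Cons.prems(12)[OF WU]) (simp add: cW x)
        qed (use Q_le_1 in auto)
        finally show ?thesis using False by (simp add: cT cR)
      next
        case True
        have "(U - ?X) \<inter> D = {}" using D(1) Cons.prems by auto
        then have cU: "card (?U \<union> D) = card U - l + d"
          using finU finD finX X D True by (simp add: card_Un_disjoint card_Diff_subset)
        have Weq: "?U \<union> D \<union> (R - D) \<union> X = ?W" using D by auto
        have "Pr (\<lambda>w. noatt w ?T (R - D) \<and> \<not> run xs w ?T (?U \<union> D) (R - D) \<and> nobig a (?U \<union> D \<union> (R - D) \<union> X) w) \<le>
          ((1 - Q (card ?T)) ^ card (R - D) - run_val Q xs (card ?T) (card (R - D))) * \<pi>"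
        proof (rule Cons.IH)
          show "run_ok xs (card (?U \<union> D))" using ok cU by simp
          show "?T \<subseteq> V" by (rule TV)
          show "?U \<union> D \<subseteq> V" "R - D \<subseteq> V" "X \<subseteq> V" using Cons.prems D by auto
          show "?T \<inter> (?U \<union> D) = {}" "?T \<inter> (R - D) = {}" "(?U \<union> D) \<inter> (R - D) = {}"
            using Cons.prems(5,6,7) X(1) D(1) by auto
          show "X \<inter> ?T = {}" "X \<inter> (?U \<union> D) = {}" "X \<inter> (R - D) = {}"
            using Cons.prems(9,10,11) X(1) D(1) by auto
          show "Pr (nobig a W) \<le> \<pi>" if "W \<subseteq> ?U \<union> D \<union> (R - D) \<union> X" "card (?U \<union> D \<union> (R - D) \<union> X) - sum_list (map fst xs) \<le> card W" for W
          proof (rule Cons.prems(12))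
            show "W \<subseteq> U \<union> R \<union> X" using that(1) D by auto
            show "card (U \<union> R \<union> X) - sum_list (map fst (x # xs)) \<le> card W"
              using that(2) unfolding Weq cW x by simp
          qed
        qed
        then show ?thesis using True unfolding Weq by (simp add: cT cR)
      qed
    qed (use q0 in auto)
    finally show "Pr (\<lambda>w. newatt w T ?T D \<and> ?E D w) \<le> ?g (card D)" .
  qed
  also have "\<dots> = (\<Sum>b\<le>card R. real (card R choose b) * ?g b)" by (rule sum_Pow_card[OF finR])
  also have "\<dots> = (\<Sum>b\<le>card R. \<pi> * (real (card R choose b) * ?q ^ b * (1 - Q ?t) ^ (card R - b)))
      - (\<Sum>b\<le>card R. if b = d then \<pi> * (real (card R choose d) * ?q ^ d * run_val Q xs ?t (card R - d)) else 0)"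
    unfolding sum_subtractf[symmetric] by (rule sum.cong) (auto simp: algebra_simps)
  \<comment> \<open>Over all discovery numbers the weights add up to the probability that nothing in
    \<open>R\<close> attaches to \<open>T\<close>.\<close>
  also have "(\<Sum>b\<le>card R. \<pi> * (real (card R choose b) * ?q ^ b * (1 - Q ?t) ^ (card R - b))) = \<pi> * (?q + (1 - Q ?t)) ^ card R"
    unfolding binomial_ring sum_distrib_left by (simp add: mult_ac)
  also have "(\<Sum>b\<le>card R. if b = d then \<pi> * (real (card R choose d) * ?q ^ d * run_val Q xs ?t (card R - d)) else 0)
      = \<pi> * (real (card R choose d) * ?q ^ d * run_val Q xs ?t (card R - d))"
    by (cases "d \<le> card R") auto
  finally show ?case unfolding x by (simp add: algebra_simps)
qed

text \<open>A failed trial has revealed only edges meeting the vertices it explored, so the next trial runs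
  on a fresh pool.\<close>

lemma Pr_nobig_trials:
  assumes ok: "run_ok xs 1" and a: "a \<le> 1 + sum_list (map snd xs)" and n': "1 \<le> n'"
  shows "W \<subseteq> V \<Longrightarrow> n' + m * sum_list (map fst xs) \<le> card W \<Longrightarrow> Pr (nobig a W) \<le> (1 - run_val Q xs 0 (n' - 1)) ^ m"
proof (induction m arbitrary: W)
  case 0 then show ?case by (simp add: Pr_le_1)
next
  case (Suc m)
  let ?s = "run_val Q xs 0 (n' - 1)"
  have "n' \<le> card W" using Suc.prems by simp
  then obtain W0 where W0: "W0 \<subseteq> W" "card W0 = n'" using obtain_subset_with_card_n by metis
  then obtain v where v: "v \<in> W0" using n' by fastforce
  have finW: "finite W" by (rule finite_subset[OF Suc.prems(1) fin])
  have finW0: "finite W0" by (rule finite_subset[OF W0(1) finW])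
  \<comment> \<open>\<open>W0\<close> is the pool of this trial and \<open>v\<close> its root;
    \<open>X\<close> waits outside.\<close>
  define R where "R = W0 - {v}"
  define X where "X = W - W0"
  have cR: "card R = n' - 1" unfolding R_def using v W0 finW0 by simp
  have Weq: "{v} \<union> R \<union> X = W" unfolding R_def X_def using v W0 by auto
  have vV: "{} \<subseteq> V" "{v} \<subseteq> V" "R \<subseteq> V" "X \<subseteq> V" using Suc.prems W0 v unfolding R_def X_def by auto
  have dj: "{} \<inter> {v} = {}" "{} \<inter> R = {}" "{v} \<inter> R = {}" "X \<inter> {} = {}" "X \<inter> {v} = {}" "X \<inter> R = {}"
    using v W0 unfolding R_def X_def by auto
  have ok': "run_ok xs (card {v})" using ok by simp
  have s: "Pr (\<lambda>w. noatt w {} R \<and> run xs w {} {v} R) = ?s"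
    using Pr_run[OF ok' vV(1,2,3) dj(1,2,3)] cR by simp
  have s1: "?s \<le> 1" unfolding s[symmetric] by (rule Pr_le_1)
  have "Pr (nobig a W) \<le> Pr (\<lambda>w. noatt w {} R \<and> \<not> run xs w {} {v} R \<and> nobig a ({v} \<union> R \<union> X) w)"
  proof (rule Pr_mono)
    fix w assume nb: "nobig a W w"
    have "\<not> run xs w {} {v} R"
    proof
      assume r: "run xs w {} {v} R"
      have sv: "spanned w ({} \<union> {v})" by (simp add: spanned.single)
      have fR: "finite {v}" "finite R" using finW0 R_def by auto
      obtain B where B: "spanned w B" "B \<subseteq> {} \<union> {v} \<union> R" "card B = card ({} \<union> {v}) + sum_list (map snd xs)"
        using run_spanned[OF r ok' sv fR dj(1,2,3)] by blast
      have "card B < a" using nb B(1,2) Weq unfolding nobig_def by blast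
      then show False using B(3) a by simp
    qed
    then show "noatt w {} R \<and> \<not> run xs w {} {v} R \<and> nobig a ({v} \<union> R \<union> X) w"
      using nb Weq unfolding noatt_def by simp
  qed
  also have "\<dots> \<le> ((1 - Q (card ({} :: nat set))) ^ card R - run_val Q xs (card ({} :: nat set)) (card R)) * (1 - ?s) ^ m"
  proof (rule Pr_run_fails[OF ok' vV(1,2,3) dj(1,2,3) vV(4) dj(4,5,6)])
    show "0 \<le> (1 - ?s) ^ m" using s1 by simp
    fix W' assume W': "W' \<subseteq> {v} \<union> R \<union> X" "card ({v} \<union> R \<union> X) - sum_list (map fst xs) \<le> card W'"
    show "Pr (nobig a W') \<le> (1 - ?s) ^ m"
      by (rule Suc.IH) (use W' Suc.prems Weq in auto)
  qed
  also have "\<dots> = (1 - ?s) ^ Suc m" using cR by simp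
  finally show ?case .
qed

end

section \<open>Lower bounds for binomial and Poisson weights\<close>

lemma binomial_fact_lower:
  assumes "d \<le> r"
  shows "real (r - d) ^ d \<le> real (r choose d) * fact d"
proof -
  have "real (r - D) ^ d \<le> real (r choose d) * fact d" if "d \<le> D" "D \<le> r" for d D
    using that
  proof (induction d)
    case 0 then show ?case by simp
  next
    case (Suc d)
    have "Suc d * (r choose Suc d) = (r - d) * (r choose d)"
      by (metis binomial_absorb_comp binomial_absorption)
    then have eq: "real (Suc d) * real (r choose Suc d) = real (r - d) * real (r choose d)"
      by (metis of_nat_mult)
    have "real (r - D) ^ Suc d = real (r - D) * real (r - D) ^ d" by simp
    also have "\<dots> \<le> real (r - d) * (real (r choose d) * fact d)"
      using Suc by (intro mult_mono Suc.IH) auto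
    also have "\<dots> = (real (Suc d) * real (r choose Suc d)) * fact d" unfolding eq by simp
    also have "\<dots> = real (r choose Suc d) * fact (Suc d)" by (simp add: mult_ac)
    finally show ?case .
  qed
  from this[of d d] assms show ?thesis by simp
qed

lemma fact_lower: "(real m / exp 1) ^ m \<le> fact m"
proof -
  have "real m ^ m \<le> fact m * exp (real m)" by (rule power_le_fact_exp) simp
  also have "exp (real m) = exp 1 ^ m" using exp_of_nat_mult[of m "1 :: real"] by simp
  finally show ?thesis by (simp add: power_divide field_simps)
qed

text \<open>Against the product of the even numbers, 2^m m!, the product of the odd numbers loses at
  most a factor 2 m.\<close>

lemma prod_odd_lower:
  assumes "1 \<le> m"
  shows "(2 * real m / exp 1) ^ m / (2 * real m) \<le> (\<Prod>j<m. 2 * real j + 1)"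
proof -
  have "2 ^ m * fact m / (2 * real m) \<le> (\<Prod>j<m. 2 * real j + 1)"
    using assms
  proof (induction m rule: nat_induct_at_least)
    case base then show ?case by simp
  next
    case (Suc m)
    have "2 ^ Suc m * fact (Suc m) / (2 * real (Suc m)) = 2 ^ m * fact m" by (simp add: field_simps)
    also have "\<dots> \<le> (2 ^ m * fact m / (2 * real m)) * (2 * real m + 1)"
      using Suc by (simp add: field_simps)
    also have "\<dots> \<le> (\<Prod>j<m. 2 * real j + 1) * (2 * real m + 1)" using Suc by (intro mult_right_mono) auto
    finally show ?case by simp
  qed
  moreover have "(2 * real m / exp 1) ^ m / (2 * real m) \<le> 2 ^ m * fact m / (2 * real m)"
  proof (rule divide_right_mono)
    have "(2 * real m / exp 1) ^ m = 2 ^ m * (real m / exp 1) ^ m" by (simp add: power_mult_distrib power_divide)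
    also have "\<dots> \<le> 2 ^ m * fact m" by (intro mult_left_mono fact_lower) auto
    finally show "(2 * real m / exp 1) ^ m \<le> 2 ^ m * fact m" .
  qed simp
  ultimately show ?thesis by linarith
qed

lemma ln_ge_one_minus_inverse: "0 < x \<Longrightarrow> 1 - 1 / x \<le> ln (x :: real)"
  using ln_le_minus_one[of "1 / x"] by (simp add: ln_div)

text \<open>The weight is unnormalised: the missing factor exp (- \<mu>) is supplied, for all rounds
  together, by the last factor of \<open>run_val\<close>.\<close>

lemma poisson_weight_lower:
  fixes \<mu> :: real
  assumes "0 < \<mu>" "1 \<le> d"
  shows "exp (real d * ln (\<mu> / real d) + real d) / (exp 1 * real d) \<le> \<mu> ^ d / fact d"
proof -
  have d: "0 < real d" using assms by simp
  have "exp (real d * ln (\<mu> / real d) + real d) = exp (ln (\<mu> / real d)) ^ d * exp 1 ^ d"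
    using exp_of_nat_mult[of d "ln (\<mu> / real d)"] exp_of_nat_mult[of d "1 :: real"] by (simp add: exp_add)
  also have "exp (ln (\<mu> / real d)) = \<mu> / real d" using assms d by simp
  finally have e: "exp (real d * ln (\<mu> / real d) + real d) / (exp 1 * real d) = \<mu> ^ d / (exp 1 * real d * (real d / exp 1) ^ d)"
    using d by (simp add: power_divide field_simps)
  show ?thesis unfolding e
    using assms fact_upper[OF assms(2)] by (intro divide_left_mono mult_pos_pos) (auto)
qed

text \<open>For an integer within 1 above the mean, the exponent d ln (\<mu> / d) + d is at least
  \<mu> - 2, by ln x \<ge> 1 - 1 / x.\<close>

lemma poisson_weight_mode:
  fixes \<mu> D :: real
  assumes \<mu>: "1/2 \<le> \<mu>" and d: "1 \<le> d" "\<mu> \<le> real d" "real d \<le> \<mu> + 1" and D: "real d \<le> D"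
  shows "exp \<mu> / (exp 3 * D) \<le> \<mu> ^ d / fact d"
proof -
  have d0: "0 < real d" using d by simp
  have "(real d - \<mu>)\<^sup>2 \<le> 1 * (2 * \<mu>)" 
  proof -
    have "(real d - \<mu>)\<^sup>2 \<le> 1\<^sup>2" using d by (intro power_mono) auto
    then show ?thesis using \<mu> by simp
  qed
  then have "real d * real d / \<mu> \<le> 2 * real d - \<mu> + 2"
    using \<mu> by (simp add: field_simps power2_eq_square)
  then have 1: "\<mu> - 2 \<le> 2 * real d - real d * (real d / \<mu>)" by simp
  have "1 - 1 / (\<mu> / real d) \<le> ln (\<mu> / real d)" using \<mu> d0 by (intro ln_ge_one_minus_inverse) auto
  then have "real d * (1 - real d / \<mu>) \<le> real d * ln (\<mu> / real d)"
    using d0 by (intro mult_left_mono) auto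
  then have "\<mu> - 2 \<le> real d * ln (\<mu> / real d) + real d" using 1 by (simp add: algebra_simps)
  then have 2: "exp (\<mu> - 2) \<le> exp (real d * ln (\<mu> / real d) + real d)" by simp
  have "exp \<mu> / (exp 3 * D) = exp (\<mu> - 2) / (exp 1 * D)"
  proof -
    have "exp (3 :: real) = exp 2 * exp 1" by (simp add: exp_add[symmetric])
    then show ?thesis by (simp add: exp_diff)
  qed
  also have "\<dots> \<le> exp (real d * ln (\<mu> / real d) + real d) / (exp 1 * real d)"
    using 2 D d0 by (intro frac_le mult_left_mono) auto
  also have "\<dots> \<le> \<mu> ^ d / fact d" using \<mu> d by (intro poisson_weight_lower) auto
  finally show ?thesis .
qed

lemma sum_odd_lessThan: "(\<Sum>j<m. 2 * real j + 1) = (real m)\<^sup>2"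
  by (induction m) (auto simp: power2_eq_square algebra_simps)

text \<open>The discovery profile: up to the critical size (round \<open>m\<close>) each round discovers as many vertices as it
  explores, later rounds discover the typical number.\<close>

definition disc :: "nat \<Rightarrow> real \<Rightarrow> nat \<Rightarrow> nat \<Rightarrow> nat" where
  "disc L g m j = (if j < m then L else max L (nat \<lceil>(2 * real j + 1) * (real L)\<^sup>2 * g\<rceil>))"

lemma disc_ge: "L \<le> disc L g m j" unfolding disc_def by auto

lemma disc_le:
  assumes "0 \<le> g" "real L \<le> D" "(2 * real J + 1) * (real L)\<^sup>2 * g + 1 \<le> D" "j \<le> J"
  shows "real (disc L g m j) \<le> D"
proof -
  have "(2 * real j + 1) * (real L)\<^sup>2 * g \<le> (2 * real J + 1) * (real L)\<^sup>2 * g"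
    using assms by (intro mult_right_mono) auto
  moreover have "0 \<le> (2 * real j + 1) * (real L)\<^sup>2 * g" using assms by simp
  ultimately have "real (nat \<lceil>(2 * real j + 1) * (real L)\<^sup>2 * g\<rceil>) \<le> D" using assms(3) by linarith
  then show ?thesis using assms unfolding disc_def by auto
qed

text \<open>The mean of round j is \<open>\<mu> j\<close>. From round \<open>m\<close> on the
  discovery number is close to the mean and the weight is exp (\<mu> j) up to a factor exp 3 D.
  These exponents add up to (J L)^2 g - (m L)^2 g, and m L is at most 1 / (2 g). Before round
  \<open>m\<close> the weights multiply to nearly a constant, apart from a polynomial factor per
  unit of \<open>L\<close> and a constant factor per round.\<close>

lemma disc_prod_lower:
  fixes g D :: real
  assumes L: "1 \<le> L" and g: "0 < g" "(real L)\<^sup>2 * g \<le> 1/2"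
    and m: "m = nat \<lfloor>1 / (2 * real L * g)\<rfloor>" "m \<le> J"
    and D: "real L \<le> D" "(2 * real J + 1) * (real L)\<^sup>2 * g + 1 \<le> D"
  shows "exp (- real L) / (2 * real m) ^ L * (1 / (exp 3 * D)) ^ J * exp ((real J)\<^sup>2 * (real L)\<^sup>2 * g - 1 / (4 * g))
    \<le> (\<Prod>j<J. ((2 * real j + 1) * (real L)\<^sup>2 * g) ^ disc L g m j / fact (disc L g m j))"
proof -
  define \<mu> where "\<mu> j = (2 * real j + 1) * (real L)\<^sup>2 * g" for j :: nat
  have \<mu>0: "0 < \<mu> j" for j unfolding \<mu>_def using L g by simp
  have L0: "0 < real L" using L by simp
  have Lg: "real L * g \<le> 1/2"
  proof -
    have "real L * 1 \<le> real L * real L" using L by (intro mult_left_mono) auto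
    then have "real L * 1 * g \<le> real L * real L * g" using g by (intro mult_right_mono) auto
    then have "real L * g \<le> (real L)\<^sup>2 * g" by (simp add: power2_eq_square)
    then show ?thesis using g(2) by linarith
  qed
  have "1 \<le> 1 / (2 * real L * g)" using Lg L0 g by (simp add: field_simps)
  then have m1: "1 \<le> m" unfolding m(1) by linarith
  have mr: "real m \<le> 1 / (2 * real L * g)" "1 / (2 * real L * g) < real m + 1" using m1 unfolding m(1) by linarith+
  \<comment> \<open>As \<open>m\<close> is the integer part of 1 / (2 L g), \<open>X\<close> lies
    within 2 L g of 1, so even its power m L is at least exp (- L).\<close>
  define X where "X = 2 * real m * real L * g"
  have X1: "X \<le> 1" using mr(1) L0 g unfolding X_def by (simp add: field_simps)
  have X2: "1 - 2 * real L * g \<le> X" using mr(2) L0 g unfolding X_def by (simp add: field_simps)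
  have X0: "0 < X" unfolding X_def using m1 L0 g by simp
  have D0: "0 < D" using D L0 by linarith
  have small: "exp (- real L) / (2 * real m) ^ L * (1 / (exp 3 * D)) ^ m \<le> (\<Prod>j<m. \<mu> j ^ L / fact L)"
  proof -
    have XmL: "exp (- real L) \<le> (X ^ m) ^ L"
    proof -
      have "1 - 1 / X \<le> ln X" by (rule ln_ge_one_minus_inverse[OF X0])
      then have "real (m * L) * (1 - 1 / X) \<le> real (m * L) * ln X" by (intro mult_left_mono) auto
      moreover have "real (m * L) * (1 - 1 / X) = - (1 - X) / (2 * g)"
        unfolding X_def using m1 L0 g by (simp add: field_simps)
      moreover have "- real L \<le> - (1 - X) / (2 * g)" using X2 g by (simp add: field_simps)
      ultimately have "- real L \<le> real (m * L) * ln X" by linarith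
      then have "exp (- real L) \<le> exp (real (m * L) * ln X)" by simp
      also have "\<dots> = X ^ (m * L)" unfolding exp_of_nat_mult using X0 by simp
      finally show ?thesis by (simp add: power_mult)
    qed
    have "exp (- real L) / (2 * real m) ^ L * (1 / (exp 3 * D)) ^ m \<le> (X ^ m) ^ L / (2 * real m) ^ L * (1 / (exp 1 * real L)) ^ m"
    proof (intro mult_mono divide_right_mono XmL power_mono)
      have "exp 1 * real L \<le> exp 3 * D" using D L0 by (intro mult_mono) auto
      then show "1 / (exp 3 * D) \<le> 1 / (exp 1 * real L)" using L0 by (intro divide_left_mono mult_pos_pos) (auto simp: D0)
    qed (use D0 X0 in auto)
    also have "(X ^ m) ^ L / (2 * real m) ^ L = (X ^ m / (2 * real m)) ^ L" by (simp add: power_divide)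
    also have "(X ^ m / (2 * real m)) ^ L \<le> (\<Prod>j<m. \<mu> j * exp 1 / real L) ^ L"
    proof (rule power_mono)
      have "X ^ m / (2 * real m) = (real L * g * exp 1) ^ m * ((2 * real m / exp 1) ^ m / (2 * real m))"
        unfolding X_def by (simp add: power_mult_distrib power_divide)
      also have "\<dots> \<le> (real L * g * exp 1) ^ m * (\<Prod>j<m. 2 * real j + 1)"
        using L0 g by (intro mult_left_mono prod_odd_lower m1) auto
      also have "\<dots> = (\<Prod>j<m. (real L * g * exp 1) * (2 * real j + 1))" by (simp add: prod.distrib)
      also have "\<dots> = (\<Prod>j<m. \<mu> j * exp 1 / real L)"
        unfolding \<mu>_def using L0 by (intro prod.cong) (auto simp: power2_eq_square field_simps)
      finally show "X ^ m / (2 * real m) \<le> (\<Prod>j<m. \<mu> j * exp 1 / real L)" .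
    qed (use X0 in auto)
    also have "(\<Prod>j<m. \<mu> j * exp 1 / real L) ^ L * (1 / (exp 1 * real L)) ^ m = (\<Prod>j<m. (\<mu> j * exp 1 / real L) ^ L * (1 / (exp 1 * real L)))"
      by (simp only: prod.distrib prod_power_distrib prod_constant card_lessThan)
    also have "\<dots> \<le> (\<Prod>j<m. \<mu> j ^ L / fact L)"
    proof (rule prod_mono, rule conjI)
      fix j
      show "0 \<le> (\<mu> j * exp 1 / real L) ^ L * (1 / (exp 1 * real L))" using \<mu>0[of j] L0 by simp
      have "(\<mu> j * exp 1 / real L) ^ L * (1 / (exp 1 * real L)) = \<mu> j ^ L / (exp 1 * real L * (real L / exp 1) ^ L)"
        using L0 by (simp add: power_mult_distrib power_divide)
      also have "\<dots> \<le> \<mu> j ^ L / fact L"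
        using fact_upper[OF L] \<mu>0[of j] L0 by (intro divide_left_mono mult_pos_pos) auto
      finally show "(\<mu> j * exp 1 / real L) ^ L * (1 / (exp 1 * real L)) \<le> \<mu> j ^ L / fact L" .
    qed
    finally show ?thesis using X0 by (simp add: mult_right_mono)
  qed
  have big: "exp (\<mu> j) / (exp 3 * D) \<le> \<mu> j ^ disc L g m j / fact (disc L g m j)" if j: "m \<le> j" "j < J" for j
  proof (rule poisson_weight_mode)
    have d: "disc L g m j = max L (nat \<lceil>\<mu> j\<rceil>)" using j unfolding disc_def \<mu>_def by simp
    have "1 - real L * g \<le> (2 * real m + 1) * real L * g"
      using mr(2) L0 g by (simp add: field_simps)
    also have "\<dots> \<le> (2 * real j + 1) * real L * g" using j L0 g by (intro mult_right_mono) auto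
    finally have "real L * (1 - real L * g) \<le> real L * ((2 * real j + 1) * real L * g)" using L0 by simp
    then have \<mu>L: "real L - 1/2 \<le> \<mu> j" using g(2) unfolding \<mu>_def by (simp add: power2_eq_square algebra_simps)
    then show "1/2 \<le> \<mu> j" using L by linarith
    show "1 \<le> disc L g m j" using disc_ge[of L g m j] L by linarith
    show "\<mu> j \<le> real (disc L g m j)" "real (disc L g m j) \<le> \<mu> j + 1"
      unfolding d using \<mu>L \<mu>0[of j] by linarith+
    show "real (disc L g m j) \<le> D" using j g D by (intro disc_le[of g L D J]) auto
  qed
  have "exp (- real L) / (2 * real m) ^ L * (1 / (exp 3 * D)) ^ J * exp ((real J)\<^sup>2 * (real L)\<^sup>2 * g - 1 / (4 * g))
    \<le> (exp (- real L) / (2 * real m) ^ L * (1 / (exp 3 * D)) ^ m) * (\<Prod>j\<in>{m..<J}. exp (\<mu> j) / (exp 3 * D))"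
  proof -
    have P1: "(\<Prod>j\<in>{m..<J}. exp (\<mu> j) / (exp 3 * D)) = exp (\<Sum>j\<in>{m..<J}. \<mu> j) * (1 / (exp 3 * D)) ^ (J - m)"
      by (simp add: exp_sum prod_dividef power_divide)
    have "(\<Sum>j\<in>{m..<J}. \<mu> j) \<ge> (real J)\<^sup>2 * (real L)\<^sup>2 * g - 1 / (4 * g)"
    proof -
      have "(\<Sum>j\<in>{m..<J}. \<mu> j) = (\<Sum>j<J. \<mu> j) - (\<Sum>j<m. \<mu> j)"
        using m(2) by (simp add: sum_diff lessThan_minus_lessThan[symmetric] del: lessThan_minus_lessThan)
      also have "\<dots> = (real J)\<^sup>2 * (real L)\<^sup>2 * g - (real m)\<^sup>2 * (real L)\<^sup>2 * g"
        unfolding \<mu>_def by (simp only: sum_distrib_right[symmetric] sum_odd_lessThan)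
      finally have eq: "(\<Sum>j\<in>{m..<J}. \<mu> j) = (real J)\<^sup>2 * (real L)\<^sup>2 * g - (real m)\<^sup>2 * (real L)\<^sup>2 * g" .
      have "(real m)\<^sup>2 * (real L)\<^sup>2 * g = (real m * real L)\<^sup>2 * g" by (simp add: power_mult_distrib)
      also have "\<dots> \<le> (1 / (2 * g))\<^sup>2 * g"
        using mr(1) L0 g by (intro mult_right_mono power_mono) (auto simp: field_simps)
      also have "\<dots> = 1 / (4 * g)" using g by (simp add: power2_eq_square field_simps)
      finally show ?thesis using eq by linarith
    qed
    moreover have P3: "(1 / (exp 3 * D)) ^ J = (1 / (exp 3 * D)) ^ m * (1 / (exp 3 * D)) ^ (J - m)"
      using m(2) by (simp add: power_add[symmetric])
    moreover have "(a * c1 * c2) * exp x \<le> (a * c1 * c2) * exp s" if "x \<le> s" "0 \<le> a" "0 \<le> c1" "0 \<le> c2" for a c1 c2 x s :: real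
      using that by (intro mult_left_mono) auto
    moreover have "0 \<le> exp (- real L) / (2 * real m) ^ L" "0 \<le> (1 / (exp 3 * D)) ^ n" for n using D0 by auto
    ultimately have "(exp (- real L) / (2 * real m) ^ L * (1 / (exp 3 * D)) ^ m * (1 / (exp 3 * D)) ^ (J - m)) * exp ((real J)\<^sup>2 * (real L)\<^sup>2 * g - 1 / (4 * g))
       \<le> (exp (- real L) / (2 * real m) ^ L * (1 / (exp 3 * D)) ^ m * (1 / (exp 3 * D)) ^ (J - m)) * exp (\<Sum>j\<in>{m..<J}. \<mu> j)"
      by blast
    then show ?thesis unfolding P1 P3 by (simp only: mult_ac)
  qed
  also have "\<dots> \<le> (\<Prod>j<m. \<mu> j ^ L / fact L) * (\<Prod>j\<in>{m..<J}. \<mu> j ^ disc L g m j / fact (disc L g m j))"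
    using D0 \<mu>0 by (intro mult_mono small prod_mono conjI big prod_nonneg) (auto intro: less_imp_le)
  also have "(\<Prod>j<m. \<mu> j ^ L / fact L) = (\<Prod>j<m. \<mu> j ^ disc L g m j / fact (disc L g m j))"
    by (intro prod.cong) (auto simp: disc_def)
  also have "\<dots> * (\<Prod>j\<in>{m..<J}. \<mu> j ^ disc L g m j / fact (disc L g m j)) = (\<Prod>j<J. \<mu> j ^ disc L g m j / fact (disc L g m j))"
    unfolding lessThan_atLeast0 using m(2) by (intro prod.atLeastLessThan_concat) auto
  finally show ?thesis unfolding \<mu>_def .
qed

section \<open>Success probability of a single trial\<close>

context two_graphs
begin

lemma rr_lower: "real s * p i * (1 - real s * p i) \<le> rr i s"
proof -
  let ?x = "real s * p i"
  have x0: "0 \<le> ?x" using p_bounds[of i] by simp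
  have "(1 - p i) ^ s \<le> exp (- p i) ^ s"
    using p_bounds[of i] exp_ge_add_one_self[of "- p i"] by (intro power_mono) auto
  also have "\<dots> = exp (- ?x)" using exp_of_nat_mult[of s "- p i"] by simp
  also have "\<dots> \<le> 1 / (1 + ?x)"
    using exp_ge_add_one_self[of ?x] x0 by (simp add: exp_minus field_simps)
  finally have "1 - 1 / (1 + ?x) \<le> rr i s" unfolding rr_def by simp
  moreover have "?x * (1 - ?x) \<le> 1 - 1 / (1 + ?x)"
  proof -
    have "(1 - 1 / (1 + ?x)) - ?x * (1 - ?x) = ?x ^ 3 / (1 + ?x)"
      using x0 by (simp add: field_simps power3_eq_cube)
    moreover have "0 \<le> ?x ^ 3 / (1 + ?x)" using x0 by simp
    ultimately show ?thesis by linarith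
  qed
  ultimately show ?thesis by linarith
qed

text \<open>L (2 a + L) p1 p2 is the increment of s^2 p1 p2. Two of the three factors
  \<open>1 - \<delta>\<close> come from the increment in one colour, the third from the value in the
  other.\<close>

lemma Q_diff_lower:
  assumes \<delta>: "0 \<le> \<delta>" "\<delta> \<le> 1" "\<And>i. real (a + L) * p i \<le> \<delta>"
  shows "(1 - \<delta>) ^ 3 * pp * real L * (2 * real a + real L) \<le> Q (a + L) - Q a"
proof -
  have low: "real s * p i * (1 - \<delta>) \<le> rr i s" if "s \<le> a + L" for s i
  proof -
    have "real s * p i \<le> real (a + L) * p i" using that p_bounds[of i] by (intro mult_right_mono) auto
    then have "real s * p i \<le> \<delta>" using \<delta>(3)[of i] by linarith
    then have "real s * p i * (1 - \<delta>) \<le> real s * p i * (1 - real s * p i)"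
      using p_bounds[of i] by (intro mult_left_mono) auto
    then show ?thesis using rr_lower[of s i] by linarith
  qed
  have diff: "(1 - \<delta>)\<^sup>2 * (real L * p i) \<le> rr i (a + L) - rr i a" for i
  proof -
    have eq: "rr i (a + L) - rr i a = (1 - p i) ^ a * rr i L" unfolding rr_def by (simp add: power_add algebra_simps)
    have f1: "1 - \<delta> \<le> (1 - p i) ^ a"
    proof -
      have "real a * p i \<le> real (a + L) * p i" using p_bounds[of i] by (intro mult_right_mono) auto
      then have "1 - \<delta> \<le> 1 + real a * (- p i)" using \<delta>(3)[of i] by simp
      also have "\<dots> \<le> (1 + - p i) ^ a" using p_bounds[of i] by (intro Bernoulli_inequality) auto
      finally show ?thesis by simp
    qed
    have f2: "real L * p i * (1 - \<delta>) \<le> rr i L" by (rule low) simp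
    have "(1 - \<delta>) * (real L * p i * (1 - \<delta>)) \<le> (1 - p i) ^ a * rr i L"
      by (rule mult_mono[OF f1 f2]) (use \<delta>(2) p_bounds[of i] in auto)
    then have "(1 - \<delta>) * (real L * p i * (1 - \<delta>)) \<le> rr i (a + L) - rr i a" unfolding eq .
    then show ?thesis by (simp add: power2_eq_square mult_ac)
  qed
  have "(1 - \<delta>) ^ 3 * pp * real L * (2 * real a + real L) =
      ((1 - \<delta>)\<^sup>2 * (real L * p True)) * (real (a + L) * p False * (1 - \<delta>)) +
      (real a * p True * (1 - \<delta>)) * ((1 - \<delta>)\<^sup>2 * (real L * p False))"
    unfolding pp_def by (simp add: power3_eq_cube power2_eq_square algebra_simps)
  also have "\<dots> \<le> (rr True (a + L) - rr True a) * rr False (a + L) + rr True a * (rr False (a + L) - rr False a)"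
    using \<delta> p_bounds rr_mono[of a "a + L"] by (intro add_mono mult_mono diff low) (auto simp: rr_nonneg)
  also have "\<dots> = Q (a + L) - Q a" unfolding Q_def by (simp add: algebra_simps)
  finally show ?thesis .
qed

text \<open>At least \<open>\<rho>\<close> vertices stay undiscovered after all prescribed
  discoveries, so each binomial coefficient can be replaced by a Poisson weight with the same pool
  size \<open>\<rho>\<close>.\<close>

lemma run_val_map_lower:
  fixes \<rho> :: real and \<mu> :: "nat \<Rightarrow> real"
  assumes \<rho>: "0 \<le> \<rho>" and \<mu>: "\<And>j. 0 \<le> \<mu> j" "\<And>j. j < J \<Longrightarrow> \<mu> j \<le> \<rho> * (Q (1 + j * L + L) - Q (1 + j * L))"
  shows "i \<le> J \<Longrightarrow> \<rho> + real (\<Sum>j\<in>{i..<J}. dd j) \<le> real r \<Longrightarrow>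
    (\<Prod>j\<in>{i..<J}. \<mu> j ^ dd j / fact (dd j)) * (1 - Q (1 + J * L)) ^ r \<le> run_val Q (map (\<lambda>j. (L, dd j)) [i..<J]) (1 + i * L) r"
proof (induction "J - i" arbitrary: i r)
  case 0 then show ?case by simp
next
  case (Suc n)
  then have i: "i < J" by simp
  let ?q = "Q (1 + i * L + L) - Q (1 + i * L)" and ?d = "dd i"
  let ?p = "\<Prod>j\<in>{Suc i..<J}. \<mu> j ^ dd j / fact (dd j)"
  have I: "{i..<J} = insert i {Suc i..<J}" using i by auto
  have s: "\<rho> + real (\<Sum>j\<in>{Suc i..<J}. dd j) + real ?d \<le> real r" using Suc.prems(2) unfolding I by simp
  then have dr: "?d \<le> r" using \<rho> by linarith
  have \<rho>r: "\<rho> \<le> real (r - ?d)" using s unfolding of_nat_diff[OF dr] by linarith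
  have q0: "0 \<le> ?q" using Q_mono[of "1 + i * L" "1 + i * L + L"] by simp
  have p0: "0 \<le> ?p" using \<mu>(1) by (intro prod_nonneg) auto
  have Q1: "0 \<le> 1 - Q (1 + J * L)" using Q_le_1 by simp
  have IH: "?p * (1 - Q (1 + J * L)) ^ (r - ?d) \<le> run_val Q (map (\<lambda>j. (L, dd j)) [Suc i..<J]) (1 + Suc i * L) (r - ?d)"
    using Suc.hyps(2) i s dr by (intro Suc.hyps(1)) (auto simp: of_nat_diff)
  have "\<mu> i ^ ?d / fact ?d \<le> (\<rho> * ?q) ^ ?d / fact ?d"
    using \<mu>(1)[of i] \<mu>(2)[OF i] by (intro divide_right_mono power_mono) auto
  also have "\<dots> \<le> (real (r - ?d) * ?q) ^ ?d / fact ?d"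
    using \<rho> \<rho>r q0 by (intro divide_right_mono power_mono mult_right_mono) auto
  also have "\<dots> = real (r - ?d) ^ ?d / fact ?d * ?q ^ ?d" by (simp add: power_mult_distrib)
  also have "\<dots> \<le> real (r choose ?d) * ?q ^ ?d"
    using binomial_fact_lower[OF dr] q0 by (intro mult_right_mono) (auto simp: field_simps)
  finally have 1: "\<mu> i ^ ?d / fact ?d \<le> real (r choose ?d) * ?q ^ ?d" .
  have "(\<Prod>j\<in>{i..<J}. \<mu> j ^ dd j / fact (dd j)) * (1 - Q (1 + J * L)) ^ r = (\<mu> i ^ ?d / fact ?d) * (?p * (1 - Q (1 + J * L)) ^ r)"
    unfolding I by simp
  also have "\<dots> \<le> (real (r choose ?d) * ?q ^ ?d) * (?p * (1 - Q (1 + J * L)) ^ (r - ?d))"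
  proof (rule mult_mono[OF 1 mult_left_mono[OF _ p0]])
    show "(1 - Q (1 + J * L)) ^ r \<le> (1 - Q (1 + J * L)) ^ (r - ?d)"
      using Q1 Q_nonneg[of "1 + J * L"] by (intro power_decreasing) auto
  qed (use q0 p0 Q1 in auto)
  also have "\<dots> \<le> (real (r choose ?d) * ?q ^ ?d) * run_val Q (map (\<lambda>j. (L, dd j)) [Suc i..<J]) (1 + Suc i * L) (r - ?d)"
    using q0 by (intro mult_left_mono IH) auto
  also have "\<dots> = run_val Q (map (\<lambda>j. (L, dd j)) [i..<J]) (1 + i * L) r"
    unfolding upt_conv_Cons[OF i] by (simp add: add_ac)
  finally show ?case .
qed

text \<open>The first round explores the root alone and discovers \<open>L\<close> vertices. Every
  later round discovers at least \<open>L\<close>, so there are always \<open>L\<close> active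
  vertices to explore.\<close>

definition profile :: "nat \<Rightarrow> real \<Rightarrow> nat \<Rightarrow> nat \<Rightarrow> (nat \<times> nat) list" where
  "profile L g m J = (1, L) # map (\<lambda>j. (L, disc L g m j)) [0..<J]"

lemma profile_ok: "run_ok (profile L g m J) 1"
proof -
  have "run_ok (map (\<lambda>j. (L, disc L g m j)) js) u" if "L \<le> u" for js u
    using that
  proof (induction js arbitrary: u)
    case (Cons j js)
    have "L \<le> u - L + disc L g m j" using Cons.prems disc_ge[of L g m j] by simp
    then show ?case using Cons by simp
  qed simp
  then show ?thesis unfolding profile_def by simp
qed

lemma profile_fst: "sum_list (map fst (profile L g m J)) = 1 + J * L"
  unfolding profile_def by (simp add: comp_def sum_list_triv)

lemma profile_snd: "J * L \<le> sum_list (map snd (profile L g m J))"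
proof -
  have "(\<Sum>j\<leftarrow>[0..<J]. L) \<le> (\<Sum>j\<leftarrow>[0..<J]. disc L g m j)" by (intro sum_list_mono disc_ge)
  then show ?thesis unfolding profile_def by (simp add: comp_def sum_list_triv)
qed

text \<open>The growing exponent (J L)^2 g of the discovery weights is nearly cancelled by the last
  factor, the price for no further discoveries; what remains is essentially exp (- 1 / (4
  g)).\<close>

lemma trial_lower:
  fixes \<delta> \<rho> g D :: real
  assumes \<delta>: "0 \<le> \<delta>" "\<delta> \<le> 1" "\<And>i. real (1 + J * L) * p i \<le> \<delta>"
    and \<rho>: "0 \<le> \<rho>" and g: "g = (1 - \<delta>) ^ 3 * \<rho> * pp" "0 < g" and L: "1 \<le> L" "(real L)\<^sup>2 * g \<le> 1/2"
    and m: "m = nat \<lfloor>1 / (2 * real L * g)\<rfloor>" "m \<le> J"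
    and D: "real L \<le> D" "(2 * real J + 1) * (real L)\<^sup>2 * g + 1 \<le> D"
    and r: "\<rho> + real L + real J * D \<le> real r" and k: "(real (1 + J * L))\<^sup>2 * pp \<le> 1/2"
  shows "(\<rho> * pp) ^ L / fact L * (exp (- real L) / (2 * real m) ^ L * (1 / (exp 3 * D)) ^ J * exp ((real J)\<^sup>2 * (real L)\<^sup>2 * g - 1 / (4 * g)))
      * exp (- real r * ((real (1 + J * L))\<^sup>2 * pp * (1 + 2 * ((real (1 + J * L))\<^sup>2 * pp))))
    \<le> run_val Q (profile L g m J) 0 r"
proof -
  define \<mu> where "\<mu> j = (2 * real j + 1) * (real L)\<^sup>2 * g" for j :: nat
  let ?k = "1 + J * L"
  let ?prod = "\<Prod>j<J. \<mu> j ^ disc L g m j / fact (disc L g m j)"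
  have J0: "0 \<le> real J * D" using D by simp
  have Lr: "L \<le> r" using r \<rho> J0 by linarith
  have pr0: "0 \<le> ?prod" unfolding \<mu>_def using g by (intro prod_nonneg) auto
  have \<mu>q: "\<mu> j \<le> \<rho> * (Q (1 + j * L + L) - Q (1 + j * L))" if j: "j < J" for j
  proof -
    have le: "1 + j * L + L \<le> ?k" using j mult_le_mono1[of "Suc j" J L] by simp
    have "(1 - \<delta>) ^ 3 * pp * real L * (2 * real (1 + j * L) + real L) \<le> Q (1 + j * L + L) - Q (1 + j * L)"
    proof (rule Q_diff_lower[OF \<delta>(1,2)])
      fix i
      have "real (1 + j * L + L) \<le> real ?k" using le by (simp only: of_nat_le_iff)
      then have "real (1 + j * L + L) * p i \<le> real ?k * p i" using p_bounds[of i] by (intro mult_right_mono)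
      then show "real (1 + j * L + L) * p i \<le> \<delta>" using \<delta>(3)[of i] by linarith
    qed
    then have "\<rho> * ((1 - \<delta>) ^ 3 * pp * real L * (2 * real (1 + j * L) + real L)) \<le> \<rho> * (Q (1 + j * L + L) - Q (1 + j * L))"
      using \<rho> by (intro mult_left_mono)
    moreover have "\<mu> j \<le> \<rho> * ((1 - \<delta>) ^ 3 * pp * real L * (2 * real (1 + j * L) + real L))"
    proof -
      have "\<mu> j = g * (real L * (2 * (real j * real L) + real L))" unfolding \<mu>_def by (simp add: power2_eq_square algebra_simps)
      also have "\<dots> \<le> g * (real L * (2 * real (1 + j * L) + real L))" using g by (intro mult_left_mono) auto
      finally show ?thesis unfolding g(1) by (simp add: mult_ac)
    qed
    ultimately show ?thesis by linarith
  qed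
  have sumd: "real (\<Sum>j\<in>{0..<J}. disc L g m j) \<le> real J * D"
  proof -
    have "(\<Sum>j\<in>{0..<J}. real (disc L g m j)) \<le> (\<Sum>j\<in>{0..<J}. D)"
      using g D by (intro sum_mono disc_le[of g L D J]) auto
    then show ?thesis by simp
  qed
  have tail: "?prod * (1 - Q ?k) ^ (r - L) \<le> run_val Q (map (\<lambda>j. (L, disc L g m j)) [0..<J]) (1 + 0 * L) (r - L)"
  proof -
    have "(\<Prod>j\<in>{0..<J}. \<mu> j ^ disc L g m j / fact (disc L g m j)) * (1 - Q ?k) ^ (r - L) \<le>
      run_val Q (map (\<lambda>j. (L, disc L g m j)) [0..<J]) (1 + 0 * L) (r - L)"
    proof (rule run_val_map_lower[OF \<rho> _ \<mu>q])
      show "0 \<le> \<mu> j" for j unfolding \<mu>_def using g by simp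
      show "\<rho> + real (\<Sum>j\<in>{0..<J}. disc L g m j) \<le> real (r - L)" using r sumd Lr by (simp add: of_nat_diff)
    qed auto
    then show ?thesis by (simp only: lessThan_atLeast0)
  qed
  have Qk: "Q ?k \<le> (real ?k)\<^sup>2 * pp" by (rule Q_le)
  have Qk': "Q ?k \<le> 1/2" using Qk k by linarith
  have expQ: "exp (- real r * ((real ?k)\<^sup>2 * pp * (1 + 2 * ((real ?k)\<^sup>2 * pp)))) \<le> (1 - Q ?k) ^ (r - L)"
  proof -
    let ?y = "(real ?k)\<^sup>2 * pp"
    have "- Q ?k - 2 * (Q ?k)\<^sup>2 \<le> ln (1 - Q ?k)"
      using Q_nonneg[of ?k] Qk' by (intro ln_one_minus_pos_lower_bound) auto
    moreover have "Q ?k + 2 * (Q ?k)\<^sup>2 \<le> ?y + 2 * ?y\<^sup>2"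
      using Qk Q_nonneg[of ?k] by (intro add_mono mult_left_mono power_mono) auto
    ultimately have "- (?y * (1 + 2 * ?y)) \<le> ln (1 - Q ?k)" by (simp add: power2_eq_square algebra_simps)
    then have "real r * (- (?y * (1 + 2 * ?y))) \<le> real r * ln (1 - Q ?k)" by (intro mult_left_mono) auto
    then have "exp (- real r * (?y * (1 + 2 * ?y))) \<le> exp (real r * ln (1 - Q ?k))" by simp
    also have "\<dots> = (1 - Q ?k) ^ r" unfolding exp_of_nat_mult using Qk' by simp
    also have "\<dots> \<le> (1 - Q ?k) ^ (r - L)" using Qk' Q_nonneg[of ?k] by (intro power_decreasing) auto
    finally show ?thesis .
  qed
  have Q1: "Q (0 + 1) - Q 0 = pp" unfolding Q_def rr_def pp_def by simp
  have first: "(\<rho> * pp) ^ L / fact L \<le> real (r choose L) * pp ^ L"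
  proof -
    have "\<rho> \<le> real (r - L)" using r J0 Lr by (simp add: of_nat_diff)
    then have "\<rho> ^ L \<le> real (r choose L) * fact L"
      using binomial_fact_lower[OF Lr] power_mono[OF _ \<rho>, of "real (r - L)" L] by linarith
    then have "\<rho> ^ L / fact L * pp ^ L \<le> real (r choose L) * pp ^ L"
      using pp_nonneg by (intro mult_right_mono) (auto simp: field_simps)
    then show ?thesis by (simp add: power_mult_distrib)
  qed
  have "(\<rho> * pp) ^ L / fact L * (exp (- real L) / (2 * real m) ^ L * (1 / (exp 3 * D)) ^ J * exp ((real J)\<^sup>2 * (real L)\<^sup>2 * g - 1 / (4 * g)))
      * exp (- real r * ((real ?k)\<^sup>2 * pp * (1 + 2 * ((real ?k)\<^sup>2 * pp))))
    \<le> (real (r choose L) * pp ^ L) * ?prod * (1 - Q ?k) ^ (r - L)"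
  proof (intro mult_mono[OF mult_mono[OF first] expQ])
    show "exp (- real L) / (2 * real m) ^ L * (1 / (exp 3 * D)) ^ J * exp ((real J)\<^sup>2 * (real L)\<^sup>2 * g - 1 / (4 * g)) \<le> ?prod"
      unfolding \<mu>_def by (rule disc_prod_lower[OF L(1) g(2) L(2) m D])
    show "0 \<le> real (r choose L) * pp ^ L" using pp_nonneg by simp
    then show "0 \<le> real (r choose L) * pp ^ L * ?prod" using pr0 by simp
  qed (use D in auto)
  also have "\<dots> = (real (r choose L) * pp ^ L) * (?prod * (1 - Q ?k) ^ (r - L))" by (simp only: mult.assoc)
  also have "\<dots> \<le> (real (r choose L) * pp ^ L) * run_val Q (map (\<lambda>j. (L, disc L g m j)) [0..<J]) (1 + 0 * L) (r - L)"
    using pp_nonneg by (intro mult_left_mono tail) auto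
  also have "\<dots> = run_val Q (profile L g m J) 0 r"
    unfolding profile_def using Q1 by simp
  finally show ?thesis .
qed

end

section \<open>Dominating cores\<close>

definition dominating_core :: "nat set \<Rightarrow> bool \<Rightarrow> world \<Rightarrow> bool" where
  "dominating_core V i w \<longleftrightarrow> (\<exists>S\<subseteq>V. spanned w S \<and> (\<forall>v\<in>V - S. joined w i {v} S))"

text \<open>To a spanned subset of \<open>W\<close> of maximal size no vertex of \<open>W\<close>
  attaches, so its size cannot lie in the forbidden range.\<close>

lemma spanned_extend:
  assumes W: "finite W" and B: "B \<subseteq> W" "spanned w B" "a0 \<le> card B"
    and nc: "\<And>S. S \<subseteq> W \<Longrightarrow> a0 \<le> card S \<Longrightarrow> card S \<le> a1 \<Longrightarrow> spanned w S \<Longrightarrow> \<not> noatt w S (W - S)"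
  shows "\<exists>S\<subseteq>W. spanned w S \<and> a1 < card S"
proof -
  let ?P = "\<lambda>S. S \<subseteq> W \<and> spanned w S \<and> a0 \<le> card S"
  have "\<exists>S. ?P S \<and> (\<forall>S'. ?P S' \<longrightarrow> card S' \<le> card S)"
    by (rule ex_has_greatest_nat[of ?P B card "Suc (card W)"]) (use B W in \<open>auto simp: less_Suc_eq_le intro: card_mono\<close>)
  then obtain S where S: "?P S" "\<And>S'. ?P S' \<Longrightarrow> card S' \<le> card S" by metis
  have "a1 < card S"
  proof (rule ccontr)
    assume "\<not> a1 < card S"
    then have "\<not> noatt w S (W - S)" using S(1) nc[of S] by auto
    then obtain v where v: "v \<in> W" "v \<notin> S" "djoin w {v} S" unfolding noatt_def by auto
    have finS: "finite S" using S(1) W finite_subset[of S W] by simp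
    have "spanned w (insert v S)" using spanned_insert[of w S v] S(1) v by simp
    then have "card (insert v S) \<le> card S" using S v finS by (intro S(2)) auto
    then show False using v(2) finS by simp
  qed
  then show ?thesis using S(1) by auto
qed

context two_graphs
begin

text \<open>First moment. Being spanned uses pairs inside \<open>S\<close>, having no attaching
  vertex uses pairs leaving \<open>S\<close>.\<close>

lemma Pr_closed_exists:
  assumes W: "W \<subseteq> V" and f: "\<And>S. S \<subseteq> W \<Longrightarrow> a0 \<le> card S \<Longrightarrow> card S \<le> a1 \<Longrightarrow> Pr (\<lambda>w. spanned w S) \<le> f (card S)"
    and f0: "\<And>a. 0 \<le> f a"
  shows "Pr (\<lambda>w. \<exists>S\<subseteq>W. a0 \<le> card S \<and> card S \<le> a1 \<and> spanned w S \<and> noatt w S (W - S)) \<le>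
    (\<Sum>a\<in>{a0..min a1 (card W)}. real (card W choose a) * (f a * (1 - Q a) ^ (card W - a)))"
proof -
  have finW: "finite W" by (rule finite_subset[OF W fin])
  let ?X = "{S. S \<subseteq> W \<and> a0 \<le> card S \<and> card S \<le> a1}"
  have finX: "finite ?X" using finW by (intro finite_subset[of ?X "Pow W"]) auto
  let ?g = "\<lambda>a. if a0 \<le> a \<and> a \<le> a1 then f a * (1 - Q a) ^ (card W - a) else 0"
  have g0: "0 \<le> ?g a" for a using f0[of a] Q_le_1[of a] by simp
  have "Pr (\<lambda>w. \<exists>S\<subseteq>W. a0 \<le> card S \<and> card S \<le> a1 \<and> spanned w S \<and> noatt w S (W - S)) \<le>
     Pr (\<lambda>w. \<exists>S\<in>?X. spanned w S \<and> noatt w S (W - S))"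
    by (rule Pr_mono) auto
  also have "\<dots> \<le> (\<Sum>S\<in>?X. Pr (\<lambda>w. spanned w S \<and> noatt w S (W - S)))" by (rule Pr_bex[OF finX])
  also have "\<dots> \<le> (\<Sum>S\<in>?X. ?g (card S))"
  proof (rule sum_mono)
    fix S assume "S \<in> ?X"
    then have S: "S \<subseteq> W" "a0 \<le> card S" "card S \<le> a1" by auto
    have finS: "finite S" by (rule finite_subset[OF S(1) finW])
    have "Pr (\<lambda>w. spanned w S \<and> noatt w S (W - S)) = Pr (\<lambda>w. spanned w S) * Pr (\<lambda>w. noatt w S (W - S))"
      by (rule Pr_indep[OF depends_spanned depends_noatt touching_avoiding(2)[of "W - S"]])
        (auto simp: touching_def avoiding_def)
    also have "Pr (\<lambda>w. noatt w S (W - S)) = (1 - Q (card S)) ^ (card W - card S)"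
      using S W finS by (subst Pr_noatt) (auto simp: card_Diff_subset)
    also have "Pr (\<lambda>w. spanned w S) * (1 - Q (card S)) ^ (card W - card S) \<le> f (card S) * (1 - Q (card S)) ^ (card W - card S)"
      using f[OF S] Q_le_1 by (intro mult_right_mono) auto
    finally show "Pr (\<lambda>w. spanned w S \<and> noatt w S (W - S)) \<le> ?g (card S)" using S by simp
  qed
  also have "\<dots> \<le> (\<Sum>S\<in>Pow W. ?g (card S))" using finW g0 by (intro sum_mono2) auto
  also have "\<dots> = (\<Sum>a\<le>card W. real (card W choose a) * ?g a)" by (rule sum_Pow_card[OF finW])
  also have "\<dots> = (\<Sum>a\<in>{a0..min a1 (card W)}. real (card W choose a) * ?g a)"
    by (rule sum.mono_neutral_right) auto
  also have "\<dots> = (\<Sum>a\<in>{a0..min a1 (card W)}. real (card W choose a) * (f a * (1 - Q a) ^ (card W - a)))"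
    by (rule sum.cong) auto
  finally show ?thesis .
qed

lemma Pr_attset:
  assumes S: "S \<subseteq> V" "Z \<subseteq> V - S" "D \<subseteq> Z"
  shows "Pr (\<lambda>w. attset w Z S = D) = Q (card S) ^ card D * (1 - Q (card S)) ^ (card Z - card D)"
proof -
  have finD: "finite D" by (rule finite_subset[OF _ fin]) (use S in auto)
  have "(attset w Z S = D) = (newatt w {} S D \<and> noatt w S (Z - D))" for w
    using S(3) unfolding attset_def newatt_def noatt_def by auto
  then have "Pr (\<lambda>w. attset w Z S = D) = Pr (\<lambda>w. newatt w {} S D \<and> noatt w S (Z - D))" by (simp only:)
  also have "\<dots> = Pr (\<lambda>w. newatt w {} S D) * Pr (\<lambda>w. noatt w S (Z - D))"
  proof (rule Pr_indep[OF depends_newatt depends_noatt touching_avoiding(2)[of "Z - D"]])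
    show "(i, {a, b}) \<in> avoiding (Z - D)" if "a \<in> D" "b \<in> S" for i a b
      using that S by (auto simp: avoiding_def)
  qed (auto simp: touching_def)
  also have "Pr (\<lambda>w. newatt w {} S D) = (Q (card S) - Q (card ({} :: nat set))) ^ card D"
    using S by (intro Pr_newatt) auto
  also have "Pr (\<lambda>w. noatt w S (Z - D)) = (1 - Q (card S)) ^ card (Z - D)"
    using S by (intro Pr_noatt) auto
  finally show ?thesis using finD S by (simp add: card_Diff_subset)
qed

lemma depends_attset: "Z \<inter> S = {} \<Longrightarrow> depends (\<lambda>w. attset w Z S = D) (touching S \<inter> touching Z)"
proof (rule dependsI)
  fix w w' :: world assume ZS: "Z \<inter> S = {}" and ag: "\<And>i. i \<in> touching S \<inter> touching Z \<Longrightarrow> w i = w' i"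
  have "djoin w {v} S = djoin w' {v} S" if "v \<in> Z" for v
    using that by (intro dependsD[OF depends_djoin[of "{v}" S "touching S \<inter> touching Z"]] ag) (auto simp: touching_def)
  then have "attset w Z S = attset w' Z S" unfolding attset_def by auto
  then show "(attset w Z S = D) = (attset w' Z S = D)" by simp
qed

text \<open>Exposure in two stages: the pairs between \<open>S\<close> and \<open>Z\<close>
  determine the attached set D, and the pairs between D and the remaining vertices avoid
  \<open>S\<close>, so they are still fresh. The first term is an exponential Markov bound for the
  binomial size of D, the second a union bound over vertices not joined to D.\<close>

lemma Pr_not_dominating:
  assumes S: "S \<subseteq> V" "Z \<subseteq> V - S"
  shows "Pr (\<lambda>w. card (attset w Z S) < m \<or> (\<exists>v\<in>V - S - attset w Z S. \<not> joined w i {v} (attset w Z S)))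
    \<le> exp (real m - Q (card S) * real (card Z) / 2) + real (card V) * (1 - p i) ^ m"
proof -
  let ?Q = "Q (card S)" and ?z = "card Z"
  have finZ: "finite Z" by (rule finite_subset[OF _ fin]) (use S in auto)
  have Q01: "0 \<le> ?Q" "?Q \<le> 1" by (rule Q_nonneg, rule Q_le_1)
  let ?w = "\<lambda>d. ?Q ^ d * (1 - ?Q) ^ (?z - d)"
  have w0: "0 \<le> ?w d" for d using Q01 by simp
  let ?B = "\<lambda>D w. attset w Z S = D \<and> (card D < m \<or> (\<exists>v\<in>V - S - D. \<not> joined w i {v} D))"
  have p: "0 \<le> 1 - p i" "1 - p i \<le> 1" using p_bounds[of i] by auto
  have "Pr (\<lambda>w. card (attset w Z S) < m \<or> (\<exists>v\<in>V - S - attset w Z S. \<not> joined w i {v} (attset w Z S)))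
     \<le> Pr (\<lambda>w. \<exists>D\<in>Pow Z. ?B D w)"
  proof (rule Pr_mono)
    fix w assume "card (attset w Z S) < m \<or> (\<exists>v\<in>V - S - attset w Z S. \<not> joined w i {v} (attset w Z S))"
    then show "\<exists>D\<in>Pow Z. ?B D w" using attset_subset[of w Z S] by (intro bexI[of _ "attset w Z S"]) auto
  qed
  also have "\<dots> \<le> (\<Sum>D\<in>Pow Z. Pr (?B D))" using finZ by (intro Pr_bex) auto
  also have "\<dots> \<le> (\<Sum>D\<in>Pow Z. exp (real m) * (?w (card D) * exp (- real (card D))) + ?w (card D) * (real (card V) * (1 - p i) ^ m))"
  proof (rule sum_mono)
    fix D assume "D \<in> Pow Z"
    then have D: "D \<subseteq> Z" by auto
    note PD = Pr_attset[OF S D]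
    show "Pr (?B D) \<le> exp (real m) * (?w (card D) * exp (- real (card D))) + ?w (card D) * (real (card V) * (1 - p i) ^ m)"
    proof (cases "card D < m")
      case True
      have "Pr (?B D) \<le> Pr (\<lambda>w. attset w Z S = D)" by (rule Pr_mono) auto
      also have "\<dots> = ?w (card D) * 1" using PD by simp
      also have "\<dots> \<le> ?w (card D) * exp (real m - real (card D))" using True w0 by (intro mult_left_mono) auto
      also have "\<dots> = exp (real m) * (?w (card D) * exp (- real (card D)))" by (simp add: exp_diff exp_minus field_simps)
      finally show ?thesis using w0[of "card D"] p by (simp add: add_increasing2)
    next
      case False
      then have "Pr (?B D) = Pr (\<lambda>w. attset w Z S = D \<and> (\<exists>v\<in>V - S - D. \<not> joined w i {v} D))" by simp
      also have "\<dots> = Pr (\<lambda>w. attset w Z S = D) * Pr (\<lambda>w. \<exists>v\<in>V - S - D. \<not> joined w i {v} D)"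
      proof (rule Pr_indep)
        show "depends (\<lambda>w. attset w Z S = D) (touching S)"
          by (rule depends_mono[OF depends_attset]) (use S in auto)
        show "depends (\<lambda>w. \<exists>v\<in>V - S - D. \<not> joined w i {v} D) (avoiding S)"
          using S D by (intro depends_bex depends_not depends_joined) (auto simp: avoiding_def)
      qed (rule touching_avoiding)
      also have "\<dots> \<le> ?w (card D) * (real (card V) * (1 - p i) ^ m)"
        unfolding PD
      proof (rule mult_left_mono[OF _ w0])
        have "Pr (\<lambda>w. \<exists>v\<in>V - S - D. \<not> joined w i {v} D) \<le> (\<Sum>v\<in>V - S - D. Pr (\<lambda>w. \<not> joined w i {v} D))"
          using fin by (intro Pr_bex) auto
        also have "\<dots> \<le> (\<Sum>v\<in>V - S - D. (1 - p i) ^ m)"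
        proof (rule sum_mono)
          fix v assume v: "v \<in> V - S - D"
          have "Pr (\<lambda>w. \<not> joined w i {v} D) = (1 - p i) ^ (card {v} * card D)"
            using v S D by (intro Pr_not_joined) auto
          also have "\<dots> \<le> (1 - p i) ^ m" using False p by (intro power_decreasing) auto
          finally show "Pr (\<lambda>w. \<not> joined w i {v} D) \<le> (1 - p i) ^ m" .
        qed
        also have "\<dots> = real (card (V - S - D)) * (1 - p i) ^ m" by simp
        also have "\<dots> \<le> real (card V) * (1 - p i) ^ m"
          using p fin by (intro mult_right_mono) (auto intro: card_mono)
        finally show "Pr (\<lambda>w. \<exists>v\<in>V - S - D. \<not> joined w i {v} D) \<le> real (card V) * (1 - p i) ^ m" .
      qed
      finally have "Pr (?B D) \<le> ?w (card D) * (real (card V) * (1 - p i) ^ m)" .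
      moreover have "0 \<le> exp (real m) * (?w (card D) * exp (- real (card D)))" using w0 by simp
      ultimately show ?thesis by linarith
    qed
  qed
  also have "\<dots> = exp (real m) * (\<Sum>D\<in>Pow Z. ?w (card D) * exp (- real (card D))) + (\<Sum>D\<in>Pow Z. ?w (card D)) * (real (card V) * (1 - p i) ^ m)"
    by (simp only: sum.distrib sum_distrib_left sum_distrib_right)
  also have "(\<Sum>D\<in>Pow Z. ?w (card D)) = 1"
    unfolding sum_Pow_card[OF finZ, of ?w] using binomial_ring[of ?Q "1 - ?Q" ?z] by (simp add: mult_ac)
  also have "(\<Sum>D\<in>Pow Z. ?w (card D) * exp (- real (card D))) = (?Q * exp (- 1) + (1 - ?Q)) ^ ?z"
  proof -
    have "exp (- real d) = exp (- 1) ^ d" for d using exp_of_nat_mult[of d "- 1 :: real"] by simp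
    then show ?thesis
      unfolding sum_Pow_card[OF finZ, of "\<lambda>d. ?w d * exp (- real d)"] binomial_ring
      by (simp add: power_mult_distrib mult_ac)
  qed
  also have "exp (real m) * (?Q * exp (- 1) + (1 - ?Q)) ^ ?z \<le> exp (real m) * exp (- (?Q / 2)) ^ ?z"
  proof (intro mult_left_mono power_mono)
    have "exp (- 1) \<le> (1/2 :: real)" using exp_ge_add_one_self[of "1 :: real"] by (simp add: exp_minus field_simps)
    then have "?Q * exp (- 1) \<le> ?Q * (1/2)" using Q01 by (intro mult_left_mono) auto
    then show "?Q * exp (- 1) + (1 - ?Q) \<le> exp (- (?Q / 2))"
      using exp_ge_add_one_self[of "- (?Q / 2)"] by simp
  qed (use Q01 in auto)
  also have "exp (real m) * exp (- (?Q / 2)) ^ ?z = exp (real m - ?Q * real ?z / 2)"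
  proof -
    have "exp (real m - q) = exp (real m) * exp (- q)" for q by (simp add: exp_add[symmetric])
    then show ?thesis using exp_of_nat_mult[of ?z "- (?Q / 2)"] by (simp add: mult_ac)
  qed
  finally show ?thesis by simp
qed

text \<open>The large spanned set is selected by looking only at pairs that avoid \<open>Z\<close>,
  which leaves all pairs at \<open>Z\<close> fresh.\<close>

lemma Pr_dominating_core:
  assumes W: "W \<subseteq> V" and Z: "Z = V - W"
  shows "Pr (\<lambda>w. \<not> dominating_core V i w) \<le> Pr (\<lambda>w. \<not> (\<exists>S\<subseteq>W. spanned w S \<and> b < card S)) +
    (exp (real m - Q (Suc b) * real (card Z) / 2) + real (card V) * (1 - p i) ^ m)"
proof -
  let ?big = "\<lambda>w. \<exists>S. S \<subseteq> W \<and> spanned w S \<and> b < card S"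
  let ?sel = "\<lambda>w. SOME S. S \<subseteq> W \<and> spanned w S \<and> b < card S"
  let ?err = "exp (real m - Q (Suc b) * real (card Z) / 2) + real (card V) * (1 - p i) ^ m"
  let ?bad = "\<lambda>S w. card (attset w Z S) < m \<or> (\<exists>v\<in>V - S - attset w Z S. \<not> joined w i {v} (attset w Z S))"
  have finW: "finite W" by (rule finite_subset[OF W fin])
  have err0: "0 \<le> ?err" using p_bounds[of i] by simp
  have sel: "?sel w \<subseteq> W \<and> spanned w (?sel w) \<and> b < card (?sel w)" if "?big w" for w
    using that by (rule someI_ex)
  \<comment> \<open>Worlds that agree off \<open>Z\<close> give the same predicate on sets, so the
    choice operator returns the same set.\<close>
  have dep: "depends (\<lambda>w. ?big w \<and> ?sel w = S) (avoiding Z)" for S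
  proof (rule dependsI)
    fix w w' :: world assume ag: "\<And>i. i \<in> avoiding Z \<Longrightarrow> w i = w' i"
    have "(S \<subseteq> W \<and> spanned w S \<and> b < card S) = (S \<subseteq> W \<and> spanned w' S \<and> b < card S)" for S
    proof (cases "S \<subseteq> W")
      case True
      have "spanned w S = spanned w' S"
        by (rule dependsD[OF depends_spanned[of S "avoiding Z"]]) (use True Z ag in \<open>auto simp: avoiding_def\<close>)
      then show ?thesis by simp
    qed simp
    then show "(?big w \<and> ?sel w = S) = (?big w' \<and> ?sel w' = S)" by (simp only:)
  qed
  have depbad: "depends (?bad S) (touching Z)" if "S \<subseteq> W" for S
  proof (rule dependsI)
    fix w w' :: world assume ag: "\<And>i. i \<in> touching Z \<Longrightarrow> w i = w' i"
    have at: "attset w Z S = attset w' Z S" by (rule attset_cong[OF ag])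
    have "joined w i {v} (attset w' Z S) = joined w' i {v} (attset w' Z S)" for v
      by (rule dependsD[OF depends_joined[of "{v}" "attset w' Z S" i "touching Z"]])
        (use ag attset_subset[of w' Z S] in \<open>auto simp: touching_def\<close>)
    then show "?bad S w = ?bad S w'" unfolding at by simp
  qed
  have "Pr (\<lambda>w. \<not> dominating_core V i w) \<le> Pr (\<lambda>w. \<not> ?big w \<or> (\<exists>S\<in>Pow W. (?big w \<and> ?sel w = S) \<and> (b < card S \<and> ?bad S w)))"
  proof (rule Pr_mono)
    fix w assume nd: "\<not> dominating_core V i w"
    show "\<not> ?big w \<or> (\<exists>S\<in>Pow W. (?big w \<and> ?sel w = S) \<and> (b < card S \<and> ?bad S w))"
    proof (cases "?big w")
      case True
      let ?S = "?sel w"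
      let ?D = "attset w Z ?S"
      have s: "?S \<subseteq> W" "spanned w ?S" "b < card ?S" using sel[OF True] by auto
      have "?bad ?S w"
      proof (rule ccontr)
        assume "\<not> ?bad ?S w"
        then have dom: "\<And>v. v \<in> V - ?S - ?D \<Longrightarrow> joined w i {v} ?D" by auto
        have finD: "finite ?D" using attset_subset[of w Z ?S] Z fin finite_subset[of ?D V] by auto
        have "spanned w (?S \<union> ?D)" by (rule spanned_attach[OF finD s(2)]) (auto simp: attset_def)
        moreover have "?S \<union> ?D \<subseteq> V" using s(1) W attset_subset[of w Z ?S] Z by auto
        moreover have "joined w i {v} (?S \<union> ?D)" if "v \<in> V - (?S \<union> ?D)" for v
          by (rule joined_mono[OF dom[of v]]) (use that in auto)
        ultimately have "dominating_core V i w" unfolding dominating_core_def by (intro exI[of _ "?S \<union> ?D"]) auto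
        then show False using nd by simp
      qed
      then show ?thesis using True s by (intro disjI2 bexI[of _ ?S]) auto
    qed simp
  qed
  also have "\<dots> \<le> Pr (\<lambda>w. \<not> ?big w) + Pr (\<lambda>w. \<exists>S\<in>Pow W. (?big w \<and> ?sel w = S) \<and> (b < card S \<and> ?bad S w))"
    by (rule Pr_disj)
  also have "Pr (\<lambda>w. \<exists>S\<in>Pow W. (?big w \<and> ?sel w = S) \<and> (b < card S \<and> ?bad S w)) \<le>
      (\<Sum>S\<in>Pow W. Pr (\<lambda>w. (?big w \<and> ?sel w = S) \<and> (b < card S \<and> ?bad S w)))"
    using finW by (intro Pr_bex) auto
  also have "\<dots> \<le> (\<Sum>S\<in>Pow W. Pr (\<lambda>w. ?big w \<and> ?sel w = S) * ?err)"
  proof (rule sum_mono)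
    fix S assume "S \<in> Pow W"
    then have S: "S \<subseteq> W" by simp
    have "Pr (\<lambda>w. (?big w \<and> ?sel w = S) \<and> (b < card S \<and> ?bad S w)) =
       Pr (\<lambda>w. ?big w \<and> ?sel w = S) * Pr (\<lambda>w. b < card S \<and> ?bad S w)"
      by (rule Pr_indep[OF dep depends_conj[OF depends_const depbad[OF S]] touching_avoiding(2)])
    also have "\<dots> \<le> Pr (\<lambda>w. ?big w \<and> ?sel w = S) * ?err"
    proof (rule mult_left_mono[OF _ Pr_nonneg])
      show "Pr (\<lambda>w. b < card S \<and> ?bad S w) \<le> ?err"
      proof (cases "b < card S")
        case True
        have "Pr (\<lambda>w. b < card S \<and> ?bad S w) = Pr (?bad S)" using True by simp
        also have "\<dots> \<le> exp (real m - Q (card S) * real (card Z) / 2) + real (card V) * (1 - p i) ^ m"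
          by (rule Pr_not_dominating) (use S W Z in auto)
        also have "\<dots> \<le> ?err"
        proof -
          have "Q (Suc b) * real (card Z) \<le> Q (card S) * real (card Z)"
            using True by (intro mult_right_mono Q_mono) auto
          then show ?thesis by simp
        qed
        finally show ?thesis .
      next
        case False then show ?thesis using err0 by (simp add: pr_def)
      qed
    qed
    finally show "Pr (\<lambda>w. (?big w \<and> ?sel w = S) \<and> (b < card S \<and> ?bad S w)) \<le> Pr (\<lambda>w. ?big w \<and> ?sel w = S) * ?err" .
  qed
  also have "\<dots> = (\<Sum>S\<in>Pow W. Pr (\<lambda>w. ?big w \<and> ?sel w = S)) * ?err" by (rule sum_distrib_right[symmetric])
  also have "(\<Sum>S\<in>Pow W. Pr (\<lambda>w. ?big w \<and> ?sel w = S)) = Pr (\<lambda>w. \<exists>S\<in>Pow W. ?big w \<and> ?sel w = S)"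
    by (rule Pr_bex_disjoint[symmetric]) (use finW in auto)
  also have "\<dots> * ?err \<le> 1 * ?err" by (rule mult_right_mono[OF Pr_le_1 err0])
  finally show ?thesis by simp
qed

end

text \<open>A trial succeeds with probability at least n^(- (1 - \<epsilon> / 8)), and the slack of
  \<epsilon> n / 16 vertices pays for order n / ln n trials.\<close>

lemma nobig_vanishing:
  fixes \<epsilon> M :: real
  assumes \<epsilon>: "0 < \<epsilon>" "\<epsilon> \<le> 1" and M: "4 \<le> M"
  shows "\<exists>f :: nat \<Rightarrow> real. f \<longlonglongrightarrow> 0 \<and> (\<forall>\<^sub>F n in sequentially. \<forall>V p W. two_graphs V p \<longrightarrow>
    p True * p False = (1 + \<epsilon>) / (4 * real n * ln (real n)) \<longrightarrow> (\<forall>i. p i \<le> 1 / (2 * (ln (real n))\<^sup>2)) \<longrightarrow>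
    W \<subseteq> V \<longrightarrow> (1 - \<epsilon> / 16) * real n \<le> real (card W) \<longrightarrow> pr V p (nobig (nat \<lceil>M * ln (real n)\<rceil>) W) \<le> f n)"
proof -
  \<comment> \<open>Two exponents of order M^2 ln n have to cancel up to \<epsilon> ln n / 32, so
    their relative error must be small compared with \<epsilon> / M^2.\<close>
  define \<delta> where "\<delta> = min (\<epsilon> / 32) (\<epsilon> / (256 * M\<^sup>2))"
  have \<delta>: "0 < \<delta>" "\<delta> \<le> \<epsilon> / 32" "\<delta> * M\<^sup>2 \<le> \<epsilon> / 256"
  proof -
    show "0 < \<delta>" "\<delta> \<le> \<epsilon> / 32" unfolding \<delta>_def using \<epsilon> M by auto
    have "\<delta> * M\<^sup>2 \<le> \<epsilon> / (256 * M\<^sup>2) * M\<^sup>2" unfolding \<delta>_def by (intro mult_right_mono) auto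
    then show "\<delta> * M\<^sup>2 \<le> \<epsilon> / 256" using M by simp
  qed
  \<comment> \<open>Each round loses a factor exp 3 D and there are about M ln n / L rounds. A large
    constant \<open>L\<close> therefore limits this loss to n^(- \<epsilon> / 64) up to a constant;
    this is why vertices are explored in blocks.\<close>
  have "\<forall>\<^sub>F x :: real in at_top. M * (3 + ln ((M + 2) * x)) / x \<le> \<epsilon> / 64" using \<epsilon> M by real_asymp
  then obtain x0 :: real where x0: "\<And>x. x0 \<le> x \<Longrightarrow> M * (3 + ln ((M + 2) * x)) / x \<le> \<epsilon> / 64"
    unfolding eventually_at_top_linorder by blast
  define L where "L = max 1 (nat \<lceil>x0\<rceil>)"
  have L: "1 \<le> L" "x0 \<le> real L" unfolding L_def by (auto, linarith)
  define D where "D = (M + 2) * real L"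
  have D: "M * (3 + ln D) / real L \<le> \<epsilon> / 64" unfolding D_def using x0 L by simp
  \<comment> \<open>\<open>H\<close> is ln n times p1 p2 times a pool of (1 - \<epsilon> / 8) n
    vertices. Of the four factors \<open>1 - \<delta>\<close> in \<open>G\<close>, three belong to
    \<open>Q_diff_lower\<close> and one to \<open>\<rho>\<close>.\<close>
  define H where "H = (1 - \<epsilon> / 8) * (1 + \<epsilon>) / 4"
  define G where "G = (1 - \<delta>) ^ 4 * H"
  have \<delta>4: "1 - 4 * \<delta> \<le> (1 - \<delta>) ^ 4" using Bernoulli_inequality[of "- \<delta>" 4] \<delta> \<epsilon> by simp
  have H: "7 / 32 \<le> H" "H \<le> 1 / 2"
  proof -
    have "7/8 * 1 \<le> (1 - \<epsilon> / 8) * (1 + \<epsilon>)" using \<epsilon> by (intro mult_mono) auto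
    then show "7 / 32 \<le> H" unfolding H_def by simp
    have "(1 - \<epsilon> / 8) * (1 + \<epsilon>) \<le> 1 * 2" using \<epsilon> by (intro mult_mono) auto
    then have "(1 - \<epsilon> / 8) * (1 + \<epsilon>) / 4 \<le> 1 * 2 / 4" by (rule divide_right_mono) simp
    then show "H \<le> 1 / 2" unfolding H_def[symmetric] by simp
  qed
  have G: "1 / 8 \<le> G" "G \<le> 1 / 2" "G \<le> H"
  proof -
    have "7/8 * (7/32) \<le> (1 - \<delta>) ^ 4 * H" using \<delta>4 \<delta> \<epsilon> H by (intro mult_mono) auto
    then show "1 / 8 \<le> G" unfolding G_def by simp
    have "(1 - \<delta>) ^ 4 * H \<le> 1 * H" using \<delta> \<epsilon> H by (intro mult_right_mono power_le_one) auto
    then show "G \<le> H" unfolding G_def by simp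
    then show "G \<le> 1 / 2" using H by simp
  qed
  \<comment> \<open>Here the excess over the threshold enters: exp (- 1 / (4 g)) is at least n^(- (1
    - \<epsilon> / 4)).\<close>
  have G4: "1 / (4 * G) \<le> 1 - \<epsilon> / 4"
  proof -
    have "1 \<le> (1 - 4 * \<delta>) * (1 + 5 * \<epsilon> / 16)"
    proof -
      have "(1 - \<epsilon> / 8) * (1 + 5 * \<epsilon> / 16) \<le> (1 - 4 * \<delta>) * (1 + 5 * \<epsilon> / 16)"
        using \<delta> \<epsilon> by (intro mult_right_mono) auto
      moreover have "1 \<le> (1 - \<epsilon> / 8) * (1 + 5 * \<epsilon> / 16)"
      proof -
        have "\<epsilon> * \<epsilon> \<le> 1 * \<epsilon>" using \<epsilon> by (intro mult_right_mono) auto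
        then show ?thesis using \<epsilon> by (simp add: algebra_simps)
      qed
      ultimately show ?thesis by linarith
    qed
    also have "\<dots> \<le> (1 - \<delta>) ^ 4 * ((1 - \<epsilon> / 8) * (1 + \<epsilon>) * (1 - \<epsilon> / 4))"
    proof (intro mult_mono \<delta>4)
      have "0 \<le> \<epsilon> * ((1 - \<epsilon>) * (10 - \<epsilon>)) / 32" using \<epsilon> by (intro divide_nonneg_nonneg mult_nonneg_nonneg) auto
      also have "\<dots> = (1 + 5 * \<epsilon> / 8 - 11 * (\<epsilon> * \<epsilon>) / 32 + \<epsilon> * (\<epsilon> * \<epsilon>) / 32) - (1 + 5 * \<epsilon> / 16)"
        by (simp add: field_simps)
      finally have ee: "0 \<le> \<dots>" .
      have eq: "(1 - \<epsilon> / 8) * (1 + \<epsilon>) * (1 - \<epsilon> / 4) = 1 + 5 * \<epsilon> / 8 - 11 * (\<epsilon> * \<epsilon>) / 32 + \<epsilon> * (\<epsilon> * \<epsilon>) / 32"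
        by (simp add: field_simps)
      show "1 + 5 * \<epsilon> / 16 \<le> (1 - \<epsilon> / 8) * (1 + \<epsilon>) * (1 - \<epsilon> / 4)" unfolding eq using ee by (simp only: diff_ge_0_iff_ge)
    qed (use \<epsilon> \<delta> in auto)
    also have "\<dots> = 4 * G * (1 - \<epsilon> / 4)" unfolding G_def H_def by simp
    finally show ?thesis using G by (simp add: field_simps)
  qed
  \<comment> \<open>All constant factors of the success probability. Besides them there are
    \<open>L\<close> powers of 1 / ln n from the first round and \<open>L\<close> from the factor
    with \<open>m\<close>.\<close>
  define c0 where "c0 = ((1 - \<delta>) * H) ^ L / fact L * (exp (- real L) * (real L * G) ^ L) * exp (- (3 + ln D))"
  have c0: "0 < c0" unfolding c0_def using H G L \<delta> \<epsilon> by (auto intro!: mult_pos_pos divide_pos_pos zero_less_power)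
  define f where "f n = exp (- (exp (- (1 - \<epsilon> / 8) * ln (real n)) * (\<epsilon> / 16 * real n / (1 + M * ln (real n) + real L) - 1)))" for n :: nat
  have flim: "f \<longlonglongrightarrow> 0" unfolding f_def using \<epsilon> M by real_asymp
  have "\<forall>\<^sub>F n in sequentially. \<forall>V p W. two_graphs V p \<longrightarrow>
    p True * p False = (1 + \<epsilon>) / (4 * real n * ln (real n)) \<longrightarrow> (\<forall>i. p i \<le> 1 / (2 * (ln (real n))\<^sup>2)) \<longrightarrow>
    W \<subseteq> V \<longrightarrow> (1 - \<epsilon> / 16) * real n \<le> real (card W) \<longrightarrow> pr V p (nobig (nat \<lceil>M * ln (real n)\<rceil>) W) \<le> f n"
  proof -
    have e1: "\<forall>\<^sub>F n :: nat in sequentially. real L * real L + 2 * real L + 1 \<le> ln (real n)" by real_asymp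
    have e2: "\<forall>\<^sub>F n :: nat in sequentially. (1 + (M * ln (real n) + real L)) / (2 * (ln (real n))\<^sup>2) \<le> \<delta>" using \<delta> M by real_asymp
    have e3: "\<forall>\<^sub>F n :: nat in sequentially. (1 + (M * ln (real n) + real L))\<^sup>2 * ((1 + \<epsilon>) / (4 * real n * ln (real n))) \<le> \<delta>" using \<delta> M \<epsilon> by real_asymp
    have e4: "\<forall>\<^sub>F n :: nat in sequentially. 2 + real L + (M * ln (real n) / real L + 1) * D \<le> \<delta> * (1 - \<epsilon> / 8) * real n"
    proof -
      have "0 < \<delta> * (1 - \<epsilon> / 8)" using \<delta> \<epsilon> by simp
      moreover have "0 < D" "0 < real L" unfolding D_def using M L by auto
      ultimately show ?thesis using M by real_asymp
    qed
    have e5: "\<forall>\<^sub>F n :: nat in sequentially. 3 * \<delta> * (M * ln (real n) + real L)\<^sup>2 / ln (real n) + (1 + 2 * (M * ln (real n) + real L)) / ln (real n) \<le> \<epsilon> / 32 * ln (real n)"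
    proof -
      have "3 * (\<delta> * M\<^sup>2) < \<epsilon> / 32" using \<delta>(3) \<epsilon> by linarith
      then have "3 * \<delta> * M\<^sup>2 < \<epsilon> / 32" by (simp only: mult.assoc)
      define \<tau> where "\<tau> = \<epsilon> / 32 - 3 * \<delta> * M\<^sup>2"
      have \<tau>: "0 < \<tau>" using \<open>3 * \<delta> * M\<^sup>2 < \<epsilon> / 32\<close> unfolding \<tau>_def by simp
      have "\<forall>\<^sub>F n :: nat in sequentially. 3 * \<delta> * (2 * M * real L + real L * real L / ln (real n)) + (1 + 2 * (M * ln (real n) + real L)) / ln (real n) \<le> \<tau> * ln (real n)"
        using \<tau> M \<delta>(1) by real_asymp
      moreover have "\<forall>\<^sub>F n :: nat in sequentially. 0 < ln (real n)" by real_asymp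
      ultimately show ?thesis
      proof eventually_elim
        case (elim n)
        have "3 * \<delta> * (M * ln (real n) + real L)\<^sup>2 / ln (real n) = 3 * \<delta> * M\<^sup>2 * ln (real n) + 3 * \<delta> * (2 * M * real L + real L * real L / ln (real n))"
          using elim(2) by (simp add: power2_eq_square field_simps)
        then show ?case using elim(1) unfolding \<tau>_def by (simp add: algebra_simps)
      qed
    qed
    have e6: "\<forall>\<^sub>F n :: nat in sequentially. exp (- (\<epsilon> / 16) * ln (real n)) \<le> c0 * (1 / ln (real n)) ^ (2 * L)"
    proof -
      have lim: "filterlim (\<lambda>n :: nat. \<epsilon> / 16 * ln (real n)) at_top sequentially" using \<epsilon>(1) by real_asymp
      have "((\<lambda>n :: nat. (\<epsilon> / 16 * ln (real n)) ^ (2 * L) / exp (\<epsilon> / 16 * ln (real n))) \<longlongrightarrow> 0) sequentially"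
        by (rule filterlim_compose[OF tendsto_power_div_exp_0[of "2 * L"] lim])
      then have "\<forall>\<^sub>F n :: nat in sequentially. (\<epsilon> / 16 * ln (real n)) ^ (2 * L) / exp (\<epsilon> / 16 * ln (real n)) < c0 * (\<epsilon> / 16) ^ (2 * L)"
        by (rule order_tendstoD(2)) (use c0 \<epsilon> in auto)
      moreover have "\<forall>\<^sub>F n :: nat in sequentially. 0 < ln (real n)" by real_asymp
      ultimately show ?thesis
      proof eventually_elim
        case (elim n)
        have "ln (real n) ^ (2 * L) * exp (- (\<epsilon> / 16) * ln (real n)) \<le> c0"
          using elim(1) \<epsilon> by (simp add: power_mult_distrib exp_minus field_simps)
        then show ?case using elim(2) by (simp add: power_one_over field_simps)
      qed
    qed
    have e7: "\<forall>\<^sub>F n :: nat in sequentially. 3 \<le> n" by (rule eventually_ge_at_top)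
    have e8: "\<forall>\<^sub>F n :: nat in sequentially. 1 + (M * ln (real n) + real L) \<le> \<epsilon> / 16 * real n" using \<epsilon> M by real_asymp
    show ?thesis using e1 e2 e3 e4 e5 e6 e7 e8
    proof eventually_elim
      case (elim n)
      define l where "l = ln (real n)"
      define P where "P = (1 + \<epsilon>) / (4 * real n * l)"
      define J where "J = nat \<lceil>M * l / real L\<rceil>"
      define y where "y = real J * real L"
      define n' where "n' = nat \<lfloor>(1 - \<epsilon> / 8) * real n\<rfloor>"
      define \<rho> where "\<rho> = (1 - \<delta>) * ((1 - \<epsilon> / 8) * real n)"
      define g where "g = G / l"
      define m where "m = nat \<lfloor>1 / (2 * real L * g)\<rfloor>"
      have L0: "0 < real L" using L by simp
      have lge: "real L * real L + 2 * real L + 1 \<le> l" using elim(1) unfolding l_def .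
      have l: "1 \<le> l" "real L * real L \<le> l" "2 * real L \<le> l"
        using lge L0 zero_le_square[of "real L"] by linarith+
      have l0: "0 < l" using l by simp
      have n: "3 \<le> n" using elim(7) .
      have Jb: "M * l / real L \<le> real J" "real J \<le> M * l / real L + 1"
      proof -
        have "0 \<le> M * l / real L" using M l L0 by simp
        then show "M * l / real L \<le> real J" "real J \<le> M * l / real L + 1" unfolding J_def by linarith+
      qed
      have y: "M * l \<le> y" "y \<le> M * l + real L" unfolding y_def using Jb L0 by (auto simp: field_simps)
      have y0: "0 \<le> y" unfolding y_def by simp
      have k: "real (1 + J * L) = 1 + y" unfolding y_def by simp
      have \<rho>P: "\<rho> * P = (1 - \<delta>) * H / l" unfolding \<rho>_def P_def H_def using n l0 by (simp add: field_simps)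
      have g: "0 < g" unfolding g_def using G l0 by simp
      have n'b: "real n' \<le> (1 - \<epsilon> / 8) * real n" "(1 - \<epsilon> / 8) * real n - 1 \<le> real n'"
      proof -
        have "0 \<le> (1 - \<epsilon> / 8) * real n" using \<epsilon> by simp
        then show "real n' \<le> (1 - \<epsilon> / 8) * real n" "(1 - \<epsilon> / 8) * real n - 1 \<le> real n'" unfolding n'_def by linarith+
      qed
      have n'1: "1 \<le> n'"
      proof -
        have "2 \<le> \<delta> * (1 - \<epsilon> / 8) * real n"
        proof -
          have "0 \<le> (M * ln (real n) / real L + 1) * D" unfolding D_def using M L0 l0 l_def by simp
          then show ?thesis using elim(4) by linarith
        qed
        also have "\<dots> \<le> 1 * (1 - \<epsilon> / 8) * real n" using \<delta> \<epsilon> by (intro mult_right_mono) auto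
        finally have "1 \<le> real n'" using n'b by linarith
        then show ?thesis by simp
      qed
      show ?case
      proof (intro allI impI)
        fix V p W
        assume tg: "two_graphs V p" and pP: "p True * p False = (1 + \<epsilon>) / (4 * real n * ln (real n))"
          and pm: "\<forall>i. p i \<le> 1 / (2 * (ln (real n))\<^sup>2)" and W: "W \<subseteq> V" "(1 - \<epsilon> / 16) * real n \<le> real (card W)"
        interpret two_graphs V p by (rule tg)
        have ppP: "pp = P" unfolding pp_def P_def l_def using pP .
        have kP: "(1 + y)\<^sup>2 * P \<le> \<delta>"
        proof -
          have "(1 + y)\<^sup>2 * P \<le> (1 + (M * l + real L))\<^sup>2 * P"
            using y y0 \<epsilon> l0 unfolding P_def by (intro mult_right_mono power_mono) auto
          also have "\<dots> \<le> \<delta>" using elim(3) unfolding P_def l_def .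
          finally show ?thesis .
        qed
        define s where "s = run_val Q (profile L g m J) 0 (n' - 1)"
        have tl: "(\<rho> * pp) ^ L / fact L * (exp (- real L) / (2 * real m) ^ L * (1 / (exp 3 * D)) ^ J * exp ((real J)\<^sup>2 * (real L)\<^sup>2 * g - 1 / (4 * g)))
            * exp (- real (n' - 1) * ((real (1 + J * L))\<^sup>2 * pp * (1 + 2 * ((real (1 + J * L))\<^sup>2 * pp)))) \<le> s"
          unfolding s_def
        proof (rule trial_lower)
          show "0 \<le> \<delta>" "\<delta> \<le> 1" using \<delta> \<epsilon> by auto
          show "real (1 + J * L) * p i \<le> \<delta>" for i
          proof -
            have "real (1 + J * L) * p i \<le> (1 + (M * l + real L)) * (1 / (2 * l\<^sup>2))"
              unfolding k using y y0 pm p_bounds[of i] unfolding l_def by (intro mult_mono) auto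
            also have "\<dots> \<le> \<delta>" using elim(2) unfolding l_def by simp
            finally show ?thesis .
          qed
          show "0 \<le> \<rho>" unfolding \<rho>_def using \<delta> \<epsilon> by simp
          show "g = (1 - \<delta>) ^ 3 * \<rho> * pp"
          proof -
            have "(1 - \<delta>) ^ 3 * \<rho> * pp = (1 - \<delta>) ^ 3 * (\<rho> * P)" unfolding ppP by (simp only: mult.assoc)
            also have "\<dots> = g" unfolding \<rho>P g_def G_def by (simp add: eval_nat_numeral)
            finally show ?thesis by simp
          qed
          show "0 < g" by (rule g)
          show "1 \<le> L" by (rule L)
          show "(real L)\<^sup>2 * g \<le> 1 / 2"
          proof -
            have "(real L)\<^sup>2 * g \<le> l * ((1/2) / l)" unfolding g_def power2_eq_square using l l0 G by (intro mult_mono divide_right_mono) auto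
            then show ?thesis using l0 by simp
          qed
          show "m = nat \<lfloor>1 / (2 * real L * g)\<rfloor>" by (rule m_def)
          show "m \<le> J"
          proof -
            have "1 / (2 * real L * g) = l / real L * (1 / (2 * G))" unfolding g_def using l0 by simp
            also have "\<dots> \<le> l / real L * M"
            proof (rule mult_left_mono)
              have "1/8 * 4 \<le> G * M" using G M by (intro mult_mono) auto
              then have "1 \<le> M * (2 * G)" by (simp add: mult_ac)
              then show "1 / (2 * G) \<le> M" using G by (simp add: divide_le_eq)
            qed (use l0 L0 in simp)
            also have "\<dots> \<le> real J" using Jb by (simp add: mult_ac)
            finally have "1 / (2 * real L * g) \<le> real J" .
            then show ?thesis unfolding m_def by linarith
          qed
          show "real L \<le> D" unfolding D_def using M L0 by simp
          show "(2 * real J + 1) * (real L)\<^sup>2 * g + 1 \<le> D"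
          proof -
            have "(2 * real J + 1) * (real L)\<^sup>2 * g = (2 * y + real L) * real L * g" unfolding y_def by (simp add: power2_eq_square algebra_simps)
            also have "\<dots> \<le> (2 * (M * l + real L) + real L) * real L * ((1/2) / l)"
              unfolding g_def using y G l0 L0 M by (intro mult_mono divide_right_mono) auto
            also have "\<dots> = M * real L + (3 / 2 * real L) / l * real L" using l0 by (simp add: field_simps)
            also have "\<dots> \<le> M * real L + 1 * real L" using l l0 L0 by (intro add_left_mono mult_right_mono) auto
            finally show ?thesis unfolding D_def using L by (simp add: algebra_simps)
          qed
          show "\<rho> + real L + real J * D \<le> real (n' - 1)"
          proof -
            have "real J * D \<le> (M * l / real L + 1) * D" using Jb M L0 unfolding D_def by (intro mult_right_mono) auto
            moreover have "2 + real L + (M * l / real L + 1) * D \<le> \<delta> * (1 - \<epsilon> / 8) * real n" using elim(4) unfolding l_def .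
            moreover have "\<rho> + \<delta> * (1 - \<epsilon> / 8) * real n = (1 - \<epsilon> / 8) * real n" 
            proof -
              have "(1 - \<delta>) * a + \<delta> * a = a" for a by (simp add: left_diff_distrib)
              then show ?thesis unfolding \<rho>_def by (simp only: mult.assoc)
            qed
            moreover have "real (n' - 1) = real n' - 1" using n'1 by simp
            ultimately show ?thesis using n'b by linarith
          qed
          show "(real (1 + J * L))\<^sup>2 * pp \<le> 1 / 2" unfolding k ppP using kP \<delta> \<epsilon> by simp
        qed
        have s_low: "exp (- (1 - \<epsilon> / 8) * l) \<le> s"
        proof -
          have D0: "0 < D" unfolding D_def using M L0 by simp
          have 1: "((1 - \<delta>) * H / l) ^ L / fact L = ((1 - \<delta>) * H) ^ L / fact L * (1 / l) ^ L" by (simp add: power_divide)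
          have 2: "exp (- real L) * (real L * G) ^ L * (1 / l) ^ L \<le> exp (- real L) / (2 * real m) ^ L"
          proof -
            have "1 \<le> 1 / (2 * real L * g)"
            proof -
              have "2 * real L * g \<le> 2 * real L * ((1/2) / l)" unfolding g_def using G l0 L0 by (intro mult_left_mono divide_right_mono) auto
              also have "\<dots> \<le> 1" using l l0 by simp
              finally show ?thesis using g L0 by simp
            qed
            then have m1: "1 \<le> m" "real m \<le> 1 / (2 * real L * g)" unfolding m_def by linarith+
            then have "2 * real m \<le> l / (real L * G)" unfolding g_def using l0 L0 G by (simp add: field_simps)
            then have "real L * G / l \<le> 1 / (2 * real m)" using m1 l0 L0 G by (simp add: field_simps)
            then have "(real L * G / l) ^ L \<le> (1 / (2 * real m)) ^ L" using l0 L0 G by (intro power_mono) auto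
            then have "exp (- real L) * (real L * G / l) ^ L \<le> exp (- real L) * (1 / (2 * real m)) ^ L" by (intro mult_left_mono) auto
            then show ?thesis by (simp add: power_divide)
          qed
          have 3: "exp (- (\<epsilon> / 64) * l) * exp (- (3 + ln D)) \<le> (1 / (exp 3 * D)) ^ J"
          proof -
            have lnD: "0 \<le> 3 + ln D"
            proof -
              have "1 \<le> D" unfolding D_def using M L by (metis add_increasing2 mult_ge1_I of_nat_1 of_nat_le_iff one_le_numeral order_trans zero_le_numeral)
              then show ?thesis by simp
            qed
            have "(1 / (exp 3 * D)) = exp (- (3 + ln D))" using D0 by (simp only: exp_minus exp_add exp_ln inverse_eq_divide)
            then have "(1 / (exp 3 * D)) ^ J = exp (real J * (- (3 + ln D)))" unfolding exp_of_nat_mult by simp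
            moreover have "- (\<epsilon> / 64) * l + - (3 + ln D) \<le> real J * (- (3 + ln D))"
            proof -
              have "real J * (3 + ln D) \<le> (M * l / real L + 1) * (3 + ln D)" using Jb lnD by (intro mult_right_mono) auto
              also have "\<dots> = (M * (3 + ln D) / real L) * l + (3 + ln D)" using L0 by (simp add: field_simps)
              also have "\<dots> \<le> \<epsilon> / 64 * l + (3 + ln D)" using D l0 by (intro add_right_mono mult_right_mono) auto
              finally show ?thesis by (simp only: mult_minus_right mult_minus_left)
            qed
            ultimately show ?thesis by (simp only: exp_add[symmetric] exp_le_cancel_iff)
          qed
          have 4: "exp (- (1 - \<epsilon> / 4) * l - \<epsilon> / 32 * l) \<le>
             exp ((real J)\<^sup>2 * (real L)\<^sup>2 * g - 1 / (4 * g)) * exp (- real (n' - 1) * ((real (1 + J * L))\<^sup>2 * pp * (1 + 2 * ((real (1 + J * L))\<^sup>2 * pp))))"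
          proof -
            have J: "(real J)\<^sup>2 * (real L)\<^sup>2 * g = y\<^sup>2 * g" unfolding y_def by (simp add: power_mult_distrib)
            have a: "1 / (4 * g) \<le> (1 - \<epsilon> / 4) * l"
            proof -
              have "1 / (4 * g) = 1 / (4 * G) * l" unfolding g_def using l0 by simp
              also have "\<dots> \<le> (1 - \<epsilon> / 4) * l" using G4 l0 by (intro mult_right_mono) auto
              finally show ?thesis .
            qed
            have b: "real (n' - 1) * ((1 + y)\<^sup>2 * P * (1 + 2 * ((1 + y)\<^sup>2 * P))) - y\<^sup>2 * g \<le> \<epsilon> / 32 * l"
            proof -
              have P0: "0 \<le> P" unfolding P_def using \<epsilon> l0 by simp
              have nP: "real (n' - 1) * P \<le> H / l"
              proof -
                have "real (n' - 1) * P \<le> ((1 - \<epsilon> / 8) * real n) * P" using n'b P0 by (intro mult_right_mono) auto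
                also have "\<dots> = H / l" unfolding P_def H_def using n l0 by (simp add: field_simps)
                finally show ?thesis .
              qed
              have "real (n' - 1) * ((1 + y)\<^sup>2 * P * (1 + 2 * ((1 + y)\<^sup>2 * P))) = (real (n' - 1) * P) * ((1 + y)\<^sup>2 * (1 + 2 * ((1 + y)\<^sup>2 * P)))"
                by (simp add: mult_ac)
              also have "\<dots> \<le> (H / l) * ((1 + y)\<^sup>2 * (1 + 2 * \<delta>))"
                using nP kP P0 H l0 by (intro mult_mono) auto
              finally have "real (n' - 1) * ((1 + y)\<^sup>2 * P * (1 + 2 * ((1 + y)\<^sup>2 * P))) - y\<^sup>2 * g \<le> (H / l) * ((1 + y)\<^sup>2 * (1 + 2 * \<delta>)) - y\<^sup>2 * g" by simp
              also have "\<dots> = (H / l) * ((1 + y)\<^sup>2 * (1 + 2 * \<delta>) - y\<^sup>2 * (1 - \<delta>) ^ 4)"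
                unfolding g_def G_def by (simp add: algebra_simps)
              also have "\<dots> \<le> (H / l) * (6 * \<delta> * y\<^sup>2 + 2 * (1 + 2 * y))"
              proof (rule mult_left_mono)
                have "y\<^sup>2 * (1 - 4 * \<delta>) \<le> y\<^sup>2 * (1 - \<delta>) ^ 4" using \<delta>4 by (intro mult_left_mono) auto
                moreover have "(1 + y)\<^sup>2 * (1 + 2 * \<delta>) - y\<^sup>2 * (1 - 4 * \<delta>) = 6 * \<delta> * y\<^sup>2 + (1 + 2 * \<delta>) * (1 + 2 * y)"
                  by (simp add: power2_eq_square algebra_simps)
                moreover have "(1 + 2 * \<delta>) * (1 + 2 * y) \<le> 2 * (1 + 2 * y)" using \<delta> \<epsilon> y0 by (intro mult_right_mono) auto
                ultimately show "(1 + y)\<^sup>2 * (1 + 2 * \<delta>) - y\<^sup>2 * (1 - \<delta>) ^ 4 \<le> 6 * \<delta> * y\<^sup>2 + 2 * (1 + 2 * y)" by linarith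
              qed (use H l0 in auto)
              also have "\<dots> \<le> ((1/2) / l) * (6 * \<delta> * (M * l + real L)\<^sup>2 + 2 * (1 + 2 * (M * l + real L)))"
                using H l0 \<delta> y y0 by (intro mult_mono divide_right_mono add_mono mult_left_mono power_mono) auto
              also have "\<dots> = 3 * \<delta> * (M * l + real L)\<^sup>2 / l + (1 + 2 * (M * l + real L)) / l"
                using l0 by (simp add: field_simps)
              also have "\<dots> \<le> \<epsilon> / 32 * l" using elim(5) unfolding l_def .
              finally show ?thesis .
            qed
            show ?thesis unfolding k ppP J exp_add[symmetric] exp_le_cancel_iff mult_minus_left using a b by linarith
          qed
          \<comment> \<open>Budget for the exponent: \<epsilon> / 16 for constants and powers of ln
            n, \<epsilon> / 64 for the rounds, \<epsilon> / 32 for the imperfect cancellation. The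
            total is below \<epsilon> / 8, half of the available \<epsilon> / 4.\<close>
          have "exp (- (1 - \<epsilon> / 8) * l) \<le> exp (- (\<epsilon> / 16) * l) * (exp (- (\<epsilon> / 64) * l) * exp (- (1 - \<epsilon> / 4) * l - \<epsilon> / 32 * l))"
          proof -
            have "- (1 - \<epsilon> / 8) * l \<le> - (\<epsilon> / 16) * l + (- (\<epsilon> / 64) * l + (- (1 - \<epsilon> / 4) * l - \<epsilon> / 32 * l))"
            proof -
              have "0 \<le> \<epsilon> * l" using \<epsilon> l0 by simp
              then show ?thesis by (simp add: algebra_simps)
            qed
            then show ?thesis by (simp only: exp_add[symmetric] exp_le_cancel_iff)
          qed
          also have "\<dots> \<le> (c0 * (1 / l) ^ (2 * L)) * (exp (- (\<epsilon> / 64) * l) * exp (- (1 - \<epsilon> / 4) * l - \<epsilon> / 32 * l))"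
            using elim(6) unfolding l_def by (intro mult_right_mono) auto
          also have "\<dots> = (((1 - \<delta>) * H) ^ L / fact L * (1 / l) ^ L) * ((exp (- real L) * (real L * G) ^ L * (1 / l) ^ L) *
              (exp (- (\<epsilon> / 64) * l) * exp (- (3 + ln D))) * exp (- (1 - \<epsilon> / 4) * l - \<epsilon> / 32 * l))"
          proof -
            have "(1 / l) ^ (2 * L) = (1 / l) ^ L * (1 / l) ^ L" by (simp only: mult_2 power_add)
            then show ?thesis unfolding c0_def by (simp only: mult_ac times_divide_eq_left times_divide_eq_right)
          qed
          also have "\<dots> \<le> ((\<rho> * pp) ^ L / fact L) * ((exp (- real L) / (2 * real m) ^ L) * (1 / (exp 3 * D)) ^ J *
              (exp ((real J)\<^sup>2 * (real L)\<^sup>2 * g - 1 / (4 * g)) * exp (- real (n' - 1) * ((real (1 + J * L))\<^sup>2 * pp * (1 + 2 * ((real (1 + J * L))\<^sup>2 * pp))))))"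
            unfolding ppP \<rho>P 1
          proof (rule mult_left_mono[OF mult_mono[OF mult_mono[OF 2 3] 4[unfolded ppP]]])
            show "0 \<le> ((1 - \<delta>) * H) ^ L / fact L * (1 / l) ^ L" using \<delta> \<epsilon> H l0 by simp
          qed (use D0 in auto)
          also have "\<dots> \<le> s" using tl by (simp only: mult.assoc)
          finally show ?thesis .
        qed
        \<comment> \<open>The pool needs (1 - \<epsilon> / 8) n of the (1 - \<epsilon> / 16) n
          vertices; the difference is used up at 1 + y explored vertices per trial.\<close>
        define T where "T = nat \<lfloor>\<epsilon> / 16 * real n / (1 + y)\<rfloor>"
        have T: "real T \<le> \<epsilon> / 16 * real n / (1 + y)" "\<epsilon> / 16 * real n / (1 + y) - 1 \<le> real T"
        proof -
          have "0 \<le> \<epsilon> / 16 * real n / (1 + y)" using \<epsilon> y0 by simp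
          then show "real T \<le> \<epsilon> / 16 * real n / (1 + y)" "\<epsilon> / 16 * real n / (1 + y) - 1 \<le> real T" unfolding T_def by linarith+
        qed
        have "Pr (nobig (nat \<lceil>M * l\<rceil>) W) \<le> (1 - s) ^ T"
          unfolding s_def
        proof (rule Pr_nobig_trials[OF profile_ok _ n'1 W(1)])
          have "M * l \<le> real (J * L)" using y(1) unfolding y_def by simp
          then have "nat \<lceil>M * l\<rceil> \<le> J * L" by linarith
          then show "nat \<lceil>M * l\<rceil> \<le> 1 + sum_list (map snd (profile L g m J))" using profile_snd[where L = L and g = g and m = m and J = J] by linarith
          have "real T * (1 + y) \<le> \<epsilon> / 16 * real n" using T(1) y0 by (simp add: field_simps)
          then have "real n' + real T * (1 + y) \<le> real (card W)" using n'b W(2) by (simp add: algebra_simps)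
          then have "real (n' + T * (1 + J * L)) \<le> real (card W)" unfolding y_def by (simp only: of_nat_add of_nat_mult of_nat_1)
          then show "n' + T * sum_list (map fst (profile L g m J)) \<le> card W" unfolding profile_fst by (simp only: of_nat_le_iff)
        qed
        also have "\<dots> \<le> exp (- (real T * s))"
        proof -
          \<comment> \<open>Read off from a single trial, whose failure bound 1 - s dominates a
            probability.\<close>
          have "s \<le> 1"
          proof -
            have "1 - s \<ge> 0"
            proof (rule ccontr)
              assume "\<not> 0 \<le> 1 - s"
              have c1: "n' + 1 * sum_list (map fst (profile L g m J)) \<le> card W"
              proof -
                have "1 + y \<le> \<epsilon> / 16 * real n" using y(2) elim(8) unfolding l_def by linarith
                then have "real n' + (1 + y) \<le> real (card W)" using n'b W(2) by (simp add: algebra_simps)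
                then have "real (n' + (1 + J * L)) \<le> real (card W)" unfolding y_def by (simp only: of_nat_add of_nat_mult of_nat_1)
                then show ?thesis unfolding profile_fst by (simp only: of_nat_le_iff mult_1)
              qed
              have "Pr (nobig (1 + sum_list (map snd (profile L g m J))) W) \<le> (1 - s) ^ 1"
                unfolding s_def by (rule Pr_nobig_trials[OF profile_ok order_refl n'1 W(1) c1])
              then show False using \<open>\<not> 0 \<le> 1 - s\<close> Pr_nonneg[of "nobig (1 + sum_list (map snd (profile L g m J))) W"] by simp
            qed
            then show ?thesis by simp
          qed
          then have "(1 - s) ^ T \<le> exp (- s) ^ T" using exp_ge_add_one_self[of "- s"] by (intro power_mono) auto
          also have "\<dots> = exp (- (real T * s))" using exp_of_nat_mult[of T "- s"] by simp
          finally show ?thesis .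
        qed
        also have "\<dots> \<le> f n"
        proof -
          have "\<epsilon> / 16 * real n / (1 + M * l + real L) - 1 \<le> \<epsilon> / 16 * real n / (1 + y) - 1"
            using \<epsilon> y y0 by (intro diff_right_mono divide_left_mono mult_pos_pos) auto
          then have t: "\<epsilon> / 16 * real n / (1 + M * l + real L) - 1 \<le> real T" using T by linarith
          have "0 \<le> \<epsilon> / 16 * real n / (1 + M * l + real L) - 1"
          proof -
            have "0 < 1 + M * l + real L" using M l0 L0 by (simp add: add_pos_pos)
            then show ?thesis using elim(8) unfolding l_def by (simp add: field_simps)
          qed
          then have "exp (- (1 - \<epsilon> / 8) * l) * (\<epsilon> / 16 * real n / (1 + M * l + real L) - 1) \<le> s * real T"
            using s_low t by (intro mult_mono) (auto intro: order_trans[OF _ s_low])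
          then show ?thesis unfolding f_def l_def[symmetric] by (simp add: mult_ac)
        qed
        finally show "Pr (nobig (nat \<lceil>M * ln (real n)\<rceil>) W) \<le> f n" unfolding l_def .
      qed
    qed
  qed
  then show ?thesis using flim by blast
qed

context two_graphs
begin

text \<open>Unlike \<open>rr_lower\<close>, this stays useful when s p_i is of constant order or
  larger.\<close>

lemma rr_lower_frac: "real s * p i / (1 + real s * p i) \<le> rr i s"
proof -
  let ?x = "real s * p i"
  have x0: "0 \<le> ?x" using p_bounds[of i] by simp
  have "(1 - p i) ^ s \<le> exp (- p i) ^ s"
    using p_bounds[of i] exp_ge_add_one_self[of "- p i"] by (intro power_mono) auto
  also have "\<dots> = exp (- ?x)" using exp_of_nat_mult[of s "- p i"] by simp
  also have "\<dots> \<le> 1 / (1 + ?x)"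
    using exp_ge_add_one_self[of ?x] x0 by (simp add: exp_minus field_simps)
  finally have "1 - 1 / (1 + ?x) \<le> rr i s" unfolding rr_def by simp
  then show ?thesis using x0 by (simp add: field_simps)
qed

end

text \<open>With z = a n P, the first moment at size a is at most (2 e z)^a exp (- a z / B) up to a
  factor of order 1 / P. For z above a constant the second factor wins, so the cluster bound with
  exponent 1 suffices. Since a \<ge> M ln n, a large \<open>M\<close> pushes z beyond that constant
  and each term below n^(- M) / P. The upper limit C / p_i keeps a p_j \<le> C, so that Q a stays of
  order a^2 P, and it is at most n / 4.\<close>

lemma closed_spanned_vanishing:
  fixes \<epsilon> C :: real
  assumes \<epsilon>: "0 < \<epsilon>" "\<epsilon> \<le> 1" and C: "1 \<le> C"
  shows "\<exists>M\<ge>4. \<exists>f :: nat \<Rightarrow> real. f \<longlonglongrightarrow> 0 \<and> (\<forall>\<^sub>F n in sequentially. \<forall>V p W i. two_graphs V p \<longrightarrow>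
    p True * p False = (1 + \<epsilon>) / (4 * real n * ln (real n)) \<longrightarrow> p (\<not> i) \<le> p i \<longrightarrow>
    W \<subseteq> V \<longrightarrow> card W \<le> n \<longrightarrow> real n / 2 \<le> real (card W) \<longrightarrow>
    pr V p (\<lambda>w. \<exists>S\<subseteq>W. nat \<lceil>M * ln (real n)\<rceil> \<le> card S \<and> card S \<le> nat \<lfloor>C / p i\<rfloor> \<and> spanned w S \<and> noatt w S (W - S)) \<le> f n)"
proof -
  \<comment> \<open>The 4 comes from the at least n / 4 vertices of \<open>W\<close> outside the
    set, the square from the lower bound on \<open>Q\<close>.\<close>
  define B where "B = 4 * (1 + C)\<^sup>2"
  have B: "0 < B" unfolding B_def using C by simp
  have "\<forall>\<^sub>F z :: real in at_top. ln (2 * exp 1 * z) - z / B \<le> - 1" using B by real_asymp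
  then obtain z0 :: real where z0: "\<And>z. z0 \<le> z \<Longrightarrow> ln (2 * exp 1 * z) - z / B \<le> - 1"
    unfolding eventually_at_top_linorder by blast
  define M where "M = max 4 (4 * z0)"
  have M: "4 \<le> M" "z0 \<le> M / 4" unfolding M_def by auto
  obtain C0 where C0: "0 \<le> C0" "spanned_bounded C0 1" using spanned_bounded_ex[of 1] by auto
  define f where "f n = (real n + 1) * (C0 * (4 * real n * ln (real n)) * exp (- (M * ln (real n))))" for n :: nat
  have flim: "f \<longlonglongrightarrow> 0"
  proof -
    have "(\<lambda>n. (real n + 1) * (C0 * (4 * real n * ln (real n)) * exp (- (4 * ln (real n))))) \<longlonglongrightarrow> 0" by real_asymp
    moreover have "\<forall>\<^sub>F n in sequentially. norm (f n) \<le> (real n + 1) * (C0 * (4 * real n * ln (real n)) * exp (- (4 * ln (real n))))"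
      using eventually_ge_at_top[of 3]
    proof eventually_elim
      case (elim n)
      have l: "0 \<le> ln (real n)" using elim by simp
      have "4 * ln (real n) \<le> M * ln (real n)" using M l by (intro mult_right_mono) auto
      then have "f n \<le> (real n + 1) * (C0 * (4 * real n * ln (real n)) * exp (- (4 * ln (real n))))"
        unfolding f_def using C0 l by (intro mult_left_mono) auto
      moreover have "0 \<le> f n" unfolding f_def using C0 l by simp
      ultimately show ?case by simp
    qed
    ultimately show ?thesis by (rule Lim_null_comparison[rotated])
  qed
  have "\<forall>\<^sub>F n in sequentially. \<forall>V p W i. two_graphs V p \<longrightarrow>
    p True * p False = (1 + \<epsilon>) / (4 * real n * ln (real n)) \<longrightarrow> p (\<not> i) \<le> p i \<longrightarrow>
    W \<subseteq> V \<longrightarrow> card W \<le> n \<longrightarrow> real n / 2 \<le> real (card W) \<longrightarrow>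
    pr V p (\<lambda>w. \<exists>S\<subseteq>W. nat \<lceil>M * ln (real n)\<rceil> \<le> card S \<and> card S \<le> nat \<lfloor>C / p i\<rfloor> \<and> spanned w S \<and> noatt w S (W - S)) \<le> f n"
  proof -
    have e1: "\<forall>\<^sub>F n :: nat in sequentially. 16 * C\<^sup>2 * (4 * real n * ln (real n)) \<le> (real n)\<^sup>2" by real_asymp
    have e2: "\<forall>\<^sub>F n :: nat in sequentially. 1 \<le> ln (real n)" by real_asymp
    show ?thesis using e1 e2 eventually_ge_at_top[of 3]
    proof eventually_elim
      case (elim n)
      define l where "l = ln (real n)"
      define P where "P = (1 + \<epsilon>) / (4 * real n * l)"
      have l: "1 \<le> l" using elim(2) unfolding l_def .
      have n: "3 \<le> n" using elim(3) .
      have P: "0 < P" unfolding P_def using \<epsilon> l n by simp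
      have P1: "1 / (4 * real n * l) \<le> P" unfolding P_def using \<epsilon> l n by (intro divide_right_mono) auto
      show ?case
      proof (intro allI impI)
        fix V p W i
        assume tg: "two_graphs V p" and pP: "p True * p False = (1 + \<epsilon>) / (4 * real n * ln (real n))"
          and pi: "p (\<not> i) \<le> p i" and W: "W \<subseteq> V" "card W \<le> n" "real n / 2 \<le> real (card W)"
        interpret two_graphs V p by (rule tg)
        have ppP: "pp = P" unfolding pp_def P_def l_def using pP .
        have pq: "p i * p (\<not> i) = P" using ppP unfolding pp_def by (cases i) (auto simp: mult.commute)
        have pi0: "0 < p i" using pq P p_bounds[of i] by (cases "p i = 0") auto
        let ?a0 = "nat \<lceil>M * l\<rceil>" and ?a1 = "nat \<lfloor>C / p i\<rfloor>"
        have a1: "real ?a1 \<le> C / p i" using C pi0 by simp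
        have Ca: "C / p i \<le> real n / 4"
        proof -
          have "P \<le> (p i)\<^sup>2" using pi pi0 pq by (metis mult_left_mono less_imp_le power2_eq_square)
          then have "1 / (4 * real n * l) \<le> (p i)\<^sup>2" using P1 by linarith
          then have "1 \<le> 4 * real n * l * (p i)\<^sup>2" using n l by (simp add: divide_le_eq mult_ac)
          then have "16 * C\<^sup>2 * 1 \<le> 16 * C\<^sup>2 * (4 * real n * l * (p i)\<^sup>2)" by (intro mult_left_mono) auto
          also have "\<dots> \<le> (real n)\<^sup>2 * (p i)\<^sup>2"
            using mult_right_mono[OF elim(1), of "(p i)\<^sup>2"] unfolding l_def by (simp add: mult_ac)
          finally have "(4 * C)\<^sup>2 \<le> (real n * p i)\<^sup>2" by (simp add: power_mult_distrib)
          then have "4 * C \<le> real n * p i" by (rule power2_le_imp_le) (use pi0 in simp)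
          then show ?thesis using pi0 by (simp add: field_simps)
        qed
        have "Pr (\<lambda>w. \<exists>S\<subseteq>W. ?a0 \<le> card S \<and> card S \<le> ?a1 \<and> spanned w S \<and> noatt w S (W - S)) \<le>
          (\<Sum>a\<in>{?a0..min ?a1 (card W)}. real (card W choose a) * (sbound C0 1 P a * (1 - Q a) ^ (card W - a)))"
        proof (rule Pr_closed_exists[OF W(1)])
          show "0 \<le> sbound C0 1 P a" for a using C0 P by (intro sbound_nonneg) auto
          show "Pr (\<lambda>w. spanned w S) \<le> sbound C0 1 P (card S)" if "S \<subseteq> W" "?a0 \<le> card S" for S
          proof (rule spanned_boundedD[OF C0(2) tg _ P])
            show "p True * p False \<le> P" using ppP unfolding pp_def by simp
            show "S \<subseteq> V" using that W by auto
            have "0 < M * l" using M l by simp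
            then show "S \<noteq> {}" using that by auto
          qed
        qed
        also have "\<dots> \<le> (\<Sum>a\<in>{?a0..min ?a1 (card W)}. C0 * (4 * real n * l) * exp (- (M * l)))"
        proof (rule sum_mono)
          fix a assume a: "a \<in> {?a0..min ?a1 (card W)}"
          have aM: "M * l \<le> real a" using a by (simp add: nat_le_iff ceiling_le_iff)
          have "1 * 1 \<le> M * l" using M l by (intro mult_mono) auto
          then have apos: "1 \<le> real a" using aM by linarith
          have "real a \<le> real ?a1" using a by simp
          then have aC: "real a \<le> C / p i" using a1 by linarith
          then have an: "real a \<le> real n / 4" using Ca by linarith
          define z where "z = real a * (real n * P)"
          have z: "M / 4 \<le> z"
          proof -
            have "M / 4 = (M * l) * (real n * (1 / (4 * real n * l)))" using l n by (simp add: field_simps)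
            also have "\<dots> \<le> real a * (real n * P)" using aM P1 M l n by (intro mult_mono) auto
            finally show ?thesis unfolding z_def .
          qed
          have z0': "0 < z" using z M by linarith
          have lnz: "ln (2 * exp 1 * z) - z / B \<le> - 1" using z M by (intro z0) linarith
          have Qlow: "(real a)\<^sup>2 * P / (1 + C)\<^sup>2 \<le> Q a"
          proof -
            have low: "real a * p j / (1 + C) \<le> rr j a" for j
            proof -
              have "p j \<le> p i" using pi by (cases "j = i") auto
              then have "real a * p j \<le> real a * p i" by (intro mult_left_mono) auto
              also have "\<dots> \<le> C" using aC pi0 by (simp add: field_simps)
              finally have x: "real a * p j \<le> C" .
              have "real a * p j / (1 + C) \<le> real a * p j / (1 + real a * p j)"
                using x p_bounds[of j] C by (intro divide_left_mono mult_pos_pos add_pos_nonneg) auto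
              then show ?thesis using rr_lower_frac[of a j] by linarith
            qed
            have "(real a)\<^sup>2 * P / (1 + C)\<^sup>2 = (real a * p True / (1 + C)) * (real a * p False / (1 + C))"
              unfolding ppP[symmetric] pp_def by (simp add: power2_eq_square)
            also have "\<dots> \<le> rr True a * rr False a"
              using p_bounds C by (intro mult_mono low rr_nonneg) auto
            finally show ?thesis unfolding Q_def .
          qed
          have pw: "(1 - Q a) ^ (card W - a) \<le> exp (- (real a * z / B))"
          proof -
            have "(1 - Q a) ^ (card W - a) \<le> exp (- Q a) ^ (card W - a)"
              using Q_le_1[of a] exp_ge_add_one_self[of "- Q a"] by (intro power_mono) auto
            also have "\<dots> = exp (- (real (card W - a) * Q a))" using exp_of_nat_mult[of "card W - a" "- Q a"] by simp
            also have "\<dots> \<le> exp (- (real a * z / B))"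
            proof -
              have "real n / 4 \<le> real (card W - a)" using an W(3) a by (simp add: of_nat_diff)
              then have "real n / 4 * ((real a)\<^sup>2 * P / (1 + C)\<^sup>2) \<le> real (card W - a) * Q a"
                using Qlow P by (intro mult_mono) auto
              moreover have "real n / 4 * ((real a)\<^sup>2 * P / (1 + C)\<^sup>2) = real a * z / B"
                unfolding z_def B_def by (simp add: power2_eq_square)
              ultimately show ?thesis by simp
            qed
            finally show ?thesis .
          qed
          have ch: "real (card W choose a) * sbound C0 1 P a \<le> C0 / P * (2 * exp 1 * z) ^ a"
          proof -
            have "real (card W choose a) * fact a \<le> real (card W) ^ a"
              using binomial_fact_pow[of "card W" a] by (metis of_nat_fact of_nat_le_iff of_nat_mult of_nat_power)
            also have "\<dots> \<le> real n ^ a" using W(2) by (intro power_mono) auto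
            finally have c: "real (card W choose a) * fact a \<le> real n ^ a" .
            have "real (card W choose a) * sbound C0 1 P a = (real (card W choose a) * fact a) * (C0 * (2 * exp 1 * real a) ^ a * P ^ (a - 1))"
              unfolding sbound_def by (simp add: mult_ac)
            also have "\<dots> \<le> real n ^ a * (C0 * (2 * exp 1 * real a) ^ a * P ^ (a - 1))"
              using c C0 P by (intro mult_right_mono) auto
            also have "P ^ (a - 1) = P ^ a / P" using P apos power_minus_mult[of a P] by (simp add: field_simps)
            also have "real n ^ a * (C0 * (2 * exp 1 * real a) ^ a * (P ^ a / P)) = C0 / P * (2 * exp 1 * z) ^ a"
              unfolding z_def by (simp add: power_mult_distrib mult_ac)
            finally show ?thesis .
          qed
          have "real (card W choose a) * (sbound C0 1 P a * (1 - Q a) ^ (card W - a)) =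
             (real (card W choose a) * sbound C0 1 P a) * (1 - Q a) ^ (card W - a)" by simp
          also have "\<dots> \<le> (C0 / P * (2 * exp 1 * z) ^ a) * exp (- (real a * z / B))"
            using Q_le_1[of a] C0 P z0' by (intro mult_mono ch pw) auto
          also have "\<dots> = C0 / P * exp (real a * (ln (2 * exp 1 * z) - z / B))"
          proof -
            have "(2 * exp 1 * z) ^ a = exp (real a * ln (2 * exp 1 * z))" unfolding exp_of_nat_mult using z0' by simp
            then show ?thesis by (simp add: right_diff_distrib exp_diff exp_minus field_simps)
          qed
          also have "\<dots> \<le> C0 / P * exp (- (M * l))"
          proof -
            have "real a * (ln (2 * exp 1 * z) - z / B) \<le> real a * (- 1)" using lnz by (intro mult_left_mono) auto
            then have "real a * (ln (2 * exp 1 * z) - z / B) \<le> - (M * l)" using aM by linarith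
            then show ?thesis using C0 P by (intro mult_left_mono) auto
          qed
          also have "\<dots> \<le> C0 * (4 * real n * l) * exp (- (M * l))"
          proof -
            have "1 / P \<le> 4 * real n * l" using P1 P n l by (simp add: field_simps)
            then have "C0 * (1 / P) \<le> C0 * (4 * real n * l)" using C0 by (intro mult_left_mono)
            then show ?thesis by (intro mult_right_mono) auto
          qed
          finally show "real (card W choose a) * (sbound C0 1 P a * (1 - Q a) ^ (card W - a)) \<le> C0 * (4 * real n * l) * exp (- (M * l))" .
        qed
        also have "\<dots> = real (card {?a0..min ?a1 (card W)}) * (C0 * (4 * real n * l) * exp (- (M * l)))" by simp
        also have "\<dots> \<le> (real n + 1) * (C0 * (4 * real n * l) * exp (- (M * l)))"
        proof (rule mult_right_mono)
          have "card {?a0..min ?a1 (card W)} \<le> Suc n" using W(2) by simp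
          then show "real (card {?a0..min ?a1 (card W)}) \<le> real n + 1" by linarith
        qed (use C0 l in auto)
        also have "\<dots> = f n" unfolding f_def l_def by simp
        finally show "Pr (\<lambda>w. \<exists>S\<subseteq>W. nat \<lceil>M * ln (real n)\<rceil> \<le> card S \<and> card S \<le> ?a1 \<and> spanned w S \<and> noatt w S (W - S)) \<le> f n"
          unfolding l_def .
      qed
    qed
  qed
  then show ?thesis using M(1) flim by blast
qed

text \<open>The pool \<open>{1..nW}\<close> yields the large spanned set; the reserved vertices \<open>Z\<close> then attach to it often
  enough for it to dominate in colour \<open>i\<close>.\<close>

theorem dominating_core_whp:
  fixes \<epsilon> :: real
  assumes \<epsilon>: "0 < \<epsilon>" "\<epsilon> \<le> 1"
  shows "\<exists>f :: nat \<Rightarrow> real. f \<longlonglongrightarrow> 0 \<and> (\<forall>\<^sub>F n in sequentially. \<forall>p i. two_graphs {1..n} p \<longrightarrow>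
    p True * p False = (1 + \<epsilon>) / (4 * real n * ln (real n)) \<longrightarrow> p (\<not> i) \<le> p i \<longrightarrow> p i \<le> 1 / (2 * (ln (real n))\<^sup>2) \<longrightarrow>
    ln (real n) / real n \<le> p (\<not> i) \<longrightarrow> pr {1..n} p (\<lambda>w. \<not> dominating_core {1..n} i w) \<le> f n)"
proof -
  \<comment> \<open>2048 = 8 times 256: with this value the estimate \<open>QZ\<close> reduces to
    the lower bound ln n / n for the smaller edge probability.\<close>
  define C where "C = 2048 / \<epsilon>"
  have C: "1 \<le> C" unfolding C_def using \<epsilon> by (simp add: field_simps)
  obtain M fB where M: "4 \<le> M" and fB: "fB \<longlonglongrightarrow> 0" and sB: "\<forall>\<^sub>F n in sequentially. \<forall>V p W i. two_graphs V p \<longrightarrow>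
    p True * p False = (1 + \<epsilon>) / (4 * real n * ln (real n)) \<longrightarrow> p (\<not> i) \<le> p i \<longrightarrow>
    W \<subseteq> V \<longrightarrow> card W \<le> n \<longrightarrow> real n / 2 \<le> real (card W) \<longrightarrow>
    pr V p (\<lambda>w. \<exists>S\<subseteq>W. nat \<lceil>M * ln (real n)\<rceil> \<le> card S \<and> card S \<le> nat \<lfloor>C / p i\<rfloor> \<and> spanned w S \<and> noatt w S (W - S)) \<le> fB n"
    using closed_spanned_vanishing[OF \<epsilon> C] by (elim exE conjE)
  obtain fA where fA: "fA \<longlonglongrightarrow> 0" and sA: "\<forall>\<^sub>F n in sequentially. \<forall>V p W. two_graphs V p \<longrightarrow>
    p True * p False = (1 + \<epsilon>) / (4 * real n * ln (real n)) \<longrightarrow> (\<forall>i. p i \<le> 1 / (2 * (ln (real n))\<^sup>2)) \<longrightarrow>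
    W \<subseteq> V \<longrightarrow> (1 - \<epsilon> / 16) * real n \<le> real (card W) \<longrightarrow> pr V p (nobig (nat \<lceil>M * ln (real n)\<rceil>) W) \<le> fA n"
    using nobig_vanishing[OF \<epsilon> M] by (elim exE conjE)
  define f where "f n = fA n + fB n + (exp (- (3 * ln (real n))) + real n * exp (- (3 * ln (real n))))" for n :: nat
  have "(\<lambda>n :: nat. exp (- (3 * ln (real n))) + real n * exp (- (3 * ln (real n)))) \<longlonglongrightarrow> 0" by real_asymp
  then have "f \<longlonglongrightarrow> 0 + 0 + 0" unfolding f_def by (intro tendsto_add fA fB)
  moreover have "\<forall>\<^sub>F n in sequentially. \<forall>p i. two_graphs {1..n} p \<longrightarrow>
    p True * p False = (1 + \<epsilon>) / (4 * real n * ln (real n)) \<longrightarrow> p (\<not> i) \<le> p i \<longrightarrow> p i \<le> 1 / (2 * (ln (real n))\<^sup>2) \<longrightarrow>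
    ln (real n) / real n \<le> p (\<not> i) \<longrightarrow> pr {1..n} p (\<lambda>w. \<not> dominating_core {1..n} i w) \<le> f n"
  proof -
    have e1: "\<forall>\<^sub>F n :: nat in sequentially. 1 \<le> \<epsilon> / 32 * real n" using \<epsilon> by real_asymp
    have e2: "\<forall>\<^sub>F n :: nat in sequentially. 1 \<le> ln (real n)" by real_asymp
    have e3: "\<forall>\<^sub>F n :: nat in sequentially. C\<^sup>2 * (ln (real n))\<^sup>2 * (4 * real n * ln (real n)) \<le> (real n)\<^sup>2" by real_asymp
    show ?thesis using sA sB e1 e2 e3 eventually_ge_at_top[of 3]
    proof eventually_elim
      case (elim n)
      define l where "l = ln (real n)"
      define P where "P = (1 + \<epsilon>) / (4 * real n * l)"
      have l: "1 \<le> l" using elim(4) unfolding l_def .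
      have n: "3 \<le> n" using elim(6) .
      have P: "0 < P" unfolding P_def using \<epsilon> l n by simp
      have P1: "1 / (4 * real n * l) \<le> P" unfolding P_def using \<epsilon> l n by (intro divide_right_mono) auto
      show ?case
      proof (intro allI impI)
        fix p i
        let ?V = "{1..n}"
        assume tg: "two_graphs ?V p" and pP: "p True * p False = (1 + \<epsilon>) / (4 * real n * ln (real n))"
          and pi: "p (\<not> i) \<le> p i" and pil: "p i \<le> 1 / (2 * (ln (real n))\<^sup>2)" and pn: "ln (real n) / real n \<le> p (\<not> i)"
        interpret two_graphs ?V p by (rule tg)
        have ppP: "pp = P" unfolding pp_def P_def l_def using pP .
        have pq: "p i * p (\<not> i) = P" using ppP unfolding pp_def by (cases i) (auto simp: mult.commute)
        have pi0: "0 < p i" using pq P p_bounds[of i] by (cases "p i = 0") auto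
        define nW where "nW = nat \<lceil>(1 - \<epsilon> / 16) * real n\<rceil>"
        have nW: "(1 - \<epsilon> / 16) * real n \<le> real nW" "real nW \<le> (1 - \<epsilon> / 16) * real n + 1"
        proof -
          have "0 \<le> (1 - \<epsilon> / 16) * real n" using \<epsilon> by simp
          then show "(1 - \<epsilon> / 16) * real n \<le> real nW" "real nW \<le> (1 - \<epsilon> / 16) * real n + 1" unfolding nW_def by linarith+
        qed
        have nWn: "nW \<le> n"
        proof -
          have "real nW \<le> real n" using nW(2) elim(3) by (simp add: algebra_simps)
          then show ?thesis by simp
        qed
        let ?W = "{1..nW}" and ?b = "nat \<lfloor>C / p i\<rfloor>"
        define Z where "Z = ?V - ?W"
        have WV: "?W \<subseteq> ?V" using nWn by auto
        have cZ: "\<epsilon> / 32 * real n \<le> real (card Z)"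
        proof -
          have "card Z = n - nW" unfolding Z_def using WV by (simp add: card_Diff_subset)
          then have "real (card Z) = real n - real nW" using nWn by (simp add: of_nat_diff)
          then show ?thesis using nW(2) elim(3) by (simp add: algebra_simps)
        qed
        \<comment> \<open>With \<open>m\<close> attached vertices, a given vertex has no edge of
          colour \<open>i\<close> to them with probability at most n^(- 3).\<close>
        define m where "m = nat \<lceil>3 * l / p i\<rceil>"
        have lp: "1 \<le> l / p i" using l pi0 p_bounds[of i] by (simp add: field_simps)
        have m: "3 * l / p i \<le> real m" "real m \<le> 4 * (l / p i)"
        proof -
          have "0 \<le> 3 * l / p i" using l pi0 by simp
          then have "3 * l / p i \<le> real m" "real m \<le> 3 * l / p i + 1" unfolding m_def by linarith+
          then show "3 * l / p i \<le> real m" "real m \<le> 4 * (l / p i)" using lp by auto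
        qed
        have bC: "C / p i \<le> real (Suc ?b)"
        proof -
          have "0 \<le> C / p i" using C pi0 by simp
          then show ?thesis by linarith
        qed
        \<comment> \<open>At size C / p_i an edge of the likelier colour is present with probability
          at least 1/2, so the other colour decides.\<close>
        have Qb: "min (C * p (\<not> i) / p i) 1 / 4 \<le> Q (Suc ?b)"
        proof -
          let ?x = "real (Suc ?b) * p i" and ?y = "real (Suc ?b) * p (\<not> i)"
          have x: "1 \<le> ?x" using bC C pi0 by (simp add: field_simps)
          have half: "1 / 2 \<le> t / (1 + t)" if "1 \<le> t" for t :: real using that by (simp add: field_simps)
          have r1: "1 / 2 \<le> rr i (Suc ?b)" using rr_lower_frac[of "Suc ?b" i] half[OF x] by linarith
          have y: "C * p (\<not> i) / p i \<le> ?y"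
            using mult_right_mono[OF bC, of "p (\<not> i)"] p_bounds[of "\<not> i"] by simp
          have y0: "0 \<le> ?y" using p_bounds[of "\<not> i"] by simp
          have "min ?y 1 / 2 \<le> ?y / (1 + ?y)"
          proof (cases "1 \<le> ?y")
            case True then show ?thesis using half[OF True] by (simp add: min_def)
          next
            case False
            then have "?y * (1 + ?y) \<le> ?y * 2" using y0 by (intro mult_left_mono) auto
            then have "?y / 2 \<le> ?y / (1 + ?y)" using y0 by (simp add: field_simps)
            then show ?thesis using False by (simp add: min_def)
          qed
          moreover have "min (C * p (\<not> i) / p i) 1 \<le> min ?y 1" using y by auto
          ultimately have r2: "min (C * p (\<not> i) / p i) 1 / 2 \<le> rr (\<not> i) (Suc ?b)"
            using rr_lower_frac[of "Suc ?b" "\<not> i"] by linarith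
          have mn0: "0 \<le> min (C * p (\<not> i) / p i) 1" using C pi0 p_bounds[of "\<not> i"] by simp
          have "min (C * p (\<not> i) / p i) 1 / 4 = 1 / 2 * (min (C * p (\<not> i) / p i) 1 / 2)" by simp
          also have "\<dots> \<le> rr i (Suc ?b) * rr (\<not> i) (Suc ?b)"
            using mn0 by (intro mult_mono r1 r2 rr_nonneg) auto
          also have "\<dots> = Q (Suc ?b)" unfolding Q_def by (cases i) (auto simp: mult.commute)
          finally show ?thesis .
        qed
        have QZ: "2 * real m \<le> Q (Suc ?b) * real (card Z) / 2"
        proof -
          have "8 * (l / p i) \<le> min (C * p (\<not> i) / p i) 1 * (\<epsilon> * real n / 256)"
          proof (cases "C * p (\<not> i) / p i \<le> 1")
            case True
            \<comment> \<open>Here the lower bound for the smaller edge probability enters.\<close>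
            have "l \<le> p (\<not> i) * real n" using pn n unfolding l_def by (simp add: field_simps)
            then have "8 * l / p i \<le> 8 * (p (\<not> i) * real n) / p i" using pi0 by (intro divide_right_mono) auto
            also have "\<dots> = C * p (\<not> i) / p i * (\<epsilon> * real n / 256)" unfolding C_def using \<epsilon> by simp
            finally show ?thesis using True by (simp add: min_def)
          next
            case False
            have "P \<le> (p i)\<^sup>2" using pi pi0 pq by (metis mult_left_mono less_imp_le power2_eq_square)
            then have "1 / (4 * real n * l) \<le> (p i)\<^sup>2" using P1 by linarith
            then have "1 \<le> 4 * real n * l * (p i)\<^sup>2" using n l by (simp add: divide_le_eq mult_ac)
            then have "C\<^sup>2 * l\<^sup>2 * 1 \<le> C\<^sup>2 * l\<^sup>2 * (4 * real n * l * (p i)\<^sup>2)" by (intro mult_left_mono) auto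
            also have "\<dots> \<le> (real n)\<^sup>2 * (p i)\<^sup>2"
              using mult_right_mono[OF elim(5), of "(p i)\<^sup>2"] unfolding l_def by (simp add: mult_ac)
            finally have "(C * l)\<^sup>2 \<le> (real n * p i)\<^sup>2" by (simp add: power_mult_distrib)
            then have "C * l \<le> real n * p i" by (rule power2_le_imp_le) (use pi0 in simp)
            then have "2048 * l \<le> \<epsilon> * (real n * p i)" unfolding C_def using \<epsilon> by (simp add: field_simps)
            then have "8 * (l / p i) \<le> \<epsilon> * real n / 256" using pi0 by (simp add: field_simps)
            then show ?thesis using False by (simp add: min_def)
          qed
          also have "\<dots> = (min (C * p (\<not> i) / p i) 1 / 4) * (\<epsilon> / 32 * real n) / 2" by simp
          also have "\<dots> \<le> Q (Suc ?b) * real (card Z) / 2"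
            using Qb cZ \<epsilon> Q_nonneg by (intro divide_right_mono mult_mono) auto
          finally show ?thesis using m(2) by linarith
        qed
        have "Pr (\<lambda>w. \<not> dominating_core ?V i w) \<le> Pr (\<lambda>w. \<not> (\<exists>S\<subseteq>?W. spanned w S \<and> ?b < card S)) +
            (exp (real m - Q (Suc ?b) * real (card Z) / 2) + real (card ?V) * (1 - p i) ^ m)"
          by (rule Pr_dominating_core[OF WV Z_def])
        also have "Pr (\<lambda>w. \<not> (\<exists>S\<subseteq>?W. spanned w S \<and> ?b < card S)) \<le>
            Pr (\<lambda>w. nobig (nat \<lceil>M * ln (real n)\<rceil>) ?W w \<or>
              (\<exists>S\<subseteq>?W. nat \<lceil>M * ln (real n)\<rceil> \<le> card S \<and> card S \<le> ?b \<and> spanned w S \<and> noatt w S (?W - S)))"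
        proof (rule Pr_mono)
          fix w assume nb: "\<not> (\<exists>S\<subseteq>?W. spanned w S \<and> ?b < card S)"
          show "nobig (nat \<lceil>M * ln (real n)\<rceil>) ?W w \<or>
              (\<exists>S\<subseteq>?W. nat \<lceil>M * ln (real n)\<rceil> \<le> card S \<and> card S \<le> ?b \<and> spanned w S \<and> noatt w S (?W - S))"
          proof (rule ccontr)
            assume c: "\<not> ?thesis"
            then obtain B where B: "B \<subseteq> ?W" "spanned w B" "nat \<lceil>M * ln (real n)\<rceil> \<le> card B"
              unfolding nobig_def by (auto simp: not_less)
            have "\<exists>S\<subseteq>?W. spanned w S \<and> ?b < card S"
              by (rule spanned_extend[OF _ B]) (use c in auto)
            then show False using nb by simp
          qed
        qed
        also have "\<dots> \<le> Pr (nobig (nat \<lceil>M * ln (real n)\<rceil>) ?W) +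
            Pr (\<lambda>w. \<exists>S\<subseteq>?W. nat \<lceil>M * ln (real n)\<rceil> \<le> card S \<and> card S \<le> ?b \<and> spanned w S \<and> noatt w S (?W - S))"
          by (rule Pr_disj)
        also have "Pr (nobig (nat \<lceil>M * ln (real n)\<rceil>) ?W) \<le> fA n"
        proof (rule elim(1)[rule_format, OF tg pP _ WV])
          show "p j \<le> 1 / (2 * (ln (real n))\<^sup>2)" for j
            using pi pil by (cases "j = i") auto
          show "(1 - \<epsilon> / 16) * real n \<le> real (card ?W)" using nW(1) by simp
        qed
        also have "Pr (\<lambda>w. \<exists>S\<subseteq>?W. nat \<lceil>M * ln (real n)\<rceil> \<le> card S \<and> card S \<le> ?b \<and> spanned w S \<and> noatt w S (?W - S)) \<le> fB n"
        proof (rule elim(2)[rule_format, OF tg pP pi WV])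
          show "card ?W \<le> n" using nWn by simp
          have "real n / 2 \<le> (1 - \<epsilon> / 16) * real n" using \<epsilon> mult_right_mono[of "1/2" "1 - \<epsilon> / 16" "real n"] by simp
          then show "real n / 2 \<le> real (card ?W)" using nW(1) by simp
        qed
        also have "exp (real m - Q (Suc ?b) * real (card Z) / 2) \<le> exp (- (3 * l))"
        proof -
          have "l \<le> l / p i" using l pi0 p_bounds[of i] by (simp add: field_simps)
          then have "3 * l \<le> real m" using m(1) by simp
          then show ?thesis using QZ by simp
        qed
        also have "(1 - p i) ^ m \<le> exp (- (3 * l))"
        proof -
          have "(1 - p i) ^ m \<le> exp (- p i) ^ m"
            using p_bounds[of i] exp_ge_add_one_self[of "- p i"] by (intro power_mono) auto
          also have "\<dots> = exp (- (real m * p i))" using exp_of_nat_mult[of m "- p i"] by simp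
          also have "\<dots> \<le> exp (- (3 * l))" using m(1) pi0 by (simp add: field_simps)
          finally show ?thesis .
        qed
        finally show "Pr (\<lambda>w. \<not> dominating_core ?V i w) \<le> f n"
          unfolding f_def l_def by (simp add: mult_left_mono)
      qed
    qed
  qed
  ultimately show ?thesis by (intro exI[of _ f]) simp
qed

section \<open>Connected double graphs\<close>

lemma spanned_mono: "spanned w B \<Longrightarrow> (\<And>x. w x \<Longrightarrow> w' x) \<Longrightarrow> spanned w' B"
proof (induction rule: spanned.induct)
  case (single v) then show ?case by (intro spanned.single)
next
  case (merge A B)
  have "djoin w' A B" using merge.hyps(4) merge.prems unfolding djoin_def joined_def by metis
  then show ?case using merge by (intro spanned.merge) auto
qed

lemma increasing_dominating_core: "increasing (dominating_core V i)"
  unfolding increasing_def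
proof (intro allI impI)
  fix w w' :: world
  assume le: "\<forall>x. w x \<longrightarrow> w' x" and "dominating_core V i w"
  then obtain S where S: "S \<subseteq> V" "spanned w S" "\<forall>v\<in>V - S. joined w i {v} S"
    unfolding dominating_core_def by auto
  have "spanned w' S" using S(2) le by (auto intro: spanned_mono)
  moreover have "\<forall>v\<in>V - S. joined w' i {v} S"
  proof
    fix v assume "v \<in> V - S"
    then have "joined w i {v} S" using S(3) by simp
    then show "joined w' i {v} S" using le unfolding joined_def by metis
  qed
  ultimately show "dominating_core V i w'" unfolding dominating_core_def using S(1) by metis
qed

definition colour_graph :: "nat set \<Rightarrow> bool \<Rightarrow> world \<Rightarrow> nat set set" where
  "colour_graph V i w = {e \<in> [V]\<^bsup>2\<^esup>. w (i, e)}"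

lemma graph_connected_mono:
  assumes "graph_connected V E" "E \<subseteq> E'"
  shows "graph_connected V E'"
proof -
  have "{(x, y). x \<in> V \<and> y \<in> V \<and> {x, y} \<in> E}\<^sup>* \<subseteq> {(x, y). x \<in> V \<and> y \<in> V \<and> {x, y} \<in> E'}\<^sup>*"
    using assms(2) by (intro rtrancl_mono) auto
  then show ?thesis using assms(1) unfolding graph_connected_def same_component_def by fast
qed

definition both_connected :: "nat set \<Rightarrow> world \<Rightarrow> bool" where
  "both_connected V w \<longleftrightarrow> (\<forall>i. graph_connected V (colour_graph V i w))"

lemma increasing_both_connected: "increasing (both_connected V)"
  unfolding increasing_def both_connected_def
proof (intro allI impI)
  fix w w' :: world and i
  assume le: "\<forall>x. w x \<longrightarrow> w' x" and c: "\<forall>i. graph_connected V (colour_graph V i w)"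
  have "colour_graph V i w \<subseteq> colour_graph V i w'" unfolding colour_graph_def using le by auto
  then show "graph_connected V (colour_graph V i w')" using c by (metis graph_connected_mono)
qed

lemma dominating_core_connected_spanned:
  assumes "finite V" "dominating_core V i w" "both_connected V w"
  shows "spanned w V"
proof -
  obtain S where S: "S \<subseteq> V" "spanned w S" "\<forall>v\<in>V - S. joined w i {v} S"
    using assms(2) unfolding dominating_core_def by auto
  have c: "graph_connected V (colour_graph V (\<not> i) w)" using assms(3) unfolding both_connected_def by (rule spec)
  show ?thesis
    by (rule dominating_connected_spanned[OF assms(1) S(1,2) _ c]) (use S(3) in \<open>auto simp: colour_graph_def\<close>)
qed

text \<open>On the support no pair outside the vertex set is an edge, so \<open>w\<close> is
  recovered from its two colour graphs.\<close>

lemma percolates_iff_spanned: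
  assumes V: "finite V" and w: "w \<in> set_pmf (bprod (UNIV \<times> [V]\<^bsup>2\<^esup>) ps)"
  shows "jigsaw_percolates (V, colour_graph V True w, colour_graph V False w) \<longleftrightarrow> spanned w V"
proof -
  let ?w = "edge_world (colour_graph V True w) (colour_graph V False w)"
  have fin: "finite ((UNIV :: bool set) \<times> [V]\<^bsup>2\<^esup>)" using V by (simp add: finite_imp_finite_nsets)
  have "w (i, e) \<Longrightarrow> e \<in> [V]\<^bsup>2\<^esup>" for i e using set_bprod[OF fin w, of "(i, e)"] by auto
  then have "?w (i, e) = w (i, e)" for i e unfolding edge_world_def colour_graph_def by auto
  then have eq: "?w = w" by (intro ext) auto
  have sub: "colour_graph V i w \<subseteq> [V]\<^bsup>2\<^esup>" for i unfolding colour_graph_def by auto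
  show ?thesis
    using percolates_imp_spanned[OF V sub sub] spanned_imp_percolates[OF V sub sub] eq by metis
qed

section \<open>Transfer to the random double graph\<close>

lemma gnp_bprod:
  "gnp n p = map_pmf (\<lambda>w. {e \<in> [{1..n}]\<^bsup>2\<^esup>. w (i, e)}) (Pi_pmf ({i} \<times> [{1..n}]\<^bsup>2\<^esup>) False (\<lambda>_. bernoulli_pmf p))"
proof -
  have "Pi_pmf ([{1..n}]\<^bsup>2\<^esup>) False (\<lambda>_. bernoulli_pmf p) =
      map_pmf (\<lambda>g. g \<circ> Pair i) (Pi_pmf ({i} \<times> [{1..n}]\<^bsup>2\<^esup>) False (\<lambda>_. bernoulli_pmf p))"
    by (rule Pi_pmf_bij_betw) (auto simp: finite_imp_finite_nsets bij_betw_def inj_on_def)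
  then show ?thesis unfolding gnp_def by (simp add: map_pmf_comp)
qed

lemma double_gnp_bprod:
  "double_gnp n p q = map_pmf (\<lambda>w. ({1..n}, colour_graph {1..n} True w, colour_graph {1..n} False w))
     (bprod (UNIV \<times> [{1..n}]\<^bsup>2\<^esup>) (\<lambda>(i, e). if i then p else q))"
proof -
  let ?E = "[{1..n}]\<^bsup>2\<^esup>"
  let ?T = "{True} \<times> ?E" and ?F = "{False} \<times> ?E"
  let ?b = "\<lambda>(i, e). bernoulli_pmf (if i then p else q)"
  have fin: "finite ?E" by (simp add: finite_imp_finite_nsets)
  have U: "(UNIV :: bool set) \<times> ?E = ?T \<union> ?F" by (auto simp: UNIV_bool)
  have "Pi_pmf (?T \<union> ?F) False ?b =
      map_pmf (\<lambda>(f, g) x. if x \<in> ?T then f x else g x) (pair_pmf (Pi_pmf ?T False ?b) (Pi_pmf ?F False ?b))"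
    using fin by (intro Pi_pmf_union) auto
  also have "Pi_pmf ?T False ?b = Pi_pmf ?T False (\<lambda>_. bernoulli_pmf p)" by (rule Pi_pmf_cong) auto
  also have "Pi_pmf ?F False ?b = Pi_pmf ?F False (\<lambda>_. bernoulli_pmf q)" by (rule Pi_pmf_cong) auto
  finally have u: "bprod (UNIV \<times> ?E) (\<lambda>(i, e). if i then p else q) =
      map_pmf (\<lambda>(f, g) x. if x \<in> ?T then f x else g x)
        (pair_pmf (Pi_pmf ?T False (\<lambda>_. bernoulli_pmf p)) (Pi_pmf ?F False (\<lambda>_. bernoulli_pmf q)))"
    unfolding bprod_def U by (simp add: case_prod_unfold)
  show ?thesis
    unfolding u double_gnp_def gnp_bprod[of n p True] gnp_bprod[of n q False] map_pair[symmetric] map_pmf_comp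
    by (rule map_pmf_cong) (auto simp: colour_graph_def)
qed

lemma prob_double_gnp:
  "measure_pmf.prob (double_gnp n p q) {G. \<Phi> G} =
   pr {1..n} (\<lambda>i. if i then p else q) (\<lambda>w. \<Phi> ({1..n}, colour_graph {1..n} True w, colour_graph {1..n} False w))"
  unfolding pr_def double_gnp_bprod measure_map_pmf by (simp add: vimage_def)

lemma pr_cong:
  assumes "\<And>w. w \<in> set_pmf (bprod (UNIV \<times> [V]\<^bsup>2\<^esup>) (\<lambda>(i, e). p i)) \<Longrightarrow> A w = B w"
  shows "pr V p A = pr V p B"
  unfolding pr_def using assms by (rule measure_pmf_cong_set)

lemma prob_percolates_conj:
  "measure_pmf.prob (double_gnp n p q) {G. jigsaw_percolates G \<and> \<Psi> G} =
   pr {1..n} (\<lambda>i. if i then p else q)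
     (\<lambda>w. spanned w {1..n} \<and> \<Psi> ({1..n}, colour_graph {1..n} True w, colour_graph {1..n} False w))"
  unfolding prob_double_gnp by (rule pr_cong) (simp add: percolates_iff_spanned)

text \<open>Both graphs are complete with positive probability. This guarantees a genuine condition:
  given a null event, the conditional probability would be 0 by the convention for division.\<close>

lemma pr_both_connected_pos:
  assumes tg: "two_graphs {1..n} p" and n: "1 \<le> n" and p: "\<And>i. 0 < p i"
  shows "0 < pr {1..n} p (both_connected {1..n})"
proof -
  interpret two_graphs "{1..n}" p by (rule tg)
  let ?I = "(UNIV :: bool set) \<times> [{1..n}]\<^bsup>2\<^esup>"
  let ?w = "\<lambda>x. x \<in> ?I" and ?M = "bprod ?I (\<lambda>(i, e). p i)"
  have fin: "finite ?I" by (simp add: finite_imp_finite_nsets)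
  have "pmf ?M ?w = (\<Prod>x\<in>?I. pmf (bernoulli_pmf (case x of (i, e) \<Rightarrow> p i)) True)"
    unfolding bprod_def using fin by (subst pmf_Pi) (auto intro!: prod.cong)
  also have "\<dots> = (\<Prod>x\<in>?I. case x of (i, e) \<Rightarrow> p i)" using p_bounds by (intro prod.cong) auto
  also have "\<dots> > 0" using p by (intro prod_pos) auto
  finally have "0 < pmf ?M ?w" .
  also have "\<dots> = measure_pmf.prob ?M {?w}" by (simp add: measure_pmf_single)
  also have "\<dots> \<le> measure_pmf.prob ?M {w. both_connected {1..n} w}"
  proof (rule measure_pmf.finite_measure_mono)
    have "graph_connected {1..n} (colour_graph {1..n} i ?w)" for i
    proof -
      have e: "colour_graph {1..n} i ?w = [{1..n}]\<^bsup>2\<^esup>" unfolding colour_graph_def by auto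
      have "(u, v) \<in> same_component {1..n} ([{1..n}]\<^bsup>2\<^esup>)" if "u \<in> {1..n}" "v \<in> {1..n}" for u v
      proof (cases "u = v")
        case True then show ?thesis using that unfolding same_component_def by auto
      next
        case False
        then have "{u, v} \<in> [{1..n}]\<^bsup>2\<^esup>" using that by (simp add: nsets_def card_insert_if)
        then have "(u, v) \<in> {(x, y). x \<in> {1..n} \<and> y \<in> {1..n} \<and> {x, y} \<in> [{1..n}]\<^bsup>2\<^esup>}" using that by simp
        then have "(u, v) \<in> {(x, y). x \<in> {1..n} \<and> y \<in> {1..n} \<and> {x, y} \<in> [{1..n}]\<^bsup>2\<^esup>}\<^sup>*" by (rule r_into_rtrancl)
        then show ?thesis unfolding same_component_def using that by simp
      qed
      then show ?thesis unfolding e graph_connected_def using n by auto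
    qed
    then show "{?w} \<subseteq> {w. both_connected {1..n} w}" unfolding both_connected_def by simp
  qed simp
  finally show ?thesis unfolding pr_def .
qed

text \<open>The pair of edge probabilities is lowered to one with product exactly
  \<open>(1 + \<epsilon>) / (4 n ln n)\<close> and both members at most of order \<open>1 / (ln n)\<^sup>2\<close>; the existence of a
  dominating core is an increasing event and survives.\<close>

lemma connected_spanned_whp:
  fixes \<epsilon> :: real
  assumes \<epsilon>: "0 < \<epsilon>" "\<epsilon> \<le> 1"
  shows "\<exists>f :: nat \<Rightarrow> real. f \<longlonglongrightarrow> 0 \<and> (\<forall>\<^sub>F n in sequentially. \<forall>p. two_graphs {1..n} p \<longrightarrow>
    (1 + \<epsilon>) / (4 * real n * ln (real n)) \<le> p True * p False \<longrightarrow> (\<forall>i. ln (real n) / real n \<le> p i) \<longrightarrow>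
    0 < pr {1..n} p (both_connected {1..n}) \<and>
    (1 - f n) * pr {1..n} p (both_connected {1..n}) \<le> pr {1..n} p (\<lambda>w. spanned w {1..n} \<and> both_connected {1..n} w))"
proof -
  obtain f where f: "f \<longlonglongrightarrow> 0" and core: "\<forall>\<^sub>F n in sequentially. \<forall>p i. two_graphs {1..n} p \<longrightarrow>
    p True * p False = (1 + \<epsilon>) / (4 * real n * ln (real n)) \<longrightarrow> p (\<not> i) \<le> p i \<longrightarrow> p i \<le> 1 / (2 * (ln (real n))\<^sup>2) \<longrightarrow>
    ln (real n) / real n \<le> p (\<not> i) \<longrightarrow> pr {1..n} p (\<lambda>w. \<not> dominating_core {1..n} i w) \<le> f n"
    using dominating_core_whp[OF \<epsilon>] by (elim exE conjE)
  have e1: "\<forall>\<^sub>F n :: nat in sequentially. sqrt ((1 + \<epsilon>) / (4 * real n * ln (real n))) \<le> 1 / (2 * (ln (real n))\<^sup>2)"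
    using \<epsilon> by real_asymp
  have e2: "\<forall>\<^sub>F n :: nat in sequentially. ln (real n) / real n \<le> sqrt ((1 + \<epsilon>) / (4 * real n * ln (real n)))"
    using \<epsilon> by real_asymp
  have e3: "\<forall>\<^sub>F n :: nat in sequentially. 1 \<le> ln (real n)" by real_asymp
  have "\<forall>\<^sub>F n in sequentially. \<forall>p. two_graphs {1..n} p \<longrightarrow>
    (1 + \<epsilon>) / (4 * real n * ln (real n)) \<le> p True * p False \<longrightarrow> (\<forall>i. ln (real n) / real n \<le> p i) \<longrightarrow>
    0 < pr {1..n} p (both_connected {1..n}) \<and>
    (1 - f n) * pr {1..n} p (both_connected {1..n}) \<le> pr {1..n} p (\<lambda>w. spanned w {1..n} \<and> both_connected {1..n} w)"
    using core e1 e2 e3 eventually_ge_at_top[of 3]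
  proof eventually_elim
    case (elim n)
    define l where "l = ln (real n)"
    define P where "P = (1 + \<epsilon>) / (4 * real n * l)"
    have l: "1 \<le> l" and n: "3 \<le> n" using elim(4,5) unfolding l_def by auto
    have P0: "0 < P" unfolding P_def using \<epsilon> l n by simp
    have sP: "sqrt P \<le> 1 / (2 * l\<^sup>2)" "l / real n \<le> sqrt P" using elim(2,3) unfolding P_def l_def by auto
    have ss: "sqrt P * sqrt P = P" using P0 by simp
    show ?case
    proof (intro allI impI conjI)
      fix p
      assume tg: "two_graphs {1..n} p" and pP: "(1 + \<epsilon>) / (4 * real n * ln (real n)) \<le> p True * p False"
        and pl: "\<forall>i. ln (real n) / real n \<le> p i"
      interpret two_graphs "{1..n}" p by (rule tg)
      let ?V = "{1..n}"
      have lnn: "0 < l / real n" using l n by simp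
      have ppos: "0 < p i" for i using pl lnn unfolding l_def by (metis less_le_trans)
      show "0 < pr ?V p (both_connected ?V)"
        by (rule pr_both_connected_pos[OF tg]) (use n ppos in auto)
      have "\<exists>i. p (\<not> i) \<le> p i"
        by (cases "p False \<le> p True") (auto intro: exI[of _ True] exI[of _ False])
      then obtain i where i: "p (\<not> i) \<le> p i" ..
      have pPi: "P \<le> p i * p (\<not> i)" using pP unfolding P_def l_def by (cases i) (auto simp: mult.commute)
      \<comment> \<open>The smaller probability is cut at sqrt P and the larger one solves a b = P,
        so b \<le> a. The bound b \<ge> ln n / n then gives a \<le> P n / ln n, which is of order 1
        / (ln n)^2.\<close>
      define b where "b = min (p (\<not> i)) (sqrt P)"
      define a where "a = P / b"
      have b0: "0 < b" and bP: "b \<le> sqrt P" and bp: "b \<le> p (\<not> i)" and bl: "l / real n \<le> b"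
        unfolding b_def using ppos P0 sP(2) pl by (auto simp: l_def)
      have ab: "a * b = P" unfolding a_def using b0 by simp
      have "sqrt P \<le> a"
        unfolding a_def using mult_left_mono[OF bP, of "sqrt P"] b0 P0 ss by (simp add: le_divide_eq)
      then have ba: "b \<le> a" using bP by simp
      have ap: "a \<le> p i"
      proof (cases "p (\<not> i) \<le> sqrt P")
        case True
        then show ?thesis unfolding a_def b_def using pPi ppos by (simp add: divide_le_eq)
      next
        case False
        then have "b = sqrt P" unfolding b_def by simp
        then have "a = sqrt P" unfolding a_def using ss P0 by (simp add: real_div_sqrt)
        then show ?thesis using False i by simp
      qed
      have al: "a \<le> 1 / (2 * l\<^sup>2)"
      proof (cases "p (\<not> i) \<le> sqrt P")
        case True
        have "a \<le> P / (l / real n)" unfolding a_def using bl lnn P0 b0 by (intro divide_left_mono mult_pos_pos) auto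
        also have "\<dots> = (1 + \<epsilon>) / (4 * l\<^sup>2)" unfolding P_def using n l by (simp add: power2_eq_square field_simps)
        also have "\<dots> \<le> 2 / (4 * l\<^sup>2)" using \<epsilon> l by (intro divide_right_mono) auto
        finally show ?thesis by simp
      next
        case False
        then have "b = sqrt P" unfolding b_def by simp
        then have "a = sqrt P" unfolding a_def using ss P0 by (simp add: real_div_sqrt)
        then show ?thesis using sP(1) by simp
      qed
      define p' where "p' j = (if j = i then a else b)" for j
      have p': "p' i = a" "p' (\<not> i) = b" unfolding p'_def by auto
      have p'p: "0 \<le> p' j \<and> p' j \<le> p j \<and> p j \<le> 1" for j
        unfolding p'_def using ap bp b0 ba p_bounds[of j] by (cases "j = i"; cases i; cases j) auto
      have tg': "two_graphs ?V p'"
      proof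
        show "p' j \<in> {0..1}" for j using p'p[of j] by auto
      qed simp
      have fin: "finite ((UNIV :: bool set) \<times> [?V]\<^bsup>2\<^esup>)" by (simp add: finite_imp_finite_nsets)
      have "pr ?V p' (\<lambda>w. \<not> dominating_core ?V i w) \<le> f n"
      proof (rule elim(1)[rule_format, OF tg'])
        have "p' True * p' False = a * b" unfolding p'_def by (cases i) auto
        then show "p' True * p' False = (1 + \<epsilon>) / (4 * real n * ln (real n))" using ab unfolding P_def l_def by simp
      qed (use p' ba al bl in \<open>auto simp: l_def\<close>)
      then have "1 - f n \<le> pr ?V p' (dominating_core ?V i)" unfolding pr_def bprob_not by simp
      also have "\<dots> \<le> pr ?V p (dominating_core ?V i)"
        unfolding pr_def by (rule bprob_mono_params[OF fin _ increasing_dominating_core]) (use p'p in auto)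
      finally have core': "1 - f n \<le> pr ?V p (dominating_core ?V i)" .
      have "(1 - f n) * pr ?V p (both_connected ?V) \<le> pr ?V p (dominating_core ?V i) * pr ?V p (both_connected ?V)"
        using core' by (rule mult_right_mono) (simp add: pr_def)
      also have "\<dots> \<le> pr ?V p (\<lambda>w. dominating_core ?V i w \<and> both_connected ?V w)"
        unfolding pr_def
        by (rule Harris_inequality[OF fin _ increasing_dominating_core increasing_both_connected])
          (use p_bounds in auto)
      also have "\<dots> \<le> pr ?V p (\<lambda>w. spanned w ?V \<and> both_connected ?V w)"
        unfolding pr_def by (rule bprob_mono) (auto intro: dominating_core_connected_spanned)
      finally show "(1 - f n) * pr ?V p (both_connected ?V) \<le> pr ?V p (\<lambda>w. spanned w ?V \<and> both_connected ?V w)" .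
    qed
  qed
  then show ?thesis using f by (intro exI[of _ f]) simp
qed

theorem theorem1p2:
  fixes \<epsilon> :: real and p1 p2 :: "nat \<Rightarrow> real"
  assumes "\<epsilon> > 0"
    and "\<And>n. p1 n \<in> {0..1}" and "\<And>n. p2 n \<in> {0..1}"
  shows
    "((\<forall>\<^sub>F n in sequentially. p1 n * p2 n \<le> (1 - \<epsilon>) / (4 * real n * ln (real n))) \<longrightarrow>
        (\<lambda>n. \<P>(G in measure_pmf (double_gnp n (p1 n) (p2 n)). \<not> jigsaw_percolates G))
          \<longlonglongrightarrow> 1) \<and>
     ((\<forall>\<^sub>F n in sequentially. p1 n * p2 n \<ge> (1 + \<epsilon>) / (4 * real n * ln (real n)) \<and>
          p1 n \<ge> ln (real n) / real n \<and> p2 n \<ge> ln (real n) / real n) \<longrightarrow>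
        (\<lambda>n. \<P>(G in measure_pmf (double_gnp n (p1 n) (p2 n)). jigsaw_percolates G
             \<bar> (case G of (V, E1, E2) \<Rightarrow> graph_connected V E1 \<and> graph_connected V E2)))
          \<longlonglongrightarrow> 1)"
proof (intro conjI impI)
  define p where "p n = (\<lambda>i. if i then p1 n else p2 n)" for n
  have tg: "two_graphs {1..n} (p n)" for n
    by unfold_locales (use assms(2,3) in \<open>auto simp: p_def\<close>)
  have pp: "p n True * p n False = p1 n * p2 n" for n unfolding p_def by simp
  have pos: "\<forall>\<^sub>F n :: nat in sequentially. 0 < 4 * real n * ln (real n)" by real_asymp
  {
    assume sub: "\<forall>\<^sub>F n in sequentially. p1 n * p2 n \<le> (1 - \<epsilon>) / (4 * real n * ln (real n))"
    \<comment> \<open>A larger \<epsilon> makes the hypothesis stronger, so \<epsilon> may be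
      capped.\<close>
    have "0 < min \<epsilon> (1 / 2)" "min \<epsilon> (1 / 2) < 1" using assms(1) by auto
    from subcritical_not_spanned[OF this] obtain f where f: "f \<longlonglongrightarrow> 0"
      and nsp: "\<forall>\<^sub>F n in sequentially. \<forall>p. two_graphs {1..n} p \<longrightarrow>
        p True * p False \<le> (1 - min \<epsilon> (1 / 2)) / (4 * real n * ln (real n)) \<longrightarrow>
        pr {1..n} p (\<lambda>w. spanned w {1..n}) \<le> f n"
      by (elim exE conjE)
    have eq: "\<P>(G in measure_pmf (double_gnp n (p1 n) (p2 n)). \<not> jigsaw_percolates G) =
        1 - pr {1..n} (p n) (\<lambda>w. spanned w {1..n})" for n
      using prob_percolates_conj[of n "p1 n" "p2 n" "\<lambda>_. True"]
        measure_pmf.prob_compl[of "{G. jigsaw_percolates G}" "double_gnp n (p1 n) (p2 n)"]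
      by (simp add: p_def Compl_eq_Diff_UNIV[symmetric] Collect_neg_eq)
    have low: "\<forall>\<^sub>F n in sequentially. 1 - f n \<le> 1 - pr {1..n} (p n) (\<lambda>w. spanned w {1..n})"
      using nsp sub pos
    proof eventually_elim
      case (elim n)
      have "(1 - \<epsilon>) / (4 * real n * ln (real n)) \<le> (1 - min \<epsilon> (1 / 2)) / (4 * real n * ln (real n))"
        using elim(3) by (intro divide_right_mono) auto
      then have "pr {1..n} (p n) (\<lambda>w. spanned w {1..n}) \<le> f n"
        using elim(1)[rule_format, OF tg] elim(2) pp[of n] by simp
      then show ?case by simp
    qed
    show "(\<lambda>n. \<P>(G in measure_pmf (double_gnp n (p1 n) (p2 n)). \<not> jigsaw_percolates G)) \<longlonglongrightarrow> 1"
      unfolding eq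
    proof (rule real_tendsto_sandwich[OF low])
      show "\<forall>\<^sub>F n in sequentially. 1 - pr {1..n} (p n) (\<lambda>w. spanned w {1..n}) \<le> 1" by (simp add: pr_def)
      show "(\<lambda>n. 1 - f n) \<longlonglongrightarrow> 1" using tendsto_diff[OF tendsto_const f, of 1] by simp
    qed simp
  }
  {
    assume sup: "\<forall>\<^sub>F n in sequentially. p1 n * p2 n \<ge> (1 + \<epsilon>) / (4 * real n * ln (real n)) \<and>
          p1 n \<ge> ln (real n) / real n \<and> p2 n \<ge> ln (real n) / real n"
    let ?q = "\<lambda>n. pr {1..n} (p n) (\<lambda>w. spanned w {1..n} \<and> both_connected {1..n} w)"
      and ?c = "\<lambda>n. pr {1..n} (p n) (both_connected {1..n})"
    have "0 < min \<epsilon> 1" "min \<epsilon> 1 \<le> 1" using assms(1) by auto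
    from connected_spanned_whp[OF this] obtain f where f: "f \<longlonglongrightarrow> 0"
      and sp: "\<forall>\<^sub>F n in sequentially. \<forall>p. two_graphs {1..n} p \<longrightarrow>
        (1 + min \<epsilon> 1) / (4 * real n * ln (real n)) \<le> p True * p False \<longrightarrow> (\<forall>i. ln (real n) / real n \<le> p i) \<longrightarrow>
        0 < pr {1..n} p (both_connected {1..n}) \<and>
        (1 - f n) * pr {1..n} p (both_connected {1..n}) \<le> pr {1..n} p (\<lambda>w. spanned w {1..n} \<and> both_connected {1..n} w)"
      by (elim exE conjE)
    have bc: "both_connected {1..n} = (\<lambda>w. graph_connected {1..n} (colour_graph {1..n} True w) \<and>
        graph_connected {1..n} (colour_graph {1..n} False w))" for n
      unfolding both_connected_def by (simp add: all_bool_eq)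
    have eq: "\<P>(G in measure_pmf (double_gnp n (p1 n) (p2 n)). jigsaw_percolates G
        \<bar> (case G of (V, E1, E2) \<Rightarrow> graph_connected V E1 \<and> graph_connected V E2)) = ?q n / ?c n" for n
    proof -
      have "measure_pmf.prob (double_gnp n (p1 n) (p2 n)) {G. jigsaw_percolates G \<and>
          (case G of (V, E1, E2) \<Rightarrow> graph_connected V E1 \<and> graph_connected V E2)} = ?q n"
        unfolding bc p_def prob_percolates_conj by (simp only: prod.case)
      moreover have "measure_pmf.prob (double_gnp n (p1 n) (p2 n))
          {G. case G of (V, E1, E2) \<Rightarrow> graph_connected V E1 \<and> graph_connected V E2} = ?c n"
        unfolding bc p_def prob_double_gnp by (simp only: prod.case)
      ultimately show ?thesis by (simp only: cond_prob_def space_measure_pmf UNIV_I simp_thms)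
    qed
    have low: "\<forall>\<^sub>F n in sequentially. 1 - f n \<le> ?q n / ?c n"
      using sp sup pos
    proof eventually_elim
      case (elim n)
      have "(1 + min \<epsilon> 1) / (4 * real n * ln (real n)) \<le> (1 + \<epsilon>) / (4 * real n * ln (real n))"
        using elim(3) by (intro divide_right_mono) auto
      then have "(1 + min \<epsilon> 1) / (4 * real n * ln (real n)) \<le> p n True * p n False"
        using elim(2) unfolding pp by (meson order_trans)
      moreover have "\<forall>i. ln (real n) / real n \<le> p n i" using elim(2) unfolding p_def by simp
      ultimately have "0 < ?c n \<and> (1 - f n) * ?c n \<le> ?q n" using elim(1)[rule_format, OF tg] by blast
      then show ?case by (simp add: le_divide_eq)
    qed
    show "(\<lambda>n. \<P>(G in measure_pmf (double_gnp n (p1 n) (p2 n)). jigsaw_percolates G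
        \<bar> (case G of (V, E1, E2) \<Rightarrow> graph_connected V E1 \<and> graph_connected V E2))) \<longlonglongrightarrow> 1"
      unfolding eq
    proof (rule real_tendsto_sandwich[OF low])
      have le: "?q n \<le> ?c n" for n unfolding pr_def by (rule bprob_mono) simp
      have nonneg: "0 \<le> ?c n" for n unfolding pr_def by simp
      \<comment> \<open>Also true for a null condition, where the quotient is 0.\<close>
      have "?q n / ?c n \<le> 1" for n
        using divide_right_mono[OF le[of n] nonneg[of n]] by (cases "?c n = 0") simp_all
      then show "\<forall>\<^sub>F n in sequentially. ?q n / ?c n \<le> 1" by simp
      show "(\<lambda>n. 1 - f n) \<longlonglongrightarrow> 1" using tendsto_diff[OF tendsto_const f, of 1] by simp
    qed simp
  }
qed

end
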